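(* Let $h\in[1,n]$ and let $A=(a_{i,j}),B\in\Xi_{N,2r}$ with $B=E^\theta_{h,h+1}+\mathrm{diag}(\widehat\gamma)$ for some $\gamma\in\Lambda(n+1,r-1)$, and assume $\mathrm{ro}(B)=\widehat\lambda$, $\mathrm{co}(B)=\mathrm{ro}(A)=\widehat\mu$, $\mathrm{co}(A)=\widehat\nu$ with $\lambda,\mu,\nu\in\Lambda(n+1,r)$. Let $\varepsilon=\mathrm{sgn}(A)$ and $$g_{h,A,p}=\begin{cases}\boldsymbol q^{\sum_{j>p}a_{h,j}}[\![a_{h,p}+1]\!],&a_{h+1,p}>0,\\0,&a_{h+1,p}=0.\end{cases}$$ Assume $B\in\Xi^{\circ\circ\circ}$. Then $h<n$ and, for $A\in\Xi^{\circ\circ\bullet}\sqcup\Xi^{\circ\circ\circ}$, the following hold in $S^{D}_{\boldsymbol q}(n,r)$ (terms with coefficient $g_{h,A,p}=0$ being zero): $$\phi_{{}^{+}B^{+}}\,\phi_{{}^{+}A^{\varepsilon}}=\sum_{1\le p\le N}g_{h,A,p}\,\phi_{{}^{+}({}_hA_p)^{\varepsilon}},\qquad \phi_{{}^{-}B^{-}}\,\phi_{{}^{-}A^{-\varepsilon}}=\sum_{1\le p\le N}g_{h,A,p}\,\phi_{{}^{-}({}_hA_p)^{-\varepsilon}}.$$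
   Context: Let $n\ge1$, $r\ge4$, $N=2n+1$, $[a,b]=\{x\in\mathbb Z:a\le x\le b\}$, $\mathcal A=\mathbb Z[\boldsymbol q]$ with $\boldsymbol q$ an indeterminate, $[\![m]\!]=(\boldsymbol q^m-1)/(\boldsymbol q-1)$. $W$ is the group of permutations $w$ of $[1,2r]$ with $w(i)+w(2r+1-i)=2r+1$ for all $i$ (type $B_r$), with Coxeter generators $s_i=(i,i+1)(2r-i,2r+1-i)$ ($1\le i<r$) and $s_r=(r,r+1)$. $H=H_{\boldsymbol q,1}$ is the $\mathcal A$-algebra generated by $T_1,\dots,T_r$ with relations $T_iT_j=T_jT_i$ ($|i-j|\ge2$), $T_jT_{j+1}T_j=T_{j+1}T_jT_{j+1}$ ($1\le j<r-1$), $T_{r-1}T_rT_{r-1}T_r=T_rT_{r-1}T_rT_{r-1}$, $T_i^2=(\boldsymbol q-1)T_i+\boldsymbol q$ ($i<r$), $T_r^2=1$; it has basis $\{T_w\}_{w\in W}$ defined via reduced expressions. $\Lambda(n+1,m)=\{\lambda\in\mathbb N^{n+1}:\sum\lambda_i=m\}$, $\widehat\lambda=(\lambda_1,\dots,\lambda_n,2\lambda_{n+1},\lambda_n,\dots,\lambda_1)$. For $\lambda\in\Lambda(n+1,r)$, $W_\lambda$ is generated by the $s_j$, $j\in[1,r]$, with $j\notin\{\lambda_1+\dots+\lambda_i:i\in[1,n]\}$. $\Xi_{N,2r}$ is the set of $N\times N$ matrices $A=(a_{i,j})$ over $\mathbb N$ with $a_{i,j}=a_{N+1-i,N+1-j}$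 and $\sum a_{i,j}=2r$; $\mathrm{ro}(A),\mathrm{co}(A)$ are the row sum and column sum vectors. Let $R_i^{\widehat\lambda}$ ($1\le i\le N$) be the consecutive intervals of lengths $\widehat\lambda_i$ partitioning $[1,2r]$. The map $(\lambda,d,\mu)\mapsto(|R_i^{\widehat\lambda}\cap dR_j^{\widehat\mu}|)_{i,j}$, with $\lambda,\mu\in\Lambda(n+1,r)$ and $d$ a minimal length representative of a $W_\lambda$-$W_\mu$ double coset, is a bijection onto $\Xi_{N,2r}$; if $A$ is the image of $(\lambda,d,\mu)$ write $d_A=d$ (then $\mathrm{ro}(A)=\widehat\lambda$, $\mathrm{co}(A)=\widehat\mu$). $\check W\le W$ is the subgroup of $w$ with $\#\{i\in[1,r]:w(i)>r\}$ even (type $D_r$), with Coxeter generators $s_1,\dots,s_{r-1},s_rs_{r-1}s_r$; $\check H\subset H$ is the subalgebra generated by $T_1,\dots,T_{r-1},T_rT_{r-1}T_r$, with basis $\{T_w\}_{w\in\check W}$. $\Lambda^{D}(n,r)$ consists of symbols $\lambda^\bullet$ ($\lambda\in\Lambda(n+1,r)$, $\lambda_{n+1}\ne0$) and $\lambda^+,\lambda^-$ ($\lambda_{n+1}=0$); $\check W_{\lambda^\bullet}=W_\lambda\cap\check W$, $\check W_{\lambda^+}=W_\lambda$, $\check W_{\lambda^-}=s_rW_\lambda s_r$; $\check x_\alpha=\sum_{w\in\check W_\alpha}T_w$; $S^{D}_{\boldsymbol q}(n,r)=\mathrm{End}_{\check H}(\bigoplus_{\alpha\in\Lambda^{D}(n,r)}\check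 x_\alpha\check H)$, product being composition (also written $*$). For $\alpha,\beta\in\Lambda^{D}(n,r)$ and $d$ the minimal length representative (for $\check W$) of a $\check W_\alpha$-$\check W_\beta$ double coset in $\check W$, $\phi^d_{\alpha,\beta}(\check x_\gamma h)=\delta_{\beta,\gamma}\sum_{w\in\check W_\alpha d\check W_\beta}T_wh$. $\mathrm{sgn}(A)\in\{+,-\}$ is $+$ iff $\sum_{i\in[1,n],\,j\in[n+2,N]}a_{i,j}$ is even; signs multiply as usual and $-\varepsilon$ is the opposite sign. For $A\in\Xi_{N,2r}$ with $a_{n+1,n+1}=0$ one has symbols ${}^{\varepsilon}A^{\varepsilon'}$ with $\varepsilon\varepsilon'=\mathrm{sgn}(A)$. With $\mathrm{ro}(A)=\widehat\lambda$, $\mathrm{co}(A)=\widehat\mu$, put $\lambda^{[\varepsilon]}=\lambda^\varepsilon$ if $\lambda_{n+1}=0$, $\lambda^{[\varepsilon]}=\lambda^\bullet$ otherwise (same for $\mu$), $s^{+}=1$, $s^{-}=s_r$. Then $\phi_{{}^{\varepsilon}A^{\varepsilon'}}=\phi^{d}_{\lambda^{[\varepsilon]},\mu^{[\varepsilon']}}$, $d$ the minimal representative of $\check W_{\lambda^{[\varepsilon]}}s^{\varepsilon}d_As^{\varepsilon'}\check W_{\mu^{[\varepsilon']}}$. With $\mathrm{ro}(A)=\widehat\lambda,\mathrm{co}(A)=\widehat\mu$: $\Xi^{\circ\circ\circ}$ is the set of $A\in\Xi_{N,2r}$ with $a_{n+1,n+1}=0$, $\lambda_{n+1}=0=\mu_{n+1}$;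 $\Xi^{\circ\circ\bullet}$ the set of those with $a_{n+1,n+1}=0$, $\lambda_{n+1}=0\ne\mu_{n+1}$. $E^\theta_{i,j}=E_{i,j}+E_{N+1-i,N+1-j}$ ($E_{i,j}$ matrix units), ${}_hA_p=A+E^\theta_{h,p}-E^\theta_{h+1,p}$. *)

theory Defs
  imports
    "HOL-Computational_Algebra.Polynomial"
    "HOL-Library.Poly_Mapping"
    "HOL-Library.FuncSet"
    "HOL-Combinatorics.Permutations"
    "HOL-Algebra.Generated_Groups"
    "HOL-Algebra.Generated_Rings"
    "HOL-Algebra.QuotRing"
    "HOL-Algebra.Module"
begin

text \<open>
  Elements of the group of type \<open>B\<^sub>r\<close> are permutations of \<open>{1..2 * r}\<close>, represented as
  functions that are the identity outside this set; the product is composition.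
\<close>

definition WB :: "nat \<Rightarrow> (nat \<Rightarrow> nat) set" where
  "WB r = {w. w permutes {1..2 * r} \<and> (\<forall>i\<in>{1..2 * r}. w i + w (2 * r + 1 - i) = 2 * r + 1)}"

definition WB_group :: "nat \<Rightarrow> (nat \<Rightarrow> nat) monoid" where
  "WB_group r = \<lparr>carrier = WB r, mult = (\<circ>), one = id\<rparr>"

definition cox :: "nat \<Rightarrow> nat \<Rightarrow> nat \<Rightarrow> nat" where
  "cox r i =
     (if i < r then transpose i (i + 1) \<circ> transpose (2 * r - i) (2 * r + 1 - i)
      else transpose r (r + 1))"

definition cox_gens_B :: "nat \<Rightarrow> (nat \<Rightarrow> nat) set" where
  "cox_gens_B r = cox r ` {1..r}"

definition WD :: "nat \<Rightarrow> (nat \<Rightarrow> nat) set" where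
  "WD r = {w \<in> WB r. even (card {i \<in> {1..r}. w i > r})}"

definition cox_gens_D :: "nat \<Rightarrow> (nat \<Rightarrow> nat) set" where
  "cox_gens_D r = cox r ` {1..<r} \<union> {cox r r \<circ> cox r (r - 1) \<circ> cox r r}"

definition comp_list :: "('a \<Rightarrow> 'a) list \<Rightarrow> 'a \<Rightarrow> 'a" where
  "comp_list ws = foldr (\<circ>) ws id"

definition cox_length :: "('a \<Rightarrow> 'a) set \<Rightarrow> ('a \<Rightarrow> 'a) \<Rightarrow> nat" where
  "cox_length S w = (LEAST k. \<exists>ws. set ws \<subseteq> S \<and> length ws = k \<and> comp_list ws = w)"

definition double_coset :: "('a \<Rightarrow> 'a) set \<Rightarrow> ('a \<Rightarrow> 'a) \<Rightarrow> ('a \<Rightarrow> 'a) set \<Rightarrow> ('a \<Rightarrow> 'a) set" where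
  "double_coset U d V = {u \<circ> d \<circ> v | u v. u \<in> U \<and> v \<in> V}"

definition is_min_rep ::
  "('a \<Rightarrow> 'a) set \<Rightarrow> ('a \<Rightarrow> 'a) set \<Rightarrow> ('a \<Rightarrow> 'a) set \<Rightarrow> ('a \<Rightarrow> 'a) \<Rightarrow> bool" where
  "is_min_rep S U V d \<longleftrightarrow> (\<forall>w\<in>double_coset U d V. cox_length S d \<le> cox_length S w)"

text \<open>
  The free algebra over \<open>\<int>[q]\<close> (here \<^typ>\<open>int poly\<close>) consists of the finitely supported functions
  on words; the product of \<^typ>\<open>'a \<Rightarrow>\<^sub>0 'b\<close> is convolution with respect to the additively written
  monoid structure on the index type, here concatenation.
\<close>

datatype word = Word (letters: "nat list")

instantiation word :: monoid_add
begin
definition zero_word :: word where "0 = Word []"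
definition plus_word :: "word \<Rightarrow> word \<Rightarrow> word" where "u + v = Word (letters u @ letters v)"
instance by standard (auto simp: zero_word_def plus_word_def)
end

type_synonym free = "word \<Rightarrow>\<^sub>0 int poly"

definition qvar :: "int poly" where
  "qvar = [:0, 1:]"

definition free_const :: "int poly \<Rightarrow> free" where
  "free_const c = Poly_Mapping.single 0 c"

definition free_gen :: "nat \<Rightarrow> free" where
  "free_gen i = Poly_Mapping.single (Word [i]) 1"

definition free_alg :: "nat \<Rightarrow> free ring" where
  "free_alg r =
     \<lparr>carrier = {f. \<forall>w\<in>Poly_Mapping.keys f. set (letters w) \<subseteq> {1..r}},
      mult = (*), one = 1, zero = 0, add = (+)\<rparr>"

definition hecke_rels :: "nat \<Rightarrow> free set" where
  "hecke_rels r =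
     {free_gen i * free_gen j - free_gen j * free_gen i | i j.
        i \<in> {1..r} \<and> j \<in> {1..r} \<and> (i + 2 \<le> j \<or> j + 2 \<le> i)}
   \<union> {free_gen j * free_gen (j + 1) * free_gen j - free_gen (j + 1) * free_gen j * free_gen (j + 1) | j.
        1 \<le> j \<and> j < r - 1}
   \<union> {free_gen (r - 1) * free_gen r * free_gen (r - 1) * free_gen r
        - free_gen r * free_gen (r - 1) * free_gen r * free_gen (r - 1)}
   \<union> {free_gen i * free_gen i - (free_const (qvar - 1) * free_gen i + free_const qvar) | i.
        1 \<le> i \<and> i < r}
   \<union> {free_gen r * free_gen r - 1}"

definition hecke_ideal :: "nat \<Rightarrow> free set" where
  "hecke_ideal r = genideal (free_alg r) (hecke_rels r)"

definition hecke :: "nat \<Rightarrow> free set ring" where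
  "hecke r = free_alg r Quot hecke_ideal r"

definition hconst :: "nat \<Rightarrow> int poly \<Rightarrow> free set" where
  "hconst r c = hecke_ideal r +>\<^bsub>free_alg r\<^esub> free_const c"

definition Tgen :: "nat \<Rightarrow> nat \<Rightarrow> free set" where
  "Tgen r i = hecke_ideal r +>\<^bsub>free_alg r\<^esub> free_gen i"

definition reduced_expr :: "nat \<Rightarrow> (nat \<Rightarrow> nat) \<Rightarrow> nat list \<Rightarrow> bool" where
  "reduced_expr r w js \<longleftrightarrow>
     set js \<subseteq> {1..r} \<and> comp_list (map (cox r) js) = w \<and> length js = cox_length (cox_gens_B r) w"

text \<open>By Matsumoto's theorem the choice of the reduced expression is immaterial.\<close>

definition Tw :: "nat \<Rightarrow> (nat \<Rightarrow> nat) \<Rightarrow> free set" where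
  "Tw r w = foldr (\<lambda>i x. Tgen r i \<otimes>\<^bsub>hecke r\<^esub> x) (SOME js. reduced_expr r w js) \<one>\<^bsub>hecke r\<^esub>"

text \<open>The subring generated by the scalars and the given elements is the generated subalgebra.\<close>

definition heckeD :: "nat \<Rightarrow> free set set" where
  "heckeD r = generate_ring (hecke r)
     (range (hconst r) \<union> Tgen r ` {1..<r}
      \<union> {Tgen r r \<otimes>\<^bsub>hecke r\<^esub> Tgen r (r - 1) \<otimes>\<^bsub>hecke r\<^esub> Tgen r r})"

text \<open>
  Vectors and matrices are indexed from 1 and extended by zero outside their index range, so that
  equality of functions is equality of vectors and of matrices.
\<close>

type_synonym vec = "nat \<Rightarrow> nat"
type_synonym mat = "nat \<Rightarrow> nat \<Rightarrow> nat"

definition Lam :: "nat \<Rightarrow> nat \<Rightarrow> vec set" where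
  "Lam k m = {la. (\<forall>i. i \<notin> {1..k} \<longrightarrow> la i = 0) \<and> (\<Sum>i=1..k. la i) = m}"

definition hat :: "nat \<Rightarrow> vec \<Rightarrow> vec" where
  "hat n la i =
     (if 1 \<le> i \<and> i \<le> n then la i
      else if i = n + 1 then 2 * la (n + 1)
      else if n + 2 \<le> i \<and> i \<le> 2 * n + 1 then la (2 * n + 2 - i)
      else 0)"

definition WB_par :: "nat \<Rightarrow> nat \<Rightarrow> vec \<Rightarrow> (nat \<Rightarrow> nat) set" where
  "WB_par n r la = generate (WB_group r)
     {cox r j | j. j \<in> {1..r} \<and> j \<notin> (\<lambda>i. \<Sum>k=1..i. la k) ` {1..n}}"

definition Xi :: "nat \<Rightarrow> nat \<Rightarrow> mat set" where
  "Xi n r = {A.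
     (\<forall>i j. i \<notin> {1..2 * n + 1} \<or> j \<notin> {1..2 * n + 1} \<longrightarrow> A i j = 0) \<and>
     (\<forall>i\<in>{1..2 * n + 1}. \<forall>j\<in>{1..2 * n + 1}. A i j = A (2 * n + 2 - i) (2 * n + 2 - j)) \<and>
     (\<Sum>i=1..2 * n + 1. \<Sum>j=1..2 * n + 1. A i j) = 2 * r}"

definition ro :: "nat \<Rightarrow> mat \<Rightarrow> vec" where
  "ro n A i = (\<Sum>j=1..2 * n + 1. A i j)"

definition co :: "nat \<Rightarrow> mat \<Rightarrow> vec" where
  "co n A j = (\<Sum>i=1..2 * n + 1. A i j)"

definition Rint :: "nat \<Rightarrow> vec \<Rightarrow> nat \<Rightarrow> nat set" where
  "Rint n la i = {(\<Sum>k=1..<i. hat n la k) <.. (\<Sum>k=1..i. hat n la k)}"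

text \<open>Outside the index range the intervals are empty, so the following matrix vanishes there.\<close>

definition coset_matrix :: "nat \<Rightarrow> vec \<Rightarrow> (nat \<Rightarrow> nat) \<Rightarrow> vec \<Rightarrow> mat" where
  "coset_matrix n la d \<mu> i j = card (Rint n la i \<inter> d ` Rint n \<mu> j)"

definition d_mat :: "nat \<Rightarrow> nat \<Rightarrow> mat \<Rightarrow> nat \<Rightarrow> nat" where
  "d_mat n r A = (THE d. \<exists>la\<in>Lam (n + 1) r. \<exists>\<mu>\<in>Lam (n + 1) r.
     d \<in> WB r \<and> is_min_rep (cox_gens_B r) (WB_par n r la) (WB_par n r \<mu>) d \<and>
     coset_matrix n la d \<mu> = A)"

definition ro_comp :: "nat \<Rightarrow> nat \<Rightarrow> mat \<Rightarrow> vec" where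
  "ro_comp n r A = (THE la. la \<in> Lam (n + 1) r \<and> ro n A = hat n la)"

definition co_comp :: "nat \<Rightarrow> nat \<Rightarrow> mat \<Rightarrow> vec" where
  "co_comp n r A = (THE \<mu>. \<mu> \<in> Lam (n + 1) r \<and> co n A = hat n \<mu>)"

definition Xi_ooo :: "nat \<Rightarrow> nat \<Rightarrow> mat set" where
  "Xi_ooo n r = {A \<in> Xi n r. A (n + 1) (n + 1) = 0 \<and>
     (\<exists>la\<in>Lam (n + 1) r. \<exists>\<mu>\<in>Lam (n + 1) r. ro n A = hat n la \<and> co n A = hat n \<mu> \<and>
        la (n + 1) = 0 \<and> \<mu> (n + 1) = 0)}"

definition Xi_oob :: "nat \<Rightarrow> nat \<Rightarrow> mat set" where
  "Xi_oob n r = {A \<in> Xi n r. A (n + 1) (n + 1) = 0 \<and>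
     (\<exists>la\<in>Lam (n + 1) r. \<exists>\<mu>\<in>Lam (n + 1) r. ro n A = hat n la \<and> co n A = hat n \<mu> \<and>
        la (n + 1) = 0 \<and> \<mu> (n + 1) \<noteq> 0)}"

definition E_unit :: "nat \<Rightarrow> nat \<Rightarrow> mat" where
  "E_unit i j = (\<lambda>k l. if k = i \<and> l = j then 1 else 0)"

definition E_theta :: "nat \<Rightarrow> nat \<Rightarrow> nat \<Rightarrow> mat" where
  "E_theta n i j = (\<lambda>k l. E_unit i j k l + E_unit (2 * n + 2 - i) (2 * n + 2 - j) k l)"

definition diag_mat :: "vec \<Rightarrow> mat" where
  "diag_mat v = (\<lambda>k l. if k = l then v k else 0)"

text \<open>
  The subtraction below is truncated; for \<open>h < n\<close> truncation occurs only if \<open>A (h + 1) p = 0\<close>,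
  when the coefficient \<open>g_coeff n h A p\<close> vanishes.
\<close>

definition shift_mat :: "nat \<Rightarrow> nat \<Rightarrow> mat \<Rightarrow> nat \<Rightarrow> mat" where
  "shift_mat n h A p = (\<lambda>k l. A k l + E_theta n h p k l - E_theta n (h + 1) p k l)"

definition qint :: "nat \<Rightarrow> int poly" where
  "qint m = (qvar ^ m - 1) div (qvar - 1)"

definition g_coeff :: "nat \<Rightarrow> nat \<Rightarrow> mat \<Rightarrow> nat \<Rightarrow> int poly" where
  "g_coeff n h A p =
     (if A (h + 1) p > 0 then qvar ^ (\<Sum>j\<in>{p<..2 * n + 1}. A h j) * qint (A h p + 1) else 0)"

datatype sign = Pos | Neg

primrec opp :: "sign \<Rightarrow> sign" where
  "opp Pos = Neg"
| "opp Neg = Pos"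

definition mat_sgn :: "nat \<Rightarrow> mat \<Rightarrow> sign" where
  "mat_sgn n A = (if even (\<Sum>i=1..n. \<Sum>j=n + 2..2 * n + 1. A i j) then Pos else Neg)"

datatype symb = Bullet vec | Signed vec sign

definition LamD :: "nat \<Rightarrow> nat \<Rightarrow> symb set" where
  "LamD n r = {Bullet la | la. la \<in> Lam (n + 1) r \<and> la (n + 1) \<noteq> 0}
     \<union> {Signed la e | la e. la \<in> Lam (n + 1) r \<and> la (n + 1) = 0}"

fun WD_par :: "nat \<Rightarrow> nat \<Rightarrow> symb \<Rightarrow> (nat \<Rightarrow> nat) set" where
  "WD_par n r (Bullet la) = WB_par n r la \<inter> WD r"
| "WD_par n r (Signed la Pos) = WB_par n r la"
| "WD_par n r (Signed la Neg) = (\<lambda>w. cox r r \<circ> w \<circ> cox r r) ` WB_par n r la"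

definition Tsum :: "nat \<Rightarrow> (nat \<Rightarrow> nat) set \<Rightarrow> free set" where
  "Tsum r X = (\<Oplus>\<^bsub>hecke r\<^esub>w\<in>X. Tw r w)"

definition xD :: "nat \<Rightarrow> nat \<Rightarrow> symb \<Rightarrow> free set" where
  "xD n r \<alpha> = Tsum r (WD_par n r \<alpha>)"

text \<open>
  The right module \<open>\<Oplus>\<^sub>\<alpha> x\<^sub>\<alpha> H\<^sup>D\<close>, an external direct sum over a finite index set, hence realised as
  the set of families \<open>(m\<^sub>\<alpha>)\<close> with \<open>m\<^sub>\<alpha> \<in> x\<^sub>\<alpha> H\<^sup>D\<close>.
\<close>

definition permD :: "nat \<Rightarrow> nat \<Rightarrow> (symb \<Rightarrow> free set) set" where
  "permD n r = (\<Pi>\<^sub>E \<alpha>\<in>LamD n r. (\<lambda>h. xD n r \<alpha> \<otimes>\<^bsub>hecke r\<^esub> h) ` heckeD r)"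

definition permD_add ::
  "nat \<Rightarrow> nat \<Rightarrow> (symb \<Rightarrow> free set) \<Rightarrow> (symb \<Rightarrow> free set) \<Rightarrow> symb \<Rightarrow> free set" where
  "permD_add n r m m' = (\<lambda>\<alpha>\<in>LamD n r. m \<alpha> \<oplus>\<^bsub>hecke r\<^esub> m' \<alpha>)"

definition permD_act ::
  "nat \<Rightarrow> nat \<Rightarrow> (symb \<Rightarrow> free set) \<Rightarrow> free set \<Rightarrow> symb \<Rightarrow> free set" where
  "permD_act n r m h = (\<lambda>\<alpha>\<in>LamD n r. m \<alpha> \<otimes>\<^bsub>hecke r\<^esub> h)"

definition permD_zero :: "nat \<Rightarrow> nat \<Rightarrow> symb \<Rightarrow> free set" where
  "permD_zero n r = (\<lambda>\<alpha>\<in>LamD n r. \<zero>\<^bsub>hecke r\<^esub>)"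

definition permD_inj :: "nat \<Rightarrow> nat \<Rightarrow> symb \<Rightarrow> free set \<Rightarrow> symb \<Rightarrow> free set" where
  "permD_inj n r \<alpha> x = (\<lambda>\<beta>\<in>LamD n r. if \<beta> = \<alpha> then x else \<zero>\<^bsub>hecke r\<^esub>)"

text \<open>
  Endomorphisms commute with the right action of \<open>H\<^sup>D\<close>; linearity over \<open>\<int>[q]\<close> is a special case,
  as the scalars lie in \<open>H\<^sup>D\<close>.
\<close>

definition schurD :: "nat \<Rightarrow> nat \<Rightarrow> (int poly, (symb \<Rightarrow> free set) \<Rightarrow> symb \<Rightarrow> free set) module" where
  "schurD n r =
     \<lparr>carrier = {f \<in> permD n r \<rightarrow>\<^sub>E permD n r.
         (\<forall>m\<in>permD n r. \<forall>m'\<in>permD n r. f (permD_add n r m m') = permD_add n r (f m) (f m')) \<and>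
         (\<forall>m\<in>permD n r. \<forall>h\<in>heckeD r. f (permD_act n r m h) = permD_act n r (f m) h)},
      mult = (\<lambda>f g. compose (permD n r) f g),
      one = (\<lambda>m\<in>permD n r. m),
      zero = (\<lambda>m\<in>permD n r. permD_zero n r),
      add = (\<lambda>f g. \<lambda>m\<in>permD n r. permD_add n r (f m) (g m)),
      smult = (\<lambda>c f. \<lambda>m\<in>permD n r. permD_act n r (f m) (hconst r c))\<rparr>"

definition phi_d :: "nat \<Rightarrow> nat \<Rightarrow> symb \<Rightarrow> symb \<Rightarrow> (nat \<Rightarrow> nat) \<Rightarrow> (symb \<Rightarrow> free set) \<Rightarrow> symb \<Rightarrow> free set" where
  "phi_d n r \<alpha> \<beta> d = (THE f. f \<in> carrier (schurD n r) \<and>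
     (\<forall>\<gamma>\<in>LamD n r. \<forall>h\<in>heckeD r.
        f (permD_inj n r \<gamma> (xD n r \<gamma> \<otimes>\<^bsub>hecke r\<^esub> h)) =
          (if \<beta> = \<gamma>
           then permD_inj n r \<alpha>
                  (Tsum r (double_coset (WD_par n r \<alpha>) d (WD_par n r \<beta>)) \<otimes>\<^bsub>hecke r\<^esub> h)
           else permD_zero n r)))"

definition mark :: "nat \<Rightarrow> vec \<Rightarrow> sign \<Rightarrow> symb" where
  "mark n la e = (if la (n + 1) = 0 then Signed la e else Bullet la)"

primrec s_pow :: "nat \<Rightarrow> sign \<Rightarrow> nat \<Rightarrow> nat" where
  "s_pow r Pos = id"
| "s_pow r Neg = cox r r"

text \<open>
  \<open>phi_mat n r e A e'\<close> is meaningful if \<open>A \<in> Xi n r\<close>, \<open>A (n + 1) (n + 1) = 0\<close> and the product of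
  the signs \<open>e\<close> and \<open>e'\<close> is \<open>mat_sgn n A\<close>.
\<close>

definition phi_mat :: "nat \<Rightarrow> nat \<Rightarrow> sign \<Rightarrow> mat \<Rightarrow> sign \<Rightarrow> (symb \<Rightarrow> free set) \<Rightarrow> symb \<Rightarrow> free set" where
  "phi_mat n r e A e' =
     (let \<alpha> = mark n (ro_comp n r A) e;
          \<beta> = mark n (co_comp n r A) e';
          U = WD_par n r \<alpha>;
          V = WD_par n r \<beta>;
          d = (THE d. d \<in> double_coset U (s_pow r e \<circ> d_mat n r A \<circ> s_pow r e') V \<and>
                 is_min_rep (cox_gens_D r) U V d)
      in phi_d n r \<alpha> \<beta> d)"

end

theory Submission
  imports Defs
begin

text \<open>
  Since \<open>T\<^sub>r\<^sup>2 = 1\<close>, multiplication by \<open>T\<^sub>r\<close> permutes the basis, so the Hecke algebra only sees the length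
  function of type \<open>D\<close>, extended to type \<open>B\<close> by giving \<open>s\<^sub>r\<close> length \<open>0\<close>. Let \<open>X\<^sub>A\<close> be the set of those \<open>w\<close>
  with coset matrix \<open>A\<close> for which the number of \<open>i \<le> r\<close> with \<open>w i > r\<close> has the parity prescribed by
  \<open>sgn A\<close>. Its elements of minimal length are increasing on all blocks and hence determined by \<open>A\<close>; so \<open>X\<^sub>A\<close> is
  a single double coset of type \<open>D\<close>, and the basis element of \<open>A\<close> with signs \<open>\<epsilon>\<close>, \<open>\<epsilon>'\<close> sends \<open>x\<^sub>\<beta> h\<close> to
  the sum of \<open>T\<^sub>w\<close> over \<open>s\<^sup>\<epsilon> X\<^sub>A s\<^sup>\<epsilon>'\<close>, times \<open>h\<close>.

  Let \<open>{a + 1..b}\<close> be the \<open>h\<close>-th block of \<open>\<lambda>\<close> and let \<open>z\<close> be the sum of the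
  \<open>T\<^sub>k T\<^sub>k\<^sub>+\<^sub>1 \<dots> T\<^sub>b\<^sub>-\<^sub>1\<close> over \<open>k\<close> in this block. Then \<open>T(X\<^sub>B) = z x\<^sub>\<mu>\<close>, which reduces both identities to the
  computation of \<open>z T(X\<^sub>A)\<close>. If \<open>Z\<close> is stable under the symmetric group of the block and \<open>Z\<^sub>e\<close> consists of the
  \<open>w \<in> Z\<close> such that exactly \<open>e\<close> elements of the block have a larger preimage than \<open>b\<close>, then
  \<open>z T(Z\<^sub>e) = q\<^sup>e T(Z)\<close>. The part of \<open>X\<^sub>A\<close> on which \<open>b\<close> lies in column \<open>p\<close> is the union of the \<open>Z\<^sub>e\<close>
  with \<open>Z = X\<close> of the shifted matrix, where \<open>e\<close> runs through an interval of length \<open>a\<^sub>h\<^sub>p + 1\<close> that starts at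
  the sum of the \<open>a\<^sub>h\<^sub>j\<close> with \<open>j > p\<close>; summing the powers of \<open>q\<close> gives the coefficient.
\<close>

section \<open>Signed permutations and inversions\<close>

text \<open>Most objects are given by choice or by definite description, and this shapes the proof.
  \<open>Tw\<close> picks some reduced word, so Matsumoto's theorem must precede every computation.
  \<open>d_mat\<close>, the type D representative in \<open>phi_mat\<close> and \<open>phi_d\<close>
  are defined by \<open>THE\<close>, so existence and uniqueness have to be supplied: every matrix
  comes from a signed permutation; a permutation that is increasing on blocks in both directions is
  determined by its matrix; and \<open>T(X_A)\<close> is a left multiple of the \<open>x\<close> of
  its column symbol as well as a right multiple of the \<open>x\<close> of its row symbol, which
  makes the endomorphism well defined. The delicate point is to compare two kinds of minimality.
  Type D minimality leaves the order of \<open>w r\<close> and \<open>w (r + 1)\<close> open if both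
  positions lie in the middle block. The corner sum behind sgn(A) counts the negative entries
  outside that block, so the prescribed parity settles this order, and the minimal element agrees
  with \<open>d_mat\<close>, which is defined in type B.\<close>

abbreviation iv :: "('a \<Rightarrow> 'a) \<Rightarrow> 'a \<Rightarrow> 'a" where
  "iv w \<equiv> inv_into UNIV w"

lemma comp_list_Nil [simp]: "comp_list [] = id"
  unfolding comp_list_def by (rule ext) simp

lemma comp_list_Cons [simp]: "comp_list (s # ws) = s \<circ> comp_list ws"
  unfolding comp_list_def by (rule ext) simp

lemma comp_list_append [simp]: "comp_list (us @ ws) = comp_list us \<circ> comp_list ws"
  by (induction us) (simp_all add: o_assoc)

definition inv_on :: "nat set \<Rightarrow> (nat \<Rightarrow> nat) \<Rightarrow> nat" where
  "inv_on S f = card {(x, y). x \<in> S \<and> y \<in> S \<and> x < y \<and> f y < f x}"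

text \<open>Values above \<open>r\<close> are the negative entries of a signed permutation written
  on \<open>{1..2 * r}\<close>; the parity of their number separates type D from its complement in
  type B.\<close>

definition neg :: "nat \<Rightarrow> (nat \<Rightarrow> nat) \<Rightarrow> nat" where
  "neg r w = card {x \<in> {1..r}. w x > r}"

text \<open>The transposition keeps the order of every pair other than \<open>(i, i + 1)\<close>, so
  it carries the inversions of \<open>f\<close> bijectively to inversions of the composite, and only
  the pair \<open>(i, i + 1)\<close> itself is new.\<close>

lemma inv_on_swap:
  assumes "finite S" "i \<in> S" "i + 1 \<in> S" "f i < f (i + 1)"
  shows "inv_on S (f \<circ> transpose i (i + 1)) = inv_on S f + 1"
proof -
  let ?t = "transpose i (i + 1)"
  let ?P = "\<lambda>f. {(x, y). x \<in> S \<and> y \<in> S \<and> x < y \<and> f y < f x}"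
  have tS: "?t x \<in> S \<longleftrightarrow> x \<in> S" for x
    using assms by (auto simp: transpose_def)
  have mono: "?t x < ?t y" if "x < y" "(x, y) \<noteq> (i, i + 1)" for x y
    using that by (auto simp: transpose_def split: if_splits)
  have eq: "?P (f \<circ> ?t) = insert (i, i + 1) (map_prod ?t ?t ` ?P f)" (is "?L = ?R")
  proof -
    have *: "(x, y) \<in> ?L \<longleftrightarrow> (x, y) \<in> ?R" for x y
    proof (cases "(x, y) = (i, i + 1)")
      case True
      then show ?thesis using assms by auto
    next
      case False
      show ?thesis
      proof
        assume L: "(x, y) \<in> ?L"
        then have "(?t x, ?t y) \<in> ?P f" using mono[OF _ False] tS by auto
        then have "map_prod ?t ?t (?t x, ?t y) \<in> map_prod ?t ?t ` ?P f" by (rule imageI)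
        then show "(x, y) \<in> ?R" by simp
      next
        assume "(x, y) \<in> ?R"
        then obtain u v where uv: "(u, v) \<in> ?P f" "x = ?t u" "y = ?t v" using False by auto
        then have "(u, v) \<noteq> (i, i + 1)" using assms by auto
        then show "(x, y) \<in> ?L" using uv mono tS by auto
      qed
    qed
    show ?thesis
    proof (rule Set.set_eqI)
      fix z show "z \<in> ?L \<longleftrightarrow> z \<in> ?R"
        using *[of "fst z" "snd z"] by (simp only: prod.collapse)
    qed
  qed
  have fin: "finite (?P f)"
    by (rule finite_subset[of _ "S \<times> S"]) (use assms in auto)
  have inj: "card (map_prod ?t ?t ` ?P f) = card (?P f)"
    by (intro card_image inj_on_subset[OF prod.inj_map[OF inj_transpose inj_transpose] subset_UNIV])
  have notin: "(i, i + 1) \<notin> map_prod ?t ?t ` ?P f"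
    by (auto simp: transpose_def split: if_splits)
  show ?thesis
    unfolding inv_on_def eq
    by (simp only: card_insert_disjoint[OF finite_imageI[OF fin] notin] inj Suc_eq_plus1)
qed

text \<open>Reading an inversion \<open>(x, y)\<close> backwards as the pair of values
  \<open>(w y, w x)\<close> gives an inversion of the inverse.\<close>

lemma inv_on_iv:
  assumes "w permutes S"
  shows "inv_on S (iv w) = inv_on S w"
proof -
  let ?P = "\<lambda>f. {(x, y). x \<in> S \<and> y \<in> S \<and> x < y \<and> f y < f x}"
  define v where "v = iv w"
  have v: "v (w x) = x" "w (v x) = x" "w x \<in> S \<longleftrightarrow> x \<in> S" "v x \<in> S \<longleftrightarrow> x \<in> S" for x
    using assms permutes_inv[OF assms]
    by (simp_all add: v_def permutes_inverses permutes_in_image[of w S] permutes_in_image[of "iv w" S])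
  have "bij_betw (\<lambda>(x, y). (w y, w x)) (?P w) (?P v)"
    by (rule bij_betw_byWitness[where f' = "\<lambda>(x, y). (v y, v x)"]) (auto simp: v)
  from bij_betw_same_card[OF this] show ?thesis by (simp add: inv_on_def v_def)
qed

text \<open>The bound makes \<open>r - 1\<close> a legitimate index, as required by the generator
  \<open>s_r s_(r-1) s_r\<close> and by the braid relation of length four.\<close>

locale rank =
  fixes r :: nat
  assumes r2: "2 \<le> r"
begin

lemma r_pos [simp]: "0 < r" "Suc 0 \<le> r"
  using r2 by auto

lemma WB_permutes: "w \<in> WB r \<Longrightarrow> w permutes {1..2 * r}"
  by (simp add: WB_def)

lemma WB_bij: "w \<in> WB r \<Longrightarrow> bij w"
  using WB_permutes permutes_bij by blast

lemma WB_eq_iff [simp]: "w \<in> WB r \<Longrightarrow> w x = w y \<longleftrightarrow> x = y"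
  using WB_bij by (meson bij_is_inj injD)

lemma WB_range [simp]: "w \<in> WB r \<Longrightarrow> w x \<in> {1..2 * r} \<longleftrightarrow> x \<in> {1..2 * r}"
  using WB_permutes permutes_in_image by metis

lemma WB_bounds:
  assumes "w \<in> WB r" "1 \<le> x" "x \<le> 2 * r"
  shows "1 \<le> w x" "w x \<le> 2 * r" "Suc 0 \<le> w x"
  using WB_range[OF assms(1), of x] assms by auto

lemma WB_mirror:
  assumes "w \<in> WB r" "1 \<le> x" "x \<le> 2 * r"
  shows "w (2 * r + 1 - x) = 2 * r + 1 - w x"
  using assms unfolding WB_def by (auto dest!: bspec[where x = x])

lemma WB_iv_simps [simp]:
  assumes "w \<in> WB r"
  shows "w (iv w x) = x" "iv w (w x) = x"
  using WB_permutes[OF assms] by (auto simp: permutes_inverses)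

lemma WB_iv_comp [simp]:
  assumes "w \<in> WB r"
  shows "w \<circ> iv w = id" "iv w \<circ> w = id"
  using assms by auto

lemma WB_id [simp]: "id \<in> WB r"
  by (auto simp: WB_def permutes_id)

lemma WB_comp [simp]:
  assumes "u \<in> WB r" "v \<in> WB r"
  shows "u \<circ> v \<in> WB r"
proof -
  have "u (v i) + u (v (2 * r + 1 - i)) = 2 * r + 1" if i: "i \<in> {1..2 * r}" for i
  proof -
    have "v i \<in> {1..2 * r}" using assms(2) i by (simp only: WB_range)
    moreover have "v (2 * r + 1 - i) = 2 * r + 1 - v i"
      using WB_mirror[OF assms(2)] i by auto
    ultimately show ?thesis using assms(1) unfolding WB_def by auto
  qed
  then show ?thesis
    using permutes_compose[OF WB_permutes[OF assms(2)] WB_permutes[OF assms(1)]]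
    by (auto simp: WB_def)
qed

lemma WB_iv [simp]:
  assumes "w \<in> WB r"
  shows "iv w \<in> WB r"
proof -
  have p: "iv w permutes {1..2 * r}" using permutes_inv[OF WB_permutes[OF assms]] .
  have "iv w i + iv w (2 * r + 1 - i) = 2 * r + 1" if i: "i \<in> {1..2 * r}" for i
  proof -
    have j: "iv w i \<in> {1..2 * r}" using i p permutes_in_image by metis
    then have "w (2 * r + 1 - iv w i) = 2 * r + 1 - i"
      using WB_mirror[OF assms, of "iv w i"] assms by auto
    then have "iv w (2 * r + 1 - i) = 2 * r + 1 - iv w i"
      using WB_iv_simps(2)[OF assms] by metis
    then show ?thesis using j by auto
  qed
  then show ?thesis using p by (auto simp: WB_def)
qed

lemma iv_iv [simp]: "w \<in> WB r \<Longrightarrow> iv (iv w) = w"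
  using WB_bij inv_inv_eq by blast

lemma iv_comp [simp]: "u \<in> WB r \<Longrightarrow> v \<in> WB r \<Longrightarrow> iv (u \<circ> v) = iv v \<circ> iv u"
  using WB_bij o_inv_distrib by blast

lemma WB_cancel [simp]:
  assumes "w \<in> WB r"
  shows "w \<circ> (iv w \<circ> v) = v" "iv w \<circ> (w \<circ> v) = v" "v \<circ> w \<circ> iv w = v" "v \<circ> iv w \<circ> w = v"
  using assms by (auto simp: fun_eq_iff)

lemma finite_WB [simp]: "finite (WB r)"
  by (rule finite_subset[of _ "{w. w permutes {1..2 * r}}"])
    (auto simp: WB_def finite_permutations)

lemma cox_apply:
  assumes "i < r"
  shows "cox r i x = (if x = i then i + 1 else if x = i + 1 then i
    else if x = 2 * r - i then 2 * r + 1 - i else if x = 2 * r + 1 - i then 2 * r - i else x)"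
proof -
  obtain j where j: "2 * r - i = j" "2 * r + 1 - i = j + 1" "i + 1 < j" using assms by auto
  then show ?thesis using assms by (simp add: cox_def transpose_def)
qed

lemma cox_low: "i < r \<Longrightarrow> x \<le> r \<Longrightarrow> cox r i x = (if x = i then i + 1 else if x = i + 1 then i else x)"
  by (simp add: cox_apply)

lemma cox_r_apply:
  "cox r r x = (if x = r then r + 1 else if x = r + 1 then r else x)"
  by (auto simp: cox_def transpose_def)

lemma cox_WB [simp]:
  assumes "i \<in> {1..r}"
  shows "cox r i \<in> WB r"
proof (cases "i < r")
  case True
  have "cox r i permutes {1..2 * r}"
    unfolding cox_def using True assms
    by (auto intro!: permutes_compose permutes_swap_id)
  moreover obtain j where j: "2 * r = i + j" "i + 1 < j" using True
    by (intro that[of "2 * r - i"]) auto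
  moreover have "cox r i x + cox r i (2 * r + 1 - x) = 2 * r + 1" if "x \<in> {1..2 * r}" for x
  proof -
    have "cox r i x = (if x = i then i + 1 else if x = i + 1 then i
      else if x = j then j + 1 else if x = j + 1 then j else x)" for x
      using True j by (simp add: cox_apply)
    then show ?thesis using that j assms unfolding j by auto
  qed
  ultimately show ?thesis by (auto simp: WB_def)
next
  case False
  then have [simp]: "i = r" using assms by auto
  have "cox r r permutes {1..2 * r}"
    unfolding cox_def using assms by (auto intro!: permutes_swap_id)
  then show ?thesis using assms by (auto simp: WB_def cox_r_apply)
qed

lemma cox_cox [simp]:
  assumes "i \<in> {1..r}"
  shows "cox r i (cox r i x) = x"
  using assms by (cases "i < r") (auto simp: cox_apply cox_r_apply)

lemma cox_cox_comp [simp]: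
  assumes "i \<in> {1..r}"
  shows "cox r i \<circ> cox r i = id" "cox r i \<circ> (cox r i \<circ> v) = v" "v \<circ> cox r i \<circ> cox r i = v"
  using assms by (auto simp: fun_eq_iff)

lemma iv_cox [simp]:
  assumes "i \<in> {1..r}"
  shows "iv (cox r i) = cox r i"
  using assms by (intro inv_unique_comp) auto

definition invs :: "(nat \<Rightarrow> nat) \<Rightarrow> nat" where "invs = inv_on {1..2 * r}"

text \<open>The generator is a product of two disjoint adjacent transpositions that are mirror
  images of each other. The symmetry of \<open>w\<close> turns the ascent at \<open>i\<close> into
  one at \<open>2 * r - i\<close>, so each of them creates one inversion.\<close>

lemma invs_cox:
  assumes "1 \<le> i" "i < r" "w \<in> WB r" "w i < w (i + 1)"
  shows "invs (w \<circ> cox r i) = invs w + 2"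
proof -
  let ?j = "2 * r - i"
  let ?v = "w \<circ> transpose i (i + 1)"
  have e: "w \<circ> cox r i = ?v \<circ> transpose ?j (?j + 1)"
    using assms by (simp add: cox_def o_assoc Suc_diff_le)
  have 1: "invs ?v = invs w + 1"
    unfolding invs_def by (rule inv_on_swap) (use assms in auto)
  have m: "w (2 * r - i) = 2 * r + 1 - w (i + 1)" "w (2 * r + 1 - i) = 2 * r + 1 - w i"
    using WB_mirror[OF assms(3), of i] WB_mirror[OF assms(3), of "i + 1"] assms by auto
  have "w (i + 1) \<le> 2 * r" using WB_bounds[OF assms(3), of "i + 1"] assms by auto
  moreover have "2 * r + 1 - i = ?j + 1" using assms by auto
  ultimately have "w ?j < w (?j + 1)" using m assms(1,2,4) by auto
  then have "invs (?v \<circ> transpose ?j (?j + 1)) = invs ?v + 1"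
    unfolding invs_def using assms by (intro inv_on_swap) (auto simp: transpose_def)
  then show ?thesis using 1 e by simp
qed

lemma invs_cox_r:
  assumes "w \<in> WB r" "w r < w (r + 1)"
  shows "invs (w \<circ> cox r r) = invs w + 1"
  unfolding cox_def invs_def using inv_on_swap[of "{1..2 * r}" r w] assms r2 by auto

lemma neg_cox:
  assumes "1 \<le> i" "i < r"
  shows "neg r (w \<circ> cox r i) = neg r w"
proof -
  have "bij_betw (cox r i) {x \<in> {1..r}. w (cox r i x) > r} {x \<in> {1..r}. w x > r}"
    by (rule bij_betw_byWitness[where f' = "cox r i"]) (use assms in \<open>auto simp: cox_low\<close>)
  then show ?thesis by (auto simp: neg_def dest: bij_betw_same_card)
qed

lemma WB_r_less:
  assumes "w \<in> WB r"
  shows "w r < w (r + 1) \<longleftrightarrow> w r \<le> r"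
  using WB_mirror[OF assms, of r] WB_bounds[OF assms, of r] r2 by auto

lemma neg_cox_r:
  assumes "w \<in> WB r" "w r < w (r + 1)"
  shows "neg r (w \<circ> cox r r) = neg r w + 1"
proof -
  have m: "w (r + 1) = 2 * r + 1 - w r" using WB_mirror[OF assms(1), of r] r2 by auto
  have le: "w r \<le> r" using WB_r_less assms by auto
  have "{x \<in> {1..r}. (w \<circ> cox r r) x > r} = insert r {x \<in> {1..r}. w x > r}"
    using le m r2 by (auto simp: cox_r_apply)
  then show ?thesis using le by (auto simp: neg_def)
qed

text \<open>A negative entry at \<open>x\<close> makes \<open>(x, 2 * r + 1 - x)\<close> an
  inversion. The bound guarantees that the subtraction in \<open>lenD2\<close> is never
  truncated.\<close>

lemma neg_le_invs: "w \<in> WB r \<Longrightarrow> neg r w \<le> invs w"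
  unfolding neg_def invs_def inv_on_def
proof (rule card_inj_on_le[where f = "\<lambda>x. (x, 2 * r + 1 - x)"])
  assume w: "w \<in> WB r"
  show "inj_on (\<lambda>x. (x, 2 * r + 1 - x)) {x \<in> {1..r}. r < w x}" by (auto intro: inj_onI)
  show "(\<lambda>x. (x, 2 * r + 1 - x)) ` {x \<in> {1..r}. r < w x}
    \<subseteq> {(x, y). x \<in> {1..2 * r} \<and> y \<in> {1..2 * r} \<and> x < y \<and> w y < w x}"
    using WB_mirror[OF w] by auto
  show "finite {(x, y). x \<in> {1..2 * r} \<and> y \<in> {1..2 * r} \<and> x < y \<and> w y < w x}"
    by (rule finite_subset[of _ "{1..2 * r} \<times> {1..2 * r}"]) auto
qed

text \<open>These are twice the Coxeter lengths of types \<open>B\<close> and \<open>D\<close>; the latter is extended to all of type \<open>B\<close>.\<close>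

definition lenB2 :: "(nat \<Rightarrow> nat) \<Rightarrow> nat" where "lenB2 w = invs w + neg r w"
definition lenD2 :: "(nat \<Rightarrow> nat) \<Rightarrow> nat" where "lenD2 w = invs w - neg r w"

text \<open>For \<open>i < r\<close> two inversions appear and \<open>neg\<close> is unchanged; for
  \<open>i = r\<close> there is one new inversion and one new negative entry. The sum grows by two
  in both cases, hence the doubled length.\<close>

lemma lenB2_cox:
  assumes "i \<in> {1..r}" "w \<in> WB r" "w i < w (i + 1)"
  shows "lenB2 (w \<circ> cox r i) = lenB2 w + 2"
proof (cases "i < r")
  case True
  then show ?thesis using assms by (auto simp: lenB2_def invs_cox neg_cox)
next
  case False
  then have "i = r" using assms by auto
  then show ?thesis using invs_cox_r neg_cox_r assms by (simp add: lenB2_def)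
qed

lemma lenD2_cox:
  assumes "1 \<le> i" "i < r" "w \<in> WB r" "w i < w (i + 1)"
  shows "lenD2 (w \<circ> cox r i) = lenD2 w + 2"
  using assms neg_le_invs[of w] by (auto simp: lenD2_def invs_cox neg_cox)

text \<open>\<open>s_r\<close> changes \<open>invs\<close> and \<open>neg\<close> by the same
  amount, so the difference does not see it.\<close>

lemma lenD2_cox_r:
  assumes "w \<in> WB r"
  shows "lenD2 (w \<circ> cox r r) = lenD2 w"
proof -
  have *: "lenD2 (v \<circ> cox r r) = lenD2 v" if "v \<in> WB r" "v r < v (r + 1)" for v
    using invs_cox_r[OF that] neg_cox_r[OF that] by (simp add: lenD2_def)
  show ?thesis
  proof (cases "w r < w (r + 1)")
    case True
    then show ?thesis using * assms by auto
  next
    case False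
    moreover have "w r \<noteq> w (r + 1)" using assms by auto
    ultimately have "(w \<circ> cox r r) r < (w \<circ> cox r r) (r + 1)" by (auto simp: cox_r_apply)
    then have "lenD2 (w \<circ> cox r r \<circ> cox r r) = lenD2 (w \<circ> cox r r)"
      using assms by (intro *) auto
    then show ?thesis by simp
  qed
qed

text \<open>If \<open>x \<le> r\<close> has a value above \<open>r\<close>, then the mirror image of
  this value is at most \<open>r\<close>, and the inverse sends it to the mirror image of
  \<open>x\<close>, which is above \<open>r\<close>.\<close>

lemma neg_iv:
  assumes w: "w \<in> WB r"
  shows "neg r (iv w) = neg r w"
proof -
  have "bij_betw (\<lambda>x. 2 * r + 1 - w x) {x \<in> {1..r}. w x > r} {x \<in> {1..r}. iv w x > r}"
  proof (rule bij_betw_byWitness[where f' = "\<lambda>x. 2 * r + 1 - iv w x"])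
    have b: "w x \<le> 2 * r" "iv w x \<le> 2 * r" if "1 \<le> x" "x \<le> r" for x
      using that WB_bounds[OF w, of x] WB_bounds[OF WB_iv[OF w], of x] by auto
    have m: "iv w (2 * r + 1 - w x) = 2 * r + 1 - x" if "1 \<le> x" "x \<le> r" for x
      using that WB_mirror[OF WB_iv[OF w], of "w x"] w WB_bounds[OF w, of x] by auto
    have m': "w (2 * r + 1 - iv w x) = 2 * r + 1 - x" if "1 \<le> x" "x \<le> r" for x
      using that WB_mirror[OF w, of "iv w x"] w WB_bounds[OF WB_iv[OF w], of x] by auto
    show "\<forall>a\<in>{x \<in> {1..r}. r < w x}. 2 * r + 1 - iv w (2 * r + 1 - w a) = a" using m by auto
    show "\<forall>a\<in>{x \<in> {1..r}. r < iv w x}. 2 * r + 1 - w (2 * r + 1 - iv w a) = a" using m' by auto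
    show "(\<lambda>x. 2 * r + 1 - w x) ` {x \<in> {1..r}. r < w x} \<subseteq> {x \<in> {1..r}. r < iv w x}"
      using m b by fastforce
    show "(\<lambda>x. 2 * r + 1 - iv w x) ` {x \<in> {1..r}. r < iv w x} \<subseteq> {x \<in> {1..r}. r < w x}"
      using m' b by fastforce
  qed
  from bij_betw_same_card[OF this] show ?thesis by (simp add: neg_def)
qed

lemma lenB2_iv [simp]: "w \<in> WB r \<Longrightarrow> lenB2 (iv w) = lenB2 w"
  using inv_on_iv[OF WB_permutes, of w] by (simp add: lenB2_def invs_def neg_iv)

lemma lenD2_iv [simp]: "w \<in> WB r \<Longrightarrow> lenD2 (iv w) = lenD2 w"
  using inv_on_iv[OF WB_permutes, of w] by (simp add: lenD2_def invs_def neg_iv)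

lemma lenB2_cox_desc:
  assumes "i \<in> {1..r}" "w \<in> WB r" "w (i + 1) < w i"
  shows "lenB2 w = lenB2 (w \<circ> cox r i) + 2"
proof -
  have "(w \<circ> cox r i) i < (w \<circ> cox r i) (i + 1)"
    using assms by (cases "i < r") (auto simp: cox_apply cox_r_apply)
  then have "lenB2 (w \<circ> cox r i \<circ> cox r i) = lenB2 (w \<circ> cox r i) + 2"
    using assms by (intro lenB2_cox) auto
  then show ?thesis using assms by simp
qed

lemma iv_cox_comp:
  assumes "i \<in> {1..r}" "w \<in> WB r"
  shows "iv (cox r i \<circ> w) = iv w \<circ> cox r i"
  using assms by simp

lemma lenB2_cox_left:
  assumes "i \<in> {1..r}" "w \<in> WB r" "iv w i < iv w (i + 1)"
  shows "lenB2 (cox r i \<circ> w) = lenB2 w + 2"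
proof -
  have "lenB2 (iv (cox r i \<circ> w)) = lenB2 (iv w) + 2"
    unfolding iv_cox_comp[OF assms(1,2)] using assms by (intro lenB2_cox) auto
  then show ?thesis using assms(1,2) by (simp del: iv_comp)
qed

lemma lenB2_cox_left_desc:
  assumes "i \<in> {1..r}" "w \<in> WB r" "iv w (i + 1) < iv w i"
  shows "lenB2 w = lenB2 (cox r i \<circ> w) + 2"
proof -
  have "lenB2 (iv w) = lenB2 (iv (cox r i \<circ> w)) + 2"
    unfolding iv_cox_comp[OF assms(1,2)] using assms by (intro lenB2_cox_desc) auto
  then show ?thesis using assms(1,2) by (simp del: iv_comp)
qed

lemma WB_increasing_mirror:
  assumes "w \<in> WB r" "1 \<le> i" "i < r" "w i < w (i + 1)"
  shows "w (2 * r - i) < w (2 * r + 1 - i)"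
  using WB_mirror[OF assms(1), of i] WB_mirror[OF assms(1), of "i + 1"] assms
    WB_bounds[OF assms(1), of "i + 1"] by auto

text \<open>Mirror symmetry extends the ascents to all of \<open>{1..2 * r}\<close>, and an
  increasing permutation satisfies \<open>i \<le> w i\<close> throughout.\<close>

lemma increasing_eq_id:
  assumes w: "w \<in> WB r" and inc: "\<And>i. i \<in> {1..r} \<Longrightarrow> w i < w (i + 1)"
  shows "w = id"
proof -
  have step: "w i < w (i + 1)" if "1 \<le> i" "i < 2 * r" for i
  proof (cases "i \<le> r")
    case True
    then show ?thesis using inc that by auto
  next
    case False
    then have "w (2 * r - (2 * r - i)) < w (2 * r + 1 - (2 * r - i))"
    proof (intro WB_increasing_mirror[OF w])
      show "w (2 * r - i) < w (2 * r - i + 1)" by (rule inc) (use False that in auto)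
    qed (use False that in auto)
    moreover have "2 * r - (2 * r - i) = i" "2 * r + 1 - (2 * r - i) = i + 1" using that by auto
    ultimately show ?thesis by simp
  qed
  have ge: "i \<le> w i" if "1 \<le> i" "i \<le> 2 * r" for i
    using that
  proof (induction i rule: nat_induct_at_least)
    case base
    then show ?case using WB_bounds[OF w, of 1] r2 by auto
  next
    case (Suc n)
    then show ?case using step[of n] by auto
  qed
  then show ?thesis using permutes_natset_ge[OF WB_permutes[OF w]] by auto
qed

lemma exists_descent:
  assumes w: "w \<in> WB r" "w \<noteq> id"
  shows "\<exists>i\<in>{1..r}. w (i + 1) < w i"
proof (rule ccontr)
  assume "\<not> ?thesis"
  then have "w i < w (i + 1)" if "i \<in> {1..r}" for i
    using WB_eq_iff[OF w(1), of i "i + 1"] that by (metis Suc_eq_plus1 n_not_Suc_n nat_neq_iff)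
  then show False using increasing_eq_id w by auto
qed

end

text \<open>A word with \<open>k\<close> letters raises \<open>f\<close> to at most
  \<open>2 * k\<close>, while stripping descents reaches \<open>id\<close> with exactly two units
  per letter; so \<open>f\<close> is twice the minimal word length. The abstract form serves types B
  and D alike.\<close>

lemma cox_length_eq:
  fixes f :: "('a \<Rightarrow> 'a) \<Rightarrow> nat"
  assumes id: "id \<in> G" "f id = 0"
    and S: "\<And>s w. s \<in> S \<Longrightarrow> w \<in> G \<Longrightarrow> s \<circ> w \<in> G"
    and le: "\<And>s w. s \<in> S \<Longrightarrow> w \<in> G \<Longrightarrow> f (s \<circ> w) \<le> f w + 2"
    and desc: "\<And>w. w \<in> G \<Longrightarrow> w \<noteq> id \<Longrightarrow> \<exists>s\<in>S. \<exists>v\<in>G. w = s \<circ> v \<and> f w = f v + 2"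
    and w: "w \<in> G"
  shows "2 * cox_length S w = f w"
    and "\<exists>ws. set ws \<subseteq> S \<and> length ws = cox_length S w \<and> comp_list ws = w"
proof -
  have words: "comp_list ws \<in> G \<and> f (comp_list ws) \<le> 2 * length ws" if "set ws \<subseteq> S" for ws
    using that
  proof (induction ws)
    case Nil
    show ?case using id by (simp add: id_def)
  next
    case (Cons s ws)
    then show ?case using S[of s "comp_list ws"] le[of s "comp_list ws"]
      by (simp add: o_def)
  qed
  have ex: "\<exists>ws. set ws \<subseteq> S \<and> 2 * length ws = f w \<and> comp_list ws = w" if "w \<in> G" for w
    using that
  proof (induction "f w" arbitrary: w rule: less_induct)
    case less
    show ?case
    proof (cases "w = id")
      case True
      then show ?thesis using id by (intro exI[of _ "[]"]) auto
    next
      case False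
      then obtain s v where v: "s \<in> S" "v \<in> G" "w = s \<circ> v" "f w = f v + 2"
        using desc less by blast
      then obtain ws where "set ws \<subseteq> S" "2 * length ws = f v" "comp_list ws = v"
        using less(1)[of v] by auto
      then show ?thesis using v by (intro exI[of _ "s # ws"]) auto
    qed
  qed
  obtain ws where ws: "set ws \<subseteq> S" "2 * length ws = f w" "comp_list ws = w"
    using ex[OF w] by blast
  have "cox_length S w = length ws"
    unfolding cox_length_def
  proof (rule Least_equality)
    show "\<exists>vs. set vs \<subseteq> S \<and> length vs = length ws \<and> comp_list vs = w" using ws by blast
    fix k assume "\<exists>vs. set vs \<subseteq> S \<and> length vs = k \<and> comp_list vs = w"
    then obtain vs where "set vs \<subseteq> S" "length vs = k" "comp_list vs = w" by blast
    then show "length ws \<le> k" using words[of vs] ws by auto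
  qed
  then show "2 * cox_length S w = f w"
    and "\<exists>ws. set ws \<subseteq> S \<and> length ws = cox_length S w \<and> comp_list ws = w"
    using ws by auto
qed

context rank begin

lemma invs_id [simp]: "invs id = 0"
  by (simp add: invs_def inv_on_def) (metis (no_types, lifting) Collect_empty_eq case_prodE less_asym' card.empty)

lemma neg_id [simp]: "neg r id = 0"
  by (simp add: neg_def)

lemma lenB2_id [simp]: "lenB2 id = 0" and lenD2_id [simp]: "lenD2 id = 0"
  by (simp_all add: lenB2_def lenD2_def)

lemma WB_trichotomy:
  assumes "w \<in> WB r"
  shows "w x < w y \<or> w y < w x \<or> x = y"
  using WB_eq_iff[OF assms, of x y] by linarith

lemma WB_eqI:
  assumes u: "u \<in> WB r" and v: "v \<in> WB r" and eq: "\<And>x. 1 \<le> x \<Longrightarrow> x \<le> r \<Longrightarrow> u x = v x"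
  shows "u = v"
proof
  fix x
  consider "x \<notin> {1..2 * r}" | "1 \<le> x" "x \<le> r" | "r < x" "x \<le> 2 * r" by fastforce
  then show "u x = v x"
  proof cases
    case 1
    then show ?thesis using WB_permutes u v permutes_not_in by metis
  next
    case 2
    then show ?thesis by (rule eq)
  next
    case 3
    then have "u (2 * r + 1 - (2 * r + 1 - x)) = v (2 * r + 1 - (2 * r + 1 - x))"
      using WB_mirror[OF u, of "2 * r + 1 - x"] WB_mirror[OF v, of "2 * r + 1 - x"]
        eq[of "2 * r + 1 - x"] by auto
    then show ?thesis using 3 by auto
  qed
qed

lemma lenB2_cox_left_le:
  assumes "i \<in> {1..r}" "w \<in> WB r"
  shows "lenB2 (cox r i \<circ> w) \<le> lenB2 w + 2"
  using lenB2_cox_left[OF assms] lenB2_cox_left_desc[OF assms] WB_trichotomy[OF WB_iv[OF assms(2)], of i "i + 1"]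
  by auto

lemma
  assumes w: "w \<in> WB r"
  shows cox_length_B: "2 * cox_length (cox_gens_B r) w = lenB2 w"
    and reduced_expr_exists: "\<exists>js. reduced_expr r w js"
proof -
  have G: "\<exists>s\<in>cox_gens_B r. \<exists>v\<in>WB r. w = s \<circ> v \<and> lenB2 w = lenB2 v + 2"
    if w: "w \<in> WB r" "w \<noteq> id" for w
  proof -
    \<comment> \<open>Descents are read off on the right, so a left descent of \<open>w\<close> is
      found as a descent of its inverse.\<close>
    have "iv w \<noteq> id" using w by (metis iv_iv inv_id)
    then obtain i where i: "i \<in> {1..r}" "iv w (i + 1) < iv w i" using exists_descent[of "iv w"] w by auto
    have "w = cox r i \<circ> (cox r i \<circ> w)" using i by simp
    then show ?thesis
      using lenB2_cox_left_desc[OF i(1) w(1) i(2)] i(1) w(1) cox_WB WB_comp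
      by (metis cox_gens_B_def imageI)
  qed
  note * = cox_length_eq[where G = "WB r" and S = "cox_gens_B r" and f = lenB2, OF _ _ _ _ G w]
  have le: "lenB2 (s \<circ> w) \<le> lenB2 w + 2" if "s \<in> cox_gens_B r" "w \<in> WB r" for s w
    using that lenB2_cox_left_le by (auto simp: cox_gens_B_def)
  have cl: "s \<circ> w \<in> WB r" if "s \<in> cox_gens_B r" "w \<in> WB r" for s w
    using that by (auto simp: cox_gens_B_def)
  show "2 * cox_length (cox_gens_B r) w = lenB2 w"
    by (rule *(1)) (use le cl in auto)
  have "\<exists>ws. set ws \<subseteq> cox_gens_B r \<and> length ws = cox_length (cox_gens_B r) w \<and> comp_list ws = w"
    by (rule *(2)) (use le cl in auto)
  then obtain ws where ws: "set ws \<subseteq> cox_gens_B r" "length ws = cox_length (cox_gens_B r) w" "comp_list ws = w"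
    by blast
  have "ws \<in> map (cox r) ` lists {1..r}"
    unfolding lists_image[symmetric] using ws(1) by (auto simp: cox_gens_B_def)
  then obtain js where "ws = map (cox r) js" "set js \<subseteq> {1..r}" by auto
  then show "\<exists>js. reduced_expr r w js" using ws by (auto simp: reduced_expr_def)
qed

lemma comp_list_WB:
  assumes "set js \<subseteq> {1..r}"
  shows "comp_list (map (cox r) js) \<in> WB r"
  using assms by (induction js) simp_all

lemma lenB2_comp_list_le:
  assumes "set js \<subseteq> {1..r}"
  shows "lenB2 (comp_list (map (cox r) js)) \<le> 2 * length js"
  using assms
proof (induction js)
  case Nil
  then show ?case using lenB2_id by (simp add: id_def)
next
  case (Cons i js)
  then have "lenB2 (cox r i \<circ> comp_list (map (cox r) js)) \<le> lenB2 (comp_list (map (cox r) js)) + 2"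
    by (intro lenB2_cox_left_le comp_list_WB) auto
  then show ?case using Cons by (simp add: o_def)
qed

lemma reduced_expr_iff:
  "reduced_expr r w js \<longleftrightarrow> set js \<subseteq> {1..r} \<and> comp_list (map (cox r) js) = w \<and> lenB2 w = 2 * length js"
  using cox_length_B[of w] comp_list_WB[of js] unfolding reduced_expr_def by auto

text \<open>The first letter of a reduced word has to account for two units of \<open>lenB2\<close>,
  which happens exactly if it is a left descent. In this form reduced words can be assembled and
  taken apart letter by letter.\<close>

lemma reduced_expr_Cons:
  "reduced_expr r w (i # js) \<longleftrightarrow>
     i \<in> {1..r} \<and> w \<in> WB r \<and> iv w (i + 1) < iv w i \<and> reduced_expr r (cox r i \<circ> w) js"
proof
  assume "reduced_expr r w (i # js)"
  then have i: "i \<in> {1..r}" and js: "set js \<subseteq> {1..r}" and w: "w = cox r i \<circ> comp_list (map (cox r) js)"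
    and l: "lenB2 w = 2 * length js + 2"
    by (auto simp: reduced_expr_iff)
  let ?v = "comp_list (map (cox r) js)"
  have wW: "w \<in> WB r" using w i comp_list_WB[OF js] by simp
  have v: "?v = cox r i \<circ> w" using w i by simp
  have le: "lenB2 (cox r i \<circ> w) \<le> 2 * length js" using lenB2_comp_list_le[OF js] v by simp
  then have d: "iv w (i + 1) < iv w i"
    using lenB2_cox_left[OF i wW] l WB_trichotomy[OF WB_iv[OF wW], of i "i + 1"] by auto
  then have "lenB2 (cox r i \<circ> w) = 2 * length js"
    using lenB2_cox_left_desc[OF i wW] l by simp
  then show "i \<in> {1..r} \<and> w \<in> WB r \<and> iv w (i + 1) < iv w i \<and> reduced_expr r (cox r i \<circ> w) js"
    using i wW d js v by (simp add: reduced_expr_iff)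
next
  assume R: "i \<in> {1..r} \<and> w \<in> WB r \<and> iv w (i + 1) < iv w i \<and> reduced_expr r (cox r i \<circ> w) js"
  then have "lenB2 w = lenB2 (cox r i \<circ> w) + 2" using lenB2_cox_left_desc by blast
  then show "reduced_expr r w (i # js)" using R by (auto simp: reduced_expr_iff)
qed

section \<open>Braid relations in the group and Matsumoto's theorem\<close>

lemma cox_commute:
  assumes "1 \<le> i" "i + 2 \<le> j" "j \<le> r"
  shows "cox r i (cox r j x) = cox r j (cox r i x)"
proof -
  have "cox r i \<circ> cox r j = cox r j \<circ> cox r i"
  proof (rule WB_eqI)
    fix x assume x: "1 \<le> x" "x \<le> r"
    show "(cox r i \<circ> cox r j) x = (cox r j \<circ> cox r i) x"
    proof (cases "j = r")
      case True
      have "cox r i (r + 1) = r + 1" using True assms by (simp add: cox_apply)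
      then show ?thesis using x assms True by (auto simp: cox_low cox_r_apply)
    next
      case False
      then show ?thesis using x assms by (auto simp: cox_low)
    qed
  qed (use assms in auto)
  then show ?thesis by (metis comp_apply)
qed

lemma cox_braid:
  assumes "1 \<le> i" "i + 1 < r"
  shows "cox r i (cox r (i + 1) (cox r i x)) = cox r (i + 1) (cox r i (cox r (i + 1) x))"
proof -
  have "cox r i \<circ> cox r (i + 1) \<circ> cox r i = cox r (i + 1) \<circ> cox r i \<circ> cox r (i + 1)"
    by (rule WB_eqI) (use assms in \<open>auto simp: cox_low\<close>)
  then show ?thesis by (metis comp_apply)
qed

lemma cox_pred_r_apply:
  "cox r (r - 1) x = (if x = r - 1 then r else if x = r then r - 1
    else if x = r + 1 then r + 2 else if x = r + 2 then r + 1 else x)"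
  using r2 by (auto simp: cox_apply)

lemma cox_pred_r_values:
  "cox r (r - 1) (r - 1) = r" "cox r (r - 1) r = r - 1"
  "cox r (r - 1) (r + 1) = r + 2" "cox r (r - 1) (r + 2) = r + 1"
  "cox r r (r - 1) = r - 1" "cox r r r = r + 1" "cox r r (r + 1) = r" "cox r r (r + 2) = r + 2"
  unfolding cox_pred_r_apply cox_r_apply using r2 by auto

lemma cox_braid4:
  "cox r (r - 1) (cox r r (cox r (r - 1) (cox r r x))) = cox r r (cox r (r - 1) (cox r r (cox r (r - 1) x)))"
proof -
  have "r - 1 \<in> {1..r}" "r \<in> {1..r}" using r2 by auto
  note W = this[THEN cox_WB]
  have "cox r (r - 1) \<circ> cox r r \<circ> cox r (r - 1) \<circ> cox r r = cox r r \<circ> cox r (r - 1) \<circ> cox r r \<circ> cox r (r - 1)"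
  proof (rule WB_eqI)
    fix x assume x: "1 \<le> x" "x \<le> r"
    consider "x = r - 1" | "x = r" | "x < r - 1" using x by linarith
    then show "(cox r (r - 1) \<circ> cox r r \<circ> cox r (r - 1) \<circ> cox r r) x
      = (cox r r \<circ> cox r (r - 1) \<circ> cox r r \<circ> cox r (r - 1)) x"
    proof cases
      case 3
      then have "cox r (r - 1) x = x" "cox r r x = x" unfolding cox_pred_r_apply cox_r_apply by auto
      then show ?thesis by simp
    qed (simp_all only: o_apply cox_pred_r_values)
  qed (intro WB_comp W)+
  then show ?thesis by (metis comp_apply)
qed

text \<open>Matsumoto's theorem: if two reduced words of \<open>w\<close> start with different letters \<open>i\<close> and \<open>j\<close>,
  then \<open>w\<close> has reduced words starting with either side of the braid relation of \<open>i\<close> and \<open>j\<close>.\<close>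

lemma matsumoto:
  fixes f :: "nat \<Rightarrow> 'b \<Rightarrow> 'b"
  assumes e: "e \<in> C" and f: "\<And>i x. i \<in> {1..r} \<Longrightarrow> x \<in> C \<Longrightarrow> f i x \<in> C"
    and comm: "\<And>i j x. 1 \<le> i \<Longrightarrow> i + 2 \<le> j \<Longrightarrow> j \<le> r \<Longrightarrow> x \<in> C \<Longrightarrow> f i (f j x) = f j (f i x)"
    and braid: "\<And>i x. 1 \<le> i \<Longrightarrow> i + 1 < r \<Longrightarrow> x \<in> C \<Longrightarrow>
      f i (f (i + 1) (f i x)) = f (i + 1) (f i (f (i + 1) x))"
    and braid4: "\<And>x. x \<in> C \<Longrightarrow> f (r - 1) (f r (f (r - 1) (f r x))) = f r (f (r - 1) (f r (f (r - 1) x)))"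
    and red: "reduced_expr r w js" "reduced_expr r w ks"
  shows "foldr f js e = foldr f ks e"
proof -
  have closed: "foldr f js e \<in> C" if "reduced_expr r w js" for w js
    using that by (induction js arbitrary: w) (auto simp: reduced_expr_Cons e intro!: f)
  have ivc: "iv (cox r i \<circ> w) = iv w \<circ> cox r i" if "i \<in> {1..r}" "w \<in> WB r" for i w
    using that by simp
  have main: "foldr f (i # js) e = foldr f (j # ks) e"
    if IH: "\<And>w ls ms. length ls = n \<Longrightarrow> reduced_expr r w ls \<Longrightarrow> reduced_expr r w ms \<Longrightarrow> foldr f ls e = foldr f ms e"
      and n: "length js = n" "length ks = n" and lt: "i < j"
      and ri: "reduced_expr r w (i # js)" and rj: "reduced_expr r w (j # ks)"
    for n w i j js ks
  proof -
    from ri rj have i: "1 \<le> i" "i \<le> r" and j: "1 \<le> j" "j \<le> r" and w: "w \<in> WB r"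
      and di: "iv w (i + 1) < iv w i" and dj: "iv w (j + 1) < iv w j"
      and ri': "reduced_expr r (cox r i \<circ> w) js" and rj': "reduced_expr r (cox r j \<circ> w) ks"
      by (auto simp: reduced_expr_Cons)
    \<comment> \<open>By the induction hypothesis the tails may be exchanged for any other reduced
      words of the same elements, so it is enough to find tails for which the two products are
      related by a braid relation.\<close>
    have *: "foldr f (i # js) e = foldr f (j # ks) e"
      if "reduced_expr r (cox r i \<circ> w) as" "reduced_expr r (cox r j \<circ> w) bs"
        "f i (foldr f as e) = f j (foldr f bs e)" for as bs
      using IH[OF n(1) ri' that(1)] IH[OF n(2) rj' that(2)] that(3) by simp
    consider "i + 2 \<le> j" | "j = i + 1" "j < r" | "i = r - 1" "j = r" using lt j by linarith
    then show ?thesis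
    proof cases
      case 1
      have fixi: "cox r j i = i" "cox r j (i + 1) = i + 1"
        using 1 i j by (cases "j = r"; auto simp: cox_low cox_r_apply)+
      have fixj: "cox r i j = j" "cox r i (j + 1) = j + 1"
        using 1 i j by (auto simp: cox_apply)
      have c: "cox r i \<circ> (cox r j \<circ> w) = cox r j \<circ> (cox r i \<circ> w)"
        using cox_commute[of i j] 1 i j by auto
      have "cox r j \<circ> (cox r i \<circ> w) \<in> WB r" using i j w by simp
      then obtain vs where vs: "reduced_expr r (cox r j \<circ> (cox r i \<circ> w)) vs"
        using reduced_expr_exists by blast
      show ?thesis
      proof (rule *)
        show "reduced_expr r (cox r i \<circ> w) (j # vs)"
          using vs i j w dj fixj ivc by (auto simp: reduced_expr_Cons)
        show "reduced_expr r (cox r j \<circ> w) (i # vs)"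
          using vs c i j w di fixi ivc by (auto simp: reduced_expr_Cons)
        show "f i (foldr f (j # vs) e) = f j (foldr f (i # vs) e)"
          using comm[of i j "foldr f vs e"] closed[OF vs] 1 i j by simp
      qed
    next
      case 2
      have cv: "cox r i i = i + 1" "cox r i (i + 1) = i" "cox r i (i + 2) = i + 2"
        "cox r (i + 1) i = i" "cox r (i + 1) (i + 1) = i + 2" "cox r (i + 1) (i + 2) = i + 1"
        using 2 i by (auto simp: cox_low)
      have c: "cox r i \<circ> (cox r (i + 1) \<circ> (cox r i \<circ> w)) = cox r (i + 1) \<circ> (cox r i \<circ> (cox r (i + 1) \<circ> w))"
        using cox_braid[of i] 2 i by auto
      have ii: "i \<in> {1..r}" "i + 1 \<in> {1..r}" using 2 i by auto
      have p: "i + 1 + 1 = i + 2" by simp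
      have "cox r i \<circ> (cox r (i + 1) \<circ> (cox r i \<circ> w)) \<in> WB r" using ii w by simp
      then obtain vs where vs: "reduced_expr r (cox r i \<circ> (cox r (i + 1) \<circ> (cox r i \<circ> w))) vs"
        using reduced_expr_exists by blast
      have W: "cox r i \<circ> w \<in> WB r" "cox r (i + 1) \<circ> w \<in> WB r"
        "cox r (i + 1) \<circ> (cox r i \<circ> w) \<in> WB r" "cox r i \<circ> (cox r (i + 1) \<circ> w) \<in> WB r"
        using ii w by (auto intro!: WB_comp cox_WB)
      have d: "iv w (i + 1) < iv w i" "iv w (i + 2) < iv w (i + 1)" "iv w (i + 2) < iv w i"
        using di dj 2 by auto
      have ev: "iv (cox r k \<circ> v) x = iv v (cox r k x)" if "k \<in> {i, i + 1}" "v \<in> WB r" for k v x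
        using that ii ivc[of k v] by auto
      show ?thesis
      proof (rule *)
        show "reduced_expr r (cox r i \<circ> w) ((i + 1) # i # vs)"
          unfolding reduced_expr_Cons using vs ii w W d by (simp only: ev cv p insert_iff simp_thms)
        show "reduced_expr r (cox r j \<circ> w) (i # (i + 1) # vs)"
          unfolding reduced_expr_Cons 2 using vs c ii w W d
          by (simp only: ev cv p insert_iff simp_thms)
        show "f i (foldr f ((i + 1) # i # vs) e) = f j (foldr f (i # (i + 1) # vs) e)"
          using braid[of i "foldr f vs e"] closed[OF vs] 2 i by simp
      qed
    next
      case 3
      let ?a = "cox r (r - 1)" and ?b = "cox r r"
      have ii: "r - 1 \<in> {1..r}" "r \<in> {1..r}" using r2 by auto
      have m: "iv w (r + 1) = 2 * r + 1 - iv w r" "iv w (r + 2) = 2 * r + 1 - iv w (r - 1)"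
        using WB_mirror[OF WB_iv[OF w], of r] WB_mirror[OF WB_iv[OF w], of "r - 1"] r2 by auto
      note cv = cox_pred_r_values
      have pr: "r - 1 + 1 = r" using r2 by simp
      have di': "iv w r < iv w (r - 1)" and dj': "iv w (r + 1) < iv w r" using di dj 3 pr by simp_all
      have le: "iv w r \<le> 2 * r" "iv w (r - 1) \<le> 2 * r"
        using WB_bounds(2)[OF WB_iv[OF w], of r] WB_bounds(2)[OF WB_iv[OF w], of "r - 1"] r2 by auto
      \<comment> \<open>Mirror symmetry doubles the two given descents: the preimages of
        \<open>r - 1, ..., r + 2\<close> are strictly decreasing, which supplies every descent met
        along either side of the relation of length four.\<close>
      have d: "iv w r < iv w (r - 1)" "iv w (r + 1) < iv w r" "iv w (r + 2) < iv w (r + 1)"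
        "iv w (r + 1) < iv w (r - 1)" "iv w (r + 2) < iv w r" "iv w (r + 2) < iv w (r - 1)"
        using di' dj' m le by linarith+
      have c: "?a \<circ> (?b \<circ> (?a \<circ> (?b \<circ> w))) = ?b \<circ> (?a \<circ> (?b \<circ> (?a \<circ> w)))"
        using cox_braid4 by auto
      have "?b \<circ> (?a \<circ> (?b \<circ> (?a \<circ> w))) \<in> WB r" using ii w by (intro WB_comp cox_WB)
      then obtain vs where vs: "reduced_expr r (?b \<circ> (?a \<circ> (?b \<circ> (?a \<circ> w)))) vs"
        using reduced_expr_exists by blast
      have W: "?a \<circ> w \<in> WB r" "?b \<circ> w \<in> WB r"
        "?b \<circ> (?a \<circ> w) \<in> WB r" "?a \<circ> (?b \<circ> w) \<in> WB r"
        "?a \<circ> (?b \<circ> (?a \<circ> w)) \<in> WB r" "?b \<circ> (?a \<circ> (?b \<circ> w)) \<in> WB r"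
        using ii w by (auto intro!: WB_comp cox_WB)
      have ev: "iv (cox r k \<circ> v) x = iv v (cox r k x)" if "k \<in> {r - 1, r}" "v \<in> WB r" for k v x
        using that ii ivc[of k v] by auto
      show ?thesis
      proof (rule *)
        show "reduced_expr r (cox r i \<circ> w) (r # (r - 1) # r # vs)"
          unfolding reduced_expr_Cons 3 pr using vs ii w W d
          by (simp only: ev cv insert_iff simp_thms)
        show "reduced_expr r (cox r j \<circ> w) ((r - 1) # r # (r - 1) # vs)"
          unfolding reduced_expr_Cons 3 pr using vs c ii w W d
          by (simp only: ev cv insert_iff simp_thms)
        show "f i (foldr f (r # (r - 1) # r # vs) e) = f j (foldr f ((r - 1) # r # (r - 1) # vs) e)"
          using braid4[of "foldr f vs e"] closed[OF vs] 3 by simp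
      qed
    qed
  qed
  have "foldr f js e = foldr f ks e" if "length js = n" "reduced_expr r w js" "reduced_expr r w ks" for n w js ks
    using that
  proof (induction n arbitrary: w js ks)
    case 0
    then show ?case using lenB2_id by (auto simp: reduced_expr_iff id_def)
  next
    case (Suc n)
    have len: "length ks = Suc n" using Suc.prems by (auto simp: reduced_expr_iff)
    obtain i js' where js: "js = i # js'" "length js' = n" using Suc.prems by (cases js) auto
    obtain j ks' where ks: "ks = j # ks'" "length ks' = n" using len by (cases ks) auto
    have IH: "foldr f ls e = foldr f ms e"
      if "length ls = n" "reduced_expr r w ls" "reduced_expr r w ms" for w ls ms
      using Suc.IH that by blast
    consider "i < j" | "j < i" | "i = j" by linarith
    then show ?case
    proof cases
      case 1
      show ?thesis unfolding js ks
        by (rule main[OF IH js(2) ks(2) 1]) (use Suc.prems js ks in auto)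
    next
      case 2
      show ?thesis unfolding js ks
        by (rule main[OF IH ks(2) js(2) 2, symmetric]) (use Suc.prems js ks in auto)
    next
      case 3
      have "foldr f js' e = foldr f ks' e"
        by (rule IH[OF js(2), of "cox r i \<circ> w"]) (use Suc.prems js ks 3 in \<open>auto simp: reduced_expr_Cons\<close>)
      then show ?thesis using js ks 3 by simp
    qed
  qed
  then show ?thesis using red by blast
qed

end

section \<open>The Hecke algebra\<close>

lemma free_carrier_iff: "f \<in> carrier (free_alg r) \<longleftrightarrow> (\<forall>w\<in>Poly_Mapping.keys f. set (letters w) \<subseteq> {1..r})"
  by (simp add: free_alg_def)

lemma free_carrier_closed:
  assumes "f \<in> carrier (free_alg r)" "g \<in> carrier (free_alg r)"
  shows "f + g \<in> carrier (free_alg r)" "f - g \<in> carrier (free_alg r)"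
    "- f \<in> carrier (free_alg r)" "f * g \<in> carrier (free_alg r)"
proof -
  show "f + g \<in> carrier (free_alg r)" "f - g \<in> carrier (free_alg r)" "- f \<in> carrier (free_alg r)"
    using assms keys_add[of f g] keys_diff[of f g] by (auto simp: free_carrier_iff)
  show "f * g \<in> carrier (free_alg r)"
    unfolding free_carrier_iff
  proof
    fix w assume "w \<in> Poly_Mapping.keys (f * g)"
    then obtain u v where "u \<in> Poly_Mapping.keys f" "v \<in> Poly_Mapping.keys g" "w = u + v"
      using keys_mult[of f g] by auto
    then show "set (letters w) \<subseteq> {1..r}"
      using assms by (auto simp: free_carrier_iff plus_word_def)
  qed
qed

lemma free_const_carrier: "free_const c \<in> carrier (free_alg r)"
  by (simp add: free_carrier_iff free_const_def zero_word_def)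

lemma one_zero_carrier: "(1 :: free) \<in> carrier (free_alg r)" "(0 :: free) \<in> carrier (free_alg r)"
  by (simp_all add: free_carrier_iff zero_word_def)

lemma free_gen_carrier: "i \<in> {1..r} \<Longrightarrow> free_gen i \<in> carrier (free_alg r)"
  by (simp add: free_carrier_iff free_gen_def)

lemma free_alg_simps:
  "x \<otimes>\<^bsub>free_alg r\<^esub> y = x * y" "x \<oplus>\<^bsub>free_alg r\<^esub> y = x + y" "\<one>\<^bsub>free_alg r\<^esub> = 1" "\<zero>\<^bsub>free_alg r\<^esub> = 0"
  by (simp_all add: free_alg_def)

lemma ring_free_alg: "ring (free_alg r)"
proof (rule ringI)
  show "abelian_group (free_alg r)"
  proof (rule abelian_groupI)
    fix x assume "x \<in> carrier (free_alg r)"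
    then show "\<exists>y\<in>carrier (free_alg r). y \<oplus>\<^bsub>free_alg r\<^esub> x = \<zero>\<^bsub>free_alg r\<^esub>"
      by (intro bexI[of _ "- x"]) (simp_all add: free_alg_simps free_carrier_closed)
  qed (simp_all add: free_alg_simps free_carrier_closed one_zero_carrier add_ac)
  show "Group.monoid (free_alg r)"
    by (rule monoidI) (simp_all add: free_alg_simps free_carrier_closed one_zero_carrier mult.assoc)
qed (simp_all add: free_alg_simps distrib_left distrib_right)

text \<open>Scalars live on the empty word and so commute with monomials; a general element is the
  sum of its monomials.\<close>

lemma free_const_central: "free_const c * f = f * free_const c"
proof -
  have "free_const c * Poly_Mapping.single a b = Poly_Mapping.single a b * free_const c" for a b
    by (simp add: free_const_def mult_single mult.commute)
  then have "free_const c * (\<Sum>a\<in>Poly_Mapping.keys f. Poly_Mapping.single a (Poly_Mapping.lookup f a))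
    = (\<Sum>a\<in>Poly_Mapping.keys f. Poly_Mapping.single a (Poly_Mapping.lookup f a)) * free_const c"
    by (simp add: sum_distrib_left sum_distrib_right)
  moreover have "(\<Sum>a\<in>Poly_Mapping.keys f. Poly_Mapping.single a (Poly_Mapping.lookup f a)) = f"
    by (rule poly_mapping_eqI)
      (auto simp: lookup_sum lookup_single when_def in_keys_iff sum.delta')
  ultimately show ?thesis by simp
qed

context rank begin

abbreviation H :: "free set ring" where "H \<equiv> hecke r"
abbreviation hmult :: "free set \<Rightarrow> free set \<Rightarrow> free set" (infixl "\<cdot>" 70) where
  "x \<cdot> y \<equiv> x \<otimes>\<^bsub>hecke r\<^esub> y"
abbreviation hadd :: "free set \<Rightarrow> free set \<Rightarrow> free set" (infixl "\<boxplus>" 65) where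
  "x \<boxplus> y \<equiv> x \<oplus>\<^bsub>hecke r\<^esub> y"
abbreviation hone :: "free set" ("\<one>\<^sub>H") where "\<one>\<^sub>H \<equiv> \<one>\<^bsub>hecke r\<^esub>"
abbreviation T :: "nat \<Rightarrow> free set" where "T \<equiv> Tgen r"
abbreviation TW :: "(nat \<Rightarrow> nat) \<Rightarrow> free set" where "TW \<equiv> Tw r"

lemma pred_r_in [simp]: "r - 1 \<in> {1..r}" "r - Suc 0 \<in> {1..r}" "Suc 0 \<le> r - Suc 0"
  using r2 by auto

lemma hecke_rels_carrier: "hecke_rels r \<subseteq> carrier (free_alg r)"
  unfolding hecke_rels_def
  by (auto intro!: free_carrier_closed free_gen_carrier free_const_carrier one_zero_carrier)

lemma hecke_ideal: "ideal (hecke_ideal r) (free_alg r)"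
  unfolding hecke_ideal_def by (rule ring.genideal_ideal[OF ring_free_alg hecke_rels_carrier])

sublocale H: ring "hecke r"
  unfolding hecke_def by (rule ideal.quotient_is_ring[OF hecke_ideal])

definition hcls :: "free \<Rightarrow> free set" where "hcls f = hecke_ideal r +>\<^bsub>free_alg r\<^esub> f"

lemma hcls_hom: "hcls \<in> ring_hom (free_alg r) (hecke r)"
  using ideal.rcos_ring_hom[OF hecke_ideal] unfolding hecke_def hcls_def[abs_def] .

lemma hcls_mult: "f \<in> carrier (free_alg r) \<Longrightarrow> g \<in> carrier (free_alg r) \<Longrightarrow> hcls (f * g) = hcls f \<cdot> hcls g"
  using ring_hom_mult[OF hcls_hom] by (simp add: free_alg_simps)

lemma hcls_add: "f \<in> carrier (free_alg r) \<Longrightarrow> g \<in> carrier (free_alg r) \<Longrightarrow> hcls (f + g) = hcls f \<boxplus> hcls g"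
  using ring_hom_add[OF hcls_hom] by (simp add: free_alg_simps)

lemma hcls_one: "hcls 1 = \<one>\<^sub>H"
  using ring_hom_one[OF hcls_hom] by (simp add: free_alg_simps)

lemma hcls_closed: "f \<in> carrier (free_alg r) \<Longrightarrow> hcls f \<in> carrier H"
  using ring_hom_closed[OF hcls_hom] .

lemma carrier_hcls: "x \<in> carrier H \<Longrightarrow> \<exists>f\<in>carrier (free_alg r). x = hcls f"
  unfolding hecke_def FactRing_def hcls_def by (auto simp: A_RCOSETS_def')

text \<open>A relator lies in the generated ideal, so its class vanishes. All relations among the
  \<open>T i\<close> are drawn from the presentation through this lemma.\<close>

lemma hcls_eqI:
  assumes "f - g \<in> hecke_rels r" "f \<in> carrier (free_alg r)" "g \<in> carrier (free_alg r)"
  shows "hcls f = hcls g"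
proof -
  interpret F: ring "free_alg r" by (rule ring_free_alg)
  interpret I: ideal "hecke_ideal r" "free_alg r" by (rule hecke_ideal)
  have "f - g \<in> hecke_ideal r"
    unfolding hecke_ideal_def using F.genideal_self[OF hecke_rels_carrier] assms(1) by blast
  then have "hcls (f - g) = \<zero>\<^bsub>H\<^esub>"
    using I.a_rcos_const by (simp add: hcls_def hecke_def FactRing_def)
  moreover have "hcls (g + (f - g)) = hcls g \<boxplus> hcls (f - g)"
    using assms by (intro hcls_add free_carrier_closed)
  ultimately show ?thesis using hcls_closed[OF assms(3)] by simp
qed

lemma T_hcls: "T i = hcls (free_gen i)" and hconst_hcls: "hconst r c = hcls (free_const c)"
  by (simp_all add: Tgen_def hconst_def hcls_def)

lemma T_closed [simp]: "i \<in> {1..r} \<Longrightarrow> T i \<in> carrier H"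
  by (simp add: T_hcls hcls_closed free_gen_carrier)

lemma hconst_closed [simp]: "hconst r c \<in> carrier H"
  by (simp add: hconst_hcls hcls_closed free_const_carrier)

lemma hconst_central:
  assumes "x \<in> carrier H" shows "hconst r c \<cdot> x = x \<cdot> hconst r c"
  using carrier_hcls[OF assms]
  by (auto simp: hconst_hcls hcls_mult[symmetric] free_const_carrier free_const_central)

lemma hconst_mult: "hconst r (c * d) = hconst r c \<cdot> hconst r d"
  by (simp add: hconst_hcls hcls_mult[symmetric] free_const_carrier)
    (simp add: free_const_def mult_single)

lemma hconst_add: "hconst r (c + d) = hconst r c \<boxplus> hconst r d"
  by (simp add: hconst_hcls hcls_add[symmetric] free_const_carrier)
    (simp add: free_const_def single_add)

lemma hconst_one: "hconst r 1 = \<one>\<^sub>H"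
  by (simp add: hconst_hcls free_const_def hcls_one[symmetric])

lemma hconst_zero: "hconst r 0 = \<zero>\<^bsub>H\<^esub>"
proof -
  have "hconst r 0 \<boxplus> hconst r 0 = hconst r 0" using hconst_add[of 0 0] by simp
  then show ?thesis by (meson H.add.l_cancel_one hconst_closed)
qed

lemmas hcls_simps = hcls_mult hcls_add hcls_one free_gen_carrier free_carrier_closed one_zero_carrier free_const_carrier

lemma T_comm:
  assumes "i \<in> {1..r}" "j \<in> {1..r}" "i + 2 \<le> j"
  shows "T i \<cdot> T j = T j \<cdot> T i"
proof -
  have "hcls (free_gen i * free_gen j) = hcls (free_gen j * free_gen i)"
  proof (rule hcls_eqI)
    show "free_gen i * free_gen j - free_gen j * free_gen i \<in> hecke_rels r"
      unfolding hecke_rels_def by (rule UnI1, rule UnI1, rule UnI1, rule UnI1, intro CollectI exI[of _ i] exI[of _ j]) (use assms in auto)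
  qed (use assms in \<open>auto intro!: free_carrier_closed free_gen_carrier\<close>)
  then show ?thesis using assms by (simp add: T_hcls hcls_simps)
qed

lemma T_braid:
  assumes "1 \<le> i" "i + 1 < r"
  shows "T i \<cdot> T (i + 1) \<cdot> T i = T (i + 1) \<cdot> T i \<cdot> T (i + 1)"
proof -
  have "hcls (free_gen i * free_gen (i + 1) * free_gen i) = hcls (free_gen (i + 1) * free_gen i * free_gen (i + 1))"
  proof (rule hcls_eqI)
    show "free_gen i * free_gen (i + 1) * free_gen i - free_gen (i + 1) * free_gen i * free_gen (i + 1) \<in> hecke_rels r"
      unfolding hecke_rels_def by (rule UnI1, rule UnI1, rule UnI1, rule UnI2) (use assms in auto)
  qed (use assms in \<open>auto intro!: free_carrier_closed free_gen_carrier\<close>)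
  then show ?thesis using assms by (simp add: T_hcls hcls_simps)
qed

lemma T_braid4:
  "T (r - 1) \<cdot> T r \<cdot> T (r - 1) \<cdot> T r = T r \<cdot> T (r - 1) \<cdot> T r \<cdot> T (r - 1)"
proof -
  have "hcls (free_gen (r - 1) * free_gen r * free_gen (r - 1) * free_gen r)
    = hcls (free_gen r * free_gen (r - 1) * free_gen r * free_gen (r - 1))"
  proof (rule hcls_eqI)
    show "free_gen (r - 1) * free_gen r * free_gen (r - 1) * free_gen r
      - free_gen r * free_gen (r - 1) * free_gen r * free_gen (r - 1) \<in> hecke_rels r"
      unfolding hecke_rels_def by blast
  qed (use r2 in \<open>auto intro!: free_carrier_closed free_gen_carrier\<close>)
  then show ?thesis using r2 by (simp add: T_hcls hcls_simps)
qed

abbreviation hq :: "free set" where "hq \<equiv> hconst r qvar"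

lemma T_quad:
  assumes "1 \<le> i" "i < r"
  shows "T i \<cdot> T i = hconst r (qvar - 1) \<cdot> T i \<boxplus> hq"
proof -
  have "hcls (free_gen i * free_gen i) = hcls (free_const (qvar - 1) * free_gen i + free_const qvar)"
  proof (rule hcls_eqI)
    show "free_gen i * free_gen i - (free_const (qvar - 1) * free_gen i + free_const qvar) \<in> hecke_rels r"
      unfolding hecke_rels_def by (rule UnI1, rule UnI2) (use assms in auto)
  qed (use assms in \<open>auto intro!: free_carrier_closed free_gen_carrier free_const_carrier\<close>)
  then show ?thesis using assms by (simp add: T_hcls hconst_hcls hcls_simps)
qed

lemma T_r_sq: "T r \<cdot> T r = \<one>\<^sub>H"
proof -
  have "hcls (free_gen r * free_gen r) = hcls 1"
  proof (rule hcls_eqI)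
    show "free_gen r * free_gen r - 1 \<in> hecke_rels r" unfolding hecke_rels_def by blast
  qed (auto intro!: free_carrier_closed free_gen_carrier one_zero_carrier)
  then show ?thesis by (simp add: T_hcls hcls_simps)
qed

abbreviation Tword :: "nat list \<Rightarrow> free set" where "Tword js \<equiv> foldr (\<lambda>i x. T i \<cdot> x) js \<one>\<^sub>H"

text \<open>Left multiplications by the \<open>T i\<close> satisfy the braid relations on the
  carrier, so Matsumoto's theorem applies to them and the word chosen in \<open>Tw\<close> may be
  exchanged for any other.\<close>

lemma Tw_reduced:
  assumes "reduced_expr r w js"
  shows "TW w = Tword js"
proof -
  have red: "reduced_expr r w (SOME js. reduced_expr r w js)" using assms by (rule someI)
  show ?thesis
    unfolding Tw_def
  proof (rule matsumoto[where C = "carrier H", OF _ _ _ _ _ red assms])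
    fix i j x assume "1 \<le> i" "i + 2 \<le> j" "j \<le> r" "x \<in> carrier H"
    then show "T i \<cdot> (T j \<cdot> x) = T j \<cdot> (T i \<cdot> x)"
      using T_comm[of i j] by (simp add: H.m_assoc[symmetric])
  next
    fix i x assume "1 \<le> i" "i + 1 < r" "x \<in> carrier H"
    then show "T i \<cdot> (T (i + 1) \<cdot> (T i \<cdot> x)) = T (i + 1) \<cdot> (T i \<cdot> (T (i + 1) \<cdot> x))"
      using T_braid[of i] by (simp add: H.m_assoc[symmetric])
  next
    fix x assume "x \<in> carrier H"
    then show "T (r - 1) \<cdot> (T r \<cdot> (T (r - 1) \<cdot> (T r \<cdot> x))) = T r \<cdot> (T (r - 1) \<cdot> (T r \<cdot> (T (r - 1) \<cdot> x)))"
      using T_braid4 by (simp add: H.m_assoc[symmetric])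
  qed auto
qed

lemma Tword_closed: "set js \<subseteq> {1..r} \<Longrightarrow> Tword js \<in> carrier H"
  by (induction js) auto

lemma Tw_closed [simp]:
  assumes "w \<in> WB r" shows "TW w \<in> carrier H"
proof -
  obtain js where js: "reduced_expr r w js" using reduced_expr_exists[OF assms] by blast
  then show ?thesis using Tw_reduced[OF js] Tword_closed by (simp add: reduced_expr_def)
qed

lemma Tw_id [simp]: "TW id = \<one>\<^sub>H"
proof -
  have "reduced_expr r id []" by (simp add: reduced_expr_iff)
  from Tw_reduced[OF this] show ?thesis by simp
qed

lemma Tw_left:
  assumes "i \<in> {1..r}" "w \<in> WB r" "iv w i < iv w (i + 1)"
  shows "T i \<cdot> TW w = TW (cox r i \<circ> w)"
proof -
  obtain js where js: "reduced_expr r w js" using reduced_expr_exists[OF assms(2)] by blast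
  then have "reduced_expr r (cox r i \<circ> w) (i # js)"
    using lenB2_cox_left[OF assms] assms(1) by (auto simp: reduced_expr_iff)
  from Tw_reduced[OF this] Tw_reduced[OF js] show ?thesis by simp
qed

lemma Tword_append:
  assumes "set js \<subseteq> {1..r}" "i \<in> {1..r}"
  shows "Tword (js @ [i]) = Tword js \<cdot> T i"
  using assms by (induction js) (auto simp: H.m_assoc Tword_closed)

lemma Tw_right:
  assumes "i \<in> {1..r}" "w \<in> WB r" "w i < w (i + 1)"
  shows "TW w \<cdot> T i = TW (w \<circ> cox r i)"
proof -
  obtain js where js: "reduced_expr r w js" using reduced_expr_exists[OF assms(2)] by blast
  then have "reduced_expr r (w \<circ> cox r i) (js @ [i])"
    using lenB2_cox[OF assms] assms(1) by (auto simp: reduced_expr_iff)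
  from Tw_reduced[OF this] Tw_reduced[OF js] show ?thesis
    using js assms(1) Tword_append[of js i] by (simp add: reduced_expr_def)
qed

text \<open>If \<open>s_r\<close> shortens \<open>w\<close>, the ascending case applied to
  \<open>s_r w\<close> and the relation that \<open>T r\<close> squares to one give the same
  formula; so no condition on lengths remains.\<close>

lemma Tw_r_left:
  assumes w: "w \<in> WB r"
  shows "T r \<cdot> TW w = TW (cox r r \<circ> w)"
proof (cases "iv w r < iv w (r + 1)")
  case True
  then show ?thesis using Tw_left[of r w] w by simp
next
  case False
  then have "iv w (r + 1) < iv w r" using WB_trichotomy[OF WB_iv[OF w], of r "r + 1"] by auto
  then have "T r \<cdot> TW (cox r r \<circ> w) = TW w"
    using Tw_left[of r "cox r r \<circ> w"] w by (simp add: cox_r_apply)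
  then have "T r \<cdot> TW w = T r \<cdot> (T r \<cdot> TW (cox r r \<circ> w))" by simp
  then show ?thesis using w T_r_sq by (simp add: H.m_assoc[symmetric])
qed

lemma Tw_r_right:
  assumes w: "w \<in> WB r"
  shows "TW w \<cdot> T r = TW (w \<circ> cox r r)"
proof (cases "w r < w (r + 1)")
  case True
  then show ?thesis using Tw_right[of r w] w by simp
next
  case False
  then have "w (r + 1) < w r" using WB_trichotomy[OF w, of r "r + 1"] by auto
  then have "TW (w \<circ> cox r r) \<cdot> T r = TW w"
    using Tw_right[of r "w \<circ> cox r r"] w by (simp add: cox_r_apply)
  then have "TW w \<cdot> T r = TW (w \<circ> cox r r) \<cdot> T r \<cdot> T r" by simp
  then show ?thesis using w T_r_sq by (simp add: H.m_assoc)
qed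

end

section \<open>Type D descents and block stabilisers\<close>

context rank begin

lemma neg_ident [simp]: "neg r (\<lambda>x. x) = 0" and lenD2_ident [simp]: "lenD2 (\<lambda>x. x) = 0"
  and WB_ident [simp]: "(\<lambda>x. x) \<in> WB r"
  using neg_id lenD2_id WB_id by (simp_all add: id_def)

section \<open>The parity character and the group of type D\<close>

lemma WD_iff: "w \<in> WD r \<longleftrightarrow> w \<in> WB r \<and> even (neg r w)"
  by (simp add: WD_def neg_def)

lemma even_neg_cox:
  assumes "w \<in> WB r" "i \<in> {1..r}"
  shows "even (neg r (w \<circ> cox r i)) \<longleftrightarrow> (even (neg r w) \<longleftrightarrow> i < r)"
proof (cases "i < r")
  case True
  then show ?thesis using neg_cox assms by simp
next
  case False
  then have [simp]: "i = r" using assms by simp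
  consider "w r < w (r + 1)" | "w (r + 1) < w r" using WB_trichotomy[OF assms(1), of r "r + 1"] by auto
  then show ?thesis
  proof cases
    case 1
    then show ?thesis using neg_cox_r[OF assms(1)] by simp
  next
    case 2
    then have "neg r (w \<circ> cox r r \<circ> cox r r) = neg r (w \<circ> cox r r) + 1"
      using assms by (intro neg_cox_r) (simp_all add: cox_r_apply)
    then show ?thesis by simp
  qed
qed

lemma WB_induct [consumes 1, case_names id cox]:
  assumes "w \<in> WB r" "P id"
    and "\<And>w i. w \<in> WB r \<Longrightarrow> i \<in> {1..r} \<Longrightarrow> P w \<Longrightarrow> P (w \<circ> cox r i)"
  shows "P w"
  using assms(1)
proof (induction "lenB2 w" arbitrary: w rule: less_induct)
  case less
  show ?case
  proof (cases "w = id")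
    case False
    then obtain i where i: "i \<in> {1..r}" "w (i + 1) < w i" using exists_descent less.prems by blast
    then have "P (w \<circ> cox r i)"
      using lenB2_cox_desc[OF i(1) less.prems i(2)] less.prems by (intro less.hyps) auto
    then have "P (w \<circ> cox r i \<circ> cox r i)" using i less.prems by (intro assms(3)[of "w \<circ> cox r i"] WB_comp cox_WB)
    then show ?thesis using i by simp
  qed (use assms(2) in simp)
qed

text \<open>Among the generators only \<open>s_r\<close> flips the parity of \<open>neg\<close>, so
  induction along a word shows that this parity is a homomorphism; type D is its kernel.\<close>

lemma even_neg_comp:
  assumes "v \<in> WB r" "u \<in> WB r"
  shows "even (neg r (u \<circ> v)) \<longleftrightarrow> (even (neg r u) \<longleftrightarrow> even (neg r v))"
  using assms
proof (induction v rule: WB_induct)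
  case id
  then show ?case using neg_id by (simp add: o_def id_def)
next
  case (cox w i)
  have "even (neg r (u \<circ> w \<circ> cox r i)) \<longleftrightarrow> (even (neg r (u \<circ> w)) \<longleftrightarrow> i < r)"
    using cox by (intro even_neg_cox) auto
  moreover have "even (neg r (w \<circ> cox r i)) \<longleftrightarrow> (even (neg r w) \<longleftrightarrow> i < r)"
    using cox by (intro even_neg_cox)
  moreover have "even (neg r (u \<circ> w)) \<longleftrightarrow> (even (neg r u) \<longleftrightarrow> even (neg r w))" using cox by blast
  ultimately show ?case unfolding o_def by argo
qed

lemma WD_WB: "w \<in> WD r \<Longrightarrow> w \<in> WB r"
  by (simp add: WD_iff)

lemma WD_id [simp]: "id \<in> WD r" and
  WD_comp [simp]: "u \<in> WD r \<Longrightarrow> v \<in> WD r \<Longrightarrow> u \<circ> v \<in> WD r" and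
  WD_iv [simp]: "u \<in> WD r \<Longrightarrow> iv u \<in> WD r"
  by (auto simp: WD_iff even_neg_comp neg_iv)

text \<open>The generator \<open>s\<^sub>r s\<^sub>r\<^sub>-\<^sub>1 s\<^sub>r\<close> of type \<open>D\<close> has index \<open>r\<close>. It exchanges \<open>r - 1\<close> and \<open>r + 1\<close>, so that a
  descent of \<open>w\<close> at the generator \<open>i\<close> is an inversion of \<open>w\<close> at \<open>dfst i\<close>, \<open>i + 1\<close>.\<close>

definition dgen :: "nat \<Rightarrow> nat \<Rightarrow> nat" where
  "dgen i = (if i < r then cox r i else cox r r \<circ> cox r (r - 1) \<circ> cox r r)"
definition dfst :: "nat \<Rightarrow> nat" where "dfst i = (if i < r then i else r - 1)"
definition Tdgen :: "nat \<Rightarrow> free set" where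
  "Tdgen i = (if i < r then T i else T r \<cdot> T (r - 1) \<cdot> T r)"

lemma cox_gens_D_dgen: "cox_gens_D r = dgen ` {1..r}"
proof -
  have "{1..r} = insert r {1..<r}" using r2 by auto
  then show ?thesis by (auto simp: cox_gens_D_def dgen_def)
qed

lemma dgen_WB [simp]: "i \<in> {1..r} \<Longrightarrow> dgen i \<in> WB r"
  by (auto simp: dgen_def intro!: WB_comp cox_WB)

lemma dgen_dgen [simp]:
  assumes "i \<in> {1..r}"
  shows "dgen i (dgen i x) = x" "dgen i \<circ> (dgen i \<circ> w) = w" "w \<circ> dgen i \<circ> dgen i = w"
proof -
  show "dgen i (dgen i x) = x" for x
    using assms cox_cox[of r] cox_cox[OF pred_r_in(1)] by (simp add: dgen_def del: One_nat_def)
  then show "dgen i \<circ> (dgen i \<circ> w) = w" "w \<circ> dgen i \<circ> dgen i = w" by (simp_all add: fun_eq_iff)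
qed

lemma iv_dgen [simp]: "i \<in> {1..r} \<Longrightarrow> iv (dgen i) = dgen i"
  by (intro inv_unique_comp) (auto simp: fun_eq_iff)

lemma dgen_WD [simp]:
  assumes "i \<in> {1..r}" shows "dgen i \<in> WD r"
proof -
  have c: "even (neg r (cox r i)) \<longleftrightarrow> i < r" if "i \<in> {1..r}" for i
    using even_neg_cox[OF WB_id that] by (simp add: o_def id_def)
  show ?thesis
    using assms c[of i] c[of r] c[of "r - 1"] r2
    by (auto simp: WD_iff dgen_def even_neg_comp intro!: WB_comp)
qed

lemma dgen_apply_ends:
  "dgen i (dfst i) = i + 1" "dgen i (i + 1) = dfst i" if "i \<in> {1..r}"
proof -
  have "dgen r (r - 1) = r + 1" "dgen r (r + 1) = r - 1"
    by (simp_all add: dgen_def cox_pred_r_values del: One_nat_def)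
  then show "dgen i (dfst i) = i + 1" "dgen i (i + 1) = dfst i"
    using that by (cases "i < r"; auto simp: dfst_def dgen_def cox_low)+
qed

lemma dgen_r_apply: "dgen r x = (if x = r - 1 then r + 1 else if x = r then r + 2
  else if x = r + 1 then r - 1 else if x = r + 2 then r else x)"
proof -
  consider "x \<in> {r - 1, r, r + 1, r + 2}" | "x \<notin> {r - 1, r, r + 1, r + 2}" by blast
  then show ?thesis
  proof cases
    case 1
    moreover have "dgen r (r - 1) = r + 1" "dgen r r = r + 2" "dgen r (r + 1) = r - 1" "dgen r (r + 2) = r"
      by (simp_all only: dgen_def o_apply cox_pred_r_values if_False less_irrefl)
    ultimately show ?thesis using r2 by auto
  next
    case 2
    then have "cox r r x = x" "cox r (r - 1) x = x" unfolding cox_r_apply cox_pred_r_apply by auto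
    then show ?thesis using 2 by (simp add: dgen_def)
  qed
qed

text \<open>For \<open>i = r\<close> the outer factors \<open>s_r\<close> do not affect
  \<open>lenD2\<close>, and \<open>w s_r\<close> has at \<open>r - 1\<close> and \<open>r\<close>
  the values of \<open>w\<close> at \<open>r - 1\<close> and \<open>r + 1\<close>; so the claim is
  that of \<open>s_(r-1)\<close> for \<open>w s_r\<close>.\<close>

lemma lenD2_dgen:
  assumes "i \<in> {1..r}" "w \<in> WB r" "w (dfst i) < w (i + 1)"
  shows "lenD2 (w \<circ> dgen i) = lenD2 w + 2"
proof (cases "i < r")
  case True
  then show ?thesis using lenD2_cox assms by (simp add: dgen_def dfst_def)
next
  case False
  then have [simp]: "i = r" using assms by simp
  have "lenD2 (w \<circ> dgen r) = lenD2 (w \<circ> cox r r \<circ> cox r (r - 1))"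
    using lenD2_cox_r[OF WB_comp[OF WB_comp[OF assms(2) cox_WB] cox_WB[OF pred_r_in(1)]], of r]
    by (simp add: dgen_def o_assoc)
  also have "\<dots> = lenD2 (w \<circ> cox r r) + 2"
    using assms r2 cox_pred_r_values by (intro lenD2_cox) (auto simp: dfst_def)
  finally show ?thesis using lenD2_cox_r[OF assms(2)] by simp
qed

lemma lenD2_dgen_desc:
  assumes "i \<in> {1..r}" "w \<in> WB r" "w (i + 1) < w (dfst i)"
  shows "lenD2 w = lenD2 (w \<circ> dgen i) + 2"
proof -
  have "lenD2 (w \<circ> dgen i \<circ> dgen i) = lenD2 (w \<circ> dgen i) + 2"
    using assms dgen_apply_ends[OF assms(1)] by (intro lenD2_dgen) auto
  then show ?thesis using assms by simp
qed

lemma dfst_neq: "i \<in> {1..r} \<Longrightarrow> dfst i \<noteq> i + 1"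
  by (auto simp: dfst_def)

lemma dfst_bounds:
  assumes "i \<in> {1..r}"
  shows "1 \<le> dfst i" "dfst i < i + 1" "dfst i + (i + 1) \<noteq> 2 * r + 1" "i + 1 \<le> 2 * r"
  using assms r2 by (auto simp: dfst_def; linarith)+

lemma lenD2_dgen_left:
  assumes "i \<in> {1..r}" "w \<in> WB r" "iv w (dfst i) < iv w (i + 1)"
  shows "lenD2 (dgen i \<circ> w) = lenD2 w + 2"
proof -
  have "lenD2 (iv (dgen i \<circ> w)) = lenD2 (iv w) + 2"
    using lenD2_dgen[of i "iv w"] assms by simp
  then show ?thesis using assms(1,2) by (simp del: iv_comp)
qed

lemma lenD2_dgen_left_desc:
  assumes "i \<in> {1..r}" "w \<in> WB r" "iv w (i + 1) < iv w (dfst i)"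
  shows "lenD2 w = lenD2 (dgen i \<circ> w) + 2"
proof -
  have "lenD2 (iv w) = lenD2 (iv (dgen i \<circ> w)) + 2"
    using lenD2_dgen_desc[of i "iv w"] assms by simp
  then show ?thesis using assms(1,2) by (simp del: iv_comp)
qed

text \<open>Ascents at all generators of type D leave only the order of the values at
  \<open>r\<close> and \<open>r + 1\<close> open; if these are out of order, then
  \<open>w s_r\<close> is increasing. So the elements without descent are the two of
  \<open>lenD2\<close> zero.\<close>

lemma exists_D_descent:
  assumes w: "w \<in> WB r" "w \<noteq> id" "w \<noteq> cox r r"
  shows "\<exists>i\<in>{1..r}. w (i + 1) < w (dfst i)"
proof (rule ccontr)
  assume "\<not> ?thesis"
  then have asc: "w (dfst i) < w (i + 1)" if "i \<in> {1..r}" for i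
    using WB_trichotomy[OF w(1), of "i + 1" "dfst i"] dfst_neq that by metis
  then have a: "w i < w (i + 1)" if "1 \<le> i" "i < r" for i
    using that asc[of i] by (simp add: dfst_def)
  have b: "w (r - 1) < w (r + 1)" using asc[of r] by (simp add: dfst_def)
  show False
  proof (cases "w r < w (r + 1)")
    case True
    then have "w i < w (i + 1)" if "i \<in> {1..r}" for i
      using that a by (cases "i = r") auto
    then show False using increasing_eq_id w by blast
  next
    case False
    then have c: "w (r + 1) < w r" using WB_trichotomy[OF w(1), of r "r + 1"] by auto
    have "w \<circ> cox r r = id"
    proof (rule increasing_eq_id)
      show "w \<circ> cox r r \<in> WB r" using w by simp
      fix i assume i: "i \<in> {1..r}"
      consider "i = r" | "i = r - 1" | "i < r - 1" using i by fastforce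
      then show "(w \<circ> cox r r) i < (w \<circ> cox r r) (i + 1)"
      proof cases
        case 1
        then show ?thesis using c by (simp add: cox_r_apply)
      next
        case 2
        then have "i + 1 = r" "i \<noteq> r" "i \<noteq> r + 1" using r2 by auto
        then show ?thesis using b 2 by (simp add: cox_r_apply)
      next
        case 3
        then show ?thesis using a[of i] i by (auto simp: cox_r_apply)
      qed
    qed
    then have "w \<circ> cox r r \<circ> cox r r = cox r r" by simp
    then show False using w by simp
  qed
qed

lemma exists_D_descent_WD:
  assumes w: "w \<in> WD r" "w \<noteq> id"
  shows "\<exists>i\<in>{1..r}. w (i + 1) < w (dfst i)"
proof (rule exists_D_descent)
  have "\<not> even (neg r (cox r r))"
    using even_neg_cox[of id r] by (simp add: o_def id_def)
  then show "w \<noteq> cox r r" using w by (auto simp: WD_iff)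
qed (use w WD_WB in auto)

lemma cox_length_D:
  assumes w: "w \<in> WD r"
  shows "2 * cox_length (cox_gens_D r) w = lenD2 w"
proof (rule cox_length_eq(1)[where G = "WD r"])
  fix s w assume s: "s \<in> cox_gens_D r" and w: "w \<in> WD r"
  then obtain i where i: "i \<in> {1..r}" "s = dgen i" by (auto simp: cox_gens_D_dgen)
  then show "s \<circ> w \<in> WD r" using w by simp
  show "lenD2 (s \<circ> w) \<le> lenD2 w + 2"
    using i w WD_WB lenD2_dgen_left[of i w] lenD2_dgen_left_desc[of i w]
      WB_trichotomy[of "iv w" "dfst i" "i + 1"] dfst_neq[of i] by fastforce
next
  fix w assume w: "w \<in> WD r" "w \<noteq> id"
  have "iv w \<noteq> id" using w WD_WB by (metis iv_iv inv_id)
  then obtain i where i: "i \<in> {1..r}" "iv w (i + 1) < iv w (dfst i)"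
    using exists_D_descent_WD[of "iv w"] w by auto
  show "\<exists>s\<in>cox_gens_D r. \<exists>v\<in>WD r. w = s \<circ> v \<and> lenD2 w = lenD2 v + 2"
  proof (intro bexI conjI)
    show "w = dgen i \<circ> (dgen i \<circ> w)" using i by simp
    show "lenD2 w = lenD2 (dgen i \<circ> w) + 2" using lenD2_dgen_left_desc i w WD_WB by blast
  qed (use i w in \<open>auto simp: cox_gens_D_dgen\<close>)
qed (use w in auto)

lemma Tdgen_closed [simp]: "i \<in> {1..r} \<Longrightarrow> Tdgen i \<in> carrier H"
  by (auto simp: Tdgen_def)

lemma Tw_dgen_right:
  assumes "i \<in> {1..r}" "w \<in> WB r" "w (dfst i) < w (i + 1)"
  shows "TW w \<cdot> Tdgen i = TW (w \<circ> dgen i)"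
proof (cases "i < r")
  case True
  then show ?thesis using Tw_right assms by (simp add: dgen_def dfst_def Tdgen_def)
next
  case False
  then have [simp]: "i = r" using assms by simp
  let ?u = "w \<circ> cox r r"
  have u: "?u \<in> WB r" using assms by simp
  have p: "r - 1 + 1 = r" using r2 by simp
  have "TW w \<cdot> Tdgen r = TW w \<cdot> T r \<cdot> T (r - 1) \<cdot> T r"
    using assms by (simp add: Tdgen_def H.m_assoc)
  also have "\<dots> = TW ?u \<cdot> T (r - 1) \<cdot> T r" using Tw_r_right assms by simp
  also have "TW ?u \<cdot> T (r - 1) = TW (?u \<circ> cox r (r - 1))"
    using assms(3) u by (intro Tw_right) (simp_all only: p o_apply cox_pred_r_values dfst_def pred_r_in, simp_all)
  also have "\<dots> \<cdot> T r = TW (?u \<circ> cox r (r - 1) \<circ> cox r r)"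
    by (intro Tw_r_right WB_comp u cox_WB) simp
  finally show ?thesis by (simp add: dgen_def o_assoc)
qed

lemma Tw_dgen_left:
  assumes "i \<in> {1..r}" "w \<in> WB r" "iv w (dfst i) < iv w (i + 1)"
  shows "Tdgen i \<cdot> TW w = TW (dgen i \<circ> w)"
proof (cases "i < r")
  case True
  then show ?thesis using Tw_left assms by (simp add: dgen_def dfst_def Tdgen_def)
next
  case False
  then have [simp]: "i = r" using assms by simp
  let ?u = "cox r r \<circ> w"
  have u: "?u \<in> WB r" using assms by simp
  have p: "r - 1 + 1 = r" using r2 by simp
  have iu: "iv ?u = iv w \<circ> cox r r" using assms by simp
  have "Tdgen r \<cdot> TW w = T r \<cdot> (T (r - 1) \<cdot> (T r \<cdot> TW w))"
    using assms by (simp add: Tdgen_def H.m_assoc)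
  also have "\<dots> = T r \<cdot> (T (r - 1) \<cdot> TW ?u)" using Tw_r_left assms by simp
  also have "T (r - 1) \<cdot> TW ?u = TW (cox r (r - 1) \<circ> ?u)"
    using assms(3) u unfolding iu
    by (intro Tw_left) (simp_all only: p iu o_apply cox_pred_r_values dfst_def pred_r_in, simp_all)
  also have "T r \<cdot> \<dots> = TW (cox r r \<circ> (cox r (r - 1) \<circ> ?u))"
    by (intro Tw_r_left WB_comp u cox_WB) simp
  finally show ?thesis by (simp add: dgen_def o_assoc)
qed

text \<open>A family of blocks is encoded by its labels: monotonicity makes the fibres intervals,
  and the second clause makes mirror images of blocks blocks. The blocks of a composition
  (\<open>blk\<close>) and those of a single segment (\<open>seg\<close>) are the two
  instances.\<close>

definition block_labelling :: "(nat \<Rightarrow> nat) \<Rightarrow> bool" where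
  "block_labelling c \<longleftrightarrow>
     (\<forall>x y. 1 \<le> x \<longrightarrow> x \<le> y \<longrightarrow> y \<le> 2 * r \<longrightarrow> c x \<le> c y) \<and>
     (\<forall>x y. 1 \<le> x \<longrightarrow> x \<le> y \<longrightarrow> y \<le> 2 * r \<longrightarrow> c x = c y \<longrightarrow> c (2 * r + 1 - x) = c (2 * r + 1 - y))"

text \<open>A parabolic subgroup, described as the stabiliser of all blocks;
  \<open>WB_par_eq\<close> identifies it with the subgroup generated by the
  \<open>s_j\<close>.\<close>

definition par :: "(nat \<Rightarrow> nat) \<Rightarrow> (nat \<Rightarrow> nat) set" where
  "par c = {w \<in> WB r. \<forall>x. 1 \<le> x \<longrightarrow> x \<le> 2 * r \<longrightarrow> c (w x) = c x}"

definition parD :: "(nat \<Rightarrow> nat) \<Rightarrow> (nat \<Rightarrow> nat) set" where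
  "parD c = par c \<inter> WD r"

text \<open>The pairs exchanged by the mirror symmetry are left out: their inversions do not contribute to the
  length of type \<open>D\<close>.\<close>

definition incD :: "(nat \<Rightarrow> nat) \<Rightarrow> (nat \<Rightarrow> nat) \<Rightarrow> bool" where
  "incD c v \<longleftrightarrow> (\<forall>x y. 1 \<le> x \<longrightarrow> x < y \<longrightarrow> y \<le> 2 * r \<longrightarrow> c x = c y \<longrightarrow> x + y \<noteq> 2 * r + 1 \<longrightarrow> v x < v y)"

lemma block_mono: "block_labelling c \<Longrightarrow> 1 \<le> x \<Longrightarrow> x \<le> y \<Longrightarrow> y \<le> 2 * r \<Longrightarrow> c x \<le> c y"
  by (simp add: block_labelling_def)

lemma block_between:
  assumes "block_labelling c" "c x = c y" "1 \<le> x" "x \<le> z" "z \<le> y" "y \<le> 2 * r"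
  shows "c z = c x"
  using block_mono[OF assms(1), of x z] block_mono[OF assms(1), of z y] assms by simp

lemma block_mirror:
  assumes "block_labelling c" "c x = c y" "1 \<le> x" "x \<le> 2 * r" "1 \<le> y" "y \<le> 2 * r"
  shows "c (2 * r + 1 - x) = c (2 * r + 1 - y)"
  using assms unfolding block_labelling_def by (metis nle_le)

lemma par_WB: "w \<in> par c \<Longrightarrow> w \<in> WB r" and parD_WB: "w \<in> parD c \<Longrightarrow> w \<in> WB r"
  by (auto simp: par_def parD_def)

lemma par_apply: "w \<in> par c \<Longrightarrow> 1 \<le> x \<Longrightarrow> x \<le> 2 * r \<Longrightarrow> c (w x) = c x"
  by (auto simp: par_def)

lemma par_id [simp]: "id \<in> par c" by (simp add: par_def)

lemma par_comp [simp]: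
  assumes "u \<in> par c" "v \<in> par c" shows "u \<circ> v \<in> par c"
  using assms WB_bounds[OF par_WB[OF assms(2)]] by (auto simp: par_def)

lemma par_iv [simp]:
  assumes "u \<in> par c" shows "iv u \<in> par c"
proof -
  note u = par_WB[OF assms]
  have "c (iv u x) = c x" if "1 \<le> x" "x \<le> 2 * r" for x
    using par_apply[OF assms, of "iv u x"] WB_bounds[OF WB_iv[OF u] that] u by simp
  then show ?thesis using u by (simp add: par_def)
qed

lemma parD_id [simp]: "id \<in> parD c" and
  parD_comp [simp]: "u \<in> parD c \<Longrightarrow> v \<in> parD c \<Longrightarrow> u \<circ> v \<in> parD c" and
  parD_iv [simp]: "u \<in> parD c \<Longrightarrow> iv u \<in> parD c"
  by (auto simp: parD_def)

lemma finite_parD [simp]: "finite (parD c)"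
  by (rule finite_subset[OF _ finite_WB]) (auto simp: par_def parD_def)

lemma cox_par:
  assumes c: "block_labelling c" "c i = c (i + 1)" and i: "i \<in> {1..r}"
  shows "cox r i \<in> par c"
proof (cases "i < r")
  case True
  have "c (2 * r + 1 - i) = c (2 * r + 1 - (i + 1))"
    by (rule block_mirror[OF c]) (use i True in auto)
  then show ?thesis using True i c by (auto simp: par_def cox_apply)
next
  case False
  then show ?thesis using i c by (auto simp: par_def cox_r_apply)
qed

lemma dgen_parD:
  assumes c: "block_labelling c" "c (dfst i) = c (i + 1)" and i: "i \<in> {1..r}"
  shows "dgen i \<in> parD c"
proof (cases "i < r")
  case True
  then show ?thesis using cox_par[of c i] dgen_WD[OF i] c i by (simp add: parD_def dgen_def dfst_def)
next
  case False
  then have [simp]: "i = r" using i by simp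
  have e: "c (r - 1) = c (r + 1)" using c by (simp add: dfst_def)
  then have f: "c r = c (r - 1)" by (intro block_between[OF c(1) e]) (use r2 in auto)
  have "c (2 * r + 1 - (r - 1)) = c (2 * r + 1 - (r + 1))"
    by (rule block_mirror[OF c(1) e]) (use r2 in auto)
  then have g: "c (r + 2) = c r" using r2 by (simp add: Suc_diff_le)
  have "c (dgen r x) = c x" for x
    unfolding dgen_r_apply using e f g by auto
  then show ?thesis using dgen_WD[OF i] i by (simp add: parD_def par_def)
qed

text \<open>Labels are monotone and preserved by \<open>u\<close>, so an inversion of
  \<open>u\<close> cannot join different blocks. Hence the generators at which \<open>u\<close>
  descends belong to the parabolic subgroup.\<close>

lemma par_descent:
  assumes c: "block_labelling c" and u: "u \<in> par c" and xy: "1 \<le> x" "x < y" "y \<le> 2 * r" "u y < u x"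
  shows "c x = c y"
proof -
  have "c (u y) \<le> c (u x)"
    using xy WB_bounds[OF par_WB[OF u]] by (intro block_mono[OF c]) auto
  then have "c y \<le> c x" using par_apply[OF u] xy by simp
  moreover have "c x \<le> c y" using xy by (intro block_mono[OF c]) auto
  ultimately show ?thesis by simp
qed

text \<open>Two points in one half are joined by adjacent ascents, the upper half being the mirror
  image of the lower. Pairs across the middle are joined through the ascent from
  \<open>r - 1\<close> to \<open>r + 1\<close> or its mirror image from \<open>r\<close> to
  \<open>r + 2\<close>, so that the step from \<open>r\<close> to \<open>r + 1\<close> is never
  taken.\<close>

lemma incD_I:
  assumes c: "block_labelling c" and v: "v \<in> WB r"
    and asc: "\<And>i. i \<in> {1..r} \<Longrightarrow> c (dfst i) = c (i + 1) \<Longrightarrow> v (dfst i) < v (i + 1)"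
  shows "incD c v"
proof -
  have mir: "v (2 * r + 1 - y) < v (2 * r + 1 - x)"
    if "1 \<le> x" "x \<le> 2 * r" "1 \<le> y" "y \<le> 2 * r" "v x < v y" for x y
    using that WB_mirror[OF v, of x] WB_mirror[OF v, of y] WB_bounds[OF v, of y] by auto
  have adj: "v i < v (i + 1)" if "1 \<le> i" "i < 2 * r" "i \<noteq> r" "c i = c (i + 1)" for i
  proof (cases "i < r")
    case True
    then show ?thesis using asc[of i] that by (simp add: dfst_def)
  next
    case False
    let ?j = "2 * r - i"
    have "c (2 * r + 1 - i) = c (2 * r + 1 - (i + 1))"
      by (rule block_mirror[OF c that(4)]) (use that in auto)
    then have "c ?j = c (?j + 1)" using that False by (simp add: Suc_diff_le)
    moreover have "?j < r" "?j \<in> {1..r}" using that False by auto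
    ultimately have "v ?j < v (?j + 1)" using asc[of ?j] by (simp add: dfst_def)
    then have "v (2 * r + 1 - (?j + 1)) < v (2 * r + 1 - ?j)"
      by (intro mir) (use that False in auto)
    moreover have "2 * r + 1 - (?j + 1) = i" "2 * r + 1 - ?j = i + 1" using that by auto
    ultimately show ?thesis by simp
  qed
  have chain: "v x < v y" if "1 \<le> x" "x < y" "y \<le> 2 * r" "c x = c y" "y \<le> r \<or> r < x" for x y
    using that
  proof (induction "y - x" arbitrary: y)
    case (Suc d)
    have cy: "c (y - 1) = c x"
      by (rule block_between[OF c \<open>c x = c y\<close>]) (use Suc.prems in auto)
    have step: "v (y - 1) < v y"
      using adj[of "y - 1"] Suc.prems cy by auto
    show ?case
    proof (cases "x = y - 1")
      case False
      then have "v x < v (y - 1)" using Suc.prems Suc.hyps(2) cy by (intro Suc.hyps(1)) auto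
      then show ?thesis using step by simp
    qed (use step in simp)
  qed simp
  show ?thesis
    unfolding incD_def
  proof (intro allI impI)
    fix x y assume xy: "1 \<le> x" "x < y" "y \<le> 2 * r" "c x = c y" "x + y \<noteq> 2 * r + 1"
    consider "y \<le> r \<or> r < x" | "x \<le> r - 1" "r < y" | "x = r" "r + 2 \<le> y" using xy by linarith
    then show "v x < v y"
    proof cases
      case 1
      then show ?thesis using chain xy by blast
    next
      case 2
      have e: "c (r - 1) = c x" "c (r + 1) = c x"
        by (rule block_between[OF c xy(4)]; use 2 xy r2 in auto)+
      have "v (r - 1) < v (r + 1)" using asc[of r] e by (simp add: dfst_def)
      moreover have "v x < v (r - 1)" if "x \<noteq> r - 1"
        by (rule chain) (use 2 xy e that in linarith)+
      then have "v x \<le> v (r - 1)" by (cases "x = r - 1") auto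
      moreover have "v (r + 1) \<le> v y"
        using chain[of "r + 1" y] 2 xy e by (cases "y = r + 1") auto
      ultimately show ?thesis using \<open>v x \<le> v (r - 1)\<close> by simp
    next
      case 3
      have e: "c (r + 1) = c x" "c (r + 2) = c x"
        by (rule block_between[OF c xy(4)]; use 3 xy r2 in auto)+
      have "c (2 * r + 1 - x) = c (2 * r + 1 - (r + 2))"
        by (rule block_mirror[OF c e(2)[symmetric]]) (use 3 xy r2 in auto)
      then have "c (r - 1) = c (r + 1)" using 3 e by simp
      then have "v (r - 1) < v (r + 1)" using asc[of r] by (simp add: dfst_def)
      then have "v (2 * r + 1 - (r + 1)) < v (2 * r + 1 - (r - 1))"
        by (intro mir) (use r2 in auto)
      then have "v r < v (r + 2)" using r2 by (simp add: Suc_diff_le)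
      moreover have "v (r + 2) \<le> v y"
        using chain[of "r + 2" y] 3 xy e by (cases "y = r + 2") auto
      ultimately show ?thesis using 3 by simp
    qed
  qed
qed

text \<open>\<open>u\<close> keeps the two points in their block and does not make them mirror
  images of each other, so \<open>v\<close> respects the order of their images. Thus
  \<open>v \<circ> u\<close> ascends at the generators of the blocks at which \<open>u\<close>
  does.\<close>

lemma incD_asc:
  assumes "incD c v" "u \<in> par c" "i \<in> {1..r}" "c (dfst i) = c (i + 1)" "u (dfst i) < u (i + 1)"
  shows "v (u (dfst i)) < v (u (i + 1))"
proof -
  note u = par_WB[OF assms(2)] and b = dfst_bounds[OF assms(3)]
  have "u (dfst i) + u (i + 1) \<noteq> 2 * r + 1"
  proof
    assume "u (dfst i) + u (i + 1) = 2 * r + 1"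
    then have "u (i + 1) = u (2 * r + 1 - dfst i)"
      using WB_mirror[OF u, of "dfst i"] b by auto
    then have "i + 1 = 2 * r + 1 - dfst i" using u by simp
    then show False using b by linarith
  qed
  then show ?thesis
    using assms(1,4,5) b par_apply[OF assms(2)] WB_bounds[OF u, of "dfst i"] WB_bounds[OF u, of "i + 1"]
    unfolding incD_def by auto
qed

text \<open>Removing descents inside blocks lowers \<open>lenD2\<close>, so the process stops at an
  element of the coset that is increasing on blocks.\<close>

lemma exists_min_right:
  assumes c: "block_labelling c" and w: "w \<in> WB r"
  shows "\<exists>u\<in>parD c. incD c (w \<circ> u)"
  using w
proof (induction "lenD2 w" arbitrary: w rule: less_induct)
  case less
  show ?case
  proof (cases "incD c w")
    case True
    then show ?thesis by (intro bexI[of _ id]) auto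
  next
    case False
    then obtain i where i: "i \<in> {1..r}" "c (dfst i) = c (i + 1)" "\<not> w (dfst i) < w (i + 1)"
      using incD_I[OF c less.prems] by blast
    then have d: "w (i + 1) < w (dfst i)"
      using WB_trichotomy[OF less.prems, of "i + 1" "dfst i"] dfst_neq[OF i(1)] by auto
    have "\<exists>u\<in>parD c. incD c (w \<circ> dgen i \<circ> u)"
      using lenD2_dgen_desc[OF i(1) less.prems d] less.prems i(1) by (intro less.hyps) auto
    then obtain u where "u \<in> parD c" "incD c (w \<circ> (dgen i \<circ> u))" by (auto simp: o_assoc)
    then show ?thesis using dgen_parD[OF c i(2,1)] by (intro bexI[of _ "dgen i \<circ> u"]) auto
  qed
qed

text \<open>A descent of \<open>u\<close> would lie inside a block. Applied to \<open>u\<close> with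
  this descent removed, \<open>incD_asc\<close> shows that \<open>v \<circ> u\<close> descends there
  too, although it is increasing on blocks.\<close>

lemma min_right_unique:
  assumes c: "block_labelling c" and v: "incD c v" "incD c (v \<circ> u)" and u: "u \<in> parD c"
  shows "u = id"
proof (rule ccontr)
  assume "u \<noteq> id"
  then obtain i where i: "i \<in> {1..r}" "u (i + 1) < u (dfst i)"
    using exists_D_descent_WD[of u] u by (auto simp: parD_def)
  note b = dfst_bounds[OF i(1)]
  have up: "u \<in> par c" using u by (simp add: parD_def)
  have e: "c (dfst i) = c (i + 1)" using par_descent[OF c up] b i by simp
  have "v (u (dfst i)) < v (u (i + 1))" using v(2) b e unfolding incD_def by auto
  moreover define u1 where "u1 = u \<circ> dgen i"
  have "u1 \<in> par c" using dgen_parD[OF c e i(1)] up unfolding u1_def by (intro par_comp) (auto simp: parD_def)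
  from incD_asc[OF v(1) this i(1) e] have "v (u1 (dfst i)) < v (u1 (i + 1))"
    using i dgen_apply_ends[OF i(1)] by (simp add: u1_def)
  ultimately show False using dgen_apply_ends[OF i(1)] by (simp add: u1_def)
qed

text \<open>Lengths add up: splitting off a descent of \<open>u\<close> leaves a shorter element at
  which \<open>incD_asc\<close> provides an ascent of the product with \<open>v\<close>, so the
  generator can be appended again on both sides.\<close>

lemma Tw_mult_right:
  assumes c: "block_labelling c" and v: "v \<in> WB r" "incD c v" and u: "u \<in> parD c"
  shows "TW v \<cdot> TW u = TW (v \<circ> u)"
  using u
proof (induction "lenD2 u" arbitrary: u rule: less_induct)
  case less
  show ?case
  proof (cases "u = id")
    case True
    then show ?thesis using v by simp
  next
    case False
    then obtain i where i: "i \<in> {1..r}" "u (i + 1) < u (dfst i)"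
      using exists_D_descent_WD[of u] less.prems by (auto simp: parD_def)
    note b = dfst_bounds[OF i(1)]
    have up: "u \<in> par c" "u \<in> WB r" using less.prems by (auto simp: parD_def WD_iff)
    have e: "c (dfst i) = c (i + 1)" using par_descent[OF c up(1)] b i by simp
    define u1 where u1: "u1 = u \<circ> dgen i"
    have u': "u1 \<in> parD c" unfolding u1 using dgen_parD[OF c e i(1)] less.prems by simp
    then have u'W: "u1 \<in> WB r" "u1 \<in> par c" by (auto simp: parD_def WD_iff)
    have asc: "u1 (dfst i) < u1 (i + 1)" unfolding u1 using dgen_apply_ends[OF i(1)] i by simp
    have uu: "u1 \<circ> dgen i = u" unfolding u1 using i by simp
    have "TW u = TW u1 \<cdot> Tdgen i" using Tw_dgen_right[OF i(1) u'W(1) asc] uu by simp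
    then have "TW v \<cdot> TW u = (TW v \<cdot> TW u1) \<cdot> Tdgen i"
      using v u'W i by (simp add: H.m_assoc)
    also have "TW v \<cdot> TW u1 = TW (v \<circ> u1)"
      using lenD2_dgen_desc[OF i(1) up(2) i(2)] u1 by (intro less.hyps u') simp
    also have "TW (v \<circ> u1) \<cdot> Tdgen i = TW (v \<circ> u1 \<circ> dgen i)"
      using incD_asc[OF v(2) u'W(2) i(1) e asc] v u'W by (intro Tw_dgen_right i(1)) auto
    finally show ?thesis using uu by (simp add: o_assoc[symmetric])
  qed
qed

text \<open>The counterpart for left cosets; generators are now prepended, so the monotonicity is
  required of the inverse of \<open>v\<close>.\<close>

lemma Tw_mult_left:
  assumes c: "block_labelling c" and v: "v \<in> WB r" "incD c (iv v)" and u: "u \<in> parD c"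
  shows "TW u \<cdot> TW v = TW (u \<circ> v)"
  using u
proof (induction "lenD2 u" arbitrary: u rule: less_induct)
  case less
  show ?case
  proof (cases "u = id")
    case True
    then show ?thesis using v by simp
  next
    case False
    have uW: "u \<in> WB r" using less.prems parD_WB by blast
    have "iv u \<noteq> id" using False uW by (metis iv_iv inv_id)
    then obtain i where i: "i \<in> {1..r}" "iv u (i + 1) < iv u (dfst i)"
      using exists_D_descent_WD[of "iv u"] less.prems by (auto simp: parD_def)
    note b = dfst_bounds[OF i(1)]
    have "iv u \<in> par c" using less.prems by (auto simp: parD_def)
    then have e: "c (dfst i) = c (i + 1)" using par_descent[OF c] b i by simp
    define u1 where u1: "u1 = dgen i \<circ> u"
    have u': "u1 \<in> parD c" unfolding u1 using dgen_parD[OF c e i(1)] less.prems by simp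
    then have u'W: "u1 \<in> WB r" "iv u1 \<in> par c" by (auto simp: parD_def WD_iff)
    have ivu: "iv u1 = iv u \<circ> dgen i" unfolding u1 using i uW by simp
    have asc: "iv u1 (dfst i) < iv u1 (i + 1)"
      unfolding ivu using dgen_apply_ends[OF i(1)] i by simp
    have uu: "dgen i \<circ> u1 = u" unfolding u1 using i by simp
    have "TW u = Tdgen i \<cdot> TW u1" using Tw_dgen_left[OF i(1) u'W(1) asc] uu by simp
    then have "TW u \<cdot> TW v = Tdgen i \<cdot> (TW u1 \<cdot> TW v)"
      using v u'W i by (simp add: H.m_assoc)
    also have "TW u1 \<cdot> TW v = TW (u1 \<circ> v)"
      using lenD2_dgen_left_desc[OF i(1) uW i(2)] u1 by (intro less.hyps u') simp
    also have "Tdgen i \<cdot> TW (u1 \<circ> v) = TW (dgen i \<circ> (u1 \<circ> v))"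
    proof (rule Tw_dgen_left[OF i(1)])
      show "u1 \<circ> v \<in> WB r" using u'W v by simp
      have "iv (u1 \<circ> v) = iv v \<circ> iv u1" using u'W v by (intro iv_comp)
      then show "iv (u1 \<circ> v) (dfst i) < iv (u1 \<circ> v) (i + 1)"
        using incD_asc[OF v(2) u'W(2) i(1) e asc] by (simp only: o_apply)
    qed
    finally show ?thesis using uu by (simp add: o_assoc)
  qed
qed


section \<open>Sums of basis elements over subsets of the group\<close>

abbreviation TS :: "(nat \<Rightarrow> nat) set \<Rightarrow> free set" where "TS \<equiv> Tsum r"

lemma WB_subset_finite: "X \<subseteq> WB r \<Longrightarrow> finite X"
  using finite_subset finite_WB by blast

lemma TW_Pi: "X \<subseteq> WB r \<Longrightarrow> TW \<in> X \<rightarrow> carrier H"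
  by auto

lemma Tsum_closed [simp]: "X \<subseteq> WB r \<Longrightarrow> TS X \<in> carrier H"
  unfolding Tsum_def by (intro H.finsum_closed) auto

lemma Tsum_empty [simp]: "TS {} = \<zero>\<^bsub>H\<^esub>"
  by (simp add: Tsum_def)

lemma Tsum_Un:
  assumes "X \<subseteq> WB r" "Y \<subseteq> WB r" "X \<inter> Y = {}"
  shows "TS (X \<union> Y) = TS X \<boxplus> TS Y"
  unfolding Tsum_def using assms WB_subset_finite by (intro H.finsum_Un_disjoint TW_Pi) auto

lemma Tsum_image:
  assumes "inj_on g X" "g ` X \<subseteq> WB r"
  shows "TS (g ` X) = (\<Oplus>\<^bsub>H\<^esub>w\<in>X. TW (g w))"
  unfolding Tsum_def using assms by (intro H.finsum_reindex TW_Pi)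

lemma Tsum_mult_left:
  assumes "X \<subseteq> WB r" "y \<in> carrier H"
  shows "y \<cdot> TS X = (\<Oplus>\<^bsub>H\<^esub>w\<in>X. y \<cdot> TW w)"
  unfolding Tsum_def using assms WB_subset_finite by (intro H.finsum_rdistr TW_Pi)

lemma Tsum_mult_right:
  assumes "X \<subseteq> WB r" "y \<in> carrier H"
  shows "TS X \<cdot> y = (\<Oplus>\<^bsub>H\<^esub>w\<in>X. TW w \<cdot> y)"
  unfolding Tsum_def using assms WB_subset_finite by (intro H.finsum_ldistr TW_Pi)

lemma Tsum_UN:
  assumes "finite I" "\<And>i. i \<in> I \<Longrightarrow> X i \<subseteq> WB r"
    and "\<And>i j. i \<in> I \<Longrightarrow> j \<in> I \<Longrightarrow> i \<noteq> j \<Longrightarrow> X i \<inter> X j = {}"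
  shows "TS (\<Union>i\<in>I. X i) = (\<Oplus>\<^bsub>H\<^esub>i\<in>I. TS (X i))"
  using assms
proof (induction I rule: finite_induct)
  case empty
  then show ?case by simp
next
  case (insert i I)
  have "TS (X i \<union> (\<Union>i\<in>I. X i)) = TS (X i) \<boxplus> TS (\<Union>i\<in>I. X i)"
    using insert.prems insert.hyps by (intro Tsum_Un) fastforce+
  also have "TS (\<Union>i\<in>I. X i) = (\<Oplus>\<^bsub>H\<^esub>i\<in>I. TS (X i))"
    using insert.prems by (intro insert.IH) auto
  also have "TS (X i) \<boxplus> (\<Oplus>\<^bsub>H\<^esub>i\<in>I. TS (X i)) = (\<Oplus>\<^bsub>H\<^esub>i\<in>insert i I. TS (X i))"
    using insert.hyps insert.prems by (subst H.finsum_insert) auto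
  finally show ?case by simp
qed

lemma comp_left_inj: "a \<in> WB r \<Longrightarrow> a \<circ> b = a \<circ> b' \<longleftrightarrow> b = b'"
  using WB_eq_iff[of a] by (auto simp: fun_eq_iff)

lemma comp_right_inj:
  assumes "a \<in> WB r"
  shows "b \<circ> a = b' \<circ> a \<longleftrightarrow> b = (b' :: nat \<Rightarrow> nat)"
proof
  assume "b \<circ> a = b' \<circ> a"
  then have "b \<circ> a \<circ> iv a = b' \<circ> a \<circ> iv a" by (rule arg_cong)
  then show "b = b'" using assms by simp
qed simp

text \<open>The common source of all factorisations: unique factorisation in the group, with
  products of basis elements that are again basis elements, becomes a factorisation of sums.\<close>

lemma Tsum_mult:
  assumes "A \<subseteq> WB r" "B \<subseteq> WB r" "bij_betw (\<lambda>(a, b). a \<circ> b) (A \<times> B) X"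
    and "\<And>a b. a \<in> A \<Longrightarrow> b \<in> B \<Longrightarrow> TW a \<cdot> TW b = TW (a \<circ> b)"
  shows "TS A \<cdot> TS B = TS X"
proof -
  let ?m = "\<lambda>(a :: nat \<Rightarrow> nat, b). a \<circ> b"
  have "TS A \<cdot> TS B = TS (?m ` (A \<times> B))"
    if "finite A" "A \<subseteq> WB r" "inj_on ?m (A \<times> B)" "\<And>a b. a \<in> A \<Longrightarrow> b \<in> B \<Longrightarrow> TW a \<cdot> TW b = TW (a \<circ> b)"
    for A
    using that
  proof (induction A rule: finite_induct)
    case empty
    then show ?case using assms(2) by simp
  next
    case (insert a A)
    have a: "a \<in> WB r" and A: "A \<subseteq> WB r" using insert.prems by auto
    have aB: "(\<lambda>b. a \<circ> b) ` B \<subseteq> WB r" using a assms(2) by auto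
    have AB: "?m ` (A \<times> B) \<subseteq> WB r" using A assms(2) by (auto intro!: WB_comp)
    have disj: "(\<lambda>b. a \<circ> b) ` B \<inter> ?m ` (A \<times> B) = {}"
    proof (rule ccontr)
      assume "\<not> ?thesis"
      then obtain b a' b' where *: "b \<in> B" "a' \<in> A" "b' \<in> B" "?m (a, b) = ?m (a', b')" by auto
      then have "(a, b) = (a', b')" using insert.prems(2) by (intro inj_onD[OF insert.prems(2) *(4)]) auto
      then show False using * insert.hyps by simp
    qed
    have "TS (insert a A) = TW a \<boxplus> TS A"
      unfolding Tsum_def using insert.hyps a A by (intro H.finsum_insert TW_Pi) auto
    then have "TS (insert a A) \<cdot> TS B = TW a \<cdot> TS B \<boxplus> TS A \<cdot> TS B"
      using a A assms(2) by (simp add: H.l_distr)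
    also have "TS A \<cdot> TS B = TS (?m ` (A \<times> B))"
      using insert.prems A inj_on_subset[OF insert.prems(2), of "A \<times> B"] by (intro insert.IH) auto
    also have "TW a \<cdot> TS B = (\<Oplus>\<^bsub>H\<^esub>b\<in>B. TW (a \<circ> b))"
      unfolding Tsum_mult_left[OF assms(2) Tw_closed[OF a]]
    proof (rule H.finsum_cong')
      show "(\<lambda>b. TW (a \<circ> b)) \<in> B \<rightarrow> carrier H" using aB by auto
      show "TW a \<cdot> TW b = TW (a \<circ> b)" if "b \<in> B" for b
        by (rule insert.prems(3)) (use that in auto)
    qed simp
    also have "\<dots> = TS ((\<lambda>b. a \<circ> b) ` B)"
      using aB by (intro Tsum_image[symmetric]) (auto intro!: inj_onI simp: comp_left_inj[OF a])
    also have "\<dots> \<boxplus> TS (?m ` (A \<times> B)) = TS ((\<lambda>b. a \<circ> b) ` B \<union> ?m ` (A \<times> B))"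
      by (rule Tsum_Un[OF aB AB disj, symmetric])
    also have "(\<lambda>b. a \<circ> b) ` B \<union> ?m ` (A \<times> B) = ?m ` (insert a A \<times> B)" by auto
    finally show ?case .
  qed
  then show ?thesis
    using assms WB_subset_finite[OF assms(1)] unfolding bij_betw_def by blast
qed

text \<open>Each \<open>w\<close> in \<open>X\<close> is uniquely an element increasing on blocks
  times an element of \<open>parD c\<close>: existence is \<open>exists_min_right\<close>,
  uniqueness \<open>min_right_unique\<close>.\<close>

lemma Tsum_factor_right:
  assumes c: "block_labelling c" and X: "X \<subseteq> WB r" "\<And>w u. w \<in> X \<Longrightarrow> u \<in> parD c \<Longrightarrow> w \<circ> u \<in> X"
  shows "TS X = TS {v \<in> X. incD c v} \<cdot> TS (parD c)"
proof (rule Tsum_mult[symmetric])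
  show "bij_betw (\<lambda>(a, b). a \<circ> b) ({v \<in> X. incD c v} \<times> parD c) X"
    unfolding bij_betw_def
  proof (intro conjI subset_antisym subsetI)
    show "inj_on (\<lambda>(a, b). a \<circ> b) ({v \<in> X. incD c v} \<times> parD c)"
    proof (rule inj_onI, clarify)
      fix v u v' u' assume *: "v \<in> X" "incD c v" "u \<in> parD c" "v' \<in> X" "incD c v'" "u' \<in> parD c"
        "v \<circ> u = v' \<circ> u'"
      have u: "u \<in> WB r" "u' \<in> WB r" using * parD_WB by auto
      have v': "v' = v \<circ> (u \<circ> iv u')" using *(7) u by (metis WB_cancel(3) o_assoc)
      moreover have "u \<circ> iv u' = id"
        by (rule min_right_unique[OF c *(2)]) (use * v' in auto)
      ultimately show "v = v' \<and> u = u'" using u by (metis WB_cancel(4) comp_id fun.map_id id_comp)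
    qed
    fix w assume w: "w \<in> X"
    then obtain u where u: "u \<in> parD c" "incD c (w \<circ> u)" using exists_min_right[OF c] X by blast
    then show "w \<in> (\<lambda>(a, b). a \<circ> b) ` ({v \<in> X. incD c v} \<times> parD c)"
      using w X(2) parD_WB[OF u(1)] by (intro image_eqI[of _ _ "(w \<circ> u, iv u)"]) auto
  qed (use X in auto)
qed (use assms parD_WB Tw_mult_right[OF c] in auto)

lemma Tsum_factor_left:
  assumes c: "block_labelling c" and X: "X \<subseteq> WB r" "\<And>w u. w \<in> X \<Longrightarrow> u \<in> parD c \<Longrightarrow> u \<circ> w \<in> X"
  shows "TS X = TS (parD c) \<cdot> TS {v \<in> X. incD c (iv v)}"
proof (rule Tsum_mult[symmetric])
  show "bij_betw (\<lambda>(a, b). a \<circ> b) (parD c \<times> {v \<in> X. incD c (iv v)}) X"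
    unfolding bij_betw_def
  proof (intro conjI subset_antisym subsetI)
    show "inj_on (\<lambda>(a, b). a \<circ> b) (parD c \<times> {v \<in> X. incD c (iv v)})"
    proof (rule inj_onI, clarify)
      fix u v u' v' assume *: "v \<in> X" "incD c (iv v)" "u \<in> parD c" "v' \<in> X" "incD c (iv v')" "u' \<in> parD c"
        "u \<circ> v = u' \<circ> v'"
      have u: "u \<in> WB r" "u' \<in> WB r" and v: "v \<in> WB r" "v' \<in> WB r" using * parD_WB X by auto
      have v': "v' = (iv u' \<circ> u) \<circ> v" using *(7) u by (metis WB_cancel(2) o_assoc)
      have "iv v' = iv v \<circ> iv (iv u' \<circ> u)" unfolding v' using u v by (intro iv_comp WB_comp WB_iv)
      then have "incD c (iv v \<circ> iv (iv u' \<circ> u))" using *(5) by metis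
      moreover have "iv (iv u' \<circ> u) \<in> parD c" using * by (intro parD_iv parD_comp)
      ultimately have "iv (iv u' \<circ> u) = id" using min_right_unique[OF c *(2)] by blast
      then have "iv u' \<circ> u = id" using u by (metis WB_comp WB_iv iv_iv inv_id)
      then show "u = u' \<and> v = v'" using u v' by (metis WB_cancel(1) comp_id id_comp)
    qed
    fix w assume w: "w \<in> X"
    then have wW: "w \<in> WB r" using X by blast
    then obtain u where u: "u \<in> parD c" "incD c (iv w \<circ> u)" using exists_min_right[OF c, of "iv w"] by auto
    have uW: "u \<in> WB r" using u parD_WB by blast
    have "iv (iv u \<circ> w) = iv w \<circ> u" using uW wW by simp
    then have "iv u \<circ> w \<in> {v \<in> X. incD c (iv v)}" using w X(2)[of w "iv u"] u by simp
    then show "w \<in> (\<lambda>(a, b). a \<circ> b) ` (parD c \<times> {v \<in> X. incD c (iv v)})"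
      using u uW by (intro image_eqI[of _ _ "(u, iv u \<circ> w)"]) auto
  qed (use X in auto)
qed (use assms parD_WB Tw_mult_left[OF c] in auto)

text \<open>Pairing \<open>w\<close> with \<open>w s_i\<close> writes the sum as
  \<open>P (1 + T_i)\<close>, and the quadratic relation gives
  \<open>(1 + T_i) T_i = q (1 + T_i)\<close>. The bound \<open>i < r\<close> matters since
  \<open>T r\<close> has parameter one.\<close>

lemma Tsum_parD_T:
  assumes c: "block_labelling c" and i: "1 \<le> i" "i < r" "c i = c (i + 1)"
  shows "TS (parD c) \<cdot> T i = hq \<cdot> TS (parD c)"
proof -
  define P where "P = {w \<in> parD c. w i < w (i + 1)}"
  define s where "s = cox r i"
  have sc: "s i = i + 1" "s (i + 1) = i" "s (Suc i) = i" using i by (auto simp: s_def cox_low)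
  have ii: "i \<in> {1..r}" using i by simp
  have s: "s \<in> parD c" "s \<in> WB r"
    using dgen_parD[OF c _ ii] i ii by (auto simp: s_def dgen_def dfst_def)
  have ss: "s \<circ> s = id" "\<And>w. w \<circ> s \<circ> s = w" using ii by (auto simp: s_def)
  have P: "P \<subseteq> WB r" using parD_WB by (auto simp: P_def)
  have Ps: "(\<lambda>w. w \<circ> s) ` P \<subseteq> WB r" using P s by auto
  have un: "parD c = P \<union> (\<lambda>w. w \<circ> s) ` P"
  proof (intro subset_antisym subsetI)
    fix w assume w: "w \<in> parD c"
    show "w \<in> P \<union> (\<lambda>w. w \<circ> s) ` P"
    proof (cases "w \<in> P")
      case False
      then have "w (i + 1) < w i" using w WB_trichotomy[OF parD_WB[OF w], of i "i + 1"] by (auto simp: P_def)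
      then have "w \<circ> s \<in> P" using w s sc by (simp add: P_def)
      then show ?thesis using ss(2)[of w] by (metis UnI2 image_eqI)
    qed simp
  qed (use s in \<open>auto simp: P_def\<close>)
  have disj: "P \<inter> (\<lambda>w. w \<circ> s) ` P = {}" by (auto simp: P_def sc)
  have "TS ((\<lambda>w. w \<circ> s) ` P) = (\<Oplus>\<^bsub>H\<^esub>w\<in>P. TW (w \<circ> s))"
    using s(2) Ps by (intro Tsum_image) (auto intro!: inj_onI simp: comp_right_inj)
  also have "\<dots> = (\<Oplus>\<^bsub>H\<^esub>w\<in>P. TW w \<cdot> T i)"
    using ii P s by (intro H.finsum_cong') (auto simp: P_def s_def Tw_right)
  also have "\<dots> = TS P \<cdot> T i" using P ii by (intro Tsum_mult_right[symmetric]) auto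
  finally have x: "TS (parD c) = TS P \<boxplus> TS P \<cdot> T i"
    using Tsum_Un[OF P Ps disj] un by simp
  let ?X = "TS P" and ?d = "hconst r (qvar - 1)"
  have X: "?X \<in> carrier H" and Ti: "T i \<in> carrier H" using P ii by auto
  have "TS (parD c) \<cdot> T i = ?X \<cdot> T i \<boxplus> ?X \<cdot> (T i \<cdot> T i)"
    using X Ti by (simp add: x H.l_distr H.m_assoc)
  also have "\<dots> = ?X \<cdot> (T i \<boxplus> (?d \<cdot> T i \<boxplus> hq))"
    using X Ti i by (simp add: T_quad H.r_distr)
  also have "T i \<boxplus> (?d \<cdot> T i \<boxplus> hq) = (\<one>\<^sub>H \<boxplus> ?d) \<cdot> T i \<boxplus> hq"
    using Ti by (simp add: H.l_distr H.a_assoc)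
  also have "\<one>\<^sub>H \<boxplus> ?d = hq" using hconst_add[of 1 "qvar - 1"] by (simp add: hconst_one)
  also have "?X \<cdot> (hq \<cdot> T i \<boxplus> hq) = hq \<cdot> (?X \<boxplus> ?X \<cdot> T i)"
  proof -
    have "?X \<cdot> (hq \<cdot> T i \<boxplus> hq) = (?X \<cdot> hq) \<cdot> T i \<boxplus> ?X \<cdot> hq" using X Ti by (simp add: H.r_distr H.m_assoc)
    also have "?X \<cdot> hq = hq \<cdot> ?X" using hconst_central[OF X] by simp
    also have "hq \<cdot> ?X \<cdot> T i \<boxplus> hq \<cdot> ?X = hq \<cdot> ?X \<boxplus> hq \<cdot> ?X \<cdot> T i" using X Ti by (simp add: H.a_comm)
    finally show ?thesis using X Ti by (simp add: H.r_distr H.m_assoc)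
  qed
  finally show ?thesis unfolding x .
qed

section \<open>The type D subalgebra and multiplication by powers of \<open>s_r\<close>\<close>

lemma heckeD_gens_carrier: "range (hconst r) \<union> Tgen r ` {1..<r}
      \<union> {Tgen r r \<otimes>\<^bsub>hecke r\<^esub> Tgen r (r - 1) \<otimes>\<^bsub>hecke r\<^esub> Tgen r r} \<subseteq> carrier H"
  by auto

lemma heckeD_carrier: "x \<in> heckeD r \<Longrightarrow> x \<in> carrier H"
  unfolding heckeD_def by (rule H.generate_ring_in_carrier[OF heckeD_gens_carrier])

lemma heckeD_one [simp]: "\<one>\<^sub>H \<in> heckeD r" and
  heckeD_zero [simp]: "\<zero>\<^bsub>H\<^esub> \<in> heckeD r" and
  heckeD_mult [simp]: "x \<in> heckeD r \<Longrightarrow> y \<in> heckeD r \<Longrightarrow> x \<cdot> y \<in> heckeD r" and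
  heckeD_add [simp]: "x \<in> heckeD r \<Longrightarrow> y \<in> heckeD r \<Longrightarrow> x \<boxplus> y \<in> heckeD r" and
  heckeD_hconst [simp]: "hconst r c \<in> heckeD r"
  unfolding heckeD_def
  by (auto intro: generate_ring.intros H.zero_in_generate)

lemma Tdgen_heckeD: "i \<in> {1..r} \<Longrightarrow> Tdgen i \<in> heckeD r"
  unfolding heckeD_def Tdgen_def by (intro generate_ring.incl) auto

lemma TW_heckeD:
  assumes "w \<in> WD r" shows "TW w \<in> heckeD r"
  using assms
proof (induction "lenD2 w" arbitrary: w rule: less_induct)
  case less
  show ?case
  proof (cases "w = id")
    case False
    then obtain i where i: "i \<in> {1..r}" "w (i + 1) < w (dfst i)"
      using exists_D_descent_WD less.prems by blast
    note wW = WD_WB[OF less.prems]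
    define v where "v = w \<circ> dgen i"
    have v: "v \<in> WD r" using less.prems i by (simp add: v_def)
    have "TW v \<in> heckeD r" using lenD2_dgen_desc[OF i(1) wW i(2)] v by (intro less.hyps) (simp add: v_def)
    moreover have "TW v \<cdot> Tdgen i = TW (v \<circ> dgen i)"
      using i dgen_apply_ends[OF i(1)] WD_WB[OF v] by (intro Tw_dgen_right) (simp_all add: v_def)
    ultimately show ?thesis using Tdgen_heckeD[OF i(1)] i(1) heckeD_mult by (metis dgen_dgen(3) v_def)
  qed simp
qed

lemma finsum_heckeD:
  assumes "finite I" "\<And>i. i \<in> I \<Longrightarrow> f i \<in> heckeD r"
  shows "(\<Oplus>\<^bsub>H\<^esub>i\<in>I. f i) \<in> heckeD r"
  using assms
  by (induction I rule: finite_induct) (auto simp: H.finsum_insert heckeD_carrier)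

lemma Tsum_heckeD: "X \<subseteq> WD r \<Longrightarrow> TS X \<in> heckeD r"
  unfolding Tsum_def using WB_subset_finite[of X] WD_WB TW_heckeD by (intro finsum_heckeD) blast+

fun Tsgn :: "sign \<Rightarrow> free set" where
  "Tsgn Pos = \<one>\<^sub>H"
| "Tsgn Neg = T r"

lemma Tsgn_closed [simp]: "Tsgn e \<in> carrier H"
  by (cases e) auto

lemma Tsgn_sq [simp]: "Tsgn e \<cdot> Tsgn e = \<one>\<^sub>H"
  by (cases e) (auto simp: T_r_sq)

lemma Tsgn_sq_left [simp]: "x \<in> carrier H \<Longrightarrow> Tsgn e \<cdot> (Tsgn e \<cdot> x) = x"
  by (simp add: H.m_assoc[symmetric])

lemma s_pow_WB [simp]: "s_pow r e \<in> WB r"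
  by (cases e) auto

lemma s_pow_sq [simp]: "s_pow r e \<circ> s_pow r e = id" "s_pow r e \<circ> (s_pow r e \<circ> w) = w" "w \<circ> s_pow r e \<circ> s_pow r e = w"
  by (cases e; simp)+

lemma iv_s_pow [simp]: "iv (s_pow r e) = s_pow r e"
  by (cases e) auto

lemma Tw_s_pow:
  assumes "w \<in> WB r"
  shows "TW (s_pow r e \<circ> w) = Tsgn e \<cdot> TW w" "TW (w \<circ> s_pow r e) = TW w \<cdot> Tsgn e"
  using assms by (cases e; simp add: Tw_r_left Tw_r_right)+

text \<open>A conjugate only for equal signs. In general it is a two-sided translate, which brings
  sets of odd parity into type D.\<close>

definition conj_s :: "sign \<Rightarrow> (nat \<Rightarrow> nat) set \<Rightarrow> sign \<Rightarrow> (nat \<Rightarrow> nat) set" where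
  "conj_s e X e' = (\<lambda>w. s_pow r e \<circ> w \<circ> s_pow r e') ` X"

lemma conj_s_WB: "X \<subseteq> WB r \<Longrightarrow> conj_s e X e' \<subseteq> WB r"
  by (auto simp: conj_s_def)

lemma Tsum_conj_s:
  assumes X: "X \<subseteq> WB r"
  shows "TS (conj_s e X e') = Tsgn e \<cdot> TS X \<cdot> Tsgn e'"
proof -
  have "inj_on (\<lambda>w. s_pow r e \<circ> w \<circ> s_pow r e') X"
    by (rule inj_onI) (simp add: comp_left_inj comp_right_inj)
  then have "TS (conj_s e X e') = (\<Oplus>\<^bsub>H\<^esub>w\<in>X. TW (s_pow r e \<circ> w \<circ> s_pow r e'))"
    unfolding conj_s_def using conj_s_WB[OF X, of e e'] by (intro Tsum_image) (auto simp: conj_s_def)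
  also have "\<dots> = (\<Oplus>\<^bsub>H\<^esub>w\<in>X. Tsgn e \<cdot> TW w \<cdot> Tsgn e')"
    using X by (intro H.finsum_cong') (auto simp: Tw_s_pow subset_iff)
  also have "\<dots> = (\<Oplus>\<^bsub>H\<^esub>w\<in>X. Tsgn e \<cdot> TW w) \<cdot> Tsgn e'"
    using X WB_subset_finite[OF X] by (intro H.finsum_ldistr[symmetric]) auto
  also have "(\<Oplus>\<^bsub>H\<^esub>w\<in>X. Tsgn e \<cdot> TW w) = Tsgn e \<cdot> TS X"
    by (intro Tsum_mult_left[symmetric] X) simp
  finally show ?thesis .
qed

end

section \<open>Cycles in a segment\<close>

context rank begin

text \<open>The cycle \<open>s_k ... s_(b-1)\<close> moves \<open>b\<close> to \<open>k\<close> and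
  shifts \<open>k, ..., b - 1\<close> up by one. For \<open>a < k \<le> b\<close> these are the
  minimal representatives of the cosets of the symmetric group of \<open>{a + 1..b - 1}\<close> in
  that of \<open>{a + 1..b}\<close>.\<close>

definition cyc :: "nat \<Rightarrow> nat \<Rightarrow> nat \<Rightarrow> nat" where
  "cyc b k = comp_list (map (cox r) [k..<b])"

lemma cyc_refl [simp]: "cyc b b = id"
  by (simp add: cyc_def)

lemma cyc_Suc: "k < b \<Longrightarrow> cyc b k = cox r k \<circ> cyc b (k + 1)"
  unfolding cyc_def by (subst upt_conv_Cons) simp_all

lemma cyc_snoc: "k \<le> b \<Longrightarrow> cyc (b + 1) k = cyc b k \<circ> cox r b"
  by (simp add: cyc_def)

lemma cyc_WB [simp]:
  assumes "1 \<le> k" "b \<le> r"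
  shows "cyc b k \<in> WB r"
  unfolding cyc_def by (rule comp_list_WB) (use assms in auto)

lemma cyc_low:
  assumes "1 \<le> k" "k \<le> b" "b \<le> r" "x \<le> r"
  shows "cyc b k x = (if x = b then k else if k \<le> x \<and> x < b then x + 1 else x)"
  using assms(2,1)
proof (induction k rule: inc_induct)
  case base
  then show ?case by simp
next
  case (step k)
  have "cyc b k x = cox r k (cyc b (k + 1) x)" using step by (simp add: cyc_Suc)
  also have "\<dots> = cox r k (if x = b then k + 1 else if k + 1 \<le> x \<and> x < b then x + 1 else x)"
    using step by simp
  finally show ?case using step assms by (auto simp: cox_low)
qed

lemma iv_cyc_low:
  assumes "1 \<le> k" "k \<le> b" "b \<le> r" "x \<le> r"
  shows "iv (cyc b k) x = (if x = k then b else if k < x \<and> x \<le> b then x - 1 else x)" (is "_ = ?y")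
proof -
  have "?y \<le> r" using assms by auto
  then have "cyc b k ?y = x" using assms by (auto simp: cyc_low)
  then have "iv (cyc b k) (cyc b k ?y) = iv (cyc b k) x" by (rule arg_cong)
  then show ?thesis using assms by simp
qed

text \<open>The blocks are \<open>{a + 1..b}\<close>, its mirror image and singletons.\<close>

definition seg :: "nat \<Rightarrow> nat \<Rightarrow> nat \<Rightarrow> nat" where
  "seg a b x = (if a < x \<and> x \<le> b then a + 1
     else if 2 * r + 1 - b \<le> x \<and> x \<le> 2 * r - a then 2 * r + 1 - b else x)"

lemma block_labelling_seg:
  assumes "a \<le> b" "b \<le> r"
  shows "block_labelling (seg a b)"
proof -
  \<comment> \<open>Names for the two ends of the mirror block turn truncated subtractions into
    linear equations.\<close>
  obtain a' b' where ab': "a' + a = 2 * r" "b' + b = 2 * r + 1"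
    using assms by (intro that[of "2 * r - a" "2 * r + 1 - b"]) auto
  have seg: "seg a b x = (if a < x \<and> x \<le> b then a + 1 else if b' \<le> x \<and> x \<le> a' then b' else x)" for x
  proof -
    have "2 * r - a = a'" "2 * r + 1 - b = b'" using ab' by linarith+
    then show ?thesis by (simp only: seg_def)
  qed
  have le: "a + 1 \<le> b'" "b < b'" using ab' assms by linarith+
  have mono: "seg a b x \<le> seg a b y" if "x \<le> y" for x y
    using that le unfolding seg by (simp split: if_split)
  have eq: "x = y \<or> a < x \<and> x \<le> b \<and> a < y \<and> y \<le> b \<or> b' \<le> x \<and> x \<le> a' \<and> b' \<le> y \<and> y \<le> a'"
    if "seg a b x = seg a b y" for x y
    using that le unfolding seg by (simp split: if_splits)
  have "seg a b (2 * r + 1 - x) = seg a b (2 * r + 1 - y)"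
    if xy: "1 \<le> x" "x \<le> y" "y \<le> 2 * r" "seg a b x = seg a b y" for x y
  proof -
    obtain u v where uv: "u + x = 2 * r + 1" "v + y = 2 * r + 1"
      using xy by (intro that[of "2 * r + 1 - x" "2 * r + 1 - y"]) auto
    have "u = v \<or> b' \<le> u \<and> u \<le> a' \<and> b' \<le> v \<and> v \<le> a' \<or> a < u \<and> u \<le> b \<and> a < v \<and> v \<le> b"
      using eq[OF xy(4)] uv ab' by linarith
    then have "seg a b u = seg a b v" using le unfolding seg by auto
    moreover have "2 * r + 1 - x = u" "2 * r + 1 - y = v" using uv by linarith+
    ultimately show ?thesis by simp
  qed
  then show ?thesis using mono unfolding block_labelling_def by blast
qed

lemma seg_eq_iff:
  assumes "a \<le> b" "b \<le> r" "x \<le> r" "y \<le> r"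
  shows "seg a b x = seg a b y \<longleftrightarrow> x = y \<or> (a < x \<and> x \<le> b \<and> a < y \<and> y \<le> b)"
proof -
  have "seg a b z = (if a < z \<and> z \<le> b then a + 1 else z)" if "z \<le> r" for z
    using that assms unfolding seg_def by auto
  then show ?thesis using assms by auto
qed

lemma seg_low:
  assumes "a \<le> b" "b \<le> r" "x \<le> 2 * r" "seg a b x = seg a b y" "y \<le> r" "y \<ge> 1"
  shows "x \<le> r"
  using assms by (auto simp: seg_def split: if_splits)

text \<open>The segment lies in \<open>{1..r}\<close>, disjoint from its mirror image, so the
  stabiliser acts on the lower half as the symmetric group of the segment, and the upper half
  follows by symmetry.\<close>

lemma par_seg_iff:
  assumes ab: "a \<le> b" "b \<le> r"
  shows "u \<in> par (seg a b) \<longleftrightarrow> u \<in> WB r \<and>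
    (\<forall>x. 1 \<le> x \<longrightarrow> x \<le> r \<longrightarrow> (if a < x \<and> x \<le> b then a < u x \<and> u x \<le> b else u x = x))"
    (is "_ \<longleftrightarrow> ?R")
proof
  assume u: "u \<in> par (seg a b)"
  note uW = par_WB[OF u]
  have "if a < x \<and> x \<le> b then a < u x \<and> u x \<le> b else u x = x" if x: "1 \<le> x" "x \<le> r" for x
  proof -
    have "seg a b (u x) = seg a b x" using par_apply[OF u] x by simp
    moreover have "u x \<le> r"
      by (rule seg_low[OF ab _ calculation]) (use x WB_bounds[OF uW, of x] in auto)
    ultimately show ?thesis using seg_eq_iff[OF ab, of "u x" x] x by auto
  qed
  then show ?R using uW by blast
next
  assume R: ?R
  then have uW: "u \<in> WB r" by blast
  have low: "seg a b (u x) = seg a b x \<and> u x \<le> r" if x: "1 \<le> x" "x \<le> r" for x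
    using R x ab by (auto simp: seg_def split: if_splits)
  have "seg a b (u x) = seg a b x" if x: "1 \<le> x" "x \<le> 2 * r" for x
  proof (cases "x \<le> r")
    case False
    let ?y = "2 * r + 1 - x"
    have y: "1 \<le> ?y" "?y \<le> r" using False x by auto
    have "u x = 2 * r + 1 - u ?y" using WB_mirror[OF uW, of ?y] y x by auto
    moreover have "seg a b (2 * r + 1 - u ?y) = seg a b (2 * r + 1 - ?y)"
      by (rule block_mirror[OF block_labelling_seg[OF ab]])
        (use low[OF y] y WB_bounds[OF uW, of ?y] in auto)
    ultimately show ?thesis using x by simp
  qed (use low x in blast)
  then show "u \<in> par (seg a b)" using uW by (simp add: par_def)
qed

text \<open>Nothing in \<open>{1..r}\<close> is moved beyond \<open>r\<close>, so there are no
  negative entries.\<close>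

lemma parD_seg:
  assumes ab: "a \<le> b" "b \<le> r"
  shows "parD (seg a b) = par (seg a b)"
proof -
  have "neg r u = 0" if "u \<in> par (seg a b)" for u
    using that ab unfolding par_seg_iff[OF ab] neg_def by (fastforce split: if_splits)
  then show ?thesis using par_WB by (auto simp: parD_def WD_iff)
qed

lemma incD_seg_iff:
  assumes ab: "a \<le> b" "b \<le> r" and v: "v \<in> WB r"
  shows "incD (seg a b) v \<longleftrightarrow> (\<forall>x y. a < x \<longrightarrow> x < y \<longrightarrow> y \<le> b \<longrightarrow> v x < v y)"
proof
  assume "incD (seg a b) v"
  then show "\<forall>x y. a < x \<longrightarrow> x < y \<longrightarrow> y \<le> b \<longrightarrow> v x < v y"
    using ab unfolding incD_def by (auto simp: seg_eq_iff)
next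
  assume R: "\<forall>x y. a < x \<longrightarrow> x < y \<longrightarrow> y \<le> b \<longrightarrow> v x < v y"
  show "incD (seg a b) v"
  proof (rule incD_I[OF block_labelling_seg[OF ab] v])
    fix i assume i: "i \<in> {1..r}" "seg a b (dfst i) = seg a b (i + 1)"
    have "i + 1 \<le> r"
      by (rule seg_low[OF ab _ i(2)[symmetric]]) (use i dfst_bounds[OF i(1)] in auto)
    then show "v (dfst i) < v (i + 1)" using i R seg_eq_iff[OF ab, of i "i + 1"] by (simp add: dfst_def)
  qed
qed

text \<open>When \<open>T k\<close> is applied, the largest preimage \<open>iv w b\<close> has
  already moved to \<open>k + 1\<close>, while \<open>k\<close> still carries \<open>iv w k\<close>;
  so each letter of the cycle is a left ascent.\<close>

lemma Tw_cyc_mult: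
  assumes k: "1 \<le> k" "k \<le> b" "b \<le> r" and w: "w \<in> WB r"
    and max: "\<And>j. k \<le> j \<Longrightarrow> j < b \<Longrightarrow> iv w j < iv w b"
  shows "TW (cyc b k) \<cdot> TW w = TW (cyc b k \<circ> w)"
  using k(2,1) max
proof (induction k rule: inc_induct)
  case base
  then show ?case using w Tw_id by (simp add: id_def o_def)
next
  case (step k)
  note W = cyc_WB[of "k + 1" b, OF _ k(3)]
  have kk: "k \<in> {1..r}" using step k by auto
  have "T k \<cdot> TW (cyc b (k + 1)) = TW (cox r k \<circ> cyc b (k + 1))"
    using step kk W k by (intro Tw_left) (auto simp: iv_cyc_low)
  moreover have "TW (cyc b (k + 1)) \<cdot> TW w = TW (cyc b (k + 1) \<circ> w)" using step by (simp add: o_def)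
  moreover have "T k \<cdot> TW (cyc b (k + 1) \<circ> w) = TW (cox r k \<circ> (cyc b (k + 1) \<circ> w))"
  proof (rule Tw_left[OF kk])
    have "iv (cyc b (k + 1) \<circ> w) = iv w \<circ> iv (cyc b (k + 1))" using W w by simp
    then show "iv (cyc b (k + 1) \<circ> w) k < iv (cyc b (k + 1) \<circ> w) (k + 1)"
      using step k iv_cyc_low[of "k + 1" b k] iv_cyc_low[of "k + 1" b "k + 1"] by simp
  qed (use W w in simp)
  ultimately show ?case using step kk W w
    by (metis (no_types, lifting) H.m_assoc T_closed Tw_closed cyc_Suc le_add2 o_assoc)
qed

definition cycs :: "nat \<Rightarrow> nat \<Rightarrow> (nat \<Rightarrow> nat) set" where
  "cycs a b = cyc b ` {a + 1..b}"

lemma cycs_WB: "b \<le> r \<Longrightarrow> cycs a b \<subseteq> WB r"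
  by (auto simp: cycs_def)

lemma cyc_par:
  assumes "a < k" "k \<le> b" "b \<le> r"
  shows "cyc b k \<in> par (seg a b)" "iv (cyc b k) \<in> par (seg a b)"
proof -
  have "cyc b k \<in> par (seg a b)" using assms by (subst par_seg_iff) (auto simp: cyc_low)
  then show "cyc b k \<in> par (seg a b)" "iv (cyc b k) \<in> par (seg a b)" by simp_all
qed

text \<open>Every \<open>w\<close> arises uniquely by moving the position of the largest preimage of the segment \<open>{a + 1..b}\<close>
  to the end of the segment.\<close>

lemma Tsum_cycs:
  assumes ab: "a < b" "b \<le> r" and Z: "Z \<subseteq> WB r"
    and st: "\<And>u w. u \<in> par (seg a b) \<Longrightarrow> w \<in> Z \<Longrightarrow> u \<circ> w \<in> Z"
  shows "TS (cycs a b) \<cdot> TS {w \<in> Z. \<forall>j. a < j \<longrightarrow> j < b \<longrightarrow> iv w j < iv w b} = TS Z" (is "_ \<cdot> TS ?Z0 = _")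
proof (rule Tsum_mult)
  show "TW v \<cdot> TW w = TW (v \<circ> w)" if vw: "v \<in> cycs a b" "w \<in> ?Z0" for v w
  proof -
    obtain k where "k \<in> {a + 1..b}" and v: "v = cyc b k" using vw(1) unfolding cycs_def by blast
    then have k: "a < k" "k \<le> b" "v = cyc b k" by auto
    show ?thesis unfolding k(3) by (rule Tw_cyc_mult) (use vw k ab Z in auto)
  qed
  have ivk: "iv (cyc b k \<circ> w) x = iv w (iv (cyc b k) x)" if "a < k" "k \<le> b" "w \<in> Z" for k w x
  proof -
    have "iv (cyc b k \<circ> w) = iv w \<circ> iv (cyc b k)" using that ab Z by (intro iv_comp cyc_WB) auto
    then show ?thesis by simp
  qed
  show "bij_betw (\<lambda>(v, w). v \<circ> w) (cycs a b \<times> ?Z0) Z"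
    unfolding bij_betw_def
  proof (intro conjI subset_antisym subsetI)
    show "inj_on (\<lambda>(v, w). v \<circ> w) (cycs a b \<times> ?Z0)"
    proof (rule inj_onI, clarify)
      fix v w v' w'
      assume *: "v \<in> cycs a b" "v' \<in> cycs a b" "w \<in> Z" "w' \<in> Z"
        "\<forall>j. a < j \<longrightarrow> j < b \<longrightarrow> iv w j < iv w b" "\<forall>j. a < j \<longrightarrow> j < b \<longrightarrow> iv w' j < iv w' b"
        "v \<circ> w = v' \<circ> w'"
      obtain k k' where kk: "k \<in> {a + 1..b}" "k' \<in> {a + 1..b}" and vk: "v = cyc b k" "v' = cyc b k'"
        using *(1,2) unfolding cycs_def by blast
      then have k: "a < k" "k \<le> b" "v = cyc b k" and k': "a < k'" "k' \<le> b" "v' = cyc b k'" by auto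
      \<comment> \<open>In \<open>cyc b k \<circ> w\<close> the largest preimage over the segment
        sits at \<open>k\<close>, so \<open>k\<close> can be recovered from the product.\<close>
      have mx: "iv (cyc b k \<circ> w) x < iv (cyc b k \<circ> w) k"
        if "a < k" "k \<le> b" "w \<in> Z" "\<forall>j. a < j \<longrightarrow> j < b \<longrightarrow> iv w j < iv w b" "a < x" "x \<le> b" "x \<noteq> k" for k w x
      proof -
        have e: "iv (cyc b k) k = b" using that ab by (simp add: iv_cyc_low)
        have f: "a < iv (cyc b k) x" "iv (cyc b k) x < b" using that ab by (auto simp: iv_cyc_low)
        show ?thesis unfolding ivk[OF that(1-3)] e using that(4) f by blast
      qed
      have "k = k'"
      proof (rule ccontr)
        assume "k \<noteq> k'"
        then have "iv (v \<circ> w) k' < iv (v \<circ> w) k" "iv (v' \<circ> w') k < iv (v' \<circ> w') k'"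
          using mx[of k w k'] mx[of k' w' k] * k k' by auto
        then show False using *(7) by simp
      qed
      moreover have "v \<in> WB r" using k ab by simp
      ultimately show "v = v' \<and> w = w'" using *(7) k(3) k'(3) comp_left_inj by metis
    qed
    show "z \<in> Z" if "z \<in> (\<lambda>(v, w). v \<circ> w) ` (cycs a b \<times> ?Z0)" for z
      using that st cyc_par[OF _ _ ab(2)] by (auto simp: cycs_def)
    show "w \<in> (\<lambda>(v, w). v \<circ> w) ` (cycs a b \<times> ?Z0)" if w: "w \<in> Z" for w
    proof -
      have wW: "w \<in> WB r" using w Z by blast
      define M where "M = Max (iv w ` {a + 1..b})"
      have "M \<in> iv w ` {a + 1..b}" unfolding M_def using ab by (intro Max_in) auto
      then obtain k where "k \<in> {a + 1..b}" and Mk: "M = iv w k" by blast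
      then have k: "a < k" "k \<le> b" "M = iv w k" by auto
      have le: "iv w j \<le> iv w k" if "a < j" "j \<le> b" for j
        unfolding k(3)[symmetric] M_def using that by (intro Max_ge) auto
      have lt: "iv w j < iv w k" if "a < j" "j \<le> b" "j \<noteq> k" for j
        using le[OF that(1,2)] WB_eq_iff[OF WB_iv[OF wW], of j k] that(3) by linarith
      have kW: "cyc b k \<in> WB r" using k ab by simp
      define w0 where "w0 = iv (cyc b k) \<circ> w"
      have "w0 \<in> Z" unfolding w0_def using st[OF cyc_par(2)[OF k(1,2) ab(2)] w] .
      moreover have iv0: "iv w0 = iv w \<circ> cyc b k" unfolding w0_def using kW wW by simp
      have "iv w0 j < iv w0 b" if "a < j" "j < b" for j
        using that k ab lt by (auto simp: iv0 cyc_low)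
      moreover have "w = cyc b k \<circ> w0" unfolding w0_def using kW by simp
      ultimately show ?thesis using k by (intro image_eqI[of _ _ "(cyc b k, w0)"]) (auto simp: cycs_def)
    qed
  qed
qed (use ab Z cycs_WB in auto)

text \<open>The inverse cycle is \<open>s_(m-1) ... s_t\<close>. As \<open>v\<close> is minimal in
  its coset, each of these \<open>m - t\<close> letters adds length, and the sum over the parabolic
  subgroup absorbs each of them at the price of one factor \<open>q\<close>.\<close>

lemma Tsum_parD_seg_iv_cyc:
  assumes ab: "a < b" "b \<le> r" and t: "a < t" "t \<le> m" "m \<le> b" and v: "v \<in> WB r" "incD (seg a b) (iv v)"
  shows "TS (parD (seg a b)) \<cdot> TW (iv (cyc m t) \<circ> v) = hconst r (qvar ^ (m - t)) \<cdot> (TS (parD (seg a b)) \<cdot> TW v)"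
  using t(2,3)
proof (induction m rule: dec_induct)
  case base
  have "TS (parD (seg a b)) \<in> carrier H" using parD_WB by (intro Tsum_closed) blast
  then show ?case using v by (simp add: hconst_one)
next
  case (step m)
  let ?x = "TS (parD (seg a b))"
  have x: "?x \<in> carrier H" using parD_WB by (intro Tsum_closed) blast
  have m: "1 \<le> m" "m < r" "m \<in> {1..r}" using step ab t by auto
  define u where "u = iv (cyc m t)"
  have cW: "cyc m t \<in> WB r" using t ab step by (intro cyc_WB) auto
  then have uW: "u \<in> WB r" by (simp add: u_def)
  have e: "iv (cyc (Suc m) t) = cox r m \<circ> u"
    using cyc_snoc[of t m] step cW m by (simp add: u_def)
  have iu: "iv (u \<circ> v) = iv v \<circ> cyc m t" using uW cW v by (simp add: u_def)
  have cv: "cyc m t m = t" "cyc m t (m + 1) = m + 1" using step t m by (auto simp: cyc_low)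
  have "iv v t < iv v (m + 1)"
    using v(2) incD_seg_iff[of a b "iv v"] v(1) ab step t by simp
  then have "iv (u \<circ> v) m < iv (u \<circ> v) (m + 1)" unfolding iu by (simp only: o_apply cv)
  then have "TW (cox r m \<circ> (u \<circ> v)) = T m \<cdot> TW (u \<circ> v)"
    using Tw_left[OF m(3), of "u \<circ> v"] uW v by simp
  then have "?x \<cdot> TW (iv (cyc (Suc m) t) \<circ> v) = ?x \<cdot> T m \<cdot> TW (u \<circ> v)"
    unfolding e using x uW v m by (simp add: H.m_assoc o_assoc)
  also have "?x \<cdot> T m = hq \<cdot> ?x"
    using ab step t m by (intro Tsum_parD_T block_labelling_seg) (auto simp: seg_eq_iff)
  also have "hq \<cdot> ?x \<cdot> TW (u \<circ> v) = hq \<cdot> (?x \<cdot> TW (u \<circ> v))"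
    using x uW v by (simp add: H.m_assoc)
  also have "?x \<cdot> TW (u \<circ> v) = hconst r (qvar ^ (m - t)) \<cdot> (?x \<cdot> TW v)"
    using step.IH step.hyps step.prems by (simp add: u_def o_def)
  also have "hq \<cdot> \<dots> = hconst r (qvar ^ (Suc m - t)) \<cdot> (?x \<cdot> TW v)"
    using step x v by (simp add: Suc_diff_le hconst_mult H.m_assoc)
  finally show ?case .
qed

definition above :: "nat \<Rightarrow> nat \<Rightarrow> (nat \<Rightarrow> nat) \<Rightarrow> nat" where
  "above a b w = card {k. a < k \<and> k < b \<and> iv w b < iv w k}"

text \<open>Let \<open>x\<close> and \<open>x'\<close> be the sums over the symmetric groups of
  \<open>{a + 1..b}\<close> and \<open>{a + 1..b - 1}\<close>; then \<open>z x' = x\<close>. The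
  part \<open>Ze\<close> is stable under the smaller group, so it factors as \<open>x'\<close> times
  the elements \<open>De\<close> with preimages increasing on the shorter segment. These are exactly
  \<open>iv (cyc b t) \<circ> v\<close>, where \<open>v\<close> has preimages increasing on the
  whole segment and \<open>t = b - e\<close>. Hence \<open>z T(Ze) = x T(De)\<close>, the
  \<open>e\<close> letters of the inverse cycle are absorbed by \<open>x\<close>, and
  \<open>x T(D) = T(Z)\<close>.\<close>

lemma Tsum_cycs_above:
  assumes ab: "a < b" "b \<le> r" and Z: "Z \<subseteq> WB r"
    and st: "\<And>u w. u \<in> par (seg a b) \<Longrightarrow> w \<in> Z \<Longrightarrow> u \<circ> w \<in> Z" and e: "e < b - a"
  shows "TS (cycs a b) \<cdot> TS {w \<in> Z. above a b w = e} = hconst r (qvar ^ e) \<cdot> TS Z"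
proof -
  let ?b = "b - 1"
  have ab': "a \<le> ?b" "?b \<le> r" "a \<le> b" using ab by auto
  define Ze where "Ze = {w \<in> Z. above a b w = e}"
  define De where "De = {v \<in> Ze. incD (seg a ?b) (iv v)}"
  define D where "D = {v \<in> Z. incD (seg a b) (iv v)}"
  let ?x = "TS (parD (seg a b))" and ?x' = "TS (parD (seg a ?b))"
  have x: "?x \<in> carrier H" "?x' \<in> carrier H" using parD_WB by (intro Tsum_closed; blast)+
  have sub: "par (seg a ?b) \<subseteq> par (seg a b)"
  proof
    fix u assume "u \<in> par (seg a ?b)"
    then have "u \<in> WB r"
      and R: "\<And>x. 1 \<le> x \<Longrightarrow> x \<le> r \<Longrightarrow> if a < x \<and> x \<le> ?b then a < u x \<and> u x \<le> ?b else u x = x"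
      unfolding par_seg_iff[OF ab'(1,2)] by blast+
    moreover have "if a < x \<and> x \<le> b then a < u x \<and> u x \<le> b else u x = x" if "1 \<le> x" "x \<le> r" for x
      using R[OF that] ab by (cases "x = b") (auto split: if_splits)
    ultimately show "u \<in> par (seg a b)" unfolding par_seg_iff[OF ab'(3) ab(2)] by blast
  qed
  have b1: "1 \<le> b" using ab by simp
  have fixb: "u b = b" if "u \<in> par (seg a ?b)" for u
    using that ab unfolding par_seg_iff[OF ab'(1,2)] by (auto dest!: spec[where x = b])
  have low: "a < u x \<and> u x < b" if "u \<in> par (seg a ?b)" "a < x" "x < b" for u x
  proof -
    have "x \<le> ?b" "1 \<le> x" "x \<le> r" using that ab by auto
    then have "a < u x \<and> u x \<le> ?b" using that unfolding par_seg_iff[OF ab'(1,2)] by metis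
    then show ?thesis using ab by auto
  qed
  \<comment> \<open>This is \<open>Tsum_cycs\<close> for the group of the segment itself, where
    \<open>b\<close> has the largest preimage exactly for the elements fixing
    \<open>b\<close>.\<close>
  have x1: "TS (cycs a b) \<cdot> ?x' = ?x"
  proof -
    have "{u \<in> parD (seg a b). \<forall>j. a < j \<longrightarrow> j < b \<longrightarrow> iv u j < iv u b} = parD (seg a ?b)"
      unfolding parD_seg[OF ab'(3) ab(2)] parD_seg[OF ab'(1,2)]
    proof (intro subset_antisym subsetI)
      fix u assume u: "u \<in> {u \<in> par (seg a b). \<forall>j. a < j \<longrightarrow> j < b \<longrightarrow> iv u j < iv u b}"
      then have uW: "u \<in> WB r" and R: "\<And>x. 1 \<le> x \<Longrightarrow> x \<le> r \<Longrightarrow> if a < x \<and> x \<le> b then a < u x \<and> u x \<le> b else u x = x"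
        using par_seg_iff[OF ab'(3) ab(2)] by auto
      have "iv u \<in> par (seg a b)" using u by simp
      then have "iv u b \<le> b" using ab b1 unfolding par_seg_iff[OF ab'(3) ab(2)] by auto
      have "a < u b \<and> u b \<le> b" using R[of b] ab b1 by auto
      moreover have "\<not> u b < b"
        using u \<open>iv u b \<le> b\<close> uW calculation by (auto dest!: spec[where x = "u b"])
      ultimately have ub: "u b = b" by simp
      have "if a < x \<and> x \<le> ?b then a < u x \<and> u x \<le> ?b else u x = x" if x: "1 \<le> x" "x \<le> r" for x
      proof (cases "x = b")
        case False
        then have "u x \<noteq> b" using ub uW by (metis WB_eq_iff)
        then show ?thesis using R[OF x] False ab by (auto split: if_splits)
      qed (use ub ab in auto)
      then show "u \<in> par (seg a ?b)" using uW unfolding par_seg_iff[OF ab'(1,2)] by blast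
    next
      fix u assume u: "u \<in> par (seg a ?b)"
      then have "iv u \<in> par (seg a ?b)" by simp
      then show "u \<in> {u \<in> par (seg a b). \<forall>j. a < j \<longrightarrow> j < b \<longrightarrow> iv u j < iv u b}"
        using u sub fixb[of "iv u"] low[of "iv u"] by auto
    qed
    then show ?thesis
      using Tsum_cycs[OF ab, of "parD (seg a b)"] parD_WB par_comp parD_seg[OF ab'(3) ab(2)] by auto
  qed
  have 1: "TS Ze = ?x' \<cdot> TS De"
    unfolding De_def
  proof (rule Tsum_factor_left[OF block_labelling_seg[OF ab'(1,2)]])
    show "u \<circ> w \<in> Ze" if w: "w \<in> Ze" and u: "u \<in> parD (seg a ?b)" for w u
    proof -
      have up: "u \<in> par (seg a ?b)" and wW: "w \<in> WB r" using u w Z by (auto simp: parD_def Ze_def)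
      note uW = par_WB[OF up]
      have i: "iv (u \<circ> w) x = iv w (iv u x)" for x using uW wW by simp
      have ivb: "iv u b = b" using up by (intro fixb) simp
      have "bij_betw (iv u) {k. a < k \<and> k < b \<and> iv (u \<circ> w) b < iv (u \<circ> w) k} {k. a < k \<and> k < b \<and> iv w b < iv w k}"
        by (rule bij_betw_byWitness[where f' = u])
          (use uW low[OF up] low[OF par_iv[OF up]] in \<open>auto simp: i ivb\<close>)
      then have "above a b (u \<circ> w) = above a b w"
        unfolding above_def by (rule bij_betw_same_card)
      then show ?thesis using w st[of u w] sub up by (auto simp: Ze_def)
    qed
  qed (use Z in \<open>auto simp: Ze_def\<close>)
  \<comment> \<open>Over \<open>{a + 1..b - 1}\<close> the preimages increase, and \<open>e\<close>
    of them exceed that of \<open>b\<close>; sorting therefore inserts the preimage of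
    \<open>b\<close> in front of the last \<open>e\<close> ones, at \<open>t\<close>.\<close>
  define t where "t = b - e"
  have t: "a < t" "t \<le> b" using e ab by (auto simp: t_def)
  let ?g = "\<lambda>v. iv (cyc b t) \<circ> v"
  have cW: "cyc b t \<in> WB r" using t ab by simp
  have De: "De = ?g ` D"
  proof (intro subset_antisym subsetI)
    fix v assume v: "v \<in> De"
    then have vZ: "v \<in> Z" and vW: "v \<in> WB r" and ce: "card {k. a < k \<and> k < b \<and> iv v b < iv v k} = e"
      and inc: "\<And>x y. a < x \<Longrightarrow> x < y \<Longrightarrow> y < b \<Longrightarrow> iv v x < iv v y"
      using Z incD_seg_iff[OF ab'(1,2)] ab by (auto simp: De_def Ze_def above_def)
    let ?U = "{k. a < k \<and> k < b \<and> iv v b < iv v k}"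
    have finU: "finite ?U" by (rule finite_subset[of _ "{..b}"]) auto
    \<comment> \<open>\<open>?U\<close> is closed upwards in the segment and has \<open>e\<close>
      elements, so it must be the final stretch.\<close>
    have "?U \<subseteq> {t..<b}"
    proof
      fix k assume k: "k \<in> ?U"
      have "{k..<b} \<subseteq> ?U"
      proof
        fix l assume l: "l \<in> {k..<b}"
        then have "iv v k \<le> iv v l" using inc[of k l] k by (cases "k = l") auto
        then show "l \<in> ?U" using k l by auto
      qed
      from card_mono[OF finU this] have "b - k \<le> e" unfolding ce by simp
      then show "k \<in> {t..<b}" using k by (auto simp: t_def)
    qed
    moreover have "card ?U = card {t..<b}" using ce e ab by (simp add: t_def)
    ultimately have U: "?U = {t..<b}" by (intro card_subset_eq) auto
    have lo: "iv v k < iv v b" if "a < k" "k < t" for k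
    proof -
      have "k \<notin> ?U" unfolding U using that by simp
      then have "iv v k \<le> iv v b" using that t by auto
      then show ?thesis using WB_eq_iff[OF WB_iv[OF vW], of k b] that t by simp
    qed
    have hi: "iv v b < iv v k" if "t \<le> k" "k < b" for k
    proof -
      have "k \<in> ?U" unfolding U using that by simp
      then show ?thesis by simp
    qed
    define v0 where "v0 = cyc b t \<circ> v"
    have v0: "v0 \<in> Z" "v0 \<in> WB r" unfolding v0_def using st[OF cyc_par(1)[OF t ab(2)] vZ] cW vW by auto
    have i: "iv v0 = iv v \<circ> iv (cyc b t)" using cW vW by (simp add: v0_def)
    have "iv v0 x < iv v0 y" if xy: "a < x" "x < y" "y \<le> b" for x y
    proof -
      have c: "iv (cyc b t) z = (if z = t then b else if t < z then z - 1 else z)" if "z \<le> b" for z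
        using iv_cyc_low[of t b z] t ab that by auto
      consider "y < t" | "y = t" | "x < t" "t < y" | "x = t" | "t < x" using xy by linarith
      then show ?thesis
      proof cases
        case 3
        have "iv v x < iv v b" using lo 3 xy by simp
        also have "iv v b < iv v (y - 1)" using 3 xy by (intro hi) auto
        finally show ?thesis using 3 xy by (simp add: i c)
      next
        case 5
        then show ?thesis using inc[of "x - 1" "y - 1"] xy t by (simp add: i c)
      qed (use xy t in \<open>simp_all add: i c inc lo hi\<close>)
    qed
    then have "v0 \<in> D" using v0 incD_seg_iff[OF ab'(3) ab(2), of "iv v0"] by (simp add: D_def)
    moreover have "v = ?g v0" using cW by (simp add: v0_def)
    ultimately show "v \<in> ?g ` D" by blast
  next
    fix w assume "w \<in> ?g ` D"
    then obtain v where v: "v \<in> D" and w: "w = ?g v" by blast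
    then have vZ: "v \<in> Z" and vW: "v \<in> WB r" and inc: "\<And>x y. a < x \<Longrightarrow> x < y \<Longrightarrow> y \<le> b \<Longrightarrow> iv v x < iv v y"
      using Z incD_seg_iff[OF ab'(3) ab(2)] by (auto simp: D_def)
    have wZ: "w \<in> Z" unfolding w using st[OF cyc_par(2)[OF t ab(2)] vZ] .
    then have wW: "w \<in> WB r" using Z by blast
    have i: "iv w = iv v \<circ> cyc b t" using cW vW by (simp add: w)
    have c: "cyc b t z = (if z = b then t else if t \<le> z then z + 1 else z)" if "z \<le> b" for z
      using cyc_low[of t b z] t ab that by auto
    have "iv w b < iv w k \<longleftrightarrow> t \<le> k" if "a < k" "k < b" for k
      using that t inc[of t "k + 1"] inc[of k t] by (auto simp: i c)
    then have "{k. a < k \<and> k < b \<and> iv w b < iv w k} = {t..<b}" using t by auto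
    then have "above a b w = e" using e ab by (simp add: above_def t_def)
    moreover have "iv w x < iv w y" if "a < x" "x < y" "y \<le> ?b" for x y
      using that ab inc by (auto simp: i c)
    ultimately show "w \<in> De"
      using wZ wW incD_seg_iff[OF ab'(1,2), of "iv w"] by (simp add: De_def Ze_def)
  qed
  have DW: "D \<subseteq> WB r" "De \<subseteq> WB r" using Z by (auto simp: D_def De_def Ze_def)
  have "TS (cycs a b) \<cdot> TS Ze = ?x \<cdot> TS De"
    unfolding 1 x1[symmetric] using x DW cycs_WB[OF ab(2)] by (simp add: H.m_assoc)
  also have "TS De = (\<Oplus>\<^bsub>H\<^esub>v\<in>D. TW (?g v))"
    unfolding De using DW(2)[unfolded De] cW by (intro Tsum_image) (auto intro!: inj_onI simp: comp_left_inj)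
  also have "?x \<cdot> \<dots> = (\<Oplus>\<^bsub>H\<^esub>v\<in>D. ?x \<cdot> TW (?g v))"
    using DW cW WB_subset_finite x by (intro H.finsum_rdistr) (auto intro!: Tw_closed WB_comp)
  also have "\<dots> = (\<Oplus>\<^bsub>H\<^esub>v\<in>D. hconst r (qvar ^ e) \<cdot> (?x \<cdot> TW v))"
  proof (rule H.finsum_cong')
    fix v assume "v \<in> D"
    then show "?x \<cdot> TW (?g v) = hconst r (qvar ^ e) \<cdot> (?x \<cdot> TW v)"
      using Tsum_parD_seg_iv_cyc[OF ab t(1,2) order_refl, of v] DW e by (auto simp: D_def t_def)
  qed (use DW x in auto)
  also have "\<dots> = hconst r (qvar ^ e) \<cdot> (?x \<cdot> TS D)"
    unfolding Tsum_mult_left[OF DW(1) x(1)]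
    using DW x WB_subset_finite by (intro H.finsum_rdistr[symmetric]) auto
  also have "?x \<cdot> TS D = TS Z"
    unfolding D_def using parD_seg[OF ab'(3) ab(2)] st Z
    by (intro Tsum_factor_left[symmetric] block_labelling_seg ab ab') auto
  finally show ?thesis unfolding Ze_def .
qed

end

section \<open>Blocks and coset matrices\<close>

definition psum :: "nat \<Rightarrow> vec \<Rightarrow> nat \<Rightarrow> nat" where
  "psum n la i = (\<Sum>k=1..i. hat n la k)"

text \<open>For \<open>x\<close> in \<open>{1..2 * r}\<close> this is the index of the interval
  \<open>Rint n la i\<close> containing \<open>x\<close>; taking the least index passes over empty
  intervals.\<close>

definition blk :: "nat \<Rightarrow> vec \<Rightarrow> nat \<Rightarrow> nat" where
  "blk n la x = (LEAST i. x \<le> psum n la i)"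

lemma psum_0 [simp]: "psum n la 0 = 0"
  by (simp add: psum_def)

lemma psum_Suc [simp]: "psum n la (Suc i) = psum n la i + hat n la (Suc i)"
  by (simp add: psum_def)

lemma psum_mono: "i \<le> j \<Longrightarrow> psum n la i \<le> psum n la j"
  by (induction j rule: dec_induct) auto

lemma hat_mirror: "1 \<le> k \<Longrightarrow> k \<le> 2 * n + 1 \<Longrightarrow> hat n la (2 * n + 2 - k) = hat n la k"
  by (auto simp: hat_def)

lemma psum_mirror:
  assumes "i \<le> 2 * n + 1"
  shows "psum n la (2 * n + 1 - i) + psum n la i = psum n la (2 * n + 1)"
proof -
  have "{1..2 * n + 1} = {1..i} \<union> {i + 1..2 * n + 1}" "{1..i} \<inter> {i + 1..2 * n + 1} = {}" using assms by auto
  then have "psum n la (2 * n + 1) = psum n la i + (\<Sum>k=i + 1..2 * n + 1. hat n la k)"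
    unfolding psum_def by (metis finite_atLeastAtMost sum.union_disjoint)
  also have "(\<Sum>k=i + 1..2 * n + 1. hat n la k) = psum n la (2 * n + 1 - i)"
    unfolding psum_def using assms
    by (intro sum.reindex_bij_witness[where i = "\<lambda>k. 2 * n + 2 - k" and j = "\<lambda>k. 2 * n + 2 - k"])
      (auto simp: hat_mirror[simplified])
  finally show ?thesis by simp
qed

lemma psum_low: "i \<le> n \<Longrightarrow> psum n la i = (\<Sum>k=1..i. la k)"
  unfolding psum_def by (intro sum.cong) (auto simp: hat_def)

lemma Lam_sum: "la \<in> Lam (n + 1) r \<Longrightarrow> psum n la n + la (n + 1) = r"
  by (simp add: Lam_def psum_low)

lemma psum_center: "la \<in> Lam (n + 1) r \<Longrightarrow> psum n la (n + 1) = r + la (n + 1)"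
  using Lam_sum[of la n r] by (simp add: hat_def)

lemma psum_full: "la \<in> Lam (n + 1) r \<Longrightarrow> psum n la (2 * n + 1) = 2 * r"
  using psum_mirror[of n n la] Lam_sum[of la n r] psum_center[of la n r] by simp

lemma hat_beyond: "i = 0 \<or> i > 2 * n + 1 \<Longrightarrow> hat n la i = 0"
  by (auto simp: hat_def)

lemma psum_beyond:
  assumes "la \<in> Lam (n + 1) r" "2 * n + 1 \<le> i"
  shows "psum n la i = 2 * r"
  using assms(2,1)
proof (induction i rule: nat_induct_at_least)
  case base
  then show ?case using psum_full by simp
next
  case (Suc i)
  then show ?case by (simp add: hat_beyond)
qed

lemma hat_inj:
  assumes "la \<in> Lam (n + 1) r" "mu \<in> Lam (n + 1) r" "hat n la = hat n mu"
  shows "la = mu"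
proof
  fix i
  consider "1 \<le> i" "i \<le> n" | "i = n + 1" | "i \<notin> {1..n + 1}" by fastforce
  then show "la i = mu i"
  proof cases
    case 3
    then show ?thesis using assms by (simp add: Lam_def)
  qed (use fun_cong[OF assms(3), of i] in \<open>auto simp: hat_def\<close>)
qed

lemma blk_mono: 
  assumes "la \<in> Lam (n + 1) r" "x \<le> y" "y \<le> 2 * r"
  shows "blk n la x \<le> blk n la y"
proof -
  have "y \<le> psum n la (blk n la y)"
    unfolding blk_def by (rule LeastI[of _ "2 * n + 1"]) (use psum_full assms in simp)
  then show ?thesis unfolding blk_def[of n la x] using assms by (intro Least_le) simp
qed

lemma blk_eq_iff:
  assumes "la \<in> Lam (n + 1) r" "1 \<le> x" "x \<le> 2 * r"
  shows "blk n la x = i \<longleftrightarrow> 1 \<le> i \<and> psum n la (i - 1) < x \<and> x \<le> psum n la i"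
proof
  assume i: "blk n la x = i"
  have le: "x \<le> psum n la i"
    unfolding i[symmetric] blk_def by (rule LeastI[of _ "2 * n + 1"]) (use psum_full assms in simp)
  moreover have "1 \<le> i" using le assms by (cases i) auto
  moreover have "\<not> x \<le> psum n la (i - 1)"
    using not_less_Least[of "i - 1" "\<lambda>i. x \<le> psum n la i"] i \<open>1 \<le> i\<close> unfolding blk_def by auto
  ultimately show "1 \<le> i \<and> psum n la (i - 1) < x \<and> x \<le> psum n la i" by simp
next
  assume i: "1 \<le> i \<and> psum n la (i - 1) < x \<and> x \<le> psum n la i"
  show "blk n la x = i"
    unfolding blk_def
  proof (rule Least_equality)
    fix j assume "x \<le> psum n la j"
    moreover have "psum n la j \<le> psum n la (i - 1)" if "j < i" using that by (intro psum_mono) auto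
    ultimately show "i \<le> j" using i by (meson leD leI le_trans)
  qed (use i in simp)
qed

lemma blk_bounds:
  assumes "la \<in> Lam (n + 1) r" "1 \<le> x" "x \<le> 2 * r"
  shows "1 \<le> blk n la x" "blk n la x \<le> 2 * n + 1"
proof -
  show "1 \<le> blk n la x" using blk_eq_iff[OF assms, of "blk n la x"] by simp
  show "blk n la x \<le> 2 * n + 1" unfolding blk_def using psum_full[OF assms(1)] assms(3) by (intro Least_le) simp
qed

lemma blk_mirror:
  assumes la: "la \<in> Lam (n + 1) r" and x: "1 \<le> x" "x \<le> 2 * r"
  shows "blk n la (2 * r + 1 - x) = 2 * n + 2 - blk n la x"
proof -
  let ?i = "blk n la x"
  have i: "1 \<le> ?i" "?i \<le> 2 * n + 1" using blk_bounds[OF assms] .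
  have p: "psum n la (?i - 1) < x" "x \<le> psum n la ?i" using blk_eq_iff[OF assms, of ?i] by auto
  have m: "psum n la (2 * n + 1 - ?i) + psum n la ?i = 2 * r" 
    "psum n la (2 * n + 1 - (?i - 1)) + psum n la (?i - 1) = 2 * r"
    using psum_mirror[of ?i n la] psum_mirror[of "?i - 1" n la] i psum_full[OF la] by auto
  have e: "2 * n + 1 - (?i - 1) = 2 * n + 2 - ?i" "2 * n + 2 - ?i - 1 = 2 * n + 1 - ?i" using i by auto
  have y: "1 \<le> 2 * r + 1 - x" "2 * r + 1 - x \<le> 2 * r" using x by auto
  show ?thesis unfolding blk_eq_iff[OF la y] e
    using i p m e by auto
qed

lemma Rint_iff:
  assumes la: "la \<in> Lam (n + 1) r"
  shows "x \<in> Rint n la i \<longleftrightarrow> 1 \<le> x \<and> x \<le> 2 * r \<and> blk n la x = i"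
proof -
  have e: "(\<Sum>k=1..<i. hat n la k) = psum n la (i - 1)"
    unfolding psum_def by (cases i) (auto simp: atLeastLessThanSuc_atLeastAtMost)
  have le: "psum n la i \<le> 2 * r"
  proof (cases "2 * n + 1 \<le> i")
    case True
    then show ?thesis using psum_beyond[OF la] by simp
  next
    case False
    then show ?thesis using psum_mono[of i "2 * n + 1" n la] psum_full[OF la] by simp
  qed
  have "x \<in> Rint n la i \<longleftrightarrow> psum n la (i - 1) < x \<and> x \<le> psum n la i"
    unfolding Rint_def e by (simp add: psum_def)
  also have "\<dots> \<longleftrightarrow> 1 \<le> i \<and> psum n la (i - 1) < x \<and> x \<le> psum n la i"
    by (cases i) auto
  also have "\<dots> \<longleftrightarrow> 1 \<le> x \<and> x \<le> 2 * r \<and> blk n la x = i"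
    using blk_eq_iff[OF la, of x i] le by auto
  finally show ?thesis .
qed

lemma card_Rint: "card (Rint n la i) = hat n la i"
proof (cases i)
  case (Suc j)
  have "(\<Sum>k=1..<i. hat n la k) = psum n la j" unfolding psum_def Suc by (simp add: atLeastLessThanSuc_atLeastAtMost)
  moreover have "(\<Sum>k=1..i. hat n la k) = psum n la j + hat n la i"
    using Suc psum_Suc[of n la j] by (simp add: psum_def)
  ultimately show ?thesis unfolding Rint_def by simp
qed (simp add: Rint_def hat_def)

context rank begin

lemma block_labelling_blk:
  assumes la: "la \<in> Lam (n + 1) r"
  shows "block_labelling (blk n la)"
  unfolding block_labelling_def using blk_mono[OF la] blk_mirror[OF la] by auto

lemma WB_group: "Group.group (WB_group r)"
proof (rule groupI)
  fix x assume "x \<in> carrier (WB_group r)"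
  then show "\<exists>y\<in>carrier (WB_group r). y \<otimes>\<^bsub>WB_group r\<^esub> x = \<one>\<^bsub>WB_group r\<^esub>"
    by (intro bexI[of _ "iv x"]) (auto simp: WB_group_def)
qed (auto simp: WB_group_def o_assoc intro!: WB_comp)

text \<open>A block ends at \<open>j\<close> exactly if \<open>j\<close> is a partial sum. As
  \<open>j \<le> r\<close>, a partial sum beyond the \<open>n\<close>-th can only equal
  \<open>j\<close> if the middle block is empty and \<open>j = r\<close>, and then the
  \<open>n\<close>-th one equals \<open>j\<close> as well.\<close>

lemma blk_eq_Suc_iff:
  assumes la: "la \<in> Lam (n + 1) r" and j: "j \<in> {1..r}"
  shows "blk n la j = blk n la (j + 1) \<longleftrightarrow> j \<notin> (\<lambda>i. \<Sum>k=1..i. la k) ` {1..n}"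
proof -
  have j': "1 \<le> j" "j \<le> 2 * r" "1 \<le> j + 1" "j + 1 \<le> 2 * r" using j r2 by auto
  have "blk n la j \<noteq> blk n la (j + 1) \<longleftrightarrow> (\<exists>i. psum n la i = j)"
  proof
    assume ne: "blk n la j \<noteq> blk n la (j + 1)"
    have "j \<le> psum n la (blk n la j)" "\<not> j + 1 \<le> psum n la (blk n la j)"
      using blk_eq_iff[OF la j'(1,2), of "blk n la j"] blk_eq_iff[OF la j'(3,4), of "blk n la j"] ne by auto
    then show "\<exists>i. psum n la i = j" by (intro exI[of _ "blk n la j"]) simp
  next
    assume "\<exists>i. psum n la i = j"
    then obtain i where i: "psum n la i = j" by blast
    have "blk n la j \<le> i" unfolding blk_def using i by (intro Least_le) simp
    moreover have "j + 1 \<le> psum n la (blk n la (j + 1))"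
      using blk_eq_iff[OF la j'(3,4), of "blk n la (j + 1)"] by auto
    ultimately show "blk n la j \<noteq> blk n la (j + 1)"
      using i psum_mono[of "blk n la (j + 1)" i n la] by auto
  qed
  also have "\<dots> \<longleftrightarrow> (\<exists>i\<in>{1..n}. psum n la i = j)"
  proof
    assume "\<exists>i. psum n la i = j"
    then obtain i where i: "psum n la i = j" by blast
    show "\<exists>i\<in>{1..n}. psum n la i = j"
    proof (cases "i \<le> n")
      case True
      moreover have "0 < i" using i j by (intro gr0I) auto
      ultimately show ?thesis using i by auto
    next
      case False
      then have "psum n la (n + 1) \<le> j" using psum_mono[of "n + 1" i n la] i by simp
      then have "psum n la n = j" "la (n + 1) = 0"
        using Lam_sum[OF la] psum_center[OF la] j by auto
      moreover have "0 < n" using calculation j by (intro gr0I) auto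
      ultimately show ?thesis by (intro bexI[of _ n]) auto
    qed
  qed blast
  also have "\<dots> \<longleftrightarrow> j \<in> (\<lambda>i. \<Sum>k=1..i. la k) ` {1..n}"
    using psum_low[of _ n la] by (auto simp: image_iff)
  finally show ?thesis by blast
qed

text \<open>The generators stabilise the blocks. Conversely every descent of a stabilising element
  lies inside a block by \<open>par_descent\<close>, so stripping descents writes it as a word in
  these generators.\<close>

lemma WB_par_eq:
  assumes la: "la \<in> Lam (n + 1) r"
  shows "WB_par n r la = par (blk n la)"
proof -
  let ?c = "blk n la"
  let ?G = "{cox r j | j. j \<in> {1..r} \<and> j \<notin> (\<lambda>i. \<Sum>k=1..i. la k) ` {1..n}}"
  note c = block_labelling_blk[OF la]
  have G: "?G = {cox r j | j. j \<in> {1..r} \<and> ?c j = ?c (j + 1)}"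
    using blk_eq_Suc_iff[OF la] by blast
  have one: "w \<in> par ?c" if "w \<in> generate (WB_group r) ?G" for w
    using that
  proof (induction rule: generate.induct)
    case one
    then show ?case using par_id by (simp add: WB_group_def id_def)
  next
    case (incl h)
    then show ?case unfolding G using cox_par[OF c] by auto
  next
    case (inv h)
    then obtain j where j: "j \<in> {1..r}" "h = cox r j" "h \<in> par ?c" unfolding G using cox_par[OF c] by auto
    have "inv\<^bsub>WB_group r\<^esub> h = h"
      by (rule group.inv_equality[OF WB_group]) (use j in \<open>auto simp: WB_group_def\<close>)
    then show ?case using j by simp
  next
    case (eng h1 h2)
    then show ?case using par_comp[of h1 _ h2] by (simp add: WB_group_def o_def)
  qed
  have two: "w \<in> generate (WB_group r) ?G" if "w \<in> par ?c" for w
    using that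
  proof (induction "lenB2 w" arbitrary: w rule: less_induct)
    case less
    note wW = par_WB[OF less.prems]
    show ?case
    proof (cases "w = id")
      case True
      then show ?thesis using generate.one[of "WB_group r" ?G] by (simp add: WB_group_def)
    next
      case False
      then obtain i where i: "i \<in> {1..r}" "w (i + 1) < w i" using exists_descent wW by blast
      have e: "?c i = ?c (i + 1)" by (rule par_descent[OF c less.prems]) (use i r2 in auto)
      define v where "v = w \<circ> cox r i"
      have v: "v \<in> par ?c" unfolding v_def using less.prems cox_par[OF c e i(1)] by (intro par_comp)
      have w: "w = v \<circ> cox r i" using i by (simp add: v_def)
      have "lenB2 v < lenB2 w" using lenB2_cox_desc[OF i(1) wW i(2)] by (simp add: v_def)
      then have "v \<in> generate (WB_group r) ?G" using v by (rule less.hyps)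
      moreover have "cox r i \<in> generate (WB_group r) ?G"
        unfolding G using i e by (intro generate.incl) auto
      ultimately have "v \<otimes>\<^bsub>WB_group r\<^esub> cox r i \<in> generate (WB_group r) ?G" by (rule generate.eng)
      then show ?thesis unfolding w by (simp add: WB_group_def)
    qed
  qed
  show ?thesis unfolding WB_par_def using one two by blast
qed

lemma coset_matrix_eq:
  assumes la: "la \<in> Lam (n + 1) r" "mu \<in> Lam (n + 1) r" and w: "w \<in> WB r"
  shows "coset_matrix n la w mu i j
    = card {x. 1 \<le> x \<and> x \<le> 2 * r \<and> blk n la (w x) = i \<and> blk n mu x = j}"
proof -
  have "Rint n la i \<inter> w ` Rint n mu j
    = w ` {x. 1 \<le> x \<and> x \<le> 2 * r \<and> blk n la (w x) = i \<and> blk n mu x = j}"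
    using WB_bounds[OF w] by (auto simp: Rint_iff[OF la(1)] Rint_iff[OF la(2)])
  then show ?thesis
    unfolding coset_matrix_def using w by (simp add: card_image inj_on_def)
qed

lemma coset_matrix_par:
  assumes la: "la \<in> Lam (n + 1) r" "mu \<in> Lam (n + 1) r" and w: "w \<in> WB r"
    and u: "u \<in> par (blk n la)" and v: "v \<in> par (blk n mu)"
  shows "coset_matrix n la (u \<circ> w \<circ> v) mu = coset_matrix n la w mu"
proof (intro ext)
  fix i j
  note uW = par_WB[OF u] and vW = par_WB[OF v]
  have W: "u \<circ> w \<circ> v \<in> WB r" using uW vW w by simp
  have b: "blk n la (u (w x)) = blk n la (w x)" if "1 \<le> x" "x \<le> 2 * r" for x
    using par_apply[OF u] WB_bounds[OF w] that by simp
  have v': "blk n mu (iv v x) = blk n mu x" if "1 \<le> x" "x \<le> 2 * r" for x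
    using par_apply[OF par_iv[OF v]] that by simp
  have "bij_betw v {x. 1 \<le> x \<and> x \<le> 2 * r \<and> blk n la ((u \<circ> w \<circ> v) x) = i \<and> blk n mu x = j}
    {x. 1 \<le> x \<and> x \<le> 2 * r \<and> blk n la (w x) = i \<and> blk n mu x = j}"
    by (rule bij_betw_byWitness[where f' = "iv v"])
      (use vW WB_bounds[OF vW] WB_bounds[OF WB_iv[OF vW]] par_apply[OF v] v' b in auto)
  then show "coset_matrix n la (u \<circ> w \<circ> v) mu i j = coset_matrix n la w mu i j"
    unfolding coset_matrix_eq[OF la W] coset_matrix_eq[OF la w] by (rule bij_betw_same_card)
qed

lemma card_fibers:
  assumes "finite X" "finite J" "\<And>x. x \<in> X \<Longrightarrow> f x \<in> J"
  shows "(\<Sum>j\<in>J. card {x \<in> X. f x = j}) = card X"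
proof -
  have "card (\<Union>j\<in>J. {x \<in> X. f x = j}) = (\<Sum>j\<in>J. card {x \<in> X. f x = j})"
    using assms by (intro card_UN_disjoint) auto
  moreover have "(\<Union>j\<in>J. {x \<in> X. f x = j}) = X" using assms(3) by auto
  ultimately show ?thesis by simp
qed

lemma ro_coset_matrix:
  assumes la: "la \<in> Lam (n + 1) r" "mu \<in> Lam (n + 1) r" and w: "w \<in> WB r"
  shows "ro n (coset_matrix n la w mu) = hat n la"
proof
  fix i
  let ?X = "{x. 1 \<le> x \<and> x \<le> 2 * r \<and> blk n la (w x) = i}"
  have fin: "finite ?X" by (rule finite_subset[of _ "{..2 * r}"]) auto
  have "ro n (coset_matrix n la w mu) i = (\<Sum>j=1..2 * n + 1. card {x \<in> ?X. blk n mu x = j})"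
    unfolding ro_def coset_matrix_eq[OF la w] by (intro sum.cong arg_cong[of _ _ card]) auto
  also have "\<dots> = card ?X" using fin blk_bounds[OF la(2)] by (intro card_fibers) auto
  also have "\<dots> = card (w ` ?X)" using w by (simp add: card_image inj_on_def)
  also have "w ` ?X = Rint n la i"
  proof (intro subset_antisym subsetI)
    fix y assume "y \<in> Rint n la i"
    then show "y \<in> w ` ?X" using w WB_bounds[OF WB_iv[OF w], of y]
      by (intro image_eqI[of _ _ "iv w y"]) (auto simp: Rint_iff[OF la(1)])
  qed (use WB_bounds[OF w] in \<open>auto simp: Rint_iff[OF la(1)]\<close>)
  finally show "ro n (coset_matrix n la w mu) i = hat n la i" by (simp add: card_Rint)
qed

lemma co_coset_matrix:
  assumes la: "la \<in> Lam (n + 1) r" "mu \<in> Lam (n + 1) r" and w: "w \<in> WB r"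
  shows "co n (coset_matrix n la w mu) = hat n mu"
proof
  fix j
  let ?X = "{x. 1 \<le> x \<and> x \<le> 2 * r \<and> blk n mu x = j}"
  have fin: "finite ?X" by (rule finite_subset[of _ "{..2 * r}"]) auto
  have "co n (coset_matrix n la w mu) j = (\<Sum>i=1..2 * n + 1. card {x \<in> ?X. blk n la (w x) = i})"
    unfolding co_def coset_matrix_eq[OF la w] by (intro sum.cong arg_cong[of _ _ card]) auto
  also have "\<dots> = card ?X" using fin blk_bounds[OF la(1)] WB_bounds[OF w] by (intro card_fibers) auto
  also have "?X = Rint n mu j" using Rint_iff[OF la(2)] by auto
  finally show "co n (coset_matrix n la w mu) j = hat n mu j" by (simp add: card_Rint)
qed

text \<open>In contrast to \<open>incD\<close>, mirrored pairs are compared too; this is the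
  monotonicity that belongs to minimal length in type B.\<close>

definition incB :: "(nat \<Rightarrow> nat) \<Rightarrow> (nat \<Rightarrow> nat) \<Rightarrow> bool" where
  "incB c v \<longleftrightarrow> (\<forall>x y. 1 \<le> x \<longrightarrow> x < y \<longrightarrow> y \<le> 2 * r \<longrightarrow> c x = c y \<longrightarrow> v x < v y)"

lemma incB_incD: "incB c v \<Longrightarrow> incD c v"
  by (simp add: incB_def incD_def)

text \<open>A mirrored pair inside a block encloses \<open>r\<close> and \<open>r + 1\<close>, so it
  is ordered through these two points by comparisons of pairs that are not mirrored.\<close>

lemma incD_incB:
  assumes c: "block_labelling c" and v: "incD c v" and r: "c r = c (r + 1) \<Longrightarrow> v r < v (r + 1)"
  shows "incB c v"
  unfolding incB_def
proof (intro allI impI)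
  fix x y assume xy: "1 \<le> x" "x < y" "y \<le> 2 * r" "c x = c y"
  show "v x < v y"
  proof (cases "x + y = 2 * r + 1")
    case True
    then have "x \<le> r" "r + 1 \<le> y" using xy by auto
    then have e: "c r = c x" "c (r + 1) = c x"
      by (intro block_between[OF c xy(4)]; use xy in auto)+
    have "v x < v r" if "x \<noteq> r"
      using v[unfolded incD_def, rule_format, of x r] that xy \<open>x \<le> r\<close> e(1) by simp
    then have "v x \<le> v r" by (cases "x = r") auto
    moreover have "v (r + 1) < v y" if "y \<noteq> r + 1"
      using v[unfolded incD_def, rule_format, of "r + 1" y] that xy \<open>r + 1 \<le> y\<close> e(2) by simp
    then have "v (r + 1) \<le> v y" by (cases "y = r + 1") auto
    ultimately show ?thesis using r e by simp
  qed (use v xy in \<open>simp add: incD_def\<close>)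
qed

lemma incB_I:
  assumes c: "block_labelling c" and v: "v \<in> WB r"
    and asc: "\<And>i. i \<in> {1..r} \<Longrightarrow> c i = c (i + 1) \<Longrightarrow> v i < v (i + 1)"
  shows "incB c v"
proof (rule incD_incB[OF c incD_I[OF c v]])
  fix i assume i: "i \<in> {1..r}" "c (dfst i) = c (i + 1)"
  show "v (dfst i) < v (i + 1)"
  proof (cases "i < r")
    case True
    then show ?thesis using i asc by (simp add: dfst_def)
  next
    case False
    then have [simp]: "i = r" using i by simp
    have e: "c (r - 1) = c (r + 1)" using i by (simp add: dfst_def)
    have "c r = c (r - 1)" by (rule block_between[OF c e]) (use r2 in auto)
    moreover have "r - 1 + 1 = r" using r2 by simp
    ultimately have "v (r - 1) < v r" "v r < v (r + 1)" using asc[of "r - 1"] asc[of r] e by auto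
    then show ?thesis by (simp add: dfst_def)
  qed
qed (use asc in simp)

end

section \<open>Uniqueness and existence of permutations with a given matrix\<close>

lemma exists_labelling:
  fixes a :: "'b \<Rightarrow> nat"
  assumes "finite J" "finite S" "(\<Sum>j\<in>J. a j) = card S"
  shows "\<exists>g. (\<forall>x\<in>S. g x \<in> J) \<and> (\<forall>j\<in>J. card {x \<in> S. g x = j} = a j)"
  using assms
proof (induction J arbitrary: S rule: finite_induct)
  case empty
  then show ?case by auto
next
  case (insert j J)
  have "a j \<le> card S" using insert by simp
  then obtain S0 where S0: "S0 \<subseteq> S" "card S0 = a j" using obtain_subset_with_card_n by metis
  have "card (S - S0) = (\<Sum>j\<in>J. a j)"
    using insert S0 by (simp add: card_Diff_subset finite_subset[OF S0(1)])
  then obtain g where g: "\<forall>x\<in>S - S0. g x \<in> J" "\<forall>i\<in>J. card {x \<in> S - S0. g x = i} = a i"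
    using insert.IH[of "S - S0"] insert.prems by auto
  define h where "h = (\<lambda>x. if x \<in> S0 then j else g x)"
  have "{x \<in> S. h x = j} = S0" using S0 g(1) insert.hyps by (auto simp: h_def split: if_splits)
  moreover have "{x \<in> S. h x = i} = {x \<in> S - S0. g x = i}" if "i \<in> J" for i
    using that insert.hyps by (auto simp: h_def)
  ultimately show ?case
    using g S0 by (intro exI[of _ h]) (auto simp: h_def)
qed

lemma exists_bij_over:
  assumes "finite X" "finite Y" "\<And>l. card {x \<in> X. f x = l} = card {y \<in> Y. g y = l}"
  shows "\<exists>h. bij_betw h X Y \<and> (\<forall>x\<in>X. g (h x) = f x)"
proof -
  have "\<exists>h. bij_betw h {x \<in> X. f x = l} {y \<in> Y. g y = l}" for l
    using assms by (intro finite_same_card_bij) auto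
  then obtain h where h: "\<And>l. bij_betw (h l) {x \<in> X. f x = l} {y \<in> Y. g y = l}" by metis
  define k where "k = (\<lambda>x. h (f x) x)"
  have k: "k x \<in> Y \<and> g (k x) = f x" if "x \<in> X" for x
    using that bij_betw_apply[OF h, of x "f x"] by (auto simp: k_def)
  have "bij_betw k X Y"
    unfolding bij_betw_def
  proof (intro conjI inj_onI subset_antisym subsetI)
    fix x y assume xy: "x \<in> X" "y \<in> X" "k x = k y"
    then have "f x = f y" using k by metis
    then show "x = y" using xy h[of "f x"] unfolding bij_betw_def inj_on_def k_def by auto
  next
    fix y assume "y \<in> Y"
    then have "y \<in> h (g y) ` {x \<in> X. f x = g y}" using h[of "g y"] unfolding bij_betw_def by blast
    then obtain x where "x \<in> X" "f x = g y" "y = h (g y) x" by blast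
    then have "y = k x" by (simp add: k_def)
    then show "y \<in> k ` X" using \<open>x \<in> X\<close> by blast
  qed (use k in auto)
  then show ?thesis using k by blast
qed

text \<open>Down sets of a chain are comparable by inclusion, so their size decides.\<close>

lemma down_sets_eq:
  fixes R :: "nat set"
  assumes "finite R" "D \<subseteq> R" "D' \<subseteq> R" "card D = card D'"
    and "\<And>x y. x \<in> D \<Longrightarrow> y \<in> R \<Longrightarrow> y \<le> x \<Longrightarrow> y \<in> D"
    and "\<And>x y. x \<in> D' \<Longrightarrow> y \<in> R \<Longrightarrow> y \<le> x \<Longrightarrow> y \<in> D'"
  shows "D = D'"
proof -
  have fin: "finite D" "finite D'" using assms finite_subset by blast+
  have "D \<subseteq> D' \<or> D' \<subseteq> D"
  proof (rule ccontr)
    assume "\<not> ?thesis"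
    then obtain x y where "x \<in> D" "x \<notin> D'" "y \<in> D'" "y \<notin> D" by blast
    then show False using assms by (metis nat_le_linear subsetD)
  qed
  then show ?thesis using card_subset_eq[OF fin(1)] card_subset_eq[OF fin(2)] assms(4) by metis
qed

lemma blk_le_iff:
  assumes "la \<in> Lam (n + 1) r" "1 \<le> x" "x \<le> 2 * r"
  shows "blk n la x \<le> i \<longleftrightarrow> x \<le> psum n la i"
proof
  assume "blk n la x \<le> i"
  then show "x \<le> psum n la i" using blk_eq_iff[OF assms, of "blk n la x"] psum_mono[of "blk n la x" i n la] by auto
next
  assume "x \<le> psum n la i"
  then show "blk n la x \<le> i" unfolding blk_def by (rule Least_le)
qed

lemma blk_half:
  assumes la: "la \<in> Lam (n + 1) r" "la (n + 1) = 0" and x: "1 \<le> x" "x \<le> 2 * r"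
  shows "blk n la x \<le> n \<longleftrightarrow> x \<le> r" "n + 2 \<le> blk n la x \<longleftrightarrow> r < x" "blk n la x \<noteq> n + 1"
proof -
  have p: "psum n la n = r" "psum n la (n + 1) = r" using Lam_sum[OF la(1)] psum_center[OF la(1)] la(2) by auto
  then have q: "blk n la x \<le> n \<longleftrightarrow> x \<le> r" "blk n la x \<le> n + 1 \<longleftrightarrow> x \<le> r"
    using blk_le_iff[OF la(1) x, of n] blk_le_iff[OF la(1) x, of "n + 1"] by auto
  then show "blk n la x \<le> n \<longleftrightarrow> x \<le> r" "n + 2 \<le> blk n la x \<longleftrightarrow> r < x" "blk n la x \<noteq> n + 1"
    by auto
qed

context rank begin

lemma coset_matrix_eq':
  assumes la: "la \<in> Lam (n + 1) r" "mu \<in> Lam (n + 1) r" and w: "w \<in> WB r"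
  shows "coset_matrix n la w mu i j
    = card {k. 1 \<le> k \<and> k \<le> 2 * r \<and> blk n la k = i \<and> blk n mu (iv w k) = j}"
proof -
  have "bij_betw w {x. 1 \<le> x \<and> x \<le> 2 * r \<and> blk n la (w x) = i \<and> blk n mu x = j}
    {k. 1 \<le> k \<and> k \<le> 2 * r \<and> blk n la k = i \<and> blk n mu (iv w k) = j}"
    by (rule bij_betw_byWitness[where f' = "iv w"])
      (use w WB_bounds[OF w] WB_bounds[OF WB_iv[OF w]] in auto)
  then show ?thesis unfolding coset_matrix_eq[OF assms] by (rule bij_betw_same_card)
qed

lemma coset_matrix_mirror:
  assumes la: "la \<in> Lam (n + 1) r" "mu \<in> Lam (n + 1) r" and w: "w \<in> WB r"
    and ij: "1 \<le> i" "i \<le> 2 * n + 1" "1 \<le> j" "j \<le> 2 * n + 1"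
  shows "coset_matrix n la w mu (2 * n + 2 - i) (2 * n + 2 - j) = coset_matrix n la w mu i j"
proof -
  let ?M = "\<lambda>i j. {k. 1 \<le> k \<and> k \<le> 2 * r \<and> blk n la k = i \<and> blk n mu (iv w k) = j}"
  have sub: "2 * r + 1 - k \<in> ?M (2 * n + 2 - i) (2 * n + 2 - j)"
    if "k \<in> ?M i j" for i j k
  proof -
    have k: "1 \<le> k" "k \<le> 2 * r" "blk n la k = i" "blk n mu (iv w k) = j" using that by auto
    have b: "1 \<le> iv w k" "iv w k \<le> 2 * r" using WB_bounds[OF WB_iv[OF w]] k by auto
    show ?thesis
      using k b blk_mirror[OF la(1), of k] blk_mirror[OF la(2), of "iv w k"] WB_mirror[OF WB_iv[OF w], of k]
      by auto
  qed
  have e: "2 * n + 2 - (2 * n + 2 - i) = i" "2 * n + 2 - (2 * n + 2 - j) = j" using ij by auto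
  have "bij_betw (\<lambda>k. 2 * r + 1 - k) (?M i j) (?M (2 * n + 2 - i) (2 * n + 2 - j))"
    by (rule bij_betw_byWitness[where f' = "\<lambda>k. 2 * r + 1 - k"])
      (use sub[of _ i j] sub[of _ "2 * n + 2 - i" "2 * n + 2 - j"] e in auto)
  then show ?thesis unfolding coset_matrix_eq'[OF la w] by (rule bij_betw_same_card[symmetric])
qed

text \<open>The two monotonicity conditions act in turn. As the inverse increases along a row block,
  the column labels there increase weakly and are determined by their multiplicities in the matrix.
  As \<open>w\<close> increases along a column block, it is the order isomorphism onto the places
  with that label.\<close>

lemma coset_matrix_unique:
  assumes la: "la \<in> Lam (n + 1) r" "nu \<in> Lam (n + 1) r" and w: "w \<in> WB r" "w' \<in> WB r"
    and eq: "coset_matrix n la w nu = coset_matrix n la w' nu"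
    and inc: "incB (blk n la) (iv w)" "incB (blk n nu) w" "incB (blk n la) (iv w')" "incB (blk n nu) w'"
  shows "w = w'"
proof -
  have W: "iv w \<in> WB r" "iv w' \<in> WB r" using w by simp_all
  have f: "blk n nu (iv w k) = blk n nu (iv w' k)" if k: "1 \<le> k" "k \<le> 2 * r" for k
  proof -
    let ?R = "{x. 1 \<le> x \<and> x \<le> 2 * r \<and> blk n la x = blk n la k}"
    let ?D = "\<lambda>w j. {x \<in> ?R. blk n nu (iv w x) \<le> j}"
    have fin: "finite ?R" by (rule finite_subset[of _ "{..2 * r}"]) auto
    have c: "card (?D v j) = (\<Sum>j'\<in>{1..j}. coset_matrix n la v nu (blk n la k) j')"
      if "v \<in> WB r" for v j
    proof -
      have "(\<Sum>j'\<in>{1..j}. card {x \<in> ?D v j. blk n nu (iv v x) = j'}) = card (?D v j)"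
        using fin blk_bounds[OF la(2)] WB_bounds[OF WB_iv[OF that]] by (intro card_fibers) auto
      moreover have "card {x \<in> ?D v j. blk n nu (iv v x) = j'} = coset_matrix n la v nu (blk n la k) j'"
        if "j' \<in> {1..j}" for j'
        unfolding coset_matrix_eq'[OF la \<open>v \<in> WB r\<close>] using that by (intro arg_cong[of _ _ card]) auto
      ultimately show ?thesis by simp
    qed
    have dn: "y \<in> ?D v j" if "v \<in> WB r" "incB (blk n la) (iv v)" "x \<in> ?D v j" "y \<in> ?R" "y \<le> x" for v x y j
    proof -
      have "iv v y \<le> iv v x"
        using that unfolding incB_def by (cases "y = x") (auto intro!: less_imp_le)
      then have "blk n nu (iv v y) \<le> blk n nu (iv v x)"
        using that WB_bounds[OF WB_iv[OF that(1)]] by (intro blk_mono[OF la(2)]) auto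
      then show ?thesis using that by auto
    qed
    have "?D w j = ?D w' j" for j
      by (rule down_sets_eq[OF fin])
        (use c w eq dn[OF w(1) inc(1), of _ j] dn[OF w(2) inc(3), of _ j] in auto)
    moreover have "k \<in> ?R" using k by simp
    ultimately have "blk n nu (iv w k) \<le> j \<longleftrightarrow> blk n nu (iv w' k) \<le> j" for j by blast
    then show ?thesis by (metis order_refl order_antisym)
  qed
  have "w x = w' x" if x: "1 \<le> x" "x \<le> 2 * r" for x
  proof -
    let ?R = "{y. 1 \<le> y \<and> y \<le> 2 * r \<and> blk n nu y = blk n nu x}"
    let ?F = "{k. 1 \<le> k \<and> k \<le> 2 * r \<and> blk n nu (iv w k) = blk n nu x}"
    have F: "v ` ?R = ?F" if "v = w \<or> v = w'" for v
    proof -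
      have v: "v \<in> WB r" using that w by auto
      have F': "?F = {k. 1 \<le> k \<and> k \<le> 2 * r \<and> blk n nu (iv v k) = blk n nu x}"
        using that f by auto
      show ?thesis unfolding F'
      proof (intro subset_antisym subsetI)
        fix k assume "k \<in> {k. 1 \<le> k \<and> k \<le> 2 * r \<and> blk n nu (iv v k) = blk n nu x}"
        then show "k \<in> v ` ?R"
          using v WB_bounds[OF WB_iv[OF v], of k] by (intro image_eqI[of _ _ "iv v k"]) auto
      qed (use v WB_bounds[OF v] in auto)
    qed
    have st: "v y < v z" if "v = w \<or> v = w'" "y \<in> ?R" "z \<in> ?R" "y < z" for v y z
      using that inc(2,4) unfolding incB_def by auto
    \<comment> \<open>Both maps send this initial part of the column block to down sets of
      \<open>?F\<close> of equal size. So the images agree, and with them their maxima, the values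
      at \<open>x\<close>.\<close>
    let ?S = "{y \<in> ?R. y \<le> x}"
    have fin: "finite ?F" by (rule finite_subset[of _ "{..2 * r}"]) auto
    have finS: "finite ?S" by (rule finite_subset[of _ "{..2 * r}"]) auto
    have dn: "k' \<in> v ` ?S" if v: "v = w \<or> v = w'" and k: "k \<in> v ` ?S" "k' \<in> ?F" "k' \<le> k" for v k k'
    proof -
      obtain y where "y \<in> ?S" "k = v y" using k(1) by (elim imageE)
      then have y: "y \<in> ?R" "y \<le> x" "k = v y" by simp_all
      have "k' \<in> v ` ?R" unfolding F[OF v] by (rule k(2))
      then obtain y' where y': "y' \<in> ?R" "k' = v y'" by (elim imageE)
      have "y' \<le> y" using st[OF v y(1) y'(1)] y y' k(3) by (meson leD leI)
      then have "y' \<in> ?S" using y y' by simp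
      with y'(2) show ?thesis by (rule image_eqI)
    qed
    have "w ` ?S = w' ` ?S"
    proof (rule down_sets_eq[OF fin])
      have "?S \<subseteq> ?R" by blast
      then have sub: "v ` ?S \<subseteq> v ` ?R" for v by (rule image_mono)
      show "w ` ?S \<subseteq> ?F" by (rule subset_trans[OF sub equalityD1[OF F]]) simp
      show "w' ` ?S \<subseteq> ?F" by (rule subset_trans[OF sub equalityD1[OF F]]) simp
      show "card (w ` ?S) = card (w' ` ?S)" using w by (simp add: card_image inj_on_def)
      show "y \<in> w ` ?S" if "x \<in> w ` ?S" "y \<in> ?F" "y \<le> x" for x y using dn[OF _ that] by simp
      show "y \<in> w' ` ?S" if "x \<in> w' ` ?S" "y \<in> ?F" "y \<le> x" for x y using dn[OF _ that] by simp
    qed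
    moreover have "Max (v ` ?S) = v x" if v: "v = w \<or> v = w'" for v
    proof (rule Max_eqI)
      fix k assume "k \<in> v ` ?S"
      then obtain y where y: "y \<in> ?R" "y \<le> x" "k = v y" by blast
      then show "k \<le> v x" using st[OF v y(1), of x] x by (cases "y = x") (auto intro: less_imp_le)
    qed (use finS x in auto)
    ultimately show ?thesis by metis
  qed
  then show ?thesis using w r2 by (intro WB_eqI) auto
qed

text \<open>The corner entries count the positions beyond the middle column block with values at
  most \<open>r\<close>. Mirroring turns them into the positions before that block with values above
  \<open>r\<close>; the negative entries still missing are those in the lower half of the middle
  block.\<close>

lemma sum_coset_matrix_corner:
  assumes la: "la \<in> Lam (n + 1) r" "nu \<in> Lam (n + 1) r" "la (n + 1) = 0" and w: "w \<in> WB r"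
  shows "neg r w = (\<Sum>i=1..n. \<Sum>j=n + 2..2 * n + 1. coset_matrix n la w nu i j)
    + card {x. r - nu (n + 1) < x \<and> x \<le> r \<and> r < w x}"
proof -
  let ?X = "{x. 1 \<le> x \<and> x \<le> 2 * r \<and> blk n la (w x) \<le> n \<and> n + 2 \<le> blk n nu x}"
  let ?Xi = "\<lambda>i. {x \<in> ?X. blk n la (w x) = i}"
  let ?s = "nu (n + 1)"
  have fin: "finite ?X" by (rule finite_subset[of _ "{..2 * r}"]) auto
  have s: "?s \<le> r" using Lam_sum[OF la(2)] by simp
  have "(\<Sum>j=n + 2..2 * n + 1. coset_matrix n la w nu i j) = card (?Xi i)" if i: "i \<in> {1..n}" for i
  proof -
    have "(\<Sum>j=n + 2..2 * n + 1. coset_matrix n la w nu i j)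
      = (\<Sum>j=n + 2..2 * n + 1. card {x \<in> ?Xi i. blk n nu x = j})"
      unfolding coset_matrix_eq[OF la(1,2) w]
      using i by (intro sum.cong refl arg_cong[of _ _ card]) auto
    also have "\<dots> = card (?Xi i)"
      using fin blk_bounds[OF la(2)] by (intro card_fibers) auto
    finally show ?thesis .
  qed
  then have "(\<Sum>i=1..n. \<Sum>j=n + 2..2 * n + 1. coset_matrix n la w nu i j) = (\<Sum>i=1..n. card (?Xi i))" by simp
  also have "\<dots> = card ?X" using fin blk_bounds[OF la(1)] WB_bounds[OF w] by (intro card_fibers) auto
  also have "\<dots> = card {x. 1 \<le> x \<and> x \<le> r - ?s \<and> r < w x}"
  proof -
    have X: "?X = {x. r + ?s < x \<and> x \<le> 2 * r \<and> w x \<le> r}"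
    proof (intro subset_antisym subsetI)
      have "n + 2 \<le> blk n nu x \<longleftrightarrow> r + ?s < x" if "1 \<le> x" "x \<le> 2 * r" for x
        using blk_le_iff[OF la(2) that, of "n + 1"] psum_center[OF la(2)] by auto
      then show "x \<in> {x. r + ?s < x \<and> x \<le> 2 * r \<and> w x \<le> r}" if "x \<in> ?X" for x
        using that blk_half(1)[OF la(1,3), of "w x"] WB_bounds[OF w] by auto
      show "x \<in> ?X" if "x \<in> {x. r + ?s < x \<and> x \<le> 2 * r \<and> w x \<le> r}" for x
        using that blk_half(1)[OF la(1,3), of "w x"] WB_bounds[OF w, of x]
          blk_le_iff[OF la(2), of x "n + 1"] psum_center[OF la(2)] by auto
    qed
    have "bij_betw (\<lambda>x. 2 * r + 1 - x) ?X {x. 1 \<le> x \<and> x \<le> r - ?s \<and> r < w x}"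
      unfolding X
    proof (rule bij_betw_byWitness[where f' = "\<lambda>x. 2 * r + 1 - x"])
      show "(\<lambda>x. 2 * r + 1 - x) ` {x. r + ?s < x \<and> x \<le> 2 * r \<and> w x \<le> r} \<subseteq> {x. 1 \<le> x \<and> x \<le> r - ?s \<and> r < w x}"
        using WB_mirror[OF w] by auto
      show "(\<lambda>x. 2 * r + 1 - x) ` {x. 1 \<le> x \<and> x \<le> r - ?s \<and> r < w x} \<subseteq> {x. r + ?s < x \<and> x \<le> 2 * r \<and> w x \<le> r}"
        using WB_mirror[OF w] s by auto
    qed auto
    then show ?thesis by (rule bij_betw_same_card)
  qed
  finally have S: "(\<Sum>i=1..n. \<Sum>j=n + 2..2 * n + 1. coset_matrix n la w nu i j)
    = card {x. 1 \<le> x \<and> x \<le> r - ?s \<and> r < w x}" .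
  have "{x \<in> {1..r}. w x > r} = {x. 1 \<le> x \<and> x \<le> r - ?s \<and> r < w x} \<union> {x. r - ?s < x \<and> x \<le> r \<and> r < w x}"
    using s by auto
  moreover have "card ({x. 1 \<le> x \<and> x \<le> r - ?s \<and> r < w x} \<union> {x. r - ?s < x \<and> x \<le> r \<and> r < w x})
    = card {x. 1 \<le> x \<and> x \<le> r - ?s \<and> r < w x} + card {x. r - ?s < x \<and> x \<le> r \<and> r < w x}"
    by (rule card_Un_disjoint) (auto intro: finite_subset[of _ "{..r}"])
  ultimately show ?thesis unfolding S neg_def by simp
qed

text \<open>Without this the description in \<open>d_mat\<close> could be void. The inverse
  \<open>v\<close> of the permutation is built: places carry their row block and a prescribed
  column, positions carry their column block and a prescribed row, and \<open>v\<close> matches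
  equal labels on \<open>{1..r}\<close> and is extended by mirror symmetry.\<close>

lemma exists_coset_matrix:
  assumes la: "la \<in> Lam (n + 1) r" "nu \<in> Lam (n + 1) r" "la (n + 1) = 0"
    and A: "A \<in> Xi n r" "ro n A = hat n la" "co n A = hat n nu"
  shows "\<exists>w\<in>WB r. coset_matrix n la w nu = A"
proof -
  let ?N = "{1..2 * n + 1}"
  have A0: "A i j = 0" if "i \<notin> ?N \<or> j \<notin> ?N" for i j using A(1) that by (auto simp: Xi_def)
  have Am: "A (2 * n + 2 - i) (2 * n + 2 - j) = A i j" if "i \<in> ?N" "j \<in> ?N" for i j
    using A(1) that unfolding Xi_def by (auto dest!: bspec)
  have Ac: "A (n + 1) j = 0" for j
  proof (cases "j \<in> ?N")
    case True
    have "ro n A (n + 1) = 0" using A(2) la(3) by (simp add: hat_def)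
    then show ?thesis using True unfolding ro_def by (metis finite_atLeastAtMost sum_eq_0_iff)
  qed (use A0 in auto)
  \<comment> \<open>The row sums of \<open>A\<close> allow the places of each row block to be given
    columns with the multiplicities of that row.\<close>
  have "\<exists>g. (\<forall>k\<in>Rint n la i. g k \<in> ?N) \<and> (\<forall>j\<in>?N. card {k \<in> Rint n la i. g k = j} = A i j)" for i
    using fun_cong[OF A(2), of i] card_Rint[of n la i]
    by (intro exists_labelling) (auto simp: ro_def Rint_def)
  then obtain g0 where g0: "\<And>i k. k \<in> Rint n la i \<Longrightarrow> g0 i k \<in> ?N"
    "\<And>i j. j \<in> ?N \<Longrightarrow> card {k \<in> Rint n la i. g0 i k = j} = A i j" by metis
  define g where "g = (\<lambda>k. g0 (blk n la k) k)"
  have g: "card {k \<in> Rint n la i. g k = j} = A i j" if "j \<in> ?N" for i j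
  proof -
    have "{k \<in> Rint n la i. g k = j} = {k \<in> Rint n la i. g0 i k = j}"
      using Rint_iff[OF la(1)] by (auto simp: g_def)
    then show ?thesis using g0(2)[OF that] by simp
  qed
  have gN: "g k \<in> ?N" if "1 \<le> k" "k \<le> 2 * r" for k
    using g0(1)[of k "blk n la k"] Rint_iff[OF la(1), of k] that by (simp add: g_def)
  let ?L = "\<lambda>j. {x \<in> Rint n nu j. x \<le> r}"
  \<comment> \<open>Row labels are assigned to positions in the lower half only. In the middle
    column block these get labels up to \<open>n\<close>; their mirror images receive the mirrored
    labels, and the symmetry of \<open>A\<close> makes the two halves of column \<open>n + 1\<close>
    equal.\<close>
  let ?J = "\<lambda>j. if j \<le> n then ?N - {n + 1} else {1..n}"
  have cen: "card (?L (n + 1)) = nu (n + 1)"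
  proof -
    have "?L (n + 1) = {psum n nu n<..r}"
      using Rint_iff[OF la(2), of _ "n + 1"] blk_eq_iff[OF la(2), of _ "n + 1"] psum_center[OF la(2)] by auto
    then show ?thesis using Lam_sum[OF la(2)] by simp
  qed
  have split: "(\<Sum>i\<in>?N. f i) = (\<Sum>i=1..n. f i) + f (n + 1) + (\<Sum>i=1..n. f (2 * n + 2 - i))" for f :: "nat \<Rightarrow> nat"
  proof -
    have "?N = ({1..n} \<union> {n + 1}) \<union> {n + 2..2 * n + 1}" by auto
    moreover have "sum f (({1..n} \<union> {n + 1}) \<union> {n + 2..2 * n + 1})
      = sum f ({1..n} \<union> {n + 1}) + sum f {n + 2..2 * n + 1}"
      by (rule sum.union_disjoint) auto
    moreover have "sum f ({1..n} \<union> {n + 1}) = sum f {1..n} + sum f {n + 1}"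
      by (rule sum.union_disjoint) auto
    ultimately have "(\<Sum>i\<in>?N. f i) = (\<Sum>i=1..n. f i) + f (n + 1) + (\<Sum>i=n + 2..2 * n + 1. f i)"
      by (simp only: sum.insert sum.empty finite.emptyI empty_iff not_False_eq_True add_0_right)
    also have "(\<Sum>i=n + 2..2 * n + 1. f i) = (\<Sum>i=1..n. f (2 * n + 2 - i))"
      by (rule sum.reindex_bij_witness[where i = "\<lambda>i. 2 * n + 2 - i" and j = "\<lambda>i. 2 * n + 2 - i"]) auto
    finally show ?thesis .
  qed
  have "\<exists>p. (\<forall>x\<in>?L j. p x \<in> ?J j) \<and> (\<forall>i\<in>?J j. card {x \<in> ?L j. p x = i} = A i j)" if j: "j \<in> {1..n + 1}" for j
  proof (rule exists_labelling)
    show "(\<Sum>i\<in>?J j. A i j) = card (?L j)"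
    proof (cases "j \<le> n")
      case True
      have "?L j = Rint n nu j"
      proof -
        have "x \<le> r" if "x \<in> Rint n nu j" for x
        proof -
          have x: "1 \<le> x" "x \<le> 2 * r" "blk n nu x = j" using that Rint_iff[OF la(2)] by auto
          then have "x \<le> psum n nu n" using blk_le_iff[OF la(2) x(1,2), of n] True by simp
          then show ?thesis using Lam_sum[OF la(2)] by simp
        qed
        then show ?thesis by auto
      qed
      then have "card (?L j) = co n A j" using card_Rint A(3) by simp
      also have "\<dots> = (\<Sum>i\<in>?N - {n + 1}. A i j)"
      proof -
        have "(\<Sum>i\<in>?N. A i j) = A (n + 1) j + (\<Sum>i\<in>?N - {n + 1}. A i j)" by (rule sum.remove) auto
        then show ?thesis unfolding co_def Ac by (simp only: add_0)
      qed
      finally show ?thesis using True by simp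
    next
      case False
      then have [simp]: "j = n + 1" using j by simp
      have "2 * nu (n + 1) = (\<Sum>i\<in>?N. A i (n + 1))"
        using fun_cong[OF A(3), of "n + 1"] by (simp add: co_def hat_def)
      also have "\<dots> = (\<Sum>i=1..n. A i (n + 1)) + (\<Sum>i=1..n. A (2 * n + 2 - i) (n + 1))"
        unfolding split using Ac by simp
      also have "(\<Sum>i=1..n. A (2 * n + 2 - i) (n + 1)) = (\<Sum>i=1..n. A i (n + 1))"
        using Am[of _ "n + 1"] by (intro sum.cong) auto
      finally show ?thesis using cen by simp
    qed
  qed (auto simp: Rint_def)
  then have "\<forall>j\<in>{1..n + 1}. \<exists>p. (\<forall>x\<in>?L j. p x \<in> ?J j) \<and> (\<forall>i\<in>?J j. card {x \<in> ?L j. p x = i} = A i j)"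
    by (rule ballI)
  from bchoice[OF this] obtain p0
    where "\<forall>j\<in>{1..n + 1}. (\<forall>x\<in>?L j. p0 j x \<in> ?J j) \<and> (\<forall>i\<in>?J j. card {x \<in> ?L j. p0 j x = i} = A i j)"
    by (elim exE)
  note p0' = this[THEN bspec]
  have p0: "\<And>j x. j \<in> {1..n + 1} \<Longrightarrow> x \<in> ?L j \<Longrightarrow> p0 j x \<in> ?J j"
    "\<And>i j. j \<in> {1..n + 1} \<Longrightarrow> i \<in> ?J j \<Longrightarrow> card {x \<in> ?L j. p0 j x = i} = A i j"
    by (rule p0'[THEN conjunct1, THEN bspec]; assumption)
      (rule p0'[THEN conjunct2, THEN bspec]; assumption)
  define q where "q = (\<lambda>x. p0 (blk n nu x) x)"
  define p where "p = (\<lambda>x. if x \<le> r then q x else 2 * n + 2 - q (2 * r + 1 - x))"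
  have lowblk: "blk n nu x \<in> {1..n + 1}" if "1 \<le> x" "x \<le> r" for x
    using blk_bounds[OF la(2), of x] blk_le_iff[OF la(2), of x "n + 1"] psum_center[OF la(2)] that by auto
  have q1: "q x \<in> ?J (blk n nu x)" if "1 \<le> x" "x \<le> r" for x
    using p0(1)[of "blk n nu x" x] lowblk[OF that] that Rint_iff[OF la(2), of x] by (simp add: q_def)
  have q2: "q x \<in> ?N" "q x \<noteq> n + 1" if "1 \<le> x" "x \<le> r" for x
    using q1[OF that] by (cases "blk n nu x \<le> n"; auto)+
  have qc: "card {x \<in> ?L j. q x = i} = A i j" if "j \<in> {1..n + 1}" "i \<in> ?J j" for i j
  proof -
    have "{x \<in> ?L j. q x = i} = {x \<in> ?L j. p0 j x = i}" using Rint_iff[OF la(2)] by (auto simp: q_def)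
    then show ?thesis using p0(2)[OF that] by simp
  qed
  have pm: "p (2 * r + 1 - x) = 2 * n + 2 - p x" if "1 \<le> x" "x \<le> 2 * r" for x
  proof (cases "x \<le> r")
    case True
    then show ?thesis using that by (auto simp: p_def)
  next
    case False
    then have "q (2 * r + 1 - x) \<le> 2 * n + 1" using q2(1)[of "2 * r + 1 - x"] that by auto
    then show ?thesis using False that by (auto simp: p_def)
  qed
  have pN: "p x \<in> ?N \<and> p x \<noteq> n + 1" if "1 \<le> x" "x \<le> 2 * r" for x
  proof (cases "x \<le> r")
    case True
    then show ?thesis using q2[of x] that by (simp add: p_def)
  next
    case False
    then have "q (2 * r + 1 - x) \<in> ?N" "q (2 * r + 1 - x) \<noteq> n + 1" using q2[of "2 * r + 1 - x"] that by auto
    then show ?thesis using False by (auto simp: p_def)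
  qed
  have pc: "card {x \<in> Rint n nu j. p x = i} = A i j" if i: "i \<in> {1..n}" and j: "j \<in> ?N" for i j
  proof -
    consider "j \<le> n" | "j = n + 1" | "n + 2 \<le> j" by linarith
    then show ?thesis
    proof cases
      case 1
      have "{x \<in> Rint n nu j. p x = i} = {x \<in> ?L j. q x = i}"
      proof -
        have "x \<le> r" if "x \<in> Rint n nu j" for x
        proof -
          have x: "1 \<le> x" "x \<le> 2 * r" "blk n nu x = j" using that Rint_iff[OF la(2)] by auto
          then have "x \<le> psum n nu n" using blk_le_iff[OF la(2) x(1,2), of n] 1 by simp
          then show ?thesis using Lam_sum[OF la(2)] by simp
        qed
        then show ?thesis by (auto simp: p_def)
      qed
      then show ?thesis using qc[of j i] i j 1 by auto
    next
      case 2
      have "{x \<in> Rint n nu j. p x = i} = {x \<in> ?L j. q x = i}"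
      proof -
        have low: "x \<le> r" if x: "x \<in> Rint n nu j" "p x = i" for x
        proof (rule ccontr)
          assume "\<not> x \<le> r"
          let ?y = "2 * r + 1 - x"
          have x': "1 \<le> x" "x \<le> 2 * r" "blk n nu x = n + 1" using x Rint_iff[OF la(2)] 2 by auto
          have y: "1 \<le> ?y" "?y \<le> r" using x' \<open>\<not> x \<le> r\<close> by auto
          have "blk n nu ?y = n + 1" using blk_mirror[OF la(2) x'(1,2)] x'(3) by simp
          then have "q ?y \<in> {1..n}" using q1[OF y] by simp
          then show False using x(2) \<open>\<not> x \<le> r\<close> i by (auto simp: p_def)
        qed
        have pq: "p x = q x" if "x \<le> r" for x using that by (simp add: p_def)
        show ?thesis
        proof (intro subset_antisym subsetI)
          fix x assume "x \<in> {x \<in> Rint n nu j. p x = i}"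
          then show "x \<in> {x \<in> ?L j. q x = i}" using low[of x] pq[of x] by simp
        qed (use pq in auto)
      qed
      then show ?thesis using qc[of j i] i 2 by auto
    next
      case 3
      let ?j = "2 * n + 2 - j" and ?i = "2 * n + 2 - i"
      have "bij_betw (\<lambda>x. 2 * r + 1 - x) {x \<in> Rint n nu j. p x = i} {x \<in> ?L ?j. q x = ?i}"
      proof (rule bij_betw_byWitness[where f' = "\<lambda>x. 2 * r + 1 - x"])
        have low: "x \<le> r" if "x \<in> Rint n nu ?j" for x
        proof -
          have x: "1 \<le> x" "x \<le> 2 * r" "blk n nu x = ?j" using that Rint_iff[OF la(2)] by auto
          moreover have "?j \<le> n" using 3 by linarith
          ultimately have "x \<le> psum n nu n" using blk_le_iff[OF la(2) x(1,2), of n] by simp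
          then show ?thesis using Lam_sum[OF la(2)] by simp
        qed
        show "(\<lambda>x. 2 * r + 1 - x) ` {x \<in> Rint n nu j. p x = i} \<subseteq> {x \<in> ?L ?j. q x = ?i}"
        proof (rule image_subsetI)
          fix x assume "x \<in> {x \<in> Rint n nu j. p x = i}"
          then have x: "1 \<le> x" "x \<le> 2 * r" "blk n nu x = j" "p x = i" using Rint_iff[OF la(2)] by auto
          then have y: "2 * r + 1 - x \<in> Rint n nu ?j" using blk_mirror[OF la(2) x(1,2)] by (auto simp: Rint_iff[OF la(2)])
          then show "2 * r + 1 - x \<in> {x \<in> ?L ?j. q x = ?i}"
            using low[OF y] pm[OF x(1,2)] x(4) by (simp add: p_def)
        qed
        show "(\<lambda>x. 2 * r + 1 - x) ` {x \<in> ?L ?j. q x = ?i} \<subseteq> {x \<in> Rint n nu j. p x = i}"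
        proof (rule image_subsetI)
          fix x assume "x \<in> {x \<in> ?L ?j. q x = ?i}"
          then have x: "1 \<le> x" "x \<le> 2 * r" "blk n nu x = ?j" "q x = ?i" "x \<le> r" using Rint_iff[OF la(2)] by auto
          then have "2 * r + 1 - x \<in> Rint n nu j"
            using blk_mirror[OF la(2) x(1,2)] j 3 by (auto simp: Rint_iff[OF la(2)])
          then show "2 * r + 1 - x \<in> {x \<in> Rint n nu j. p x = i}"
            using pm[OF x(1,2)] x i by (simp add: p_def)
        qed
      qed (auto simp: Rint_iff[OF la(2)])
      then have "card {x \<in> Rint n nu j. p x = i} = card {x \<in> ?L ?j. q x = ?i}" by (rule bij_betw_same_card)
      also have "\<dots> = A ?i ?j" using i j 3 by (intro qc) auto
      also have "\<dots> = A i j" using i j by (intro Am) auto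
      finally show ?thesis .
    qed
  qed
  let ?P = "{x. 1 \<le> x \<and> x \<le> 2 * r \<and> p x \<le> n}"
  have lah: "k \<le> r \<longleftrightarrow> blk n la k \<in> {1..n}" if "1 \<le> k" "k \<le> 2 * r" for k
    using blk_half(1)[OF la(1,3) that] blk_bounds[OF la(1) that] by auto
  \<comment> \<open>For every row up to \<open>n\<close> and every column, the places and the
    positions with these labels are equinumerous, both counts being the matrix entry.\<close>
  have "\<exists>h. bij_betw h {1..r} ?P \<and> (\<forall>k\<in>{1..r}. (p (h k), blk n nu (h k)) = (blk n la k, g k))"
  proof (rule exists_bij_over)
    show "finite ?P" by (rule finite_subset[of _ "{..2 * r}"]) auto
    fix l :: "nat \<times> nat"
    obtain i j where l: "l = (i, j)" by force
    show "card {k \<in> {1..r}. (blk n la k, g k) = l} = card {x \<in> ?P. (p x, blk n nu x) = l}"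
    proof (cases "i \<in> {1..n} \<and> j \<in> ?N")
      case True
      then have "{k \<in> {1..r}. (blk n la k, g k) = l} = {k \<in> Rint n la i. g k = j}"
        using lah by (auto simp: l Rint_iff[OF la(1)])
      moreover have "{x \<in> ?P. (p x, blk n nu x) = l} = {x \<in> Rint n nu j. p x = i}"
        using True by (auto simp: l Rint_iff[OF la(2)])
      ultimately show ?thesis using g[of j i] pc[of i j] True by simp
    next
      case False
      then have "{k \<in> {1..r}. (blk n la k, g k) = l} = {}"
        using lah gN by (fastforce simp: l)
      moreover have "{x \<in> ?P. (p x, blk n nu x) = l} = {}"
        using False pN blk_bounds[OF la(2)] by (fastforce simp: l)
      ultimately show ?thesis by (simp only: card.empty)
    qed
  qed auto
  then obtain h where h: "bij_betw h {1..r} ?P"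
    "\<And>k. k \<in> {1..r} \<Longrightarrow> p (h k) = blk n la k" "\<And>k. k \<in> {1..r} \<Longrightarrow> blk n nu (h k) = g k" by auto
  have hP: "1 \<le> h k" "h k \<le> 2 * r" "p (h k) \<le> n" if "1 \<le> k" "k \<le> r" for k
    using bij_betw_apply[OF h(1), of k] that by auto
  define v where "v = (\<lambda>k. if 1 \<le> k \<and> k \<le> r then h k else if r < k \<and> k \<le> 2 * r then 2 * r + 1 - h (2 * r + 1 - k) else k)"
  have vb: "1 \<le> v k \<and> v k \<le> 2 * r" if "1 \<le> k" "k \<le> 2 * r" for k
  proof (cases "k \<le> r")
    case False
    then have "1 \<le> 2 * r + 1 - k" "2 * r + 1 - k \<le> r" using that by auto
    then show ?thesis using False that hP(1,2)[of "2 * r + 1 - k"] by (simp add: v_def) linarith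
  qed (use hP that in \<open>auto simp: v_def\<close>)
  have vp: "p (v k) \<le> n \<longleftrightarrow> k \<le> r" if "1 \<le> k" "k \<le> 2 * r" for k
  proof (cases "k \<le> r")
    case False
    then have y: "1 \<le> 2 * r + 1 - k" "2 * r + 1 - k \<le> r" using that by auto
    have "p (v k) = 2 * n + 2 - p (h (2 * r + 1 - k))"
      using False that pm[OF hP(1,2)[OF y]] by (simp add: v_def)
    then show ?thesis using False hP(3)[OF y] by simp
  qed (use hP that in \<open>auto simp: v_def\<close>)
  have vm: "v k + v (2 * r + 1 - k) = 2 * r + 1" if "1 \<le> k" "k \<le> 2 * r" for k
  proof (cases "k \<le> r")
    case True
    then have "r < 2 * r + 1 - k" "2 * r + 1 - k \<le> 2 * r" "2 * r + 1 - (2 * r + 1 - k) = k" using that by auto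
    then have "v (2 * r + 1 - k) = 2 * r + 1 - h k" unfolding v_def by simp
    then show ?thesis using True that hP(1,2)[of k] by (simp add: v_def)
  next
    case False
    then have "1 \<le> 2 * r + 1 - k" "2 * r + 1 - k \<le> r" using that by auto
    then show ?thesis using False that hP(1,2)[of "2 * r + 1 - k"] by (simp add: v_def)
  qed
  have "inj_on v {1..2 * r}"
  proof (rule inj_onI)
    fix k k' assume k: "k \<in> {1..2 * r}" "k' \<in> {1..2 * r}" "v k = v k'"
    have hi: "inj_on h {1..r}" using h(1) bij_betw_def by blast
    have "k \<le> r \<longleftrightarrow> k' \<le> r" using vp[of k] vp[of k'] k by auto
    then consider "k \<le> r" "k' \<le> r" | "r < k" "r < k'" by linarith
    then show "k = k'"
    proof cases
      case 1
      then have "h k = h k'" using k by (simp add: v_def)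
      then show ?thesis using inj_onD[OF hi] 1 k by auto
    next
      case 2
      have y: "2 * r + 1 - k \<in> {1..r}" "2 * r + 1 - k' \<in> {1..r}" using 2 k by auto
      have *: "2 * r + 1 - h (2 * r + 1 - k) = 2 * r + 1 - h (2 * r + 1 - k')" using k 2 by (simp add: v_def)
      have "h (2 * r + 1 - k) = h (2 * r + 1 - k')"
      proof -
        have "h (2 * r + 1 - k) \<le> 2 * r" "h (2 * r + 1 - k') \<le> 2 * r"
          using hP(2)[of "2 * r + 1 - k"] hP(2)[of "2 * r + 1 - k'"] y by auto
        then show ?thesis using * by linarith
      qed
      then have "2 * r + 1 - k = 2 * r + 1 - k'" using inj_onD[OF hi _ y] by blast
      then show ?thesis using k by auto
    qed
  qed
  moreover have "v ` {1..2 * r} \<subseteq> {1..2 * r}" using vb by auto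
  ultimately have "bij_betw v {1..2 * r} {1..2 * r}"
    unfolding bij_betw_def using endo_inj_surj[of "{1..2 * r}" v] by simp
  then have "v permutes {1..2 * r}" by (rule bij_imp_permutes) (auto simp: v_def)
  then have vW: "v \<in> WB r" using vm by (auto simp: WB_def)
  let ?w = "iv v"
  have wW: "?w \<in> WB r" using vW by simp
  \<comment> \<open>The upper rows suffice: the lower ones follow by mirror symmetry, and the middle
    row is zero.\<close>
  have up: "coset_matrix n la ?w nu i j = A i j" if i: "i \<in> {1..n}" and j: "j \<in> ?N" for i j
  proof -
    have "{k. 1 \<le> k \<and> k \<le> 2 * r \<and> blk n la k = i \<and> blk n nu (v k) = j} = {k \<in> Rint n la i. g k = j}"
      using lah i h(3) by (auto simp: Rint_iff[OF la(1)] v_def)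
    then show ?thesis unfolding coset_matrix_eq'[OF la(1,2) wW] using vW g[OF j] by simp
  qed
  have "coset_matrix n la ?w nu i j = A i j" for i j
  proof -
    consider "i \<in> {1..n}" "j \<in> ?N" | "i = n + 1" | "i \<in> {n + 2..2 * n + 1}" "j \<in> ?N" | "i \<notin> ?N \<or> j \<notin> ?N" by fastforce
    then show ?thesis
    proof cases
      case 1
      then show ?thesis by (rule up)
    next
      case 2
      have "{k. 1 \<le> k \<and> k \<le> 2 * r \<and> blk n la k = i \<and> blk n nu (iv ?w k) = j} = {}"
        using blk_half(3)[OF la(1,3)] 2 by auto
      then show ?thesis unfolding coset_matrix_eq'[OF la(1,2) wW] 2 Ac by (simp only: card.empty)
    next
      case 3
      have "coset_matrix n la ?w nu i j = coset_matrix n la ?w nu (2 * n + 2 - i) (2 * n + 2 - j)"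
        using 3 by (intro coset_matrix_mirror[OF la(1,2) wW, symmetric]) auto
      also have "\<dots> = A (2 * n + 2 - i) (2 * n + 2 - j)" using 3 by (intro up) auto
      also have "\<dots> = A i j" using 3 by (intro Am) auto
      finally show ?thesis .
    next
      case 4
      have "{k. 1 \<le> k \<and> k \<le> 2 * r \<and> blk n la k = i \<and> blk n nu (iv ?w k) = j} = {}"
        using 4 blk_bounds[OF la(1)] blk_bounds[OF la(2)] WB_bounds[OF WB_iv[OF wW]] by fastforce
      then have "coset_matrix n la ?w nu i j = 0" unfolding coset_matrix_eq'[OF la(1,2) wW] by (simp only: card.empty)
      then show ?thesis using A0[OF 4] by simp
    qed
  qed
  then show ?thesis using wW by (intro bexI[of _ ?w]) auto
qed


text \<open>With an empty middle block every block lies in one half, so the stabiliser preserves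
  \<open>{1..r}\<close> and creates no negative entries.\<close>

lemma par_eq_parD:
  assumes la: "la \<in> Lam (n + 1) r" "la (n + 1) = 0"
  shows "par (blk n la) = parD (blk n la)"
proof -
  have "neg r u = 0" if u: "u \<in> par (blk n la)" for u
  proof -
    have "u x \<le> r" if x: "1 \<le> x" "x \<le> r" for x
    proof -
      have "blk n la x \<le> n" using blk_half(1)[OF la, of x] x by simp
      then have "blk n la (u x) \<le> n" using par_apply[OF u, of x] x by simp
      then show ?thesis using blk_half(1)[OF la, of "u x"] WB_bounds[OF par_WB[OF u], of x] x by simp
    qed
    then have "{x \<in> {1..r}. u x > r} = {}" by fastforce
    then show ?thesis unfolding neg_def by (simp only: card.empty)
  qed
  then show ?thesis using par_WB by (auto simp: parD_def WD_iff)
qed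

section \<open>The type D double coset attached to a matrix\<close>

lemma ro_comp_eq: "la \<in> Lam (n + 1) r \<Longrightarrow> ro n A = hat n la \<Longrightarrow> ro_comp n r A = la"
  unfolding ro_comp_def by (rule the_equality) (auto intro: hat_inj)

lemma co_comp_eq: "la \<in> Lam (n + 1) r \<Longrightarrow> co n A = hat n la \<Longrightarrow> co_comp n r A = la"
  unfolding co_comp_def by (rule the_equality) (auto intro: hat_inj)

text \<open>If \<open>nu (n + 1) \<noteq> 0\<close>, right multiplication by \<open>s_r\<close>
  preserves the matrix and flips the parity, so the matrix alone would describe two type D
  pieces.\<close>

definition XA :: "nat \<Rightarrow> vec \<Rightarrow> vec \<Rightarrow> mat \<Rightarrow> (nat \<Rightarrow> nat) set" where
  "XA n la nu A = {w \<in> WB r. coset_matrix n la w nu = A \<and> (even (neg r w) \<longleftrightarrow> mat_sgn n A = Pos)}"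

lemma XA_WB: "XA n la nu A \<subseteq> WB r"
  by (auto simp: XA_def)

lemma even_neg_parD: "u \<in> parD c \<Longrightarrow> even (neg r u)"
  by (simp add: parD_def WD_iff)

lemma XA_stable:
  assumes la: "la \<in> Lam (n + 1) r" "nu \<in> Lam (n + 1) r"
    and u: "u \<in> parD (blk n la)" and v: "v \<in> parD (blk n nu)" and w: "w \<in> XA n la nu A"
  shows "u \<circ> w \<circ> v \<in> XA n la nu A"
proof -
  have W: "u \<in> WB r" "v \<in> WB r" "w \<in> WB r" using parD_WB[OF u] parD_WB[OF v] subsetD[OF XA_WB w] by auto
  have P: "u \<in> par (blk n la)" "v \<in> par (blk n nu)" using u v by (auto simp: parD_def)
  have "even (neg r (u \<circ> w \<circ> v)) \<longleftrightarrow> even (neg r w)"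
    using W even_neg_parD[OF u] even_neg_parD[OF v] by (simp add: even_neg_comp)
  then show ?thesis
    using w W coset_matrix_par[OF la W(3) P] unfolding XA_def mem_Collect_eq by (metis WB_comp)
qed

text \<open>A position before \<open>r\<close> in the middle block has a value below both
  \<open>w r\<close> and its mirror image \<open>w (r + 1)\<close>, one of which is at most
  \<open>r\<close>. So only \<open>r\<close> itself can be sent above \<open>r\<close>.\<close>

lemma corner_incD:
  assumes nu: "nu \<in> Lam (n + 1) r" and w: "w \<in> WB r" "incD (blk n nu) w"
  shows "card {x. r - nu (n + 1) < x \<and> x \<le> r \<and> r < w x} = (if 0 < nu (n + 1) \<and> r < w r then 1 else 0)"
proof -
  let ?s = "nu (n + 1)"
  have b: "blk n nu x = n + 1" if "r - ?s < x" "x \<le> r + ?s" "1 \<le> x" "x \<le> 2 * r" for x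
    using that blk_eq_iff[OF nu that(3,4), of "n + 1"] Lam_sum[OF nu] psum_center[OF nu] by auto
  have "w x \<le> r" if x: "r - ?s < x" "x < r" for x
  proof -
    have "w x < w r"
      using w(2)[unfolded incD_def, rule_format, of x r] x b[of x] b[of r] r2 by auto
    moreover have "w x < w (r + 1)"
      using w(2)[unfolded incD_def, rule_format, of x "r + 1"] x b[of x] b[of "r + 1"] r2 by auto
    ultimately show ?thesis using WB_mirror[OF w(1), of r] r2 by auto
  qed
  then have "{x. r - ?s < x \<and> x \<le> r \<and> r < w x} = (if 0 < ?s \<and> r < w r then {r} else {})"
    using r2 by (auto; metis leD le_neq_implies_less)
  then show ?thesis by simp
qed

text \<open>\<open>incD\<close> leaves open only the order at \<open>r\<close> and
  \<open>r + 1\<close>. If both lie in the middle block, \<open>r < w r\<close> would add one to the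
  corner sum in \<open>neg\<close> and violate the parity required in \<open>XA\<close>.\<close>

lemma XA_incB:
  assumes la: "la \<in> Lam (n + 1) r" "nu \<in> Lam (n + 1) r" "la (n + 1) = 0"
    and w: "w \<in> XA n la nu A" "incD (blk n nu) w"
  shows "incB (blk n nu) w"
proof (rule incD_incB[OF block_labelling_blk[OF la(2)] w(2)])
  assume e: "blk n nu r = blk n nu (r + 1)"
  have wW: "w \<in> WB r" and A: "coset_matrix n la w nu = A" and s: "even (neg r w) \<longleftrightarrow> mat_sgn n A = Pos"
    using w(1) by (auto simp: XA_def)
  have "blk n nu r = n + 1" using blk_mirror[OF la(2), of r] e r2 blk_bounds[OF la(2), of r] by auto
  then have "0 < nu (n + 1)"
    using blk_eq_iff[OF la(2), of r "n + 1"] Lam_sum[OF la(2)] r2 by (cases "nu (n + 1)") auto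
  moreover have "even (card {x. r - nu (n + 1) < x \<and> x \<le> r \<and> r < w x})"
    using sum_coset_matrix_corner[OF la wW] s unfolding A mat_sgn_def by (auto split: if_splits)
  ultimately have "\<not> r < w r" using corner_incD[OF la(2) wW w(2)] by (auto split: if_splits)
  then show "w r < w (r + 1)" using WB_r_less[OF wW] by simp
qed

text \<open>An ascent from \<open>r\<close> to \<open>r + 1\<close> in a nonempty middle block
  forces \<open>w r \<le> r\<close>, so \<open>neg\<close> equals the corner sum and has the parity
  of the sign.\<close>

lemma incB_XA:
  assumes la: "la \<in> Lam (n + 1) r" "nu \<in> Lam (n + 1) r" "la (n + 1) = 0"
    and w: "w \<in> WB r" "incB (blk n nu) w" "coset_matrix n la w nu = A"
  shows "w \<in> XA n la nu A"
proof -
  have "\<not> (0 < nu (n + 1) \<and> r < w r)"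
  proof
    assume *: "0 < nu (n + 1) \<and> r < w r"
    have "blk n nu r = n + 1"
      using blk_eq_iff[OF la(2), of r "n + 1"] Lam_sum[OF la(2)] psum_center[OF la(2)] * r2 by auto
    moreover have "blk n nu (r + 1) = n + 1"
      using blk_eq_iff[OF la(2), of "r + 1" "n + 1"] Lam_sum[OF la(2)] psum_center[OF la(2)] * r2 by auto
    ultimately have "w r < w (r + 1)" using w(2) r2 unfolding incB_def by auto
    then show False using WB_r_less[OF w(1)] * by simp
  qed
  then show ?thesis
    using sum_coset_matrix_corner[OF la w(1)] corner_incD[OF la(2) w(1) incB_incD[OF w(2)]] w
    unfolding XA_def by (auto simp: mat_sgn_def split: if_splits)
qed

lemma incD_incB_half:
  assumes la: "la \<in> Lam (n + 1) r" "la (n + 1) = 0" and v: "incD (blk n la) v"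
  shows "incB (blk n la) v"
proof (rule incD_incB[OF block_labelling_blk[OF la(1)] v])
  assume "blk n la r = blk n la (r + 1)"
  then show "v r < v (r + 1)" using blk_half(1)[OF la, of r] blk_half(1)[OF la, of "r + 1"] r2 by auto
qed

lemma min_rep_incB:
  assumes c: "block_labelling c" "block_labelling c'" and w: "w \<in> WB r"
    and min: "is_min_rep (cox_gens_B r) (par c) (par c') w"
  shows "incB c (iv w)" "incB c' w"
proof -
  have le: "lenB2 w \<le> lenB2 (u \<circ> w \<circ> v)" if "u \<in> par c" "v \<in> par c'" for u v
  proof -
    have "u \<circ> w \<circ> v \<in> double_coset (par c) w (par c')" using that unfolding double_coset_def by blast
    then have "cox_length (cox_gens_B r) w \<le> cox_length (cox_gens_B r) (u \<circ> w \<circ> v)"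
      using min unfolding is_min_rep_def by blast
    moreover have "u \<circ> w \<circ> v \<in> WB r" using that w par_WB by (intro WB_comp) auto
    ultimately show ?thesis using cox_length_B[OF w] cox_length_B[of "u \<circ> w \<circ> v"] by linarith
  qed
  show "incB c' w"
  proof (rule incB_I[OF c(2) w])
    fix i assume i: "i \<in> {1..r}" "c' i = c' (i + 1)"
    have "lenB2 w \<le> lenB2 (w \<circ> cox r i)" using le[OF par_id cox_par[OF c(2) i(2,1)]] by simp
    then show "w i < w (i + 1)"
      using lenB2_cox_desc[OF i(1) w] WB_trichotomy[OF w, of i "i + 1"] by force
  qed
  show "incB c (iv w)"
  proof (rule incB_I[OF c(1)])
    fix i assume i: "i \<in> {1..r}" "c i = c (i + 1)"
    have "lenB2 w \<le> lenB2 (cox r i \<circ> w)" using le[OF cox_par[OF c(1) i(2,1)] par_id] by simp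
    then show "iv w i < iv w (i + 1)"
      using lenB2_cox_left_desc[OF i(1) w] WB_trichotomy[OF WB_iv[OF w], of i "i + 1"] by force
  qed (use w in simp)
qed

lemma min_rep_incD:
  assumes c: "block_labelling c" "block_labelling c'" and w: "w \<in> WB r"
    and le: "\<And>u v. u \<in> parD c \<Longrightarrow> v \<in> parD c' \<Longrightarrow> lenD2 w \<le> lenD2 (u \<circ> w \<circ> v)"
  shows "incD c (iv w)" "incD c' w"
proof -
  show "incD c' w"
  proof (rule incD_I[OF c(2) w])
    fix i assume i: "i \<in> {1..r}" "c' (dfst i) = c' (i + 1)"
    have "lenD2 w \<le> lenD2 (w \<circ> dgen i)" using le[OF parD_id dgen_parD[OF c(2) i(2,1)]] by simp
    then show "w (dfst i) < w (i + 1)"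
      using lenD2_dgen_desc[OF i(1) w] WB_trichotomy[OF w, of "dfst i" "i + 1"] dfst_neq[OF i(1)] by force
  qed
  show "incD c (iv w)"
  proof (rule incD_I[OF c(1)])
    fix i assume i: "i \<in> {1..r}" "c (dfst i) = c (i + 1)"
    have "lenD2 w \<le> lenD2 (dgen i \<circ> w)" using le[OF dgen_parD[OF c(1) i(2,1)] parD_id] by simp
    then show "iv w (dfst i) < iv w (i + 1)"
      using lenD2_dgen_left_desc[OF i(1) w] WB_trichotomy[OF WB_iv[OF w], of "dfst i" "i + 1"] dfst_neq[OF i(1)] by force
  qed (use w in simp)
qed

text \<open>Row and column sums recover the compositions quantified in \<open>d_mat\<close>. A
  shortest element with matrix \<open>A\<close> satisfies the description, and
  \<open>coset_matrix_unique\<close> shows that it is the only one.\<close>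

lemma d_mat_props:
  assumes la: "la \<in> Lam (n + 1) r" "nu \<in> Lam (n + 1) r" "la (n + 1) = 0"
    and A: "A \<in> Xi n r" "ro n A = hat n la" "co n A = hat n nu"
  shows "d_mat n r A \<in> WB r" "coset_matrix n la (d_mat n r A) nu = A"
    "incB (blk n la) (iv (d_mat n r A))" "incB (blk n nu) (d_mat n r A)"
proof -
  note c = block_labelling_blk[OF la(1)] block_labelling_blk[OF la(2)]
  let ?M = "{w \<in> WB r. coset_matrix n la w nu = A}"
  let ?Q = "\<lambda>d. \<exists>la\<in>Lam (n + 1) r. \<exists>\<mu>\<in>Lam (n + 1) r.
     d \<in> WB r \<and> is_min_rep (cox_gens_B r) (WB_par n r la) (WB_par n r \<mu>) d \<and> coset_matrix n la d \<mu> = A"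
  have Q: "d \<in> ?M \<and> incB (blk n la) (iv d) \<and> incB (blk n nu) d" if q: "?Q d" for d
  proof -
    obtain la' nu' where q: "la' \<in> Lam (n + 1) r" "nu' \<in> Lam (n + 1) r" "d \<in> WB r"
      "is_min_rep (cox_gens_B r) (WB_par n r la') (WB_par n r nu') d" "coset_matrix n la' d nu' = A"
      using q by blast
    have "la' = la" using hat_inj[OF q(1) la(1)] ro_coset_matrix[OF q(1-3)] q(5) A(2) by simp
    moreover have "nu' = nu" using hat_inj[OF q(2) la(2)] co_coset_matrix[OF q(1-3)] q(5) A(3) by simp
    ultimately show ?thesis
      using q min_rep_incB[OF c q(3)] by (simp add: WB_par_eq[OF la(1)] WB_par_eq[OF la(2)])
  qed
  obtain w where "w \<in> ?M" using exists_coset_matrix[OF la A] by blast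
  then obtain d where d: "d \<in> ?M" and min: "\<And>w. w \<in> ?M \<Longrightarrow> lenB2 d \<le> lenB2 w"
    using ex_has_least_nat[of "\<lambda>w. w \<in> ?M" w lenB2] by blast
  have dW: "d \<in> WB r" using d by simp
  have "is_min_rep (cox_gens_B r) (par (blk n la)) (par (blk n nu)) d"
    unfolding is_min_rep_def
  proof
    fix w assume "w \<in> double_coset (par (blk n la)) d (par (blk n nu))"
    then obtain u v where uv: "u \<in> par (blk n la)" "v \<in> par (blk n nu)" "w = u \<circ> d \<circ> v"
      unfolding double_coset_def by blast
    have "w \<in> WB r" unfolding uv(3) using uv par_WB dW by (intro WB_comp) auto
    moreover have "w \<in> ?M" using calculation coset_matrix_par[OF la(1,2) dW uv(1,2)] d uv(3) by simp
    ultimately show "cox_length (cox_gens_B r) d \<le> cox_length (cox_gens_B r) w"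
      using min[of w] cox_length_B[OF dW] cox_length_B[of w] by linarith
  qed
  then have Qd: "?Q d"
    using d by (intro bexI[OF _ la(1)] bexI[OF _ la(2)]) (simp add: WB_par_eq[OF la(1)] WB_par_eq[OF la(2)])
  have "d_mat n r A = d"
    unfolding d_mat_def
  proof (rule the_equality[where P = ?Q])
    show "?Q d" by (rule Qd)
    fix d' assume "?Q d'"
    from Q[OF this] Q[OF Qd] show "d' = d"
      by (intro coset_matrix_unique[OF la(1,2)]) auto
  qed
  then show "d_mat n r A \<in> WB r" "coset_matrix n la (d_mat n r A) nu = A"
    "incB (blk n la) (iv (d_mat n r A))" "incB (blk n nu) (d_mat n r A)"
    using Q[OF Qd] by simp_all
qed

text \<open>Here type D minimality meets type B: inside \<open>XA\<close> a minimal element for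
  \<open>lenD2\<close> is increasing in the stronger sense \<open>incB\<close>, and such an element
  is determined by its matrix.\<close>

lemma XA_min_eq_d_mat:
  assumes la: "la \<in> Lam (n + 1) r" "nu \<in> Lam (n + 1) r" "la (n + 1) = 0"
    and A: "A \<in> Xi n r" "ro n A = hat n la" "co n A = hat n nu" and w: "w \<in> XA n la nu A"
    and le: "\<And>u v. u \<in> parD (blk n la) \<Longrightarrow> v \<in> parD (blk n nu) \<Longrightarrow> lenD2 w \<le> lenD2 (u \<circ> w \<circ> v)"
  shows "w = d_mat n r A"
proof -
  note c = block_labelling_blk[OF la(1)] block_labelling_blk[OF la(2)]
  have wW: "w \<in> WB r" "coset_matrix n la w nu = A" using w by (auto simp: XA_def)
  have "incD (blk n la) (iv w)" "incD (blk n nu) w" using min_rep_incD[OF c wW(1) le] by blast+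
  then have "incB (blk n la) (iv w)" "incB (blk n nu) w"
    using incD_incB_half[OF la(1,3)] XA_incB[OF la w] by blast+
  then show ?thesis
    using d_mat_props[OF la A] wW by (intro coset_matrix_unique[OF la(1,2)]) auto
qed

text \<open>From every element of \<open>XA\<close> a minimal one can be reached inside its type D
  double coset. It is always \<open>d_mat\<close>, so all these double cosets coincide.\<close>

lemma XA_double_coset:
  assumes la: "la \<in> Lam (n + 1) r" "nu \<in> Lam (n + 1) r" "la (n + 1) = 0"
    and A: "A \<in> Xi n r" "ro n A = hat n la" "co n A = hat n nu" and w: "w \<in> XA n la nu A"
  shows "double_coset (parD (blk n la)) w (parD (blk n nu)) = XA n la nu A"
    and "lenD2 (d_mat n r A) \<le> lenD2 w" "d_mat n r A \<in> XA n la nu A"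
proof -
  let ?U = "parD (blk n la)" and ?V = "parD (blk n nu)" and ?d = "d_mat n r A"
  have *: "\<exists>u\<in>?U. \<exists>v\<in>?V. ?d = u \<circ> w \<circ> v \<and> lenD2 ?d \<le> lenD2 w" if w: "w \<in> XA n la nu A" for w
  proof -
    have "w \<in> double_coset ?U w ?V" unfolding double_coset_def by (auto intro!: exI[of _ id])
    then obtain w0 where w0: "w0 \<in> double_coset ?U w ?V"
      and min: "\<And>x. x \<in> double_coset ?U w ?V \<Longrightarrow> lenD2 w0 \<le> lenD2 x"
      using ex_has_least_nat[of "\<lambda>x. x \<in> double_coset ?U w ?V" w lenD2] by blast
    obtain u v where uv: "u \<in> ?U" "v \<in> ?V" "w0 = u \<circ> w \<circ> v" using w0 unfolding double_coset_def by blast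
    have "w0 \<in> XA n la nu A" unfolding uv(3) by (rule XA_stable[OF la(1,2) uv(1,2) w])
    moreover have "lenD2 w0 \<le> lenD2 (u' \<circ> w0 \<circ> v')" if "u' \<in> ?U" "v' \<in> ?V" for u' v'
    proof (rule min)
      have "u' \<circ> w0 \<circ> v' = (u' \<circ> u) \<circ> w \<circ> (v \<circ> v')" unfolding uv(3) by (simp only: o_assoc)
      moreover have "u' \<circ> u \<in> ?U" "v \<circ> v' \<in> ?V" using that uv by (auto intro!: parD_comp)
      ultimately show "u' \<circ> w0 \<circ> v' \<in> double_coset ?U w ?V" unfolding double_coset_def by blast
    qed
    ultimately have "w0 = ?d" by (intro XA_min_eq_d_mat[OF la A])
    moreover have "lenD2 w0 \<le> lenD2 w" using min \<open>w \<in> double_coset ?U w ?V\<close> by blast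
    ultimately show ?thesis using uv by blast
  qed
  show "lenD2 ?d \<le> lenD2 w" using *[OF w] by blast
  obtain u v where "u \<in> ?U" "v \<in> ?V" "?d = u \<circ> w \<circ> v" using *[OF w] by blast
  then show "?d \<in> XA n la nu A" using XA_stable[OF la(1,2) _ _ w] by simp
  show "double_coset ?U w ?V = XA n la nu A"
  proof (intro subset_antisym subsetI)
    fix x assume "x \<in> double_coset ?U w ?V"
    then show "x \<in> XA n la nu A" unfolding double_coset_def using XA_stable[OF la(1,2) _ _ w] by blast
  next
    fix x assume x: "x \<in> XA n la nu A"
    obtain u v where uv: "u \<in> ?U" "v \<in> ?V" "?d = u \<circ> w \<circ> v" using *[OF w] by blast
    obtain u' v' where uv': "u' \<in> ?U" "v' \<in> ?V" "?d = u' \<circ> x \<circ> v'" using *[OF x] by blast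
    have W: "u' \<in> WB r" "v' \<in> WB r" using uv' parD_WB by auto
    have "x = iv u' \<circ> (u' \<circ> x \<circ> v') \<circ> iv v'" using W by (auto simp: fun_eq_iff)
    also have "\<dots> = (iv u' \<circ> u) \<circ> w \<circ> (v \<circ> iv v')" unfolding uv'(3)[symmetric] uv(3) by (simp only: o_assoc)
    finally have "x = (iv u' \<circ> u) \<circ> w \<circ> (v \<circ> iv v')" .
    moreover have "iv u' \<circ> u \<in> ?U" "v \<circ> iv v' \<in> ?V" using uv uv' by (auto intro!: parD_comp parD_iv)
    ultimately show "x \<in> double_coset ?U w ?V" unfolding double_coset_def by blast
  qed
qed

lemma even_neg_s_pow: "even (neg r (s_pow r e)) \<longleftrightarrow> e = Pos"
  using even_neg_cox[of id r] neg_id by (cases e) (auto simp: o_def id_def)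

text \<open>This treats all symbols uniformly: for \<open>Bullet\<close> the conjugation changes
  nothing, since \<open>s_r\<close> then lies in \<open>par (blk n la)\<close> and normalises its
  type D part.\<close>

lemma WD_par_mark:
  assumes la: "la \<in> Lam (n + 1) r"
  shows "WD_par n r (mark n la e) = conj_s e (parD (blk n la)) e"
proof (cases "la (n + 1) = 0")
  case True
  then show ?thesis
    using WB_par_eq[OF la] par_eq_parD[OF la True]
    by (cases e) (auto simp: mark_def conj_s_def)
next
  case False
  have e: "blk n la r = blk n la (r + 1)"
  proof -
    have "blk n la x = n + 1" if "x = r \<or> x = r + 1" for x
      using blk_eq_iff[OF la, of x "n + 1"] Lam_sum[OF la] psum_center[OF la] False r2 that by auto
    then show ?thesis by simp
  qed
  have s: "s_pow r e \<in> par (blk n la)"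
    using cox_par[OF block_labelling_blk[OF la] e] by (cases e) auto
  have m: "s_pow r e \<circ> u \<circ> s_pow r e \<in> parD (blk n la)" if "u \<in> parD (blk n la)" for u
  proof -
    have "s_pow r e \<circ> u \<circ> s_pow r e \<in> par (blk n la)" using s that by (intro par_comp) (auto simp: parD_def)
    moreover have "even (neg r (s_pow r e \<circ> u \<circ> s_pow r e))"
      using parD_WB[OF that] even_neg_parD[OF that] by (simp add: even_neg_comp)
    ultimately show ?thesis using par_WB by (auto simp: parD_def WD_iff)
  qed
  have "conj_s e (parD (blk n la)) e = parD (blk n la)"
  proof (intro subset_antisym subsetI)
    fix u assume u: "u \<in> parD (blk n la)"
    have "u = s_pow r e \<circ> (s_pow r e \<circ> u \<circ> s_pow r e) \<circ> s_pow r e" by (simp add: o_assoc)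
    then show "u \<in> conj_s e (parD (blk n la)) e" unfolding conj_s_def using m[OF u] by (rule image_eqI)
  qed (use m in \<open>auto simp: conj_s_def\<close>)
  then show ?thesis using False WB_par_eq[OF la] by (simp add: mark_def parD_def)
qed

lemma double_coset_conj_s:
  "double_coset (conj_s e U e) (s_pow r e \<circ> d \<circ> s_pow r e') (conj_s e' V e') = conj_s e (double_coset U d V) e'"
proof -
  have *: "(s_pow r e \<circ> u \<circ> s_pow r e) \<circ> (s_pow r e \<circ> d \<circ> s_pow r e') \<circ> (s_pow r e' \<circ> v \<circ> s_pow r e')
    = s_pow r e \<circ> (u \<circ> d \<circ> v) \<circ> s_pow r e'" for u v
  proof -
    have ss: "s_pow r e (s_pow r e x) = x" for e x using s_pow_sq(1)[of e] by (metis comp_apply id_apply)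
    show ?thesis by (simp add: fun_eq_iff ss)
  qed
  show ?thesis
  proof (intro subset_antisym subsetI)
    fix x assume "x \<in> double_coset (conj_s e U e) (s_pow r e \<circ> d \<circ> s_pow r e') (conj_s e' V e')"
    then obtain u v where "u \<in> U" "v \<in> V"
      "x = (s_pow r e \<circ> u \<circ> s_pow r e) \<circ> (s_pow r e \<circ> d \<circ> s_pow r e') \<circ> (s_pow r e' \<circ> v \<circ> s_pow r e')"
      unfolding double_coset_def conj_s_def by blast
    then show "x \<in> conj_s e (double_coset U d V) e'"
      unfolding * conj_s_def double_coset_def by blast
  next
    fix x assume "x \<in> conj_s e (double_coset U d V) e'"
    then obtain u v where "u \<in> U" "v \<in> V" "x = s_pow r e \<circ> (u \<circ> d \<circ> v) \<circ> s_pow r e'"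
      unfolding double_coset_def conj_s_def by blast
    then show "x \<in> double_coset (conj_s e U e) (s_pow r e \<circ> d \<circ> s_pow r e') (conj_s e' V e')"
      unfolding *[symmetric] conj_s_def double_coset_def by blast
  qed
qed

lemma lenD2_s_pow:
  assumes "w \<in> WB r" shows "lenD2 (s_pow r e \<circ> w \<circ> s_pow r e') = lenD2 w"
proof -
  have R: "lenD2 (w \<circ> s_pow r e) = lenD2 w" if "w \<in> WB r" for w e
    using lenD2_cox_r[OF that] by (cases e) auto
  have "lenD2 (s_pow r e \<circ> w \<circ> s_pow r e') = lenD2 (s_pow r e \<circ> w)" using assms by (intro R) simp
  also have "\<dots> = lenD2 (iv (s_pow r e \<circ> w))" using assms by (intro lenD2_iv[symmetric]) simp
  also have "\<dots> = lenD2 (iv w \<circ> s_pow r e)" using assms by simp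
  also have "\<dots> = lenD2 (iv w)" using assms by (intro R) simp
  finally show ?thesis using assms by simp
qed

text \<open>The translation involves an even number of factors \<open>s_r\<close> exactly if
  \<open>e = e'\<close>, that is, exactly if \<open>neg\<close> is even on \<open>XA\<close>; so the
  result is even in all cases.\<close>

lemma conj_s_XA_WD:
  assumes "(e = e') \<longleftrightarrow> mat_sgn n A = Pos"
  shows "conj_s e (XA n la nu A) e' \<subseteq> WD r"
proof
  fix x assume "x \<in> conj_s e (XA n la nu A) e'"
  then obtain w where w: "w \<in> XA n la nu A" "x = s_pow r e \<circ> w \<circ> s_pow r e'" by (auto simp: conj_s_def)
  then have "w \<in> WB r" "even (neg r w) \<longleftrightarrow> mat_sgn n A = Pos" by (auto simp: XA_def)
  then have "even (neg r x)" unfolding w(2)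
    using assms even_neg_s_pow[of Neg] by (cases e; cases e') (simp_all add: even_neg_comp even_neg_s_pow)
  then show "x \<in> WD r" using \<open>w \<in> WB r\<close> w(2) by (simp add: WD_iff)
qed

text \<open>Multiplication by powers of \<open>s_r\<close> preserves \<open>lenD2\<close>, so the
  minimal elements of the translated double coset are the translates of those of \<open>XA\<close>.
  There is just one, the translate of \<open>d_mat\<close>, which resolves the description in
  \<open>phi_mat\<close>.\<close>

lemma phi_mat_eq_phi_d:
  assumes la: "la \<in> Lam (n + 1) r" "nu \<in> Lam (n + 1) r" "la (n + 1) = 0"
    and A: "A \<in> Xi n r" "ro n A = hat n la" "co n A = hat n nu" and e: "(e = e') \<longleftrightarrow> mat_sgn n A = Pos"
  shows "\<exists>d. phi_mat n r e A e' = phi_d n r (mark n la e) (mark n nu e') d \<and>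
    double_coset (WD_par n r (mark n la e)) d (WD_par n r (mark n nu e')) = conj_s e (XA n la nu A) e'"
proof -
  let ?a = "mark n la e" and ?b = "mark n nu e'"
  let ?U = "WD_par n r ?a" and ?V = "WD_par n r ?b"
  let ?X = "XA n la nu A" and ?d = "d_mat n r A"
  let ?g = "\<lambda>w. s_pow r e \<circ> w \<circ> s_pow r e'"
  have dX: "?d \<in> ?X"
    using d_mat_props[OF la A] by (intro incB_XA la) auto
  have dc: "double_coset ?U (?g w) ?V = conj_s e ?X e'" if "w \<in> ?X" for w
    unfolding WD_par_mark[OF la(1)] WD_par_mark[OF la(2)] double_coset_conj_s
      XA_double_coset(1)[OF la A that] ..
  have cl: "2 * cox_length (cox_gens_D r) (?g w) = lenD2 w" if "w \<in> ?X" for w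
  proof -
    have "?g w \<in> WD r" using conj_s_XA_WD[OF e, of la nu] that by (auto simp: conj_s_def)
    moreover have "w \<in> WB r" using that XA_WB by blast
    ultimately show ?thesis using cox_length_D lenD2_s_pow by simp
  qed
  have the: "(THE d. d \<in> double_coset ?U (?g ?d) ?V \<and> is_min_rep (cox_gens_D r) ?U ?V d) = ?g ?d"
  proof (rule the_equality)
    have "is_min_rep (cox_gens_D r) ?U ?V (?g ?d)"
      unfolding is_min_rep_def dc[OF dX]
    proof
      fix x assume "x \<in> conj_s e ?X e'"
      then obtain w where w: "w \<in> ?X" "x = ?g w" by (auto simp: conj_s_def)
      then show "cox_length (cox_gens_D r) (?g ?d) \<le> cox_length (cox_gens_D r) x"
        using cl[OF dX] cl[OF w(1)] XA_double_coset(2)[OF la A w(1)] by simp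
    qed
    moreover have "?g ?d \<in> double_coset ?U (?g ?d) ?V"
      unfolding dc[OF dX] conj_s_def using dX by blast
    ultimately show "?g ?d \<in> double_coset ?U (?g ?d) ?V \<and> is_min_rep (cox_gens_D r) ?U ?V (?g ?d)" by blast
    fix x assume x: "x \<in> double_coset ?U (?g ?d) ?V \<and> is_min_rep (cox_gens_D r) ?U ?V x"
    then obtain w where w: "w \<in> ?X" "x = ?g w" unfolding dc[OF dX] by (auto simp: conj_s_def)
    have "w = ?d"
    proof (rule XA_min_eq_d_mat[OF la A w(1)])
      fix u v assume uv: "u \<in> parD (blk n la)" "v \<in> parD (blk n nu)"
      have w': "u \<circ> w \<circ> v \<in> ?X" by (rule XA_stable[OF la(1,2) uv w(1)])
      then have "?g (u \<circ> w \<circ> v) \<in> double_coset ?U x ?V"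
        unfolding w(2) dc[OF w(1)] conj_s_def by blast
      then have "cox_length (cox_gens_D r) x \<le> cox_length (cox_gens_D r) (?g (u \<circ> w \<circ> v))"
        using x unfolding is_min_rep_def by blast
      then show "lenD2 w \<le> lenD2 (u \<circ> w \<circ> v)" unfolding w(2) using cl[OF w'] cl[OF w(1)] by linarith
    qed
    then show "x = ?g ?d" using w(2) by simp
  qed
  have "phi_mat n r e A e' = phi_d n r ?a ?b (?g ?d)"
    unfolding phi_mat_def ro_comp_eq[OF la(1) A(2)] co_comp_eq[OF la(2) A(3)] Let_def the ..
  then show ?thesis using dc[OF dX] by blast
qed

end

section \<open>The Schur algebra of type D\<close>

lemma finite_Lam: "finite (Lam k m)"
proof (rule finite_subset)
  show "Lam k m \<subseteq> {f. \<forall>i. (i \<in> {1..k} \<longrightarrow> f i \<in> {0..m}) \<and> (i \<notin> {1..k} \<longrightarrow> f i = 0)}"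
  proof
    fix f assume f: "f \<in> Lam k m"
    have "f i \<le> m" if "i \<in> {1..k}" for i
      using f member_le_sum[of i "{1..k}" f] that by (auto simp: Lam_def)
    then show "f \<in> {f. \<forall>i. (i \<in> {1..k} \<longrightarrow> f i \<in> {0..m}) \<and> (i \<notin> {1..k} \<longrightarrow> f i = 0)}"
      using f by (auto simp: Lam_def)
  qed
  show "finite {f. \<forall>i. (i \<in> {1..k} \<longrightarrow> f i \<in> {0..m}) \<and> (i \<notin> {1..k} \<longrightarrow> f i = 0)}"
    by (rule finite_set_of_finite_funs) auto
qed

lemma finite_LamD: "finite (LamD n r)"
proof (rule finite_subset)
  show "LamD n r \<subseteq> Bullet ` Lam (n + 1) r \<union> (\<lambda>(la, e). Signed la e) ` (Lam (n + 1) r \<times> {Pos, Neg})"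
    unfolding LamD_def by (auto simp: image_iff) (metis sign.exhaust)
qed (simp add: finite_Lam)

lemma mark_LamD: "la \<in> Lam (n + 1) r \<Longrightarrow> mark n la e \<in> LamD n r"
  by (auto simp: mark_def LamD_def)

lemma LamD_mark: "\<alpha> \<in> LamD n r \<Longrightarrow> \<exists>la\<in>Lam (n + 1) r. \<exists>e. \<alpha> = mark n la e"
  by (auto simp: mark_def LamD_def)

context rank begin

lemma xD_mark:
  assumes "la \<in> Lam (n + 1) r"
  shows "xD n r (mark n la e) = Tsgn e \<cdot> TS (parD (blk n la)) \<cdot> Tsgn e"
  unfolding xD_def WD_par_mark[OF assms] using parD_WB by (intro Tsum_conj_s) blast

lemma xD_closed [simp]:
  assumes "\<alpha> \<in> LamD n r" shows "xD n r \<alpha> \<in> carrier H"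
proof -
  obtain la e where "la \<in> Lam (n + 1) r" "\<alpha> = mark n la e" using LamD_mark[OF assms] by blast
  then show ?thesis using parD_WB by (auto simp: xD_mark intro!: H.m_closed Tsum_closed)
qed

lemma permD_I:
  assumes "\<And>\<alpha>. \<alpha> \<in> LamD n r \<Longrightarrow> \<exists>h\<in>heckeD r. m \<alpha> = xD n r \<alpha> \<cdot> h"
    "\<And>\<alpha>. \<alpha> \<notin> LamD n r \<Longrightarrow> m \<alpha> = undefined"
  shows "m \<in> permD n r"
  unfolding permD_def using assms by (intro PiE_I) blast+

lemma permD_D:
  assumes "m \<in> permD n r"
  shows "\<alpha> \<in> LamD n r \<Longrightarrow> \<exists>h\<in>heckeD r. m \<alpha> = xD n r \<alpha> \<cdot> h" "\<alpha> \<notin> LamD n r \<Longrightarrow> m \<alpha> = undefined"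
proof -
  show "\<exists>h\<in>heckeD r. m \<alpha> = xD n r \<alpha> \<cdot> h" if "\<alpha> \<in> LamD n r"
    using PiE_mem[OF assms[unfolded permD_def] that] by (elim imageE) blast
  show "m \<alpha> = undefined" if "\<alpha> \<notin> LamD n r"
    using PiE_arb[OF assms[unfolded permD_def] that] .
qed

lemma permD_closed: "m \<in> permD n r \<Longrightarrow> \<alpha> \<in> LamD n r \<Longrightarrow> m \<alpha> \<in> carrier H"
  using permD_D(1) heckeD_carrier H.m_closed xD_closed by metis

lemma permD_ext:
  assumes "m \<in> permD n r" "m' \<in> permD n r" "\<And>\<alpha>. \<alpha> \<in> LamD n r \<Longrightarrow> m \<alpha> = m' \<alpha>"
  shows "m = m'"
  using assms permD_D(2) by (metis ext)

lemma permD_add_apply [simp]: "\<alpha> \<in> LamD n r \<Longrightarrow> permD_add n r m m' \<alpha> = m \<alpha> \<boxplus> m' \<alpha>"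
  and permD_act_apply [simp]: "\<alpha> \<in> LamD n r \<Longrightarrow> permD_act n r m h \<alpha> = m \<alpha> \<cdot> h"
  and permD_zero_apply [simp]: "\<alpha> \<in> LamD n r \<Longrightarrow> permD_zero n r \<alpha> = \<zero>\<^bsub>H\<^esub>"
  and permD_inj_apply [simp]: "\<alpha> \<in> LamD n r \<Longrightarrow> permD_inj n r \<beta> x \<alpha> = (if \<alpha> = \<beta> then x else \<zero>\<^bsub>H\<^esub>)"
  by (simp_all add: permD_add_def permD_act_def permD_zero_def permD_inj_def)

lemma permD_add_closed [simp]:
  assumes "m \<in> permD n r" "m' \<in> permD n r" shows "permD_add n r m m' \<in> permD n r"
proof (rule permD_I)
  fix \<alpha> assume a: "\<alpha> \<in> LamD n r"
  obtain h h' where h: "h \<in> heckeD r" "m \<alpha> = xD n r \<alpha> \<cdot> h" "h' \<in> heckeD r" "m' \<alpha> = xD n r \<alpha> \<cdot> h'"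
    using permD_D(1)[OF assms(1) a] permD_D(1)[OF assms(2) a] by blast
  then show "\<exists>h\<in>heckeD r. permD_add n r m m' \<alpha> = xD n r \<alpha> \<cdot> h"
    using a by (intro bexI[of _ "h \<boxplus> h'"]) (simp_all add: H.r_distr heckeD_carrier)
qed (simp add: permD_add_def)

lemma permD_act_closed [simp]:
  assumes "m \<in> permD n r" "k \<in> heckeD r" shows "permD_act n r m k \<in> permD n r"
proof (rule permD_I)
  fix \<alpha> assume a: "\<alpha> \<in> LamD n r"
  obtain h where h: "h \<in> heckeD r" "m \<alpha> = xD n r \<alpha> \<cdot> h" using permD_D(1)[OF assms(1) a] by blast
  then show "\<exists>h\<in>heckeD r. permD_act n r m k \<alpha> = xD n r \<alpha> \<cdot> h"
    using a assms by (intro bexI[of _ "h \<cdot> k"]) (simp_all add: H.m_assoc heckeD_carrier)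
qed (simp add: permD_act_def)

lemma permD_zero_closed [simp]: "permD_zero n r \<in> permD n r"
proof (rule permD_I)
  fix \<alpha> assume "\<alpha> \<in> LamD n r"
  then show "\<exists>h\<in>heckeD r. permD_zero n r \<alpha> = xD n r \<alpha> \<cdot> h" by (intro bexI[of _ "\<zero>\<^bsub>H\<^esub>"]) simp_all
qed (simp add: permD_zero_def)

lemma permD_inj_closed:
  assumes "h \<in> heckeD r" shows "permD_inj n r \<beta> (xD n r \<beta> \<cdot> h) \<in> permD n r"
proof (rule permD_I)
  fix \<alpha> assume a: "\<alpha> \<in> LamD n r"
  show "\<exists>k\<in>heckeD r. permD_inj n r \<beta> (xD n r \<beta> \<cdot> h) \<alpha> = xD n r \<alpha> \<cdot> k"
  proof (cases "\<alpha> = \<beta>")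
    case False
    then show ?thesis using a by (intro bexI[of _ "\<zero>\<^bsub>H\<^esub>"]) simp_all
  qed (use a assms in auto)
qed (simp add: permD_inj_def)

section \<open>Endomorphisms and the Hecke elements representing them\<close>

lemma schurD_carrier:
  "f \<in> carrier (schurD n r) \<longleftrightarrow> f \<in> permD n r \<rightarrow>\<^sub>E permD n r \<and>
     (\<forall>m\<in>permD n r. \<forall>m'\<in>permD n r. f (permD_add n r m m') = permD_add n r (f m) (f m')) \<and>
     (\<forall>m\<in>permD n r. \<forall>h\<in>heckeD r. f (permD_act n r m h) = permD_act n r (f m) h)"
  by (simp add: schurD_def)

lemma schurD_closed: "f \<in> carrier (schurD n r) \<Longrightarrow> m \<in> permD n r \<Longrightarrow> f m \<in> permD n r"
  unfolding schurD_carrier by (blast intro: PiE_mem)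

lemma schurD_add: "f \<in> carrier (schurD n r) \<Longrightarrow> m \<in> permD n r \<Longrightarrow> m' \<in> permD n r \<Longrightarrow>
    f (permD_add n r m m') = permD_add n r (f m) (f m')"
  unfolding schurD_carrier by blast

lemma schurD_act: "f \<in> carrier (schurD n r) \<Longrightarrow> m \<in> permD n r \<Longrightarrow> h \<in> heckeD r \<Longrightarrow>
    f (permD_act n r m h) = permD_act n r (f m) h"
  unfolding schurD_carrier by blast

lemma schurD_eqI:
  assumes f: "f \<in> carrier (schurD n r)" and g: "g \<in> carrier (schurD n r)"
    and eq: "\<And>m. m \<in> permD n r \<Longrightarrow> f m = g m"
  shows "f = g"
  using f g eq unfolding schurD_carrier by (metis PiE_ext)

lemma schurD_I:
  assumes "\<And>m. m \<in> permD n r \<Longrightarrow> f m \<in> permD n r"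
    and "\<And>m m'. m \<in> permD n r \<Longrightarrow> m' \<in> permD n r \<Longrightarrow> f (permD_add n r m m') = permD_add n r (f m) (f m')"
    and "\<And>m h. m \<in> permD n r \<Longrightarrow> h \<in> heckeD r \<Longrightarrow> f (permD_act n r m h) = permD_act n r (f m) h"
  shows "(\<lambda>m\<in>permD n r. f m) \<in> carrier (schurD n r)"
  unfolding schurD_carrier using assms by auto

lemma schurD_zero:
  assumes "f \<in> carrier (schurD n r)" shows "f (permD_zero n r) = permD_zero n r"
proof (rule permD_ext[where n = n])
  let ?z = "permD_zero n r"
  show fz: "f ?z \<in> permD n r" using schurD_closed[OF assms] by simp
  fix \<alpha> assume a: "\<alpha> \<in> LamD n r"
  have "permD_add n r ?z ?z = ?z" by (rule permD_ext[where n = n]) simp_all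
  then have "f ?z \<alpha> = f ?z \<alpha> \<boxplus> f ?z \<alpha>"
    using schurD_add[OF assms, of ?z ?z] a by (metis permD_add_apply permD_zero_closed)
  then show "f ?z \<alpha> = ?z \<alpha>"
    using permD_closed[OF fz a] a by (simp add: H.add.l_cancel_one)
qed simp

text \<open>There are finitely many symbols, so every family is a finite sum of families supported
  at one symbol; the induction removes one symbol from the support at a time.\<close>

lemma schurD_ext:
  assumes f: "f \<in> carrier (schurD n r)" and g: "g \<in> carrier (schurD n r)"
    and eq: "\<And>\<gamma> h. \<gamma> \<in> LamD n r \<Longrightarrow> h \<in> heckeD r \<Longrightarrow>
      f (permD_inj n r \<gamma> (xD n r \<gamma> \<cdot> h)) = g (permD_inj n r \<gamma> (xD n r \<gamma> \<cdot> h))"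
  shows "f = g"
proof -
  have "f m = g m" if "finite S" "m \<in> permD n r" "\<And>\<alpha>. \<alpha> \<in> LamD n r \<Longrightarrow> \<alpha> \<notin> S \<Longrightarrow> m \<alpha> = \<zero>\<^bsub>H\<^esub>" for S m
    using that
  proof (induction S arbitrary: m rule: finite_induct)
    case empty
    then have "m = permD_zero n r" by (intro permD_ext[where n = n]) simp_all
    then show ?case using schurD_zero f g by simp
  next
    case (insert \<gamma> S)
    show ?case
    proof (cases "\<gamma> \<in> LamD n r")
      case False
      then show ?thesis using insert.prems by (intro insert.IH) auto
    next
      case True
      obtain h where h: "h \<in> heckeD r" "m \<gamma> = xD n r \<gamma> \<cdot> h" using permD_D(1)[OF insert.prems(1) True] by blast
      define i where "i = permD_inj n r \<gamma> (xD n r \<gamma> \<cdot> h)"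
      define m' where "m' = m(\<gamma> := \<zero>\<^bsub>H\<^esub>)"
      have i: "i \<in> permD n r" unfolding i_def by (rule permD_inj_closed[OF h(1)])
      have m': "m' \<in> permD n r"
      proof (rule permD_I)
        fix \<alpha> assume a: "\<alpha> \<in> LamD n r"
        show "\<exists>h\<in>heckeD r. m' \<alpha> = xD n r \<alpha> \<cdot> h"
        proof (cases "\<alpha> = \<gamma>")
          case False
          then show ?thesis using permD_D(1)[OF insert.prems(1) a] by (simp add: m'_def)
        qed (use a in \<open>auto simp: m'_def intro!: bexI[of _ "\<zero>\<^bsub>H\<^esub>"]\<close>)
      qed (use True permD_D(2)[OF insert.prems(1)] in \<open>auto simp: m'_def\<close>)
      have e: "m = permD_add n r i m'"
      proof (rule permD_ext[where n = n])
        fix \<alpha> assume a: "\<alpha> \<in> LamD n r"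
        then show "m \<alpha> = permD_add n r i m' \<alpha>"
          using permD_closed[OF insert.prems(1) a] h True heckeD_carrier
          by (auto simp: i_def m'_def)
      qed (use insert.prems i m' in auto)
      have "f m' = g m'" by (rule insert.IH[OF m']) (use insert.prems in \<open>auto simp: m'_def\<close>)
      moreover have "f i = g i" unfolding i_def by (rule eq[OF True h(1)])
      ultimately show ?thesis unfolding e using schurD_add f g i m' by metis
    qed
  qed
  from this[OF finite_LamD] show ?thesis by (intro schurD_eqI[OF f g]) blast
qed

text \<open>The condition describing \<open>phi_d\<close>, with an arbitrary \<open>y\<close> in
  place of the sum over a double coset. It reduces identities between endomorphisms to identities in
  the Hecke algebra.\<close>

definition Rep :: "nat \<Rightarrow> symb \<Rightarrow> symb \<Rightarrow> free set \<Rightarrow> ((symb \<Rightarrow> free set) \<Rightarrow> symb \<Rightarrow> free set) \<Rightarrow> bool" where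
  "Rep n \<alpha> \<beta> y f \<longleftrightarrow> f \<in> carrier (schurD n r) \<and>
     (\<forall>\<gamma>\<in>LamD n r. \<forall>h\<in>heckeD r. f (permD_inj n r \<gamma> (xD n r \<gamma> \<cdot> h)) =
        (if \<beta> = \<gamma> then permD_inj n r \<alpha> (y \<cdot> h) else permD_zero n r))"

lemma Rep_unique: "Rep n \<alpha> \<beta> y f \<Longrightarrow> Rep n \<alpha> \<beta> y g \<Longrightarrow> f = g"
  unfolding Rep_def by (intro schurD_ext) auto

lemma permD_inj_zero: "permD_inj n r \<alpha> \<zero>\<^bsub>H\<^esub> = permD_zero n r"
  by (auto simp: permD_inj_def permD_zero_def)

text \<open>The map is left multiplication by \<open>z\<close> on component \<open>\<beta>\<close>.
  It is compatible with the right action by associativity, and its values lie in component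
  \<open>\<alpha>\<close> because \<open>z\<close> times \<open>xD n r \<beta>\<close> is also
  \<open>xD n r \<alpha>\<close> times an element of \<open>heckeD r\<close>.\<close>

lemma Rep_exists:
  assumes ab: "\<alpha> \<in> LamD n r" "\<beta> \<in> LamD n r" and z: "z \<in> carrier H" "y = z \<cdot> xD n r \<beta>"
    and y: "y' \<in> heckeD r" "y = xD n r \<alpha> \<cdot> y'"
  shows "\<exists>f. Rep n \<alpha> \<beta> y f"
proof -
  let ?f = "\<lambda>m. permD_inj n r \<alpha> (z \<cdot> m \<beta>)"
  have cl: "?f m \<in> permD n r" if m: "m \<in> permD n r" for m
  proof -
    obtain h where h: "h \<in> heckeD r" "m \<beta> = xD n r \<beta> \<cdot> h" using permD_D(1)[OF m ab(2)] by blast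
    have "z \<cdot> m \<beta> = y \<cdot> h" using h z ab heckeD_carrier by (simp add: H.m_assoc)
    also have "\<dots> = xD n r \<alpha> \<cdot> (y' \<cdot> h)" using y h ab heckeD_carrier by (simp add: H.m_assoc)
    finally show ?thesis using y h by (simp add: permD_inj_closed)
  qed
  have c: "(\<lambda>m\<in>permD n r. ?f m) \<in> carrier (schurD n r)"
  proof (rule schurD_I[OF cl])
    fix m m' assume m: "m \<in> permD n r" "m' \<in> permD n r"
    show "?f (permD_add n r m m') = permD_add n r (?f m) (?f m')"
      by (rule permD_ext[where n = n]) (use m cl cl[OF permD_add_closed[OF m]] ab z permD_closed[of _ n \<beta>] in \<open>simp_all add: H.r_distr\<close>)
  next
    fix m h assume m: "m \<in> permD n r" "h \<in> heckeD r"
    show "?f (permD_act n r m h) = permD_act n r (?f m) h"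
      by (rule permD_ext[where n = n]) (use m cl cl[OF permD_act_closed[OF m]] ab z permD_closed[of _ n \<beta>] heckeD_carrier in \<open>simp_all add: H.m_assoc\<close>)
  qed
  have "?f (permD_inj n r \<gamma> (xD n r \<gamma> \<cdot> h)) = (if \<beta> = \<gamma> then permD_inj n r \<alpha> (y \<cdot> h) else permD_zero n r)"
    if "\<gamma> \<in> LamD n r" "h \<in> heckeD r" for \<gamma> h
    using that ab z heckeD_carrier by (auto simp: H.m_assoc permD_inj_zero)
  then show ?thesis
    unfolding Rep_def using c permD_inj_closed by (intro exI[of _ "\<lambda>m\<in>permD n r. ?f m"]) auto
qed

lemma phi_d_Rep:
  assumes "\<exists>f. Rep n \<alpha> \<beta> (TS (double_coset (WD_par n r \<alpha>) d (WD_par n r \<beta>))) f"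
  shows "Rep n \<alpha> \<beta> (TS (double_coset (WD_par n r \<alpha>) d (WD_par n r \<beta>))) (phi_d n r \<alpha> \<beta> d)"
proof -
  let ?R = "Rep n \<alpha> \<beta> (TS (double_coset (WD_par n r \<alpha>) d (WD_par n r \<beta>)))"
  have "phi_d n r \<alpha> \<beta> d = (THE f. ?R f)" by (simp add: phi_d_def Rep_def)
  moreover have "?R (THE f. ?R f)"
    by (rule theI'[of ?R]) (use assms Rep_unique in blast)
  ultimately show ?thesis by simp
qed

lemma schurD_simps:
  "f \<otimes>\<^bsub>schurD n r\<^esub> g = compose (permD n r) f g"
  "f \<oplus>\<^bsub>schurD n r\<^esub> g = (\<lambda>m\<in>permD n r. permD_add n r (f m) (g m))"
  "\<zero>\<^bsub>schurD n r\<^esub> = (\<lambda>m\<in>permD n r. permD_zero n r)"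
  "c \<odot>\<^bsub>schurD n r\<^esub> f = (\<lambda>m\<in>permD n r. permD_act n r (f m) (hconst r c))"
  by (simp_all add: schurD_def)

lemma schurD_add_closed:
  assumes f: "f \<in> carrier (schurD n r)" and g: "g \<in> carrier (schurD n r)"
  shows "f \<oplus>\<^bsub>schurD n r\<^esub> g \<in> carrier (schurD n r)"
  unfolding schurD_simps
proof (rule schurD_I)
  fix m m' assume m: "m \<in> permD n r" "m' \<in> permD n r"
  note c = schurD_closed[OF f m(1)] schurD_closed[OF f m(2)] schurD_closed[OF g m(1)] schurD_closed[OF g m(2)]
  show "permD_add n r (f m) (g m) \<in> permD n r" using c by simp
  show "permD_add n r (f (permD_add n r m m')) (g (permD_add n r m m'))
    = permD_add n r (permD_add n r (f m) (g m)) (permD_add n r (f m') (g m'))"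
    unfolding schurD_add[OF f m] schurD_add[OF g m]
  proof (rule permD_ext[where n = n])
    fix \<alpha> assume a: "\<alpha> \<in> LamD n r"
    note c' = c[THEN permD_closed, OF a]
    show "permD_add n r (permD_add n r (f m) (f m')) (permD_add n r (g m) (g m')) \<alpha>
      = permD_add n r (permD_add n r (f m) (g m)) (permD_add n r (f m') (g m')) \<alpha>"
      using a c' by (simp add: H.add.m_ac)
  qed (use c in simp_all)
next
  fix m h assume m: "m \<in> permD n r" "h \<in> heckeD r"
  note c = schurD_closed[OF f m(1)] schurD_closed[OF g m(1)]
  show "permD_add n r (f (permD_act n r m h)) (g (permD_act n r m h)) = permD_act n r (permD_add n r (f m) (g m)) h"
    unfolding schurD_act[OF f m] schurD_act[OF g m]
  proof (rule permD_ext[where n = n])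
    fix \<alpha> assume a: "\<alpha> \<in> LamD n r"
    show "permD_add n r (permD_act n r (f m) h) (permD_act n r (g m) h) \<alpha> = permD_act n r (permD_add n r (f m) (g m)) h \<alpha>"
      using a c[THEN permD_closed, OF a] heckeD_carrier[OF m(2)] by (simp add: H.l_distr)
  qed (use c m in simp_all)
qed

lemma schurD_zero_closed: "\<zero>\<^bsub>schurD n r\<^esub> \<in> carrier (schurD n r)"
  unfolding schurD_simps
proof (rule schurD_I)
  fix m m' assume m: "m \<in> permD n r" "m' \<in> permD n r"
  show "permD_zero n r = permD_add n r (permD_zero n r) (permD_zero n r)"
    by (rule permD_ext[where n = n]) simp_all
next
  fix m h assume m: "m \<in> permD n r" "h \<in> heckeD r"
  show "permD_zero n r = permD_act n r (permD_zero n r) h"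
    by (rule permD_ext[where n = n]) (use m heckeD_carrier in simp_all)
qed simp

text \<open>Supplies the rules for finite sums in \<open>schurD n r\<close>, such as the one on the
  right of the theorem.\<close>

lemma schurD_abelian_monoid: "abelian_monoid (schurD n r)"
proof (rule abelian_monoidI)
  fix f g k
  assume f: "f \<in> carrier (schurD n r)" and g: "g \<in> carrier (schurD n r)" and k: "k \<in> carrier (schurD n r)"
  show "f \<oplus>\<^bsub>schurD n r\<^esub> g \<oplus>\<^bsub>schurD n r\<^esub> k = f \<oplus>\<^bsub>schurD n r\<^esub> (g \<oplus>\<^bsub>schurD n r\<^esub> k)"
  proof (rule schurD_eqI)
    fix m assume m: "m \<in> permD n r"
    note c = schurD_closed[OF f m] schurD_closed[OF g m] schurD_closed[OF k m]
    have "permD_add n r (permD_add n r (f m) (g m)) (k m) = permD_add n r (f m) (permD_add n r (g m) (k m))"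
    proof (rule permD_ext[where n = n])
      fix \<alpha> assume a: "\<alpha> \<in> LamD n r"
      show "permD_add n r (permD_add n r (f m) (g m)) (k m) \<alpha> = permD_add n r (f m) (permD_add n r (g m) (k m)) \<alpha>"
        using a c[THEN permD_closed, OF a] by (simp add: H.a_assoc)
    qed (use c in simp_all)
    then show "(f \<oplus>\<^bsub>schurD n r\<^esub> g \<oplus>\<^bsub>schurD n r\<^esub> k) m = (f \<oplus>\<^bsub>schurD n r\<^esub> (g \<oplus>\<^bsub>schurD n r\<^esub> k)) m"
      using m by (simp add: schurD_simps)
  qed (intro schurD_add_closed f g k)+
next
  fix f g
  assume f: "f \<in> carrier (schurD n r)" and g: "g \<in> carrier (schurD n r)"
  show "f \<oplus>\<^bsub>schurD n r\<^esub> g = g \<oplus>\<^bsub>schurD n r\<^esub> f"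
  proof (rule schurD_eqI)
    fix m assume m: "m \<in> permD n r"
    note c = schurD_closed[OF f m] schurD_closed[OF g m]
    have "permD_add n r (f m) (g m) = permD_add n r (g m) (f m)"
    proof (rule permD_ext[where n = n])
      fix \<alpha> assume a: "\<alpha> \<in> LamD n r"
      show "permD_add n r (f m) (g m) \<alpha> = permD_add n r (g m) (f m) \<alpha>"
        using a c[THEN permD_closed, OF a] by (simp add: H.a_comm)
    qed (use c in simp_all)
    then show "(f \<oplus>\<^bsub>schurD n r\<^esub> g) m = (g \<oplus>\<^bsub>schurD n r\<^esub> f) m" using m by (simp add: schurD_simps)
  qed (intro schurD_add_closed f g)+
next
  fix f assume f: "f \<in> carrier (schurD n r)"
  show "\<zero>\<^bsub>schurD n r\<^esub> \<oplus>\<^bsub>schurD n r\<^esub> f = f"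
  proof (rule schurD_eqI)
    fix m assume m: "m \<in> permD n r"
    note c = schurD_closed[OF f m]
    have "permD_add n r (permD_zero n r) (f m) = f m"
    proof (rule permD_ext[where n = n])
      fix \<alpha> assume a: "\<alpha> \<in> LamD n r"
      show "permD_add n r (permD_zero n r) (f m) \<alpha> = f m \<alpha>"
        using a permD_closed[OF c a] by simp
    qed (use c in simp_all)
    then show "(\<zero>\<^bsub>schurD n r\<^esub> \<oplus>\<^bsub>schurD n r\<^esub> f) m = f m" using m by (simp add: schurD_simps)
  qed (intro schurD_add_closed schurD_zero_closed f)+
qed (simp_all add: schurD_add_closed schurD_zero_closed)

lemma Rep_zero: "Rep n \<alpha> \<beta> \<zero>\<^bsub>H\<^esub> \<zero>\<^bsub>schurD n r\<^esub>"
  unfolding Rep_def using schurD_zero_closed heckeD_carrier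
  by (auto simp: schurD_simps permD_inj_closed permD_inj_zero)

lemma Rep_add:
  assumes f: "Rep n \<alpha> \<beta> y f" and g: "Rep n \<alpha> \<beta> y' g" and y: "y \<in> carrier H" "y' \<in> carrier H"
  shows "Rep n \<alpha> \<beta> (y \<boxplus> y') (f \<oplus>\<^bsub>schurD n r\<^esub> g)"
proof -
  have 1: "permD_add n r (permD_inj n r \<alpha> (y \<cdot> h)) (permD_inj n r \<alpha> (y' \<cdot> h)) = permD_inj n r \<alpha> ((y \<boxplus> y') \<cdot> h)"
    if "h \<in> heckeD r" for h
    using heckeD_carrier[OF that] y by (auto simp: permD_add_def permD_inj_def restrict_def fun_eq_iff H.l_distr)
  have 2: "permD_add n r (permD_zero n r) (permD_zero n r) = permD_zero n r"
    by (auto simp: permD_add_def permD_zero_def restrict_def fun_eq_iff)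
  show ?thesis
    using f g schurD_add_closed[of f n g] 1 2 permD_inj_closed
    unfolding Rep_def by (auto simp: schurD_simps)
qed

lemma Rep_smult:
  assumes f: "Rep n \<alpha> \<beta> y f" and y: "y \<in> carrier H"
  shows "Rep n \<alpha> \<beta> (hconst r c \<cdot> y) (c \<odot>\<^bsub>schurD n r\<^esub> f)"
proof -
  let ?k = "hconst r c"
  have fc: "f \<in> carrier (schurD n r)" using f by (simp add: Rep_def)
  have cl: "c \<odot>\<^bsub>schurD n r\<^esub> f \<in> carrier (schurD n r)"
    unfolding schurD_simps
  proof (rule schurD_I)
    fix m m' assume m: "m \<in> permD n r" "m' \<in> permD n r"
    note k = schurD_closed[OF fc m(1)] schurD_closed[OF fc m(2)]
    show "permD_act n r (f m) ?k \<in> permD n r" using k by simp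
    show "permD_act n r (f (permD_add n r m m')) ?k = permD_add n r (permD_act n r (f m) ?k) (permD_act n r (f m') ?k)"
      unfolding schurD_add[OF fc m]
    proof (rule permD_ext[where n = n])
      fix \<alpha> assume a: "\<alpha> \<in> LamD n r"
      show "permD_act n r (permD_add n r (f m) (f m')) ?k \<alpha> = permD_add n r (permD_act n r (f m) ?k) (permD_act n r (f m') ?k) \<alpha>"
        using a k[THEN permD_closed, OF a] by (simp add: H.l_distr)
    qed (use k in simp_all)
  next
    fix m h assume m: "m \<in> permD n r" "h \<in> heckeD r"
    note k = schurD_closed[OF fc m(1)]
    show "permD_act n r (f (permD_act n r m h)) ?k = permD_act n r (permD_act n r (f m) ?k) h"
      unfolding schurD_act[OF fc m]
    proof (rule permD_ext[where n = n])
      fix \<alpha> assume a: "\<alpha> \<in> LamD n r"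
      show "permD_act n r (permD_act n r (f m) h) ?k \<alpha> = permD_act n r (permD_act n r (f m) ?k) h \<alpha>"
        using a permD_closed[OF k a] heckeD_carrier[OF m(2)] hconst_central[of h c] by (simp add: H.m_assoc)
    qed (use k m in simp_all)
  qed
  have 1: "permD_act n r (permD_inj n r \<alpha> (y \<cdot> h)) ?k = permD_inj n r \<alpha> (?k \<cdot> y \<cdot> h)" if "h \<in> heckeD r" for h
  proof -
    have "y \<cdot> h \<cdot> ?k = ?k \<cdot> y \<cdot> h"
      using hconst_central[of "y \<cdot> h" c] y heckeD_carrier[OF that] by (simp add: H.m_assoc)
    then show ?thesis by (auto simp: permD_act_def permD_inj_def restrict_def fun_eq_iff)
  qed
  have 2: "permD_act n r (permD_zero n r) ?k = permD_zero n r"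
    by (auto simp: permD_act_def permD_zero_def restrict_def fun_eq_iff)
  show ?thesis
    using f cl 1 2 permD_inj_closed unfolding Rep_def by (auto simp: schurD_simps)
qed

text \<open>The value of \<open>g\<close> is a right multiple of \<open>xD n r \<beta>\<close> by an
  element of \<open>heckeD r\<close>, and on such multiples \<open>f\<close> acts as left
  multiplication by \<open>z\<close>.\<close>

lemma Rep_compose:
  assumes f: "Rep n \<alpha> \<beta> (z \<cdot> xD n r \<beta>) f" and g: "Rep n \<beta> \<gamma> (xD n r \<beta> \<cdot> y) g"
    and z: "z \<in> carrier H" and y: "y \<in> heckeD r" and b: "\<beta> \<in> LamD n r"
  shows "Rep n \<alpha> \<gamma> (z \<cdot> (xD n r \<beta> \<cdot> y)) (f \<otimes>\<^bsub>schurD n r\<^esub> g)"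
proof -
  have fc: "f \<in> carrier (schurD n r)" and gc: "g \<in> carrier (schurD n r)"
    using f g by (auto simp: Rep_def)
  have cl: "f \<otimes>\<^bsub>schurD n r\<^esub> g \<in> carrier (schurD n r)"
    unfolding schurD_simps compose_def
    by (rule schurD_I) (simp_all add: schurD_closed[OF fc] schurD_closed[OF gc] schurD_add[OF gc] schurD_add[OF fc]
        schurD_act[OF gc] schurD_act[OF fc])
  have "f (g (permD_inj n r \<delta> (xD n r \<delta> \<cdot> h)))
      = (if \<gamma> = \<delta> then permD_inj n r \<alpha> (z \<cdot> (xD n r \<beta> \<cdot> y) \<cdot> h) else permD_zero n r)"
    if d: "\<delta> \<in> LamD n r" "h \<in> heckeD r" for \<delta> h
  proof (cases "\<gamma> = \<delta>")
    case True
    have "g (permD_inj n r \<delta> (xD n r \<delta> \<cdot> h)) = permD_inj n r \<beta> (xD n r \<beta> \<cdot> (y \<cdot> h))"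
      using g d True y b heckeD_carrier by (simp add: Rep_def H.m_assoc)
    moreover have "f (permD_inj n r \<beta> (xD n r \<beta> \<cdot> (y \<cdot> h))) = permD_inj n r \<alpha> (z \<cdot> xD n r \<beta> \<cdot> (y \<cdot> h))"
      using f d b y by (simp add: Rep_def)
    ultimately show ?thesis using True z y b d heckeD_carrier by (simp add: H.m_assoc)
  next
    case False
    then have "g (permD_inj n r \<delta> (xD n r \<delta> \<cdot> h)) = permD_zero n r" using g d by (simp add: Rep_def)
    then show ?thesis using False schurD_zero[OF fc] by simp
  qed
  then show ?thesis
    using cl permD_inj_closed unfolding Rep_def by (auto simp: schurD_simps compose_def)
qed

lemma Rep_finsum:
  assumes "finite I" "\<And>i. i \<in> I \<Longrightarrow> Rep n \<alpha> \<beta> (y i) (F i)" "\<And>i. i \<in> I \<Longrightarrow> y i \<in> carrier H"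
  shows "Rep n \<alpha> \<beta> (\<Oplus>\<^bsub>H\<^esub>i\<in>I. y i) (\<Oplus>\<^bsub>schurD n r\<^esub>i\<in>I. F i)"
  using assms
proof (induction I rule: finite_induct)
  case empty
  interpret S: abelian_monoid "schurD n r" by (rule schurD_abelian_monoid)
  show ?case using Rep_zero by simp
next
  case (insert i I)
  interpret S: abelian_monoid "schurD n r" by (rule schurD_abelian_monoid)
  have F: "F j \<in> carrier (schurD n r)" if "j \<in> insert i I" for j using insert.prems(1)[OF that] by (simp add: Rep_def)
  have "(\<Oplus>\<^bsub>schurD n r\<^esub>j\<in>insert i I. F j) = F i \<oplus>\<^bsub>schurD n r\<^esub> (\<Oplus>\<^bsub>schurD n r\<^esub>j\<in>I. F j)"
    using insert.hyps F by (intro S.finsum_insert) auto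
  moreover have "(\<Oplus>\<^bsub>H\<^esub>j\<in>insert i I. y j) = y i \<boxplus> (\<Oplus>\<^bsub>H\<^esub>j\<in>I. y j)"
    using insert by (intro H.finsum_insert) auto
  moreover have "Rep n \<alpha> \<beta> (y i \<boxplus> (\<Oplus>\<^bsub>H\<^esub>j\<in>I. y j)) (F i \<oplus>\<^bsub>schurD n r\<^esub> (\<Oplus>\<^bsub>schurD n r\<^esub>j\<in>I. F j))"
    using insert by (intro Rep_add insert.IH H.finsum_closed) auto
  ultimately show ?case by simp
qed

text \<open>\<open>XA\<close> is stable under the parabolic subgroups on both sides, so both
  factorisations of sums apply. Factors \<open>Tsgn\<close>, which square to one, are inserted to
  pass from \<open>parD\<close> to \<open>xD\<close>; in the second factorisation the cofactor is a
  sum over type D elements and hence lies in \<open>heckeD r\<close>.\<close>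

lemma Tsum_XA_factors:
  assumes la: "la \<in> Lam (n + 1) r" "nu \<in> Lam (n + 1) r" "la (n + 1) = 0"
    and e: "(e = e') \<longleftrightarrow> mat_sgn n A = Pos"
  shows "\<exists>z\<in>carrier H. TS (conj_s e (XA n la nu A) e') = z \<cdot> xD n r (mark n nu e')"
    and "\<exists>y\<in>heckeD r. TS (conj_s e (XA n la nu A) e') = xD n r (mark n la e) \<cdot> y"
proof -
  let ?X = "XA n la nu A"
  have P: "parD c \<subseteq> WB r" for c using parD_WB by blast
  define V where "V = {v \<in> ?X. incD (blk n nu) v}"
  define U where "U = {v \<in> ?X. incD (blk n la) (iv v)}"
  have VU: "V \<subseteq> WB r" "U \<subseteq> WB r" using XA_WB[of n la nu A] unfolding V_def U_def by blast+
  have "TS ?X = TS V \<cdot> TS (parD (blk n nu))"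
    unfolding V_def
    by (rule Tsum_factor_right[OF block_labelling_blk[OF la(2)] XA_WB])
      (use XA_stable[OF la(1,2) parD_id] in simp)
  then have "TS (conj_s e ?X e') = (Tsgn e \<cdot> TS V \<cdot> Tsgn e') \<cdot> xD n r (mark n nu e')"
    using VU P by (simp add: Tsum_conj_s[OF XA_WB] xD_mark[OF la(2)] H.m_assoc)
  then show "\<exists>z\<in>carrier H. TS (conj_s e ?X e') = z \<cdot> xD n r (mark n nu e')"
    using VU by (intro bexI[of _ "Tsgn e \<cdot> TS V \<cdot> Tsgn e'"]) auto
  have "TS ?X = TS (parD (blk n la)) \<cdot> TS U"
    unfolding U_def
    by (rule Tsum_factor_left[OF block_labelling_blk[OF la(1)] XA_WB])
      (use XA_stable[OF la(1,2) _ parD_id] in simp)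
  then have "TS (conj_s e ?X e') = xD n r (mark n la e) \<cdot> (Tsgn e \<cdot> TS U \<cdot> Tsgn e')"
    using VU P by (simp add: Tsum_conj_s[OF XA_WB] xD_mark[OF la(1)] H.m_assoc)
  also have "Tsgn e \<cdot> TS U \<cdot> Tsgn e' = TS (conj_s e U e')" by (rule Tsum_conj_s[OF VU(2), symmetric])
  finally have "TS (conj_s e ?X e') = xD n r (mark n la e) \<cdot> TS (conj_s e U e')" .
  moreover have "conj_s e U e' \<subseteq> WD r"
    using conj_s_XA_WD[OF e, of la nu] by (auto simp: conj_s_def U_def)
  ultimately show "\<exists>y\<in>heckeD r. TS (conj_s e ?X e') = xD n r (mark n la e) \<cdot> y"
    using Tsum_heckeD by blast
qed

lemma phi_mat_Rep:
  assumes la: "la \<in> Lam (n + 1) r" "nu \<in> Lam (n + 1) r" "la (n + 1) = 0"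
    and A: "A \<in> Xi n r" "ro n A = hat n la" "co n A = hat n nu" and e: "(e = e') \<longleftrightarrow> mat_sgn n A = Pos"
  shows "Rep n (mark n la e) (mark n nu e') (TS (conj_s e (XA n la nu A) e')) (phi_mat n r e A e')"
proof -
  obtain d where d: "phi_mat n r e A e' = phi_d n r (mark n la e) (mark n nu e') d"
    "double_coset (WD_par n r (mark n la e)) d (WD_par n r (mark n nu e')) = conj_s e (XA n la nu A) e'"
    using phi_mat_eq_phi_d[OF la A e] by blast
  have "\<exists>f. Rep n (mark n la e) (mark n nu e') (TS (conj_s e (XA n la nu A) e')) f"
    using Rep_exists[OF mark_LamD[OF la(1)] mark_LamD[OF la(2)]] Tsum_XA_factors[OF la e] by metis
  then show ?thesis using phi_d_Rep[of n "mark n la e" "mark n nu e'" d] unfolding d by blast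
qed

end

section \<open>The product formula\<close>

text \<open>The polynomial division in \<open>qint\<close> is exact: \<open>qvar ^ m - 1\<close> is
  \<open>qvar - 1\<close> times the geometric sum.\<close>

lemma qint_eq: "qint m = (\<Sum>i<m. qvar ^ i)"
proof -
  have "qvar - 1 \<noteq> 0" by (simp add: qvar_def one_pCons)
  then show ?thesis unfolding qint_def power_diff_1_eq by simp
qed

lemma q_interval_sum: "(\<Sum>e\<in>{k..k + m}. qvar ^ e) = qvar ^ k * qint (m + 1)"
proof -
  have "(\<Sum>e\<in>{k..k + m}. qvar ^ e) = (\<Sum>i<m + 1. qvar ^ (k + i))"
    by (rule sum.reindex_bij_witness[where i = "\<lambda>i. k + i" and j = "\<lambda>e. e - k"]) auto
  then show ?thesis by (simp only: qint_eq power_add sum_distrib_left)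
qed

lemma card_split2:
  assumes "finite S" "b \<noteq> b'"
  shows "card S = card (S - {b, b'}) + (if b \<in> S then 1 else 0) + (if b' \<in> S then 1 else (0 :: nat))"
proof -
  have "card S = card (S - {b, b'}) + card (S \<inter> {b, b'})"
    using assms card_Int_Diff[of S "{b, b'}"] by simp
  also have "card (S \<inter> {b, b'}) = (if b \<in> S then 1 else 0) + (if b' \<in> S then 1 else 0)"
    using assms by (cases "b \<in> S"; cases "b' \<in> S") (auto simp: Int_insert_right)
  finally show ?thesis by simp
qed

lemma E_theta_eq: "E_theta n i j k l = (if k = i \<and> l = j then 1 else 0)
    + (if k = 2 * n + 2 - i \<and> l = 2 * n + 2 - j then 1 else 0)"
  by (simp add: E_theta_def E_unit_def)

context rank begin

lemma hconst_sum: "finite I \<Longrightarrow> hconst r (\<Sum>i\<in>I. f i) = (\<Oplus>\<^bsub>H\<^esub>i\<in>I. hconst r (f i))"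
  by (induction I rule: finite_induct) (auto simp: hconst_zero hconst_add H.finsum_insert)

lemma par_lowI:
  assumes c: "block_labelling c" and u: "u \<in> WB r" and low: "\<And>x. 1 \<le> x \<Longrightarrow> x \<le> r \<Longrightarrow> c (u x) = c x"
  shows "u \<in> par c"
proof -
  have "c (u x) = c x" if x: "1 \<le> x" "x \<le> 2 * r" for x
  proof (cases "x \<le> r")
    case False
    let ?y = "2 * r + 1 - x"
    have y: "1 \<le> ?y" "?y \<le> r" using x False by auto
    have "c (2 * r + 1 - u ?y) = c (2 * r + 1 - ?y)"
      by (rule block_mirror[OF c low[OF y]]) (use y WB_bounds[OF u, of ?y] in auto)
    moreover have "2 * r + 1 - u ?y = u x" using WB_mirror[OF u, of x] WB_bounds[OF u, of x] x by auto
    ultimately show ?thesis using x by simp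
  qed (use low x in blast)
  then show ?thesis using u by (simp add: par_def)
qed

lemma par_seg_subset:
  assumes c: "block_labelling c" and ab: "a \<le> b" "b \<le> r"
    and const: "\<And>x. a < x \<Longrightarrow> x \<le> b \<Longrightarrow> c x = k"
  shows "par (seg a b) \<subseteq> par c"
proof
  fix u assume "u \<in> par (seg a b)"
  then have uW: "u \<in> WB r" and R: "\<And>x. 1 \<le> x \<Longrightarrow> x \<le> r \<Longrightarrow> if a < x \<and> x \<le> b then a < u x \<and> u x \<le> b else u x = x"
    using par_seg_iff[OF ab] by auto
  show "u \<in> par c"
    by (rule par_lowI[OF c uW]) (use R const in \<open>metis\<close>)
qed

lemma coset_matrix_Xi:
  assumes la: "la \<in> Lam (n + 1) r" "nu \<in> Lam (n + 1) r" and w: "w \<in> WB r"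
  shows "coset_matrix n la w nu \<in> Xi n r"
proof -
  let ?M = "coset_matrix n la w nu"
  have "?M i j = 0" if "i \<notin> {1..2 * n + 1} \<or> j \<notin> {1..2 * n + 1}" for i j
  proof -
    have "{x. 1 \<le> x \<and> x \<le> 2 * r \<and> blk n la (w x) = i \<and> blk n nu x = j} = {}"
      using that blk_bounds[OF la(1)] blk_bounds[OF la(2)] WB_bounds[OF w] by fastforce
    then show ?thesis unfolding coset_matrix_eq[OF la w] by (simp only: card.empty)
  qed
  moreover have "?M i j = ?M (2 * n + 2 - i) (2 * n + 2 - j)"
    if "i \<in> {1..2 * n + 1}" "j \<in> {1..2 * n + 1}" for i j
    using that by (intro coset_matrix_mirror[OF la w, symmetric]) auto
  moreover have "(\<Sum>i=1..2 * n + 1. \<Sum>j=1..2 * n + 1. ?M i j) = 2 * r"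
  proof -
    have "(\<Sum>i=1..2 * n + 1. ro n ?M i) = psum n la (2 * n + 1)"
      unfolding ro_coset_matrix[OF la w] psum_def ..
    then show ?thesis using psum_full[OF la(1)] unfolding ro_def by simp
  qed
  ultimately show ?thesis unfolding Xi_def by blast
qed

end

text \<open>Captures what the shape of \<open>B\<close> says about its row and column sums. The
  middle blocks are empty, so the parabolic subgroups of \<open>la\<close> and \<open>mu\<close>
  consist of type D elements.\<close>

locale adjacent_compositions = rank +
  fixes n h :: nat and \<gamma> la mu :: vec
  assumes h: "1 \<le> h" "h < n"
    and ga: "\<gamma> \<in> Lam (n + 1) (r - 1)" "\<gamma> (n + 1) = 0"
    and la: "la \<in> Lam (n + 1) r" "la (n + 1) = 0"
    and mu: "mu \<in> Lam (n + 1) r" "mu (n + 1) = 0"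
    and la_eq: "\<And>i. 1 \<le> i \<Longrightarrow> i \<le> n \<Longrightarrow> la i = \<gamma> i + (if i = h then 1 else 0)"
    and mu_eq: "\<And>i. 1 \<le> i \<Longrightarrow> i \<le> n \<Longrightarrow> mu i = \<gamma> i + (if i = h + 1 then 1 else 0)"
begin

definition a :: nat where "a = psum n la (h - 1)"
definition b :: nat where "b = psum n la h"

lemma psum_la: "i \<le> n \<Longrightarrow> psum n la i = psum n \<gamma> i + (if h \<le> i then 1 else 0)"
  by (induction i) (use h in \<open>auto simp: hat_def la_eq\<close>)

lemma psum_mu: "i \<le> n \<Longrightarrow> psum n mu i = psum n \<gamma> i + (if h + 1 \<le> i then 1 else 0)"
  by (induction i) (use h in \<open>auto simp: hat_def mu_eq\<close>)

lemma a_eq: "a = psum n \<gamma> (h - 1)" and b_eq: "b = psum n \<gamma> h + 1"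
  unfolding a_def b_def using psum_la[of "h - 1"] psum_la[of h] h by auto

lemma b_a: "b = a + \<gamma> h + 1"
proof -
  have "psum n \<gamma> h = psum n \<gamma> (h - 1) + \<gamma> h" using h by (cases h) (auto simp: hat_def)
  then show ?thesis by (simp add: a_eq b_eq)
qed

lemma ab: "a < b" "b \<le> r" "a \<le> b" "1 \<le> b"
proof -
  show "a < b" "a \<le> b" "1 \<le> b" using b_a by auto
  have "psum n la h \<le> psum n la n" using h by (intro psum_mono) simp
  then show "b \<le> r" using Lam_sum[OF la(1)] by (simp add: b_def)
qed

lemma blk_la_iff: "1 \<le> k \<Longrightarrow> k \<le> 2 * r \<Longrightarrow> blk n la k = h \<longleftrightarrow> a < k \<and> k \<le> b"
  using blk_eq_iff[OF la(1), of k h] h by (simp add: a_def b_def)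

lemma blk_mu_b: "blk n mu b = h + 1"
proof -
  have "psum n mu h < b" "b \<le> psum n mu (h + 1)"
    using psum_mu[of h] psum_mu[of "h + 1"] psum_mono[of h "h + 1" n \<gamma>] h b_eq by auto
  then show ?thesis using blk_eq_iff[OF mu(1), of b "h + 1"] ab by simp
qed

lemma blk_la_b: "blk n la b = h"
  using blk_la_iff[of b] ab by simp

text \<open>Up to the middle, the partial sums of \<open>la\<close> and \<open>mu\<close> agree
  except at \<open>h\<close>, where they are \<open>b\<close> and \<open>b - 1\<close>; so only
  \<open>b\<close> and its mirror image change blocks.\<close>

lemma blk_mu_la:
  assumes x: "1 \<le> x" "x \<le> 2 * r" "x \<noteq> b" "x \<noteq> 2 * r + 1 - b"
  shows "blk n la x = blk n mu x"
proof -
  have low: "blk n la x = blk n mu x" if x: "1 \<le> x" "x \<le> r" "x \<noteq> b" for x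
  proof -
    let ?i = "blk n mu x"
    have x2: "x \<le> 2 * r" using x by simp
    have i: "1 \<le> ?i" "?i \<le> n" using blk_bounds[OF mu(1) x(1) x2] blk_half(1)[OF mu x(1) x2] x by auto
    have p: "psum n mu (?i - 1) < x" "x \<le> psum n mu ?i" using blk_eq_iff[OF mu(1) x(1) x2, of ?i] by auto
    have "psum n la (?i - 1) < x"
    proof (cases "?i - 1 = h")
      case True
      then have "psum n la (?i - 1) = b" "psum n mu (?i - 1) + 1 = b"
        using psum_mu[of h] h by (auto simp: b_def b_eq[unfolded b_def])
      then show ?thesis using p x by auto
    next
      case False
      then have "psum n la (?i - 1) = psum n mu (?i - 1)" using psum_la[of "?i - 1"] psum_mu[of "?i - 1"] i by auto
      then show ?thesis using p by simp
    qed
    moreover have "x \<le> psum n la ?i" using psum_la[of ?i] psum_mu[of ?i] i p by (auto split: if_splits)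
    ultimately show ?thesis using blk_eq_iff[OF la(1) x(1) x2, of ?i] i by simp
  qed
  show ?thesis
  proof (cases "x \<le> r")
    case False
    let ?y = "2 * r + 1 - x"
    have "blk n la ?y = blk n mu ?y" using low[of ?y] x False by auto
    then have "blk n la (2 * r + 1 - ?y) = blk n mu (2 * r + 1 - ?y)"
      using blk_mirror[OF la(1), of ?y] blk_mirror[OF mu(1), of ?y] x False by simp
    then show ?thesis using x by simp
  qed (use low x in blast)
qed

text \<open>Passing from \<open>mu\<close> to \<open>la\<close> moves \<open>b\<close> from row
  \<open>h + 1\<close> to row \<open>h\<close> and its mirror image accordingly, each within the
  column of its preimage. Matrix units on both sides avoid subtraction of natural numbers.\<close>

lemma coset_matrix_shift:
  assumes nu: "nu \<in> Lam (n + 1) r" and w: "w \<in> WB r" and p: "p = blk n nu (iv w b)"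
  shows "coset_matrix n la w nu i j + E_theta n (h + 1) p i j = coset_matrix n mu w nu i j + E_theta n h p i j"
proof -
  let ?b = "2 * r + 1 - b"
  let ?S = "\<lambda>c. {k. 1 \<le> k \<and> k \<le> 2 * r \<and> blk n c k = i \<and> blk n nu (iv w k) = j}"
  have fin: "finite (?S c)" for c by (rule finite_subset[of _ "{..2 * r}"]) auto
  have bb: "b \<noteq> ?b" "1 \<le> ?b" "?b \<le> 2 * r" "b \<le> 2 * r" using ab by auto
  have f: "blk n nu (iv w ?b) = 2 * n + 2 - p"
    using WB_mirror[OF WB_iv[OF w], of b] WB_bounds[OF WB_iv[OF w], of b] blk_mirror[OF nu, of "iv w b"] ab bb p by simp
  have l: "blk n la ?b = 2 * n + 2 - h" "blk n mu ?b = 2 * n + 2 - (h + 1)"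
    using blk_mirror[OF la(1), of b] blk_mirror[OF mu(1), of b] blk_la_b blk_mu_b ab by auto
  have "?S la - {b, ?b} = ?S mu - {b, ?b}" using blk_mu_la by auto
  moreover have "card (?S la) = card (?S la - {b, ?b}) + (if b \<in> ?S la then 1 else 0) + (if ?b \<in> ?S la then 1 else 0)"
    by (rule card_split2[OF fin bb(1)])
  moreover have "card (?S mu) = card (?S mu - {b, ?b}) + (if b \<in> ?S mu then 1 else 0) + (if ?b \<in> ?S mu then 1 else 0)"
    by (rule card_split2[OF fin bb(1)])
  moreover have "b \<in> ?S la \<longleftrightarrow> i = h \<and> j = p" "b \<in> ?S mu \<longleftrightarrow> i = h + 1 \<and> j = p"
    using blk_la_b blk_mu_b p ab by auto
  moreover have "?b \<in> ?S la \<longleftrightarrow> i = 2 * n + 2 - h \<and> j = 2 * n + 2 - p"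
    "?b \<in> ?S mu \<longleftrightarrow> i = 2 * n + 2 - (h + 1) \<and> j = 2 * n + 2 - p"
    using l f bb by auto
  ultimately show ?thesis
    unfolding coset_matrix_eq'[OF la(1) nu w] coset_matrix_eq'[OF mu(1) nu w] E_theta_eq by (simp only:)
qed

lemma block_la: "block_labelling (blk n la)" and block_mu: "block_labelling (blk n mu)"
  using block_labelling_blk la mu by auto

lemma par_seg_la: "par (seg a b) \<subseteq> parD (blk n la)"
  unfolding par_eq_parD[OF la, symmetric]
  by (rule par_seg_subset[OF block_la ab(3,2), where k = h]) (use blk_la_iff ab in auto)

lemma XA_seg_stable:
  assumes nu: "nu \<in> Lam (n + 1) r" and u: "u \<in> par (seg a b)" and w: "w \<in> XA n la nu A"
  shows "u \<circ> w \<in> XA n la nu A"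
  using XA_stable[OF la(1) nu subsetD[OF par_seg_la u] parD_id w] by simp

abbreviation z :: "free set" where "z \<equiv> TS (cycs a b)"

lemma z_closed [simp]: "z \<in> carrier H"
  using cycs_WB[OF ab(2)] by simp

text \<open>\<open>Tsum_cycs\<close> is applied to \<open>XA n la mu B\<close>. Its elements for
  which \<open>b\<close> has the largest preimage over the segment form the parabolic subgroup of
  \<open>mu\<close>: for them \<open>b\<close> comes from column \<open>h + 1\<close>, and the
  matrix relative to \<open>mu\<close> is diagonal.\<close>

lemma Tsum_B:
  assumes B: "B = (\<lambda>i j. E_theta n h (h + 1) i j + diag_mat (hat n \<gamma>) i j)"
  shows "TS (XA n la mu B) = z \<cdot> TS (parD (blk n mu))" and "mat_sgn n B = Pos"
proof -
  have hat_mu: "diag_mat (hat n mu) i j = diag_mat (hat n \<gamma>) i j + E_theta n (h + 1) (h + 1) i j" for i j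
  proof -
    have "hat n mu i = hat n \<gamma> i + (if i = h + 1 then 1 else 0) + (if i = 2 * n + 2 - (h + 1) then 1 else 0)"
      using h mu_eq mu(2) ga(2) mu_eq[of "2 * n + 2 - i"] unfolding hat_def by auto
    then show ?thesis unfolding diag_mat_def E_theta_eq by auto
  qed
  have cm: "coset_matrix n la u mu = B" if u: "u \<in> par (blk n mu)" for u
  proof (intro ext)
    fix i j
    note uW = par_WB[OF u]
    have iu: "blk n mu (iv u k) = blk n mu k" if "1 \<le> k" "k \<le> 2 * r" for k
      using par_apply[OF par_iv[OF u]] that by simp
    have "coset_matrix n mu u mu i j = diag_mat (hat n mu) i j"
    proof -
      have "{k. 1 \<le> k \<and> k \<le> 2 * r \<and> blk n mu k = i \<and> blk n mu (iv u k) = j} = (if i = j then Rint n mu i else {})"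
        using iu Rint_iff[OF mu(1)] by auto
      then show ?thesis unfolding coset_matrix_eq'[OF mu(1) mu(1) uW] diag_mat_def by (simp add: card_Rint)
    qed
    moreover have "h + 1 = blk n mu (iv u b)" using iu[of b] blk_mu_b ab by simp
    ultimately have "coset_matrix n la u mu i j + E_theta n (h + 1) (h + 1) i j
      = diag_mat (hat n mu) i j + E_theta n h (h + 1) i j"
      using coset_matrix_shift[OF mu(1) uW, of "h + 1" i j] by simp
    then show "coset_matrix n la u mu i j = B i j" unfolding hat_mu B by simp
  qed
  \<comment> \<open>\<open>id\<close> has matrix \<open>B\<close> and no negative entries, so the
    corner sum vanishes.\<close>
  show sB: "mat_sgn n B = Pos"
    using sum_coset_matrix_corner[OF la(1) mu(1) la(2) WB_id] neg_id unfolding cm[OF par_id] mat_sgn_def by simp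
  have "{w \<in> XA n la mu B. \<forall>j. a < j \<longrightarrow> j < b \<longrightarrow> iv w j < iv w b} = parD (blk n mu)"
  proof (intro subset_antisym subsetI)
    fix u assume "u \<in> parD (blk n mu)"
    then have u: "u \<in> par (blk n mu)" "u \<in> WB r" "even (neg r u)" using parD_WB even_neg_parD by (auto simp: parD_def)
    have iu: "blk n mu (iv u k) = blk n mu k" if "1 \<le> k" "k \<le> 2 * r" for k
      using par_apply[OF par_iv[OF u(1)]] that by simp
    have "iv u j < iv u b" if j: "a < j" "j < b" for j
    proof (rule ccontr)
      have j': "1 \<le> j" "j \<le> 2 * r" "j \<noteq> b" "j \<noteq> 2 * r + 1 - b" using j ab by auto
      assume "\<not> iv u j < iv u b"
      then have "blk n mu (iv u b) \<le> blk n mu (iv u j)"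
        using WB_bounds[OF WB_iv[OF u(2)], of j] j' by (intro blk_mono[OF mu(1)]) auto
      moreover have "blk n mu (iv u j) = h"
        using iu[OF j'(1,2)] blk_mu_la[OF j'] blk_la_iff[OF j'(1,2)] j by simp
      moreover have "blk n mu (iv u b) = h + 1" using iu[of b] blk_mu_b ab by simp
      ultimately show False by simp
    qed
    then show "u \<in> {w \<in> XA n la mu B. \<forall>j. a < j \<longrightarrow> j < b \<longrightarrow> iv w j < iv w b}"
      using u cm sB by (simp add: XA_def)
  next
    fix w assume "w \<in> {w \<in> XA n la mu B. \<forall>j. a < j \<longrightarrow> j < b \<longrightarrow> iv w j < iv w b}"
    then have w: "w \<in> WB r" "coset_matrix n la w mu = B"
      and max: "\<And>j. a < j \<Longrightarrow> j < b \<Longrightarrow> iv w j < iv w b" by (auto simp: XA_def)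
    note iw = WB_bounds[OF WB_iv[OF w(1)]]
    have row: "B h j = card {k. 1 \<le> k \<and> k \<le> 2 * r \<and> blk n la k = h \<and> blk n mu (iv w k) = j}" for j
      using coset_matrix_eq'[OF la(1) mu(1) w(1), of h j] w(2) by simp
    define p where "p = blk n mu (iv w b)"
    have "{k. 1 \<le> k \<and> k \<le> 2 * r \<and> blk n la k = h \<and> blk n mu (iv w k) = p} \<noteq> {}"
      using blk_la_b ab p_def by auto
    moreover have fin: "finite {k. 1 \<le> k \<and> k \<le> 2 * r \<and> blk n la k = h \<and> blk n mu (iv w k) = j}" for j
      by (rule finite_subset[of _ "{..2 * r}"]) auto
    ultimately have "B h p \<noteq> 0" unfolding row by simp
    then have "p = h \<or> p = h + 1" unfolding B E_theta_eq diag_mat_def using h by (auto split: if_splits)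
    \<comment> \<open>Column \<open>h + 1\<close> does occur in row \<open>h\<close> of
      \<open>B\<close>, and no preimage over the segment exceeds that of \<open>b\<close>.\<close>
    moreover have "h + 1 \<le> p"
    proof -
      have "B h (h + 1) \<noteq> 0" unfolding B E_theta_eq by simp
      then have "{k. 1 \<le> k \<and> k \<le> 2 * r \<and> blk n la k = h \<and> blk n mu (iv w k) = h + 1} \<noteq> {}"
        unfolding row by (intro notI) (simp only: card.empty)
      then obtain k where k: "1 \<le> k" "k \<le> 2 * r" "blk n la k = h" "blk n mu (iv w k) = h + 1" by blast
      have "iv w k \<le> iv w b" using max[of k] k(3) blk_la_iff[OF k(1,2)] by (cases "k = b") auto
      then show ?thesis using blk_mono[OF mu(1), of "iv w k" "iv w b"] iw[of b] ab k(4) p_def by auto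
    qed
    ultimately have p: "h + 1 = blk n mu (iv w b)" using p_def by simp
    \<comment> \<open>The off-diagonal units of \<open>B\<close> are those contributed by
      \<open>b\<close> and its mirror image; relative to \<open>mu\<close> they move to the
      diagonal.\<close>
    have off: "coset_matrix n mu w mu i j = 0" if "i \<noteq> j" for i j
    proof -
      have "diag_mat (hat n \<gamma>) i j = 0" "E_theta n (h + 1) (h + 1) i j = 0"
        using that by (auto simp: diag_mat_def E_theta_eq)
      then show ?thesis using coset_matrix_shift[OF mu(1) w(1) p, of i j] unfolding w(2) B by simp
    qed
    have "blk n mu (iv w k) = blk n mu k" if k: "1 \<le> k" "k \<le> 2 * r" for k
    proof (rule ccontr)
      let ?S = "{l. 1 \<le> l \<and> l \<le> 2 * r \<and> blk n mu l = blk n mu k \<and> blk n mu (iv w l) = blk n mu (iv w k)}"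
      assume "blk n mu (iv w k) \<noteq> blk n mu k"
      then have "card ?S = 0" using off[of "blk n mu k" "blk n mu (iv w k)"] coset_matrix_eq'[OF mu(1) mu(1) w(1)] by simp
      moreover have "finite ?S" by (rule finite_subset[of _ "{..2 * r}"]) auto
      ultimately have "?S = {}" by simp
      then show False using k by auto
    qed
    then have "iv w \<in> par (blk n mu)" using w by (simp add: par_def)
    then have "w \<in> par (blk n mu)" using par_iv[of "iv w"] w by simp
    then show "w \<in> parD (blk n mu)" using par_eq_parD[OF mu] by simp
  qed
  then show "TS (XA n la mu B) = z \<cdot> TS (parD (blk n mu))"
    using Tsum_cycs[OF ab(1,2) XA_WB XA_seg_stable[OF mu(1)], of B] by simp
qed

end

locale row_shift = adjacent_compositions +
  fixes nu :: vec and A :: mat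
  assumes nu: "nu \<in> Lam (n + 1) r"
    and A: "A \<in> Xi n r" "ro n A = hat n mu" "co n A = hat n nu"
begin

abbreviation "N \<equiv> 2 * n + 1"

lemma A_mirror: "i \<in> {1..N} \<Longrightarrow> j \<in> {1..N} \<Longrightarrow> A (2 * n + 2 - i) (2 * n + 2 - j) = A i j"
  using A(1) unfolding Xi_def by auto

lemma A_outside: "i \<notin> {1..N} \<or> j \<notin> {1..N} \<Longrightarrow> A i j = 0"
  using A(1) unfolding Xi_def by auto

text \<open>The mirror entry of \<open>A\<close> is positive too, and since \<open>h < n\<close> the
  two units of \<open>E_theta\<close> sit in different rows; so nothing is truncated.\<close>

lemma shift_mat_add:
  assumes p: "A (h + 1) p > 0"
  shows "shift_mat n h A p i j + E_theta n (h + 1) p i j = A i j + E_theta n h p i j"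
proof -
  have pN: "p \<in> {1..N}" using A_outside[of "h + 1" p] p by auto
  have "A (2 * n + 2 - (h + 1)) (2 * n + 2 - p) > 0" using A_mirror[of "h + 1" p] h pN p by auto
  then have "E_theta n (h + 1) p i j \<le> A i j"
    using p h by (auto simp: E_theta_eq)
  then show ?thesis by (simp add: shift_mat_def)
qed

text \<open>Some \<open>k\<close> in block \<open>h + 1\<close> of \<open>mu\<close> has its
  preimage in column \<open>p\<close>; a cycle inside this block moves \<open>k\<close> to the first
  element \<open>b\<close> without leaving \<open>XA\<close>.\<close>

lemma exists_XA_at_b:
  assumes p: "A (h + 1) p > 0"
  shows "\<exists>w\<in>XA n mu nu A. blk n nu (iv w b) = p"
proof -
  let ?d = "d_mat n r A"
  have d: "?d \<in> XA n mu nu A" "?d \<in> WB r" "coset_matrix n mu ?d nu = A"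
    using d_mat_props[OF mu(1) nu mu(2) A] incB_XA[OF mu(1) nu mu(2)] by auto
  let ?S = "{k. 1 \<le> k \<and> k \<le> 2 * r \<and> blk n mu k = h + 1 \<and> blk n nu (iv ?d k) = p}"
  have "card ?S = A (h + 1) p" unfolding coset_matrix_eq'[OF mu(1) nu d(2), symmetric] by (simp only: d(3))
  then have "?S \<noteq> {}" using p by (intro notI) (simp only: card.empty less_irrefl)
  then obtain k where k: "1 \<le> k" "k \<le> 2 * r" "blk n mu k = h + 1" "blk n nu (iv ?d k) = p" by blast
  have kr: "k \<le> r" using blk_half(1)[OF mu k(1,2)] k(3) h by simp
  have bk: "b \<le> k"
    using blk_eq_iff[OF mu(1) k(1,2), of "h + 1"] k(3) psum_mu[of h] h b_eq by simp
  have c: "cyc k b \<in> par (seg (b - 1) k)" using cyc_par(1)[of "b - 1" b k] bk kr ab by simp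
  have "par (seg (b - 1) k) \<subseteq> par (blk n mu)"
  proof (rule par_seg_subset[OF block_mu, where k = "h + 1"])
    fix x assume x: "b - 1 < x" "x \<le> k"
    have "blk n mu b = blk n mu k" using blk_mu_b k by simp
    then show "blk n mu x = h + 1"
      using block_between[OF block_mu, of b k x] x k ab blk_mu_b by auto
  qed (use bk kr in auto)
  then have u: "cyc k b \<in> parD (blk n mu)" using c par_eq_parD[OF mu] by auto
  have uW: "cyc k b \<in> WB r" using ab kr by simp
  have "iv (cyc k b \<circ> ?d) b = iv ?d k" using uW d(2) iv_cyc_low[of b k b] ab bk kr by simp
  moreover have "cyc k b \<circ> ?d \<in> XA n mu nu A" using XA_stable[OF mu(1) nu u parD_id d(1)] by simp
  ultimately show ?thesis using k(4) by (intro bexI[of _ "cyc k b \<circ> ?d"]) auto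
qed

lemma shift_mat_coset:
  assumes p: "A (h + 1) p > 0" and w: "w \<in> WB r" "blk n nu (iv w b) = p"
  shows "coset_matrix n mu w nu = A \<longleftrightarrow> coset_matrix n la w nu = shift_mat n h A p"
proof -
  note sh = coset_matrix_shift[OF nu w(1) w(2)[symmetric]]
  have "coset_matrix n mu w nu i j = A i j \<longleftrightarrow> coset_matrix n la w nu i j = shift_mat n h A p i j" for i j
    using sh[of i j] shift_mat_add[OF p, of i j] by linarith
  then show ?thesis unfolding fun_eq_iff by blast
qed

text \<open>All properties are inherited from one element whose matrix relative to \<open>la\<close>
  is the shifted one. The signs agree because both corner sums arise from the same
  \<open>neg r w\<close> by removing the same term.\<close>

lemma shift_mat_props:
  assumes p: "A (h + 1) p > 0"
  shows "shift_mat n h A p \<in> Xi n r" "ro n (shift_mat n h A p) = hat n la" "co n (shift_mat n h A p) = hat n nu"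
    "mat_sgn n (shift_mat n h A p) = mat_sgn n A"
proof -
  obtain w where w: "w \<in> XA n mu nu A" "blk n nu (iv w b) = p" using exists_XA_at_b[OF p] by blast
  then have wW: "w \<in> WB r" and mA: "coset_matrix n mu w nu = A" by (auto simp: XA_def)
  have sA: "coset_matrix n la w nu = shift_mat n h A p" using shift_mat_coset[OF p wW w(2)] mA by simp
  show "shift_mat n h A p \<in> Xi n r" using coset_matrix_Xi[OF la(1) nu wW] sA by simp
  show "ro n (shift_mat n h A p) = hat n la" using ro_coset_matrix[OF la(1) nu wW] sA by simp
  show "co n (shift_mat n h A p) = hat n nu" using co_coset_matrix[OF la(1) nu wW] sA by simp
  show "mat_sgn n (shift_mat n h A p) = mat_sgn n A"
    using sum_coset_matrix_corner[OF la(1) nu la(2) wW] sum_coset_matrix_corner[OF mu(1) nu mu(2) wW]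
    unfolding sA mA mat_sgn_def by simp
qed

definition Y :: "nat \<Rightarrow> (nat \<Rightarrow> nat) set" where
  "Y p = {w \<in> XA n mu nu A. blk n nu (iv w b) = p}"

text \<open>The change of viewpoint behind the formula: the elements come from \<open>mu\<close>,
  but relative to \<open>la\<close> the segment is a whole block and \<open>XA\<close> is stable
  under its symmetric group.\<close>

lemma Y_shift:
  assumes p: "A (h + 1) p > 0"
  shows "Y p = {w \<in> XA n la nu (shift_mat n h A p). blk n nu (iv w b) = p}"
  using shift_mat_coset[OF p] shift_mat_props(4)[OF p] unfolding Y_def XA_def by auto

lemma Y_empty:
  assumes p: "A (h + 1) p = 0"
  shows "Y p = {}"
proof (rule ccontr)
  assume "Y p \<noteq> {}"
  then obtain w where w: "w \<in> WB r" "coset_matrix n mu w nu = A" "blk n nu (iv w b) = p"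
    by (auto simp: Y_def XA_def)
  let ?S = "{k. 1 \<le> k \<and> k \<le> 2 * r \<and> blk n mu k = h + 1 \<and> blk n nu (iv w k) = p}"
  have "card ?S = 0" using p coset_matrix_eq'[OF mu(1) nu w(1), of "h + 1" p] w(2) by simp
  moreover have "finite ?S" by (rule finite_subset[of _ "{..2 * r}"]) auto
  ultimately have "?S = {}" by simp
  then show False using blk_mu_b w(3) ab by auto
qed

lemma row_h: "(\<Sum>j=1..N. A h j) = \<gamma> h"
  using fun_cong[OF A(2), of h] mu_eq[of h] h by (simp add: ro_def hat_def)

lemma shift_row_h: "shift_mat n h A p h j = A h j + (if j = p then 1 else 0)"
proof -
  have "h \<noteq> 2 * n + 2 - h" "h \<noteq> 2 * n + 2 - (h + 1)" "h \<noteq> h + 1" using h by linarith+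
  then show ?thesis unfolding shift_mat_def E_theta_eq by simp
qed

text \<open>The column of the last position of the segment is read off from the number of larger preimages
  in the segment.\<close>

lemma above_iff:
  assumes p: "A (h + 1) p > 0" and w: "w \<in> XA n la nu (shift_mat n h A p)"
  shows "blk n nu (iv w b) = p \<longleftrightarrow>
    above a b w \<in> {(\<Sum>j\<in>{p<..N}. A h j)..(\<Sum>j\<in>{p<..N}. A h j) + A h p}"
proof -
  have wW: "w \<in> WB r" and cm: "coset_matrix n la w nu = shift_mat n h A p" using w by (auto simp: XA_def)
  have pN: "p \<in> {1..N}" using A_outside[of "h + 1" p] p by auto
  note iw = WB_bounds[OF WB_iv[OF wW]]
  define f where "f = (\<lambda>k. blk n nu (iv w k))"
  \<comment> \<open>\<open>S\<close> decreases, and \<open>above a b w\<close> is at least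
    \<open>S (f b)\<close> and less than \<open>S (f b - 1)\<close>. These half-open intervals are
    disjoint for different columns, so the number determines \<open>f b\<close>.\<close>
  define S where "S = (\<lambda>j. card {k. a < k \<and> k \<le> b \<and> j < f k})"
  have fin: "finite {k. a < k \<and> k \<le> b \<and> P k}" for P by (rule finite_subset[of _ "{..b}"]) auto
  have fN: "1 \<le> f k" "f k \<le> N" if "a < k" "k \<le> b" for k
    using blk_bounds[OF nu, of "iv w k"] iw[of k] that ab by (auto simp: f_def)
  have cnt: "card {k. a < k \<and> k \<le> b \<and> f k = j} = shift_mat n h A p h j" for j
  proof -
    have "{k. a < k \<and> k \<le> b \<and> f k = j} = {k. 1 \<le> k \<and> k \<le> 2 * r \<and> blk n la k = h \<and> blk n nu (iv w k) = j}"
      using blk_la_iff ab by (auto simp: f_def)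
    then show ?thesis using coset_matrix_eq'[OF la(1) nu wW, of h j] cm by simp
  qed
  have S: "S j = (\<Sum>i\<in>{j<..N}. shift_mat n h A p h i)" for j
  proof -
    have "(\<Sum>i\<in>{j<..N}. card {k \<in> {k. a < k \<and> k \<le> b \<and> j < f k}. f k = i}) = S j"
      unfolding S_def using fN fin by (intro card_fibers) auto
    moreover have "card {k \<in> {k. a < k \<and> k \<le> b \<and> j < f k}. f k = i} = shift_mat n h A p h i" if "i \<in> {j<..N}" for i
    proof -
      have "{k \<in> {k. a < k \<and> k \<le> b \<and> j < f k}. f k = i} = {k. a < k \<and> k \<le> b \<and> f k = i}" using that by auto
      then show ?thesis using cnt by simp
    qed
    ultimately show ?thesis by simp
  qed
  have anti: "S j' \<le> S j" if "j \<le> j'" for j j'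
    unfolding S_def using that by (intro card_mono fin) auto
  let ?G = "\<Sum>j\<in>{p<..N}. A h j"
  have Sp: "S p = ?G" unfolding S shift_row_h by (intro sum.cong) auto
  \<comment> \<open>The additional one is the unit shifted into column \<open>p\<close>; it makes
    the interval consist of \<open>A h p + 1\<close> numbers.\<close>
  have "{p - 1<..N} = insert p {p<..N}" using pN by auto
  then have Sp1: "S (p - 1) = ?G + A h p + 1" using Sp unfolding S by (simp add: shift_row_h)
  let ?U = "{k. a < k \<and> k < b \<and> iv w b < iv w k}"
  have lo: "S (f b) \<le> above a b w"
    unfolding S_def above_def
  proof (rule card_mono)
    show "finite ?U" by (rule finite_subset[of _ "{..b}"]) auto
    show "{k. a < k \<and> k \<le> b \<and> f b < f k} \<subseteq> ?U"
    proof
      fix k assume k: "k \<in> {k. a < k \<and> k \<le> b \<and> f b < f k}"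
      then have "k \<noteq> b" by auto
      moreover have "\<not> iv w k \<le> iv w b"
        using k blk_mono[OF nu, of "iv w k" "iv w b"] iw[of b] ab by (auto simp: f_def)
      ultimately show "k \<in> ?U" using k by auto
    qed
  qed
  have hi: "above a b w < S (f b - 1)"
    unfolding S_def above_def
  proof (rule psubset_card_mono[OF fin])
    have fb: "1 \<le> f b" using fN[of b] ab by simp
    have "f b \<le> f k" if "a < k" "k < b" "iv w b < iv w k" for k
      unfolding f_def using that iw[of k] ab by (intro blk_mono[OF nu]) auto
    then have "?U \<subseteq> {k. a < k \<and> k \<le> b \<and> f b - 1 < f k}" using fb by fastforce
    moreover have "b \<in> {k. a < k \<and> k \<le> b \<and> f b - 1 < f k}" "b \<notin> ?U" using ab fb by auto
    ultimately show "?U \<subset> {k. a < k \<and> k \<le> b \<and> f b - 1 < f k}" by blast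
  qed
  consider "f b = p" | "f b < p" | "p < f b" by linarith
  then have "f b = p \<longleftrightarrow> above a b w \<in> {?G..?G + A h p}"
  proof cases
    case 1
    then show ?thesis using lo hi Sp Sp1 by simp
  next
    case 2
    then have "S (p - 1) \<le> S (f b)" by (intro anti) simp
    then show ?thesis using 2 lo Sp1 by simp
  next
    case 3
    then have "S (f b - 1) \<le> S p" by (intro anti) simp
    then show ?thesis using 3 hi Sp by simp
  qed
  then show ?thesis by (simp add: f_def)
qed

lemma Tsum_Y:
  assumes p: "A (h + 1) p > 0"
  shows "z \<cdot> TS (Y p) = hconst r (g_coeff n h A p) \<cdot> TS (XA n la nu (shift_mat n h A p))"
proof -
  let ?Z = "XA n la nu (shift_mat n h A p)"
  let ?G = "\<Sum>j\<in>{p<..N}. A h j"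
  let ?Ze = "\<lambda>e. {w \<in> ?Z. above a b w = e}"
  have pN: "p \<in> {1..N}" using A_outside[of "h + 1" p] p by auto
  have ZeW: "?Ze e \<subseteq> WB r" for e using XA_WB by blast
  have "Y p = (\<Union>e\<in>{?G..?G + A h p}. ?Ze e)"
    unfolding Y_shift[OF p] using above_iff[OF p] by blast
  then have "TS (Y p) = (\<Oplus>\<^bsub>H\<^esub>e\<in>{?G..?G + A h p}. TS (?Ze e))"
    using ZeW by (simp only:) (intro Tsum_UN; blast?; auto)
  then have "z \<cdot> TS (Y p) = (\<Oplus>\<^bsub>H\<^esub>e\<in>{?G..?G + A h p}. z \<cdot> TS (?Ze e))"
    using ZeW by (simp only:) (intro H.finsum_rdistr; auto)
  also have "\<dots> = (\<Oplus>\<^bsub>H\<^esub>e\<in>{?G..?G + A h p}. hconst r (qvar ^ e) \<cdot> TS ?Z)"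
  proof (rule H.finsum_cong')
    fix e assume e: "e \<in> {?G..?G + A h p}"
    have "?G + A h p \<le> (\<Sum>j=1..N. A h j)"
    proof -
      have "?G + A h p = (\<Sum>j\<in>insert p {p<..N}. A h j)" by simp
      also have "\<dots> \<le> (\<Sum>j=1..N. A h j)" using pN by (intro sum_mono2) auto
      finally show ?thesis .
    qed
    \<comment> \<open>Row \<open>h\<close> of \<open>A\<close> sums to \<open>\<gamma> h\<close>,
      while the segment has \<open>b - a = \<gamma> h + 1\<close> elements.\<close>
    then have "e < b - a" using e row_h b_a by simp
    then show "z \<cdot> TS (?Ze e) = hconst r (qvar ^ e) \<cdot> TS ?Z"
      by (intro Tsum_cycs_above[OF ab(1,2) XA_WB XA_seg_stable[OF nu]])
  qed (use XA_WB in auto)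
  also have "\<dots> = (\<Oplus>\<^bsub>H\<^esub>e\<in>{?G..?G + A h p}. hconst r (qvar ^ e)) \<cdot> TS ?Z"
    using XA_WB by (intro H.finsum_ldistr[symmetric]) auto
  also have "(\<Oplus>\<^bsub>H\<^esub>e\<in>{?G..?G + A h p}. hconst r (qvar ^ e)) = hconst r (g_coeff n h A p)"
    using p by (simp add: hconst_sum[symmetric] q_interval_sum g_coeff_def)
  finally show ?thesis .
qed

text \<open>If \<open>A (h + 1) p = 0\<close>, the truncated subtraction leaves a matrix without
  meaning, so the summand is set to zero explicitly.\<close>

definition term_at :: "nat \<Rightarrow> free set" where
  "term_at p = (if A (h + 1) p > 0
     then hconst r (g_coeff n h A p) \<cdot> TS (XA n la nu (shift_mat n h A p)) else \<zero>\<^bsub>H\<^esub>)"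

lemma term_at_closed: "term_at p \<in> carrier H"
  using XA_WB by (simp add: term_at_def)

lemma z_Tsum_A: "z \<cdot> TS (XA n mu nu A) = (\<Oplus>\<^bsub>H\<^esub>p\<in>{1..N}. term_at p)"
proof -
  have YW: "Y p \<subseteq> WB r" for p using XA_WB unfolding Y_def by blast
  have "XA n mu nu A = (\<Union>p\<in>{1..N}. Y p)"
  proof (intro subset_antisym subsetI)
    fix w assume w: "w \<in> XA n mu nu A"
    then have "w \<in> WB r" using XA_WB by blast
    then have "blk n nu (iv w b) \<in> {1..N}"
      using blk_bounds[OF nu, of "iv w b"] WB_bounds[OF WB_iv, of w b] ab by auto
    then show "w \<in> (\<Union>p\<in>{1..N}. Y p)" using w unfolding Y_def by blast
  qed (auto simp: Y_def)
  then have "TS (XA n mu nu A) = (\<Oplus>\<^bsub>H\<^esub>p\<in>{1..N}. TS (Y p))"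
    using YW by (simp only:) (intro Tsum_UN; auto simp: Y_def)
  then have "z \<cdot> TS (XA n mu nu A) = (\<Oplus>\<^bsub>H\<^esub>p\<in>{1..N}. z \<cdot> TS (Y p))"
    using YW by (simp only:) (intro H.finsum_rdistr; auto)
  also have "\<dots> = (\<Oplus>\<^bsub>H\<^esub>p\<in>{1..N}. term_at p)"
    using term_at_closed Tsum_Y Y_empty by (intro H.finsum_cong') (auto simp: term_at_def)
  finally show ?thesis .
qed

text \<open>Both sides are represented by the same Hecke element. Signs enter only through outer
  factors \<open>Tsgn\<close>, so the two formulas of the theorem are the cases \<open>Pos\<close>
  and \<open>Neg\<close> of one computation.\<close>

lemma phi_mat_product:
  assumes B: "B = (\<lambda>i j. E_theta n h (h + 1) i j + diag_mat (hat n \<gamma>) i j)"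
    "B \<in> Xi n r" "ro n B = hat n la" "co n B = hat n mu"
    and e: "(e = e') \<longleftrightarrow> mat_sgn n A = Pos"
  shows "phi_mat n r e B e \<otimes>\<^bsub>schurD n r\<^esub> phi_mat n r e A e'
    = (\<Oplus>\<^bsub>schurD n r\<^esub>p\<in>{1..N}.
         if g_coeff n h A p = 0 then \<zero>\<^bsub>schurD n r\<^esub>
         else g_coeff n h A p \<odot>\<^bsub>schurD n r\<^esub> phi_mat n r e (shift_mat n h A p) e')"
proof (rule Rep_unique)
  let ?\<alpha> = "mark n la e" and ?\<beta> = "mark n mu e" and ?\<gamma> = "mark n nu e'"
  let ?z = "Tsgn e \<cdot> z \<cdot> Tsgn e"
  let ?y = "Tsgn e \<cdot> (z \<cdot> TS (XA n mu nu A)) \<cdot> Tsgn e'"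
  have P: "parD (blk n mu) \<subseteq> WB r" using parD_WB by blast
  have "TS (conj_s e (XA n la mu B) e) = ?z \<cdot> xD n r ?\<beta>"
    using P by (simp add: Tsum_conj_s[OF XA_WB] xD_mark[OF mu(1)] Tsum_B(1)[OF B(1)] H.m_assoc)
  then have RB: "Rep n ?\<alpha> ?\<beta> (?z \<cdot> xD n r ?\<beta>) (phi_mat n r e B e)"
    using phi_mat_Rep[OF la(1) mu(1) la(2) B(2-4), of e e] Tsum_B(2)[OF B(1)] by simp
  have RA: "Rep n ?\<beta> ?\<gamma> (TS (conj_s e (XA n mu nu A) e')) (phi_mat n r e A e')"
    by (rule phi_mat_Rep[OF mu(1) nu mu(2) A e])
  obtain y where y: "y \<in> heckeD r" "TS (conj_s e (XA n mu nu A) e') = xD n r ?\<beta> \<cdot> y"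
    using Tsum_XA_factors(2)[OF mu(1) nu mu(2) e] by blast
  \<comment> \<open>The two inner factors \<open>Tsgn e\<close> cancel, so \<open>z\<close> meets
    \<open>TS (XA n mu nu A)\<close> directly.\<close>
  have "?z \<cdot> (xD n r ?\<beta> \<cdot> y) = ?y"
    unfolding y(2)[symmetric] Tsum_conj_s[OF XA_WB] using XA_WB by (simp add: H.m_assoc)
  then show "Rep n ?\<alpha> ?\<gamma> ?y (phi_mat n r e B e \<otimes>\<^bsub>schurD n r\<^esub> phi_mat n r e A e')"
    using Rep_compose[OF RB RA[unfolded y(2)] _ y(1) mark_LamD[OF mu(1)]] by simp
  have "?y = (\<Oplus>\<^bsub>H\<^esub>p\<in>{1..N}. Tsgn e \<cdot> term_at p \<cdot> Tsgn e')"
  proof -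
    have "Tsgn e \<cdot> (z \<cdot> TS (XA n mu nu A)) = (\<Oplus>\<^bsub>H\<^esub>p\<in>{1..N}. Tsgn e \<cdot> term_at p)"
      unfolding z_Tsum_A using term_at_closed by (intro H.finsum_rdistr) auto
    moreover have "(\<Oplus>\<^bsub>H\<^esub>p\<in>{1..N}. Tsgn e \<cdot> term_at p) \<cdot> Tsgn e'
      = (\<Oplus>\<^bsub>H\<^esub>p\<in>{1..N}. Tsgn e \<cdot> term_at p \<cdot> Tsgn e')"
      using term_at_closed by (intro H.finsum_ldistr) auto
    ultimately show ?thesis by simp
  qed
  moreover have "Rep n ?\<alpha> ?\<gamma> (\<Oplus>\<^bsub>H\<^esub>p\<in>{1..N}. Tsgn e \<cdot> term_at p \<cdot> Tsgn e')
    (\<Oplus>\<^bsub>schurD n r\<^esub>p\<in>{1..N}. if g_coeff n h A p = 0 then \<zero>\<^bsub>schurD n r\<^esub>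
         else g_coeff n h A p \<odot>\<^bsub>schurD n r\<^esub> phi_mat n r e (shift_mat n h A p) e')"
  proof (rule Rep_finsum)
    fix p assume "p \<in> {1..N}"
    show "Rep n ?\<alpha> ?\<gamma> (Tsgn e \<cdot> term_at p \<cdot> Tsgn e')
      (if g_coeff n h A p = 0 then \<zero>\<^bsub>schurD n r\<^esub>
       else g_coeff n h A p \<odot>\<^bsub>schurD n r\<^esub> phi_mat n r e (shift_mat n h A p) e')"
    proof (cases "g_coeff n h A p = 0")
      case True
      then have "term_at p = \<zero>\<^bsub>H\<^esub>" using XA_WB by (simp add: term_at_def hconst_zero)
      then show ?thesis using True Rep_zero by simp
    next
      case False
      then have p: "A (h + 1) p > 0" by (simp add: g_coeff_def split: if_splits)
      let ?X = "XA n la nu (shift_mat n h A p)" and ?k = "hconst r (g_coeff n h A p)"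
      have X: "TS ?X \<in> carrier H" using XA_WB by simp
      have "Rep n ?\<alpha> ?\<gamma> (TS (conj_s e ?X e')) (phi_mat n r e (shift_mat n h A p) e')"
        using shift_mat_props[OF p] e by (intro phi_mat_Rep la nu) auto
      then have "Rep n ?\<alpha> ?\<gamma> (?k \<cdot> TS (conj_s e ?X e'))
        (g_coeff n h A p \<odot>\<^bsub>schurD n r\<^esub> phi_mat n r e (shift_mat n h A p) e')"
        by (rule Rep_smult) (use X in \<open>simp add: Tsum_conj_s[OF XA_WB]\<close>)
      moreover have "?k \<cdot> TS (conj_s e ?X e') = Tsgn e \<cdot> term_at p \<cdot> Tsgn e'"
      proof -
        have "?k \<cdot> TS (conj_s e ?X e') = (?k \<cdot> Tsgn e) \<cdot> TS ?X \<cdot> Tsgn e'"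
          using X by (simp add: Tsum_conj_s[OF XA_WB] H.m_assoc)
        also have "?k \<cdot> Tsgn e = Tsgn e \<cdot> ?k" by (rule hconst_central) simp
        finally show ?thesis using X p by (simp add: term_at_def H.m_assoc)
      qed
      ultimately show ?thesis using False by simp
    qed
  qed (use term_at_closed in auto)
  ultimately show "Rep n ?\<alpha> ?\<gamma> ?y
    (\<Oplus>\<^bsub>schurD n r\<^esub>p\<in>{1..N}. if g_coeff n h A p = 0 then \<zero>\<^bsub>schurD n r\<^esub>
         else g_coeff n h A p \<odot>\<^bsub>schurD n r\<^esub> phi_mat n r e (shift_mat n h A p) e')" by simp
qed

end

lemma ro_elementary:
  assumes h: "1 \<le> h" "h \<le> n" and i: "1 \<le> i" "i \<le> n"
  shows "ro n (\<lambda>i j. E_theta n h (h + 1) i j + diag_mat (hat n \<gamma>) i j) i = (if i = h then 1 else 0) + \<gamma> i"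
proof -
  have "(\<Sum>j=1..2 * n + 1. E_theta n h (h + 1) i j) = (if i = h then 1 else 0)"
  proof -
    have "E_theta n h (h + 1) i j = (if j = h + 1 then if i = h then 1 else 0 else 0)" for j
      using h i by (auto simp: E_theta_eq)
    then show ?thesis using h by (simp only: sum.delta finite_atLeastAtMost) auto
  qed
  moreover have "(\<Sum>j=1..2 * n + 1. diag_mat (hat n \<gamma>) i j) = \<gamma> i"
  proof -
    have "diag_mat (hat n \<gamma>) i j = (if j = i then \<gamma> i else 0)" for j
      using i by (auto simp: diag_mat_def hat_def)
    then show ?thesis using i by (simp only: sum.delta finite_atLeastAtMost) auto
  qed
  ultimately show ?thesis by (simp only: ro_def sum.distrib)
qed

lemma co_elementary:
  assumes h: "1 \<le> h" "h \<le> n" and i: "1 \<le> i" "i \<le> n"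
  shows "co n (\<lambda>i j. E_theta n h (h + 1) i j + diag_mat (hat n \<gamma>) i j) i = (if i = h + 1 then 1 else 0) + \<gamma> i"
proof -
  have "(\<Sum>k=1..2 * n + 1. E_theta n h (h + 1) k i) = (if i = h + 1 then 1 else 0)"
  proof -
    have "E_theta n h (h + 1) k i = (if k = h then if i = h + 1 then 1 else 0 else 0)" for k
      using h i by (auto simp: E_theta_eq)
    then show ?thesis using h by (simp only: sum.delta finite_atLeastAtMost) auto
  qed
  moreover have "(\<Sum>k=1..2 * n + 1. diag_mat (hat n \<gamma>) k i) = \<gamma> i"
  proof -
    have "diag_mat (hat n \<gamma>) k i = (if k = i then \<gamma> i else 0)" for k
      using i by (auto simp: diag_mat_def hat_def)
    then show ?thesis using i by (simp only: sum.delta finite_atLeastAtMost) auto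
  qed
  ultimately show ?thesis by (simp only: co_def sum.distrib)
qed

theorem theorem6p3:
  fixes n r h :: nat and A B :: mat and \<gamma> la \<mu> \<nu> :: vec and \<epsilon> :: sign
  assumes "n \<ge> 1" and "r \<ge> 4"
    and "h \<in> {1..n}"
    and "A \<in> Xi n r" and "B \<in> Xi n r"
    and "\<gamma> \<in> Lam (n + 1) (r - 1)"
    and "B = (\<lambda>i j. E_theta n h (h + 1) i j + diag_mat (hat n \<gamma>) i j)"
    and "la \<in> Lam (n + 1) r" and "\<mu> \<in> Lam (n + 1) r" and "\<nu> \<in> Lam (n + 1) r"
    and "ro n B = hat n la"
    and "co n B = hat n \<mu>" and "ro n A = hat n \<mu>"
    and "co n A = hat n \<nu>"
    and "\<epsilon> = mat_sgn n A"
    and "B \<in> Xi_ooo n r"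
  shows "h < n \<and>
    (A \<in> Xi_oob n r \<union> Xi_ooo n r \<longrightarrow>
      phi_mat n r Pos B Pos \<otimes>\<^bsub>schurD n r\<^esub> phi_mat n r Pos A \<epsilon>
        = (\<Oplus>\<^bsub>schurD n r\<^esub>p\<in>{1..2 * n + 1}.
             if g_coeff n h A p = 0 then \<zero>\<^bsub>schurD n r\<^esub>
             else g_coeff n h A p \<odot>\<^bsub>schurD n r\<^esub> phi_mat n r Pos (shift_mat n h A p) \<epsilon>)
      \<and>
      phi_mat n r Neg B Neg \<otimes>\<^bsub>schurD n r\<^esub> phi_mat n r Neg A (opp \<epsilon>)
        = (\<Oplus>\<^bsub>schurD n r\<^esub>p\<in>{1..2 * n + 1}.
             if g_coeff n h A p = 0 then \<zero>\<^bsub>schurD n r\<^esub>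
             else g_coeff n h A p \<odot>\<^bsub>schurD n r\<^esub> phi_mat n r Neg (shift_mat n h A p) (opp \<epsilon>)))"
proof -
  note la = \<open>la \<in> Lam (n + 1) r\<close> and mu = \<open>\<mu> \<in> Lam (n + 1) r\<close>
  note B = \<open>B = (\<lambda>i j. E_theta n h (h + 1) i j + diag_mat (hat n \<gamma>) i j)\<close>
  note roB = \<open>ro n B = hat n la\<close> and coB = \<open>co n B = hat n \<mu>\<close>
  have h: "1 \<le> h" "h \<le> n" using \<open>h \<in> {1..n}\<close> by auto
  obtain la' mu' where "la' \<in> Lam (n + 1) r" "mu' \<in> Lam (n + 1) r" "hat n la = hat n la'" "hat n \<mu> = hat n mu'"
    "la' (n + 1) = 0" "mu' (n + 1) = 0"
    using \<open>B \<in> Xi_ooo n r\<close> roB coB unfolding Xi_ooo_def by auto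
  then have c0: "la (n + 1) = 0" "\<mu> (n + 1) = 0" using hat_inj la mu by metis+
  have co0: "co n B (n + 1) = 0" unfolding coB hat_def using c0 by simp
  then have Bc: "B i (n + 1) = 0" if "i \<in> {1..2 * n + 1}" for i
    using that unfolding co_def by (simp only: sum_eq_0_iff finite_atLeastAtMost)
  \<comment> \<open>For \<open>h = n\<close> the matrix \<open>B\<close> would have a nonzero entry
    in the middle column, whose sum is twice the vanishing middle part of
    \<open>\<mu>\<close>.\<close>
  have hn: "h < n"
  proof (rule ccontr)
    assume "\<not> h < n"
    then have "h = n" using h by simp
    then have "B n (n + 1) \<noteq> 0" unfolding B by (simp add: E_theta_eq)
    then show False using Bc[of n] h by auto
  qed
  \<comment> \<open>The middle entry of \<open>B\<close> is twice
    \<open>\<gamma> (n + 1)\<close>.\<close>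
  have g0: "\<gamma> (n + 1) = 0"
    using Bc[of "n + 1"] unfolding B by (simp add: diag_mat_def hat_def)
  have le: "la i = \<gamma> i + (if i = h then 1 else 0)" if "1 \<le> i" "i \<le> n" for i
    using ro_elementary[OF h that, of \<gamma>] fun_cong[OF roB, of i] that unfolding B[symmetric] by (simp add: hat_def)
  have me: "\<mu> i = \<gamma> i + (if i = h + 1 then 1 else 0)" if "1 \<le> i" "i \<le> n" for i
    using co_elementary[OF h that, of \<gamma>] fun_cong[OF coB, of i] that unfolding B[symmetric] by (simp add: hat_def)
  interpret row_shift r n h \<gamma> la \<mu> \<nu> A
    by unfold_locales (use assms h hn c0 g0 le me in auto)
  \<comment> \<open>The sign condition
    \<open>(e = e') \<longleftrightarrow> mat_sgn n A = Pos\<close> holds for the pair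
    \<open>Pos\<close>, \<open>\<epsilon>\<close> as well as for \<open>Neg\<close>,
    \<open>opp \<epsilon>\<close>.\<close>
  show ?thesis
    using hn phi_mat_product[OF B \<open>B \<in> Xi n r\<close> roB coB, of Pos \<epsilon>]
      phi_mat_product[OF B \<open>B \<in> Xi n r\<close> roB coB, of Neg "opp \<epsilon>"] \<open>\<epsilon> = mat_sgn n A\<close>
    by (cases \<epsilon>) auto
qed

end
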